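(* Let $w$ satisfy Assumption A, let $\rho\in\mathcal D_{\rm per}$, and for each $\varepsilon>0$ let $v_\varepsilon(\rho)\in\mathrm H^{-1}_{\rm per}(I)$ be any potential such that $\min\{F^\varepsilon_{\rm per}(\zeta)-n\langle v_\varepsilon(\rho),\zeta\rangle:\sqrt\zeta\in\mathrm H^1_{\rm per}(I),\ \int_I\zeta=1\}=F^\varepsilon_{\rm per}(\rho)-n\langle v_\varepsilon(\rho),\rho\rangle.$ Then there exist constants $C_\varepsilon\in\mathbb R$ and a sequence $\varepsilon_k\downarrow0$ such that $v_{\varepsilon_k}(\rho)+C_{\varepsilon_k}\rightharpoonup v_{\rm OT}(\rho)$ weakly in $\mathrm H^{-1}_{\rm per}(I)$, where $v_{\rm OT}(\rho)$ is a regular Kantorovich potential for $F_{\rm OT}(\rho)$. Moreover, if $w$ is $C^1$ on $\{(x,y)\in I\times I:|x-y|_{\mathbb T}>0\}$, then the regular Kantorovich potential $v_{\rm OT}(\rho)$ is unique and $v_\varepsilon(\rho)+C_\varepsilon\rightharpoonup v_{\rm OT}(\rho)$ as $\varepsilon\downarrow0$ without passing to a subsequence.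
   Context: $I=[0,2\pi]$, $I_n=I^n$, $|t|_{\mathbb T}=\min\{|t-k|:k\in2\pi\mathbb Z\}$. Assumption A: $w:I\times I\to[0,+\infty]$ symmetric, continuous (for the topology of $[0,+\infty]$), with $\{w=\infty\}=\{(x,y):|x-y|_{\mathbb T}=0\}$. $c_n(x)=\sum_{i\ne j}w(x_i,x_j)$; $F_{\rm OT}(\rho)=\min\{\int_{I_n}c_n\,d\gamma:\gamma\in\mathcal P(I_n),\text{ all marginals }=\rho\}$. $\mathrm H^1_{\rm per}(I)$: restrictions to $I$ of $2\pi$-periodic $\mathrm H^1_{\rm loc}(\mathbb R)$ functions; $\mathrm H^{-1}_{\rm per}(I)$ its dual, $\langle\cdot,\cdot\rangle$ the duality pairing. $\mathcal D_{\rm per}=\{\rho\in\mathrm H^1_{\rm per}(I):\rho(x)>0\ \forall x\in I,\ \int_I\rho=1\}$. $F^\varepsilon_{\rm per}(\rho)=\inf\{\sum_k\lambda_k\int_{I_n}(\varepsilon|\nabla\Psi_k|^2+c_n|\Psi_k|^2)\}$ over orthonormal $\Psi_k\in\wedge^n\mathrm L^2(I)\cap\mathrm H^1_{\rm per}(I_n)$, $\lambda_k\ge0$, $\sum\lambda_k=1$, $\sum_k\lambda_k\rho_{\Psi_k}=n\rho$, where $\rho_\Psi(x)=n\int|\Psi(x,x_2,\dots,x_n)|^2dx_2\cdots dx_n$ and $\mathrm H^1_{\rm per}(I_n)$ is periodic $\mathrm H^1$ on $I_n$. Kantorovich potential: a $\rho$-integrable $v:I\to\mathbb R$ with $F_{\rm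 OT}(\rho)=n\int_I\rho v$ and $c_n(x_1,\dots,x_n)-\sum_{j=1}^nv(x_j)\ge0$ for every $(x_1,\dots,x_n)\in I_n$; it is regular if continuous (a continuous function is viewed as an element of $\mathrm H^{-1}_{\rm per}(I)$). *)

theory Defs
  imports "HOL-Probability.Probability" "HOL-Combinatorics.Permutations"
begin

definition Iper :: "real set" where
  "Iper = {0 .. 2 * pi}"

definition distT :: "real \<Rightarrow> real" where
  "distT t = Inf {\<bar>t - 2 * pi * real_of_int k\<bar> | k. True}"

definition assumptionA :: "(real \<times> real \<Rightarrow> ennreal) \<Rightarrow> bool" where
  "assumptionA w \<longleftrightarrow>
     (\<forall>x\<in>Iper. \<forall>y\<in>Iper. w (x, y) = w (y, x)) \<and>
     continuous_on (Iper \<times> Iper) w \<and>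
     {p \<in> Iper \<times> Iper. w p = \<infinity>} = {(x, y) \<in> Iper \<times> Iper. distT (x - y) = 0}"

definition offdiag :: "(real \<times> real) set" where
  "offdiag = {(x, y) \<in> Iper \<times> Iper. distT (x - y) > 0}"

definition C1_offdiag :: "(real \<times> real \<Rightarrow> ennreal) \<Rightarrow> bool" where
  "C1_offdiag w \<longleftrightarrow>
     (\<exists>D :: real \<times> real \<Rightarrow> ((real \<times> real) \<Rightarrow>\<^sub>L real).
        continuous_on offdiag D \<and>
        (\<forall>p\<in>offdiag. ((\<lambda>q. enn2real (w q)) has_derivative blinfun_apply (D p)) (at p within offdiag)))"

definition trig1 :: "int \<Rightarrow> real \<Rightarrow> complex" where
  "trig1 m t = cis (real_of_int m * t)"

text \<open>g is the periodic weak derivative of f on I (test functions: trigonometric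
  polynomials, i.e. smooth 2 pi-periodic functions up to density).\<close>
definition wderiv1 :: "(real \<Rightarrow> complex) \<Rightarrow> (real \<Rightarrow> complex) \<Rightarrow> bool" where
  "wderiv1 f g \<longleftrightarrow>
     f \<in> borel_measurable (lebesgue_on Iper) \<and> g \<in> borel_measurable (lebesgue_on Iper) \<and>
     integrable (lebesgue_on Iper) (\<lambda>t. (cmod (f t))\<^sup>2) \<and>
     integrable (lebesgue_on Iper) (\<lambda>t. (cmod (g t))\<^sup>2) \<and>
     (\<forall>m::int. (\<integral>t. f t * (\<i> * of_int m * trig1 m t) \<partial>lebesgue_on Iper)
                = - (\<integral>t. g t * trig1 m t \<partial>lebesgue_on Iper))"

definition H1per :: "(real \<Rightarrow> real) \<Rightarrow> bool" where
  "H1per f \<longleftrightarrow> (\<exists>g. wderiv1 (\<lambda>t. complex_of_real (f t)) g)"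

definition Hminus :: "((real \<Rightarrow> real) \<Rightarrow> real) \<Rightarrow> bool" where
  "Hminus v \<longleftrightarrow>
     (\<forall>f h a b. H1per f \<longrightarrow> H1per h \<longrightarrow> v (\<lambda>t. a * f t + b * h t) = a * v f + b * v h) \<and>
     (\<exists>B. \<forall>f g. wderiv1 (\<lambda>t. complex_of_real (f t)) g \<longrightarrow>
          \<bar>v f\<bar> \<le> B * sqrt ((\<integral>t. (f t)\<^sup>2 \<partial>lebesgue_on Iper) + (\<integral>t. (cmod (g t))\<^sup>2 \<partial>lebesgue_on Iper)))"

text \<open>The set D_per (continuous representative of rho).\<close>
definition Dper :: "(real \<Rightarrow> real) \<Rightarrow> bool" where
  "Dper \<rho> \<longleftrightarrow> H1per \<rho> \<and> continuous_on Iper \<rho> \<and> (\<forall>x\<in>Iper. \<rho> x > 0) \<and>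
     (\<integral>t. \<rho> t \<partial>lebesgue_on Iper) = 1"

definition adm :: "(real \<Rightarrow> real) \<Rightarrow> bool" where
  "adm \<zeta> \<longleftrightarrow> (\<forall>x\<in>Iper. 0 \<le> \<zeta> x) \<and> H1per (\<lambda>t. sqrt (\<zeta> t)) \<and>
     (\<integral>t. \<zeta> t \<partial>lebesgue_on Iper) = 1"

definition muN :: "nat \<Rightarrow> (nat \<Rightarrow> real) measure" where
  "muN n = PiM {..<n} (\<lambda>_. lebesgue_on Iper)"

definition cN :: "nat \<Rightarrow> (real \<times> real \<Rightarrow> ennreal) \<Rightarrow> (nat \<Rightarrow> real) \<Rightarrow> ennreal" where
  "cN n w x = (\<Sum>i\<in>{..<n}. \<Sum>j\<in>{..<n} - {i}. w (x i, x j))"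

definition trigN :: "nat \<Rightarrow> (nat \<Rightarrow> int) \<Rightarrow> (nat \<Rightarrow> real) \<Rightarrow> complex" where
  "trigN n m x = cis (\<Sum>j<n. real_of_int (m j) * x j)"

definition wgradN :: "nat \<Rightarrow> ((nat \<Rightarrow> real) \<Rightarrow> complex) \<Rightarrow> (nat \<Rightarrow> (nat \<Rightarrow> real) \<Rightarrow> complex) \<Rightarrow> bool" where
  "wgradN n \<Psi> G \<longleftrightarrow>
     \<Psi> \<in> borel_measurable (muN n) \<and> integrable (muN n) (\<lambda>x. (cmod (\<Psi> x))\<^sup>2) \<and>
     (\<forall>j<n. G j \<in> borel_measurable (muN n) \<and> integrable (muN n) (\<lambda>x. (cmod (G j x))\<^sup>2) \<and>
        (\<forall>m::nat \<Rightarrow> int. (\<integral>x. \<Psi> x * (\<i> * of_int (m j) * trigN n m x) \<partial>muN n)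
                = - (\<integral>x. G j x * trigN n m x \<partial>muN n)))"

definition antisymN :: "nat \<Rightarrow> ((nat \<Rightarrow> real) \<Rightarrow> complex) \<Rightarrow> bool" where
  "antisymN n \<Psi> \<longleftrightarrow>
     (\<forall>\<sigma>. \<sigma> permutes {..<n} \<longrightarrow>
        (AE x in muN n. \<Psi> (x \<circ> \<sigma>) = of_int (sign \<sigma>) * \<Psi> x))"

definition innerN :: "nat \<Rightarrow> ((nat \<Rightarrow> real) \<Rightarrow> complex) \<Rightarrow> ((nat \<Rightarrow> real) \<Rightarrow> complex) \<Rightarrow> complex" where
  "innerN n \<Psi> \<Phi> = (\<integral>x. cnj (\<Psi> x) * \<Phi> x \<partial>muN n)"

text \<open>rho_Psi(t) = n * integral of |Psi(t, x_2, ..., x_n)|^2 (first variable is index 0).\<close>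
definition densN :: "nat \<Rightarrow> ((nat \<Rightarrow> real) \<Rightarrow> complex) \<Rightarrow> real \<Rightarrow> ennreal" where
  "densN n \<Psi> t = ennreal (real n) *
     (\<integral>\<^sup>+ y. ennreal ((cmod (\<Psi> (y(0 := t))))\<^sup>2) \<partial>PiM {1..<n} (\<lambda>_. lebesgue_on Iper))"

definition energyN :: "nat \<Rightarrow> (real \<times> real \<Rightarrow> ennreal) \<Rightarrow> real \<Rightarrow> ((nat \<Rightarrow> real) \<Rightarrow> complex)
    \<Rightarrow> (nat \<Rightarrow> (nat \<Rightarrow> real) \<Rightarrow> complex) \<Rightarrow> ennreal" where
  "energyN n w \<epsilon> \<Psi> G =
     (\<integral>\<^sup>+ x. ennreal (\<epsilon> * (\<Sum>j<n. (cmod (G j x))\<^sup>2)) + cN n w x * ennreal ((cmod (\<Psi> x))\<^sup>2) \<partial>muN n)"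

definition mixed :: "nat \<Rightarrow> (real \<Rightarrow> real) \<Rightarrow> (nat \<Rightarrow> real) \<Rightarrow> (nat \<Rightarrow> (nat \<Rightarrow> real) \<Rightarrow> complex)
    \<Rightarrow> (nat \<Rightarrow> nat \<Rightarrow> (nat \<Rightarrow> real) \<Rightarrow> complex) \<Rightarrow> bool" where
  "mixed n \<rho> lam \<Psi> G \<longleftrightarrow>
     (\<forall>k. 0 \<le> lam k) \<and> lam sums 1 \<and>
     (\<forall>k. antisymN n (\<Psi> k) \<and> wgradN n (\<Psi> k) (G k)) \<and>
     (\<forall>k l. innerN n (\<Psi> k) (\<Psi> l) = (if k = l then 1 else 0)) \<and>
     (AE t in lebesgue_on Iper. (\<Sum>k. ennreal (lam k) * densN n (\<Psi> k) t) = ennreal (real n * \<rho> t))"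

definition Feps :: "nat \<Rightarrow> (real \<times> real \<Rightarrow> ennreal) \<Rightarrow> real \<Rightarrow> (real \<Rightarrow> real) \<Rightarrow> ennreal" where
  "Feps n w \<epsilon> \<rho> =
     (INF s \<in> {(lam, \<Psi>, G). mixed n \<rho> lam \<Psi> G}.
        (case s of (lam, \<Psi>, G) \<Rightarrow> (\<Sum>k. ennreal (lam k) * energyN n w \<epsilon> (\<Psi> k) (G k))))"

definition coupling :: "nat \<Rightarrow> (real \<Rightarrow> real) \<Rightarrow> (nat \<Rightarrow> real) measure \<Rightarrow> bool" where
  "coupling n \<rho> \<gamma> \<longleftrightarrow>
     sets \<gamma> = sets (PiM {..<n} (\<lambda>_. restrict_space lborel Iper)) \<and> prob_space \<gamma> \<and>
     (\<forall>j<n. distr \<gamma> (restrict_space lborel Iper) (\<lambda>x. x j)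
             = density (restrict_space lborel Iper) (\<lambda>t. ennreal (\<rho> t)))"

definition FOT :: "nat \<Rightarrow> (real \<times> real \<Rightarrow> ennreal) \<Rightarrow> (real \<Rightarrow> real) \<Rightarrow> ennreal" where
  "FOT n w \<rho> = (INF \<gamma> \<in> {\<gamma>. coupling n \<rho> \<gamma>}. \<integral>\<^sup>+ x. cN n w x \<partial>\<gamma>)"

definition kantorovich_pot :: "nat \<Rightarrow> (real \<times> real \<Rightarrow> ennreal) \<Rightarrow> (real \<Rightarrow> real) \<Rightarrow> (real \<Rightarrow> real) \<Rightarrow> bool" where
  "kantorovich_pot n w \<rho> v \<longleftrightarrow>
     integrable (lebesgue_on Iper) (\<lambda>t. \<rho> t * v t) \<and>
     enn2ereal (FOT n w \<rho>) = ereal (real n * (\<integral>t. \<rho> t * v t \<partial>lebesgue_on Iper)) \<and>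
     (\<forall>x\<in>PiE {..<n} (\<lambda>_. Iper). 0 \<le> enn2ereal (cN n w x) - ereal (\<Sum>j<n. v (x j)))"

definition regular_kantorovich_pot :: "nat \<Rightarrow> (real \<times> real \<Rightarrow> ennreal) \<Rightarrow> (real \<Rightarrow> real) \<Rightarrow> (real \<Rightarrow> real) \<Rightarrow> bool" where
  "regular_kantorovich_pot n w \<rho> v \<longleftrightarrow> kantorovich_pot n w \<rho> v \<and> continuous_on Iper v"

end

theory Submission
  imports Defs
begin

text \<open>
Normalise the potential by a constant so that n V(rho) is the quantum energy of rho. For disjointly supported
orbitals with squares f_1, ..., f_n, multiplying each orbital by phases running through its mass coordinate gives
infinitely many orthonormal Slater determinants with the same density, so mixed states realise the density
(f_1 + ... + f_n) / n with energy at most epsilon times a kinetic term plus the maximal cost on the product of the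
supports. Minimality therefore bounds V(f_1) + ... + V(f_n) from above. A density comparable to rho can be cut into
windows of equal mass that are grouped into such families, and since V(rho) is nonnegative this yields a bound on
the normalised potentials in the dual norm that is uniform in epsilon, and hence a weak limit V.

For the limit the kinetic term disappears, and testing with narrow bumps shows that the upper envelope of V is
feasible in the dual transport problem. A maximal feasible u above the envelope (Zorn's lemma) is an infimum of
translates of the cost away from the diagonal, hence continuous, and V is dominated by integration against u. The
quantum energy dominates the transport cost, so n V(rho) is at least the transport cost, which by weak duality is at
least n times the integral of rho u. Since rho is strictly positive, equality at rho forces V to be integration
against u, and u is a Kantorovich potential.

If the cost is differentiable off the diagonal, any two potentials are touched from above by the same smooth
functions, so their difference is constant, and the constant is zero because the values agree. Convergence of the
whole family then follows from uniqueness of the limit along subsequences.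
\<close>

section \<open>Periodic functions on the real line\<close>

abbreviation Lper :: "real measure" where "Lper \<equiv> lebesgue_on Iper"

lemma sets_Iper [simp, measurable]: "Iper \<in> sets lebesgue" "Iper \<in> sets borel" "Iper \<in> sets lborel"
  by (auto simp: Iper_def)

lemma compact_Iper: "compact Iper" by (simp add: Iper_def)

lemma zero_in_Iper: "0 \<in> Iper" by (simp add: Iper_def)

interpretation Lper: finite_measure Lper
  by (rule finite_measure_lebesgue_on) (simp add: Iper_def)

lemma measure_Lper [simp]: "measure Lper Iper = 2 * pi"
  by (simp add: measure_def Iper_def emeasure_restrict_space)

lemma integrable_Lper_continuous:
  fixes f :: "real \<Rightarrow> 'b::euclidean_space"
  assumes "continuous_on Iper f" shows "integrable Lper f"
  using assms unfolding Iper_def by (rule continuous_imp_integrable_real)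

lemma measurable_Lper_continuous:
  fixes f :: "real \<Rightarrow> 'b::euclidean_space"
  assumes "continuous_on Iper f" shows "f \<in> borel_measurable Lper"
  using integrable_Lper_continuous[OF assms] by auto

lemma integral_Lper_eq_integral:
  fixes f :: "real \<Rightarrow> 'b::euclidean_space"
  assumes "continuous_on Iper f" shows "integral\<^sup>L Lper f = integral Iper f"
  by (rule lebesgue_integral_eq_integral[OF integrable_Lper_continuous[OF assms]]) simp

lemma integral_Lper_vector_derivative:
  fixes f :: "real \<Rightarrow> 'b::euclidean_space"
  assumes "\<And>t. (f has_vector_derivative f' t) (at t)" "continuous_on UNIV f'"
  shows "integral\<^sup>L Lper f' = f (2 * pi) - f 0"
proof -
  have "(f' has_integral (f (2 * pi) - f 0)) {0..2*pi}"
    by (rule fundamental_theorem_of_calculus) (auto intro: has_vector_derivative_at_within assms)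
  then have "integral Iper f' = f (2*pi) - f 0" unfolding Iper_def by (rule integral_unique)
  then show ?thesis
    using integral_Lper_eq_integral[of f'] assms(2) continuous_on_subset by (metis subset_UNIV)
qed

lemma integral_Lper_eq_0_continuous:
  fixes f :: "real \<Rightarrow> real"
  assumes "continuous_on Iper f" "\<And>t. t \<in> Iper \<Longrightarrow> 0 \<le> f t" "(\<integral>t. f t \<partial>Lper) = 0" "s \<in> Iper"
  shows "f s = 0"
  using integralL_eq_0_iff[of 0 "2 * pi" f] assms by (simp add: Iper_def)

lemma integral_Lper_pos:
  fixes f :: "real \<Rightarrow> real"
  assumes "continuous_on Iper f" "\<And>t. t \<in> Iper \<Longrightarrow> 0 \<le> f t" "s \<in> Iper" "0 < f s"
  shows "0 < (\<integral>t. f t \<partial>Lper)"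
proof -
  have "0 \<le> (\<integral>t. f t \<partial>Lper)" using assms(2) by (intro integral_nonneg_AE AE_I2) simp
  moreover have "(\<integral>t. f t \<partial>Lper) \<noteq> 0" using integral_Lper_eq_0_continuous[OF assms(1,2) _ assms(3)] assms(4) by auto
  ultimately show ?thesis by simp
qed

lemma continuous_on_Iper_bounded:
  assumes "continuous_on Iper (u :: real \<Rightarrow> real)"
  obtains U where "0 \<le> U" "\<And>t. t \<in> Iper \<Longrightarrow> \<bar>u t\<bar> \<le> U"
proof -
  have "bounded (u ` Iper)" using compact_imp_bounded[OF compact_continuous_image[OF assms compact_Iper]] .
  then obtain U where "\<And>t. t \<in> Iper \<Longrightarrow> \<bar>u t\<bar> \<le> U" by (auto simp: bounded_iff)
  then show ?thesis using that[of "max U 0"] by (auto simp: le_max_iff_disj)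
qed

lemma periodic_shift_int:
  fixes f :: "real \<Rightarrow> 'a"
  assumes "\<And>t. f (t + 2 * pi) = f t"
  shows "f (t + 2 * pi * of_int k) = f t"
proof -
  have shift_nat: "f (t + 2 * pi * real m) = f t" for m :: nat and t
  proof (induction m)
    case (Suc m)
    have "t + 2 * pi * real (Suc m) = (t + 2 * pi * real m) + 2 * pi" by (simp add: algebra_simps)
    then show ?case using assms[of "t + 2 * pi * real m"] Suc by metis
  qed simp
  show ?thesis
  proof (cases "k \<ge> 0")
    case True then show ?thesis using shift_nat[of t "nat k"] by simp
  next
    case False
    then show ?thesis using shift_nat[of "t + 2 * pi * of_int k" "nat (- k)"] by simp
  qed
qed

lemma shift_into_Iper: "\<exists>k::int. t + 2 * pi * of_int k \<in> Iper"
proof -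
  define k where "k = \<lfloor>t / (2 * pi)\<rfloor>"
  have "of_int k \<le> t / (2 * pi)" "t / (2 * pi) < of_int k + 1" unfolding k_def by linarith+
  then have "of_int k * (2 * pi) \<le> t" "t < (of_int k + 1) * (2 * pi)"
    by (simp_all only: pos_le_divide_eq pos_divide_less_eq pi_gt_zero zero_less_mult_iff zero_less_numeral simp_thms)
  then have "t + 2 * pi * of_int (- k) \<in> Iper" by (auto simp: Iper_def algebra_simps)
  then show ?thesis by blast
qed

lemma periodic_value_on_Iper:
  fixes f :: "real \<Rightarrow> 'a"
  assumes "\<And>t. f (t + 2 * pi) = f t"
  obtains s where "s \<in> Iper" "f s = f t"
  using shift_into_Iper[of t] periodic_shift_int[of f, OF assms] by metis

lemma antiderivative_exists:
  fixes g :: "real \<Rightarrow> 'a::euclidean_space"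
  assumes "continuous_on UNIV g"
  obtains G where "\<And>t. (G has_vector_derivative g t) (at t)" "G 0 = 0"
proof -
  have "\<exists>F. \<forall>x :: real. - \<infinity> < ereal x \<longrightarrow> ereal x < \<infinity> \<longrightarrow> (F has_vector_derivative g x) (at x)"
    using assms by (intro einterval_antiderivative) (auto simp: continuous_on_eq_continuous_at)
  then obtain F where F: "\<And>x. (F has_vector_derivative g x) (at x)" by auto
  show ?thesis
    by (rule that[of "\<lambda>t. F t - F 0"]) (use F in \<open>auto intro!: derivative_eq_intros\<close>)
qed

lemma antiderivative_periodic:
  fixes G :: "real \<Rightarrow> 'a::euclidean_space"
  assumes G: "\<And>t. (G has_vector_derivative g t) (at t)"
    and g: "continuous_on UNIV g" "\<And>t. g (t + 2 * pi) = g t"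
  shows "G (t + 2 * pi) = G t + (\<integral>t. g t \<partial>Lper)"
proof -
  have "((\<lambda>t. G (t + 2 * pi) - G t) has_vector_derivative 0) (at x)" for x
  proof -
    have "((G \<circ> (\<lambda>t. t + 2 * pi)) has_vector_derivative 1 *\<^sub>R g (x + 2 * pi)) (at x)"
      by (rule vector_diff_chain_at) (auto intro!: derivative_eq_intros G)
    from has_vector_derivative_diff[OF this G[of x]] show ?thesis by (simp add: g o_def)
  qed
  then obtain c where c: "\<And>x. G (x + 2 * pi) - G x = c"
    using has_vector_derivative_zero_constant[of UNIV "\<lambda>t. G (t + 2 * pi) - G t"] by auto
  have "G t + (G (2 * pi) - G 0) = G (t + 2 * pi)" using c[of t] c[of 0] by (simp add: algebra_simps)
  then show ?thesis using integral_Lper_vector_derivative[OF G g(1)] by simp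
qed

subsection \<open>Continuously differentiable periodic functions\<close>

definition C1per :: "(real \<Rightarrow> real) \<Rightarrow> (real \<Rightarrow> real) \<Rightarrow> bool" where
  "C1per f f' \<longleftrightarrow> (\<forall>t. (f has_real_derivative f' t) (at t)) \<and> continuous_on UNIV f' \<and>
     (\<forall>t. f (t + 2 * pi) = f t)"

lemma C1per_DERIV: "C1per f f' \<Longrightarrow> (f has_real_derivative f' t) (at t)"
  by (simp add: C1per_def)

lemma C1per_periodic: "C1per f f' \<Longrightarrow> f (t + 2 * pi) = f t"
  by (simp add: C1per_def)

lemma C1per_continuous: assumes "C1per f f'" shows "continuous_on A f" "continuous_on A f'"
proof -
  have "continuous_on UNIV f" using C1per_DERIV[OF assms]
    by (meson DERIV_isCont continuous_at_imp_continuous_on)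
  then show "continuous_on A f" using continuous_on_subset by blast
  show "continuous_on A f'" using assms unfolding C1per_def using continuous_on_subset by blast
qed

lemma C1per_const: "C1per (\<lambda>t. c) (\<lambda>t. 0)"
  by (auto simp: C1per_def)

lemma C1per_lin:
  "C1per f f' \<Longrightarrow> C1per h h' \<Longrightarrow> C1per (\<lambda>t. a * f t + b * h t) (\<lambda>t. a * f' t + b * h' t)"
  unfolding C1per_def by (auto intro!: derivative_eq_intros continuous_intros)

lemma C1per_cmult: "C1per f f' \<Longrightarrow> C1per (\<lambda>t. c * f t) (\<lambda>t. c * f' t)"
  using C1per_lin[of f f' f f' c 0] by simp

lemma C1per_diff: "C1per f f' \<Longrightarrow> C1per h h' \<Longrightarrow> C1per (\<lambda>t. f t - h t) (\<lambda>t. f' t - h' t)"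
  using C1per_lin[of f f' h h' 1 "-1"] by simp

lemma C1per_sum:
  "finite A \<Longrightarrow> (\<And>i. i \<in> A \<Longrightarrow> C1per (f i) (f' i)) \<Longrightarrow> C1per (\<lambda>t. \<Sum>i\<in>A. f i t) (\<lambda>t. \<Sum>i\<in>A. f' i t)"
proof (induction rule: finite_induct)
  case empty then show ?case by (simp add: C1per_const)
next
  case (insert x F)
  have "C1per (\<lambda>t. 1 * f x t + 1 * (\<Sum>i\<in>F. f i t)) (\<lambda>t. 1 * f' x t + 1 * (\<Sum>i\<in>F. f' i t))"
    using insert by (intro C1per_lin) auto
  then show ?case using insert by simp
qed

lemma C1per_mult:
  assumes "C1per f f'" "C1per h h'" shows "C1per (\<lambda>t. f t * h t) (\<lambda>t. f' t * h t + f t * h' t)"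
  using assms C1per_continuous[OF assms(1), of UNIV] C1per_continuous[OF assms(2), of UNIV]
  unfolding C1per_def by (auto intro!: derivative_eq_intros continuous_intros)

lemma C1per_square: "C1per f f' \<Longrightarrow> C1per (\<lambda>t. (f t)\<^sup>2) (\<lambda>t. 2 * f t * f' t)"
  using C1per_mult[of f f' f f'] by (simp add: power2_eq_square algebra_simps)

lemma C1per_compose:
  assumes "C1per f f'" "\<And>t. (\<phi> has_real_derivative \<phi>' (f t)) (at (f t))"
    "continuous_on (range f) \<phi>'"
  shows "C1per (\<lambda>t. \<phi> (f t)) (\<lambda>t. \<phi>' (f t) * f' t)"
  unfolding C1per_def
proof (intro conjI allI)
  fix t show "((\<lambda>t. \<phi> (f t)) has_real_derivative \<phi>' (f t) * f' t) (at t)"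
    by (rule DERIV_chain2[where g=f, OF assms(2) C1per_DERIV[OF assms(1)]])
  show "\<phi> (f (t + 2 * pi)) = \<phi> (f t)" by (simp add: C1per_periodic[OF assms(1)])
next
  show "continuous_on UNIV (\<lambda>t. \<phi>' (f t) * f' t)"
    using C1per_continuous[OF assms(1)]
    by (intro continuous_on_mult continuous_on_compose2[OF assms(3)]) auto
qed

lemma C1per_sqrt:
  assumes "C1per f f'" "\<And>t. 0 < f t" shows "C1per (\<lambda>t. sqrt (f t)) (\<lambda>t. inverse (sqrt (f t)) / 2 * f' t)"
  using assms(2) by (intro C1per_compose[OF assms(1), of sqrt "\<lambda>y. inverse (sqrt y) / 2"] DERIV_real_sqrt
      continuous_intros) (auto simp: less_imp_neq[symmetric])

lemma C1per_inverse:
  assumes "C1per f f'" "\<And>t. 0 < f t"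
  shows "C1per (\<lambda>t. inverse (f t)) (\<lambda>t. - (inverse (f t) ^ Suc (Suc 0)) * f' t)"
  using assms(2) by (intro C1per_compose[OF assms(1), of inverse "\<lambda>y. - (inverse y ^ Suc (Suc 0))"] DERIV_inverse
      continuous_intros) (auto simp: less_imp_neq[symmetric])

lemma C1per_shift:
  assumes "C1per f f'" shows "C1per (\<lambda>t. f (t - a)) (\<lambda>t. f' (t - a))"
  unfolding C1per_def
proof (intro conjI allI)
  fix t
  have "((\<lambda>t. f (t - a)) has_real_derivative f' (t - a) * 1) (at t)"
    by (rule DERIV_chain2[OF C1per_DERIV[OF assms]]) (auto intro!: derivative_eq_intros)
  then show "((\<lambda>t. f (t - a)) has_real_derivative f' (t - a)) (at t)" by simp
  show "continuous_on UNIV (\<lambda>t. f' (t - a))"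
    by (rule continuous_on_compose2[OF C1per_continuous(2)[OF assms, of UNIV]]) (auto intro!: continuous_intros)
  show "f (t + 2 * pi - a) = f (t - a)" using C1per_periodic[OF assms, of "t - a"] by (simp add: algebra_simps)
qed

lemma C1per_deriv_periodic:
  assumes "C1per f f'" shows "f' (t + 2 * pi) = f' t"
proof (rule DERIV_unique)
  have "((\<lambda>t. f (t + 2 * pi)) has_real_derivative f' (t + 2 * pi) * 1) (at t)"
    by (rule DERIV_chain2[OF C1per_DERIV[OF assms]]) (auto intro!: derivative_eq_intros)
  then show "(f has_real_derivative f' (t + 2 * pi)) (at t)" by (simp add: C1per_periodic[OF assms])
qed (rule C1per_DERIV[OF assms])

lemma C1per_bounded:
  assumes "C1per f f'"
  obtains B where "0 \<le> B" "\<And>t. \<bar>f t\<bar> \<le> B" "\<And>t. \<bar>f' t\<bar> \<le> B"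
proof -
  have bounded_periodic: "\<exists>B\<ge>0. \<forall>t. \<bar>h t\<bar> \<le> B" if "continuous_on Iper h" "\<And>t. h (t + 2 * pi) = h t"
    for h :: "real \<Rightarrow> real"
    using continuous_on_Iper_bounded[OF that(1)] periodic_value_on_Iper[of h, OF that(2)] by metis
  obtain B1 where "0 \<le> B1" "\<And>t. \<bar>f t\<bar> \<le> B1"
    using bounded_periodic[OF C1per_continuous(1)[OF assms] C1per_periodic[OF assms]] by blast
  moreover obtain B2 where "0 \<le> B2" "\<And>t. \<bar>f' t\<bar> \<le> B2"
    using bounded_periodic[OF C1per_continuous(2)[OF assms] C1per_deriv_periodic[OF assms]] by blast
  ultimately show ?thesis using that[of "max B1 B2"] by (auto simp: le_max_iff_disj)
qed

lemma C1per_square_increment_le: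
  assumes h: "C1per h h'" and ab: "a \<le> b" "a \<in> Iper" "b \<in> Iper"
  shows "\<bar>(h b)\<^sup>2 - (h a)\<^sup>2\<bar> \<le> (\<integral>t. (h t)\<^sup>2 \<partial>Lper) + (\<integral>t. (h' t)\<^sup>2 \<partial>Lper)"
proof -
  note h_cont = C1per_continuous[OF h]
  have "((\<lambda>t. 2 * h t * h' t) has_integral ((h b)\<^sup>2 - (h a)\<^sup>2)) {a..b}"
    by (intro fundamental_theorem_of_calculus ab(1))
      (auto intro!: derivative_eq_intros has_field_derivative_at_within[OF C1per_DERIV[OF h]]
        simp: has_real_derivative_iff_has_vector_derivative[symmetric])
  then have "\<bar>(h b)\<^sup>2 - (h a)\<^sup>2\<bar> = norm (integral {a..b} (\<lambda>t. 2 * h t * h' t))"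
    by (simp add: integral_unique)
  also have "\<dots> \<le> integral {a..b} (\<lambda>t. (h t)\<^sup>2 + (h' t)\<^sup>2)"
  proof (rule integral_norm_bound_integral)
    show "(\<lambda>t. 2 * h t * h' t) integrable_on {a..b}" "(\<lambda>t. (h t)\<^sup>2 + (h' t)\<^sup>2) integrable_on {a..b}"
      by (auto intro!: integrable_continuous_real continuous_intros h_cont)
    show "norm (2 * h x * h' x) \<le> (h x)\<^sup>2 + (h' x)\<^sup>2" for x
      using sum_squares_bound[of "h x" "h' x"] sum_squares_bound[of "h x" "- h' x"] by (auto simp: abs_le_iff)
  qed
  also have "\<dots> \<le> integral Iper (\<lambda>t. (h t)\<^sup>2 + (h' t)\<^sup>2)"
    using ab by (intro integral_subset_le)
      (auto intro!: integrable_continuous_real continuous_intros h_cont simp: Iper_def)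
  also have "\<dots> = (\<integral>t. (h t)\<^sup>2 + (h' t)\<^sup>2 \<partial>Lper)"
    by (intro integral_Lper_eq_integral[symmetric] continuous_intros h_cont)
  finally show ?thesis
    by (simp add: integrable_Lper_continuous h_cont continuous_intros)
qed

text \<open>The square exceeds its minimum, which is at most its mean, by at most the integral of $2|h h'|$.\<close>

lemma C1per_square_le:
  assumes h: "C1per h h'" and t: "t \<in> Iper"
  shows "(h t)\<^sup>2 \<le> 2 * ((\<integral>t. (h t)\<^sup>2 \<partial>Lper) + (\<integral>t. (h' t)\<^sup>2 \<partial>Lper))"
proof -
  note h_cont = C1per_continuous[OF h]
  have square_cont: "continuous_on Iper (\<lambda>t. (h t)\<^sup>2)" by (intro continuous_intros h_cont)
  obtain s where s: "s \<in> Iper" "\<And>t. t \<in> Iper \<Longrightarrow> (h s)\<^sup>2 \<le> (h t)\<^sup>2"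
    using continuous_attains_inf[OF compact_Iper _ square_cont] zero_in_Iper by blast
  have "(h s)\<^sup>2 \<le> 2 * pi * (h s)\<^sup>2" using pi_gt3 by (simp add: mult_le_cancel_right1)
  also have "\<dots> = (\<integral>t. (h s)\<^sup>2 \<partial>Lper)" by simp
  also have "\<dots> \<le> (\<integral>t. (h t)\<^sup>2 \<partial>Lper)"
    using s by (intro integral_mono integrable_Lper_continuous square_cont continuous_intros) auto
  finally have "(h s)\<^sup>2 \<le> (\<integral>t. (h t)\<^sup>2 \<partial>Lper)" .
  moreover have "(h t)\<^sup>2 - (h s)\<^sup>2 \<le> (\<integral>t. (h t)\<^sup>2 \<partial>Lper) + (\<integral>t. (h' t)\<^sup>2 \<partial>Lper)"
    using C1per_square_increment_le[OF h _ s(1) t] C1per_square_increment_le[OF h _ t s(1)] by (cases "s \<le> t") auto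
  moreover have "(\<integral>t. (h' t)\<^sup>2 \<partial>Lper) \<ge> 0" by (rule Bochner_Integration.integral_nonneg) simp
  ultimately show ?thesis by (smt (verit))
qed

subsection \<open>Mass coordinates\<close>

locale mass_coordinate =
  fixes g s :: "real \<Rightarrow> real"
  assumes density_continuous: "continuous_on UNIV g"
    and density_periodic: "\<And>t. g (t + 2 * pi) = g t"
    and density_mass: "(\<integral>t. g t \<partial>Lper) = 1"
    and coordinate_DERIV: "\<And>t. (s has_real_derivative g t) (at t)"
    and coordinate_0: "s 0 = 0"
begin

lemma coordinate_continuous: "continuous_on A s"
  using coordinate_DERIV by (meson DERIV_isCont continuous_at_imp_continuous_on)

lemma coordinate_shift: "s (t + 2 * pi) = s t + 1"
  using antiderivative_periodic[of s g t, OF _ density_continuous density_periodic] coordinate_DERIV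
  by (simp add: density_mass has_real_derivative_iff_has_vector_derivative)

lemma coordinate_2pi: "s (2 * pi) = 1"
  using coordinate_shift[of 0] by (simp add: coordinate_0)

lemma integral_compose_coordinate:
  fixes P :: "real \<Rightarrow> 'a::euclidean_space"
  assumes P: "continuous_on UNIV P" "\<And>t. P (t + 2 * pi) = P t"
  shows "(\<integral>t. g t *\<^sub>R P (2 * pi * s t - a) \<partial>Lper) = (1 / (2 * pi)) *\<^sub>R (\<integral>t. P t \<partial>Lper)"
proof -
  obtain Q where Q: "\<And>t. (Q has_vector_derivative P t) (at t)" using antiderivative_exists[OF P(1)] by metis
  let ?y = "\<lambda>t. 2 * pi * s t - a"
  have "((Q \<circ> ?y) has_vector_derivative (2 * pi * g t) *\<^sub>R P (?y t)) (at t)" for t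
    by (rule vector_diff_chain_at[OF _ Q])
      (auto intro!: derivative_eq_intros coordinate_DERIV simp:
        has_real_derivative_iff_has_vector_derivative[symmetric])
  from bounded_linear.has_vector_derivative[OF bounded_linear_scaleR_right this, of "1 / (2 * pi)"]
  have "((\<lambda>t. (1 / (2 * pi)) *\<^sub>R Q (?y t)) has_vector_derivative g t *\<^sub>R P (?y t)) (at t)" for t
    by (simp add: o_def)
  then have "(\<integral>t. g t *\<^sub>R P (?y t) \<partial>Lper) = (1 / (2 * pi)) *\<^sub>R Q (?y (2 * pi)) - (1 / (2 * pi)) *\<^sub>R Q (?y 0)"
    by (rule integral_Lper_vector_derivative)
      (auto intro!: continuous_intros density_continuous coordinate_continuous continuous_on_compose2[OF P(1)])
  also have "\<dots> = (1 / (2 * pi)) *\<^sub>R (Q (- a + 2 * pi) - Q (- a))"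
    by (simp add: coordinate_0 coordinate_2pi scaleR_diff_right add.commute)
  also have "Q (- a + 2 * pi) - Q (- a) = (\<integral>t. P t \<partial>Lper)" using antiderivative_periodic[OF Q P, of "- a"] by simp
  finally show ?thesis .
qed

lemma C1per_compose_coordinate:
  assumes W: "C1per W W'"
  shows "C1per (\<lambda>t. W (2 * pi * s t - a)) (\<lambda>t. W' (2 * pi * s t - a) * (2 * pi * g t))"
  unfolding C1per_def
proof (intro conjI allI)
  fix t
  show "((\<lambda>t. W (2 * pi * s t - a)) has_real_derivative W' (2 * pi * s t - a) * (2 * pi * g t)) (at t)"
    by (rule DERIV_chain2[OF C1per_DERIV[OF W]]) (auto intro!: derivative_eq_intros coordinate_DERIV)
  show "continuous_on UNIV (\<lambda>t. W' (2 * pi * s t - a) * (2 * pi * g t))"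
    by (intro continuous_intros continuous_on_compose2[OF C1per_continuous(2)[OF W, of UNIV]]
        density_continuous coordinate_continuous) auto
  have "2 * pi * s (t + 2 * pi) - a = 2 * pi * s t - a + 2 * pi"
    unfolding coordinate_shift by (simp add: algebra_simps)
  then show "W (2 * pi * s (t + 2 * pi) - a) = W (2 * pi * s t - a)" by (simp only: C1per_periodic[OF W])
qed

end

lemma mass_coordinate_exists:
  assumes "continuous_on UNIV g" "\<And>t. g (t + 2 * pi) = g t" "(\<integral>t. g t \<partial>Lper) = (1::real)"
  obtains s where "mass_coordinate g s"
  using antiderivative_exists[OF assms(1)] assms
  by (metis mass_coordinate.intro has_real_derivative_iff_has_vector_derivative)

lemma integral_Lper_shift:
  fixes P :: "real \<Rightarrow> 'a::euclidean_space"
  assumes "continuous_on UNIV P" "\<And>t. P (t + 2 * pi) = P t"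
  shows "(\<integral>t. P (t - a) \<partial>Lper) = (\<integral>t. P t \<partial>Lper)"
proof -
  have "mass_coordinate (\<lambda>_. 1 / (2 * pi)) (\<lambda>t. t / (2 * pi))"
    by unfold_locales (auto intro!: derivative_eq_intros continuous_intros)
  from mass_coordinate.integral_compose_coordinate[OF this assms, of a] show ?thesis by simp
qed

section \<open>Fourier approximation in the periodic Sobolev space\<close>

subsection \<open>Square-integrable functions\<close>

definition square_integrable ::
  "'a measure \<Rightarrow> ('a \<Rightarrow> 'b::{real_normed_field, banach, second_countable_topology}) \<Rightarrow> bool" where
  "square_integrable M f \<longleftrightarrow> f \<in> borel_measurable M \<and> integrable M (\<lambda>t. (norm (f t))\<^sup>2)"

abbreviation L2per :: "(real \<Rightarrow> 'b::{real_normed_field, banach, second_countable_topology}) \<Rightarrow> bool" where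
  "L2per \<equiv> square_integrable Lper"

lemma norm_lin_square_le:
  fixes a b x y :: "'a::real_normed_field"
  shows "(norm (a * x + b * y))\<^sup>2 \<le> 2 * (norm a)\<^sup>2 * (norm x)\<^sup>2 + 2 * (norm b)\<^sup>2 * (norm y)\<^sup>2"
proof -
  have "(norm (a * x + b * y))\<^sup>2 \<le> (norm (a * x) + norm (b * y))\<^sup>2"
    by (intro power_mono norm_triangle_ineq) auto
  also have "\<dots> \<le> 2 * (norm (a * x))\<^sup>2 + 2 * (norm (b * y))\<^sup>2"
    using sum_squares_bound[of "norm (a * x)" "norm (b * y)"] by (simp add: power2_sum)
  finally show ?thesis by (simp add: norm_mult power_mult_distrib)
qed

lemma square_integrable_lin:
  assumes "square_integrable M f" "square_integrable M g"
  shows "square_integrable M (\<lambda>t. a * f t + b * g t)"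
proof -
  have "integrable M (\<lambda>t. 2 * (norm a)\<^sup>2 * (norm (f t))\<^sup>2 + 2 * (norm b)\<^sup>2 * (norm (g t))\<^sup>2)"
    using assms by (auto simp: square_integrable_def)
  then have "integrable M (\<lambda>t. (norm (a * f t + b * g t))\<^sup>2)"
    by (rule Bochner_Integration.integrable_bound)
      (use assms in \<open>auto simp: square_integrable_def intro!: AE_I2 order_trans[OF norm_lin_square_le]\<close>)
  then show ?thesis using assms by (auto simp: square_integrable_def)
qed

lemma square_integrable_diff:
  "square_integrable M f \<Longrightarrow> square_integrable M g \<Longrightarrow> square_integrable M (\<lambda>t. f t - g t)"
  using square_integrable_lin[of M f g 1 "-1"] by simp

lemma square_integrable_cnj: "square_integrable M f \<Longrightarrow> square_integrable M (\<lambda>t. cnj (f t))"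
  unfolding square_integrable_def
  by (auto intro!: measurable_compose[of f M borel cnj borel] borel_measurable_continuous_onI continuous_intros)

lemma square_integrable_of_real_iff [simp]:
  "square_integrable M (\<lambda>t. complex_of_real (f t)) \<longleftrightarrow> square_integrable M f"
  by (auto simp: square_integrable_def borel_measurable_complex_iff)

lemma square_integrable_mult:
  assumes "square_integrable M f" "square_integrable M g"
  shows "integrable M (\<lambda>t. f t * g t)"
proof (rule Bochner_Integration.integrable_bound)
  show "integrable M (\<lambda>t. (norm (f t))\<^sup>2 + (norm (g t))\<^sup>2)" "(\<lambda>t. f t * g t) \<in> borel_measurable M"
    using assms by (auto simp: square_integrable_def)
  have "norm (f x) * norm (g x) \<le> (norm (f x))\<^sup>2 + (norm (g x))\<^sup>2" for x
    using sum_squares_bound[of "norm (f x)" "norm (g x)"]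
      mult_nonneg_nonneg[OF norm_ge_zero[of "f x"] norm_ge_zero[of "g x"]] by linarith
  then show "AE x in M. norm (f x * g x) \<le> norm ((norm (f x))\<^sup>2 + (norm (g x))\<^sup>2)"
    by (simp add: norm_mult)
qed

lemma integral_norm_diff_square_le:
  assumes "square_integrable M u" "square_integrable M v" "square_integrable M h"
  shows "(\<integral>t. (norm (u t - h t))\<^sup>2 \<partial>M) \<le> 2 * (\<integral>t. (norm (u t - v t))\<^sup>2 \<partial>M) + 2 * (\<integral>t. (norm (v t - h t))\<^sup>2 \<partial>M)"
proof -
  have diffs_integrable: "integrable M (\<lambda>t. (norm (u t - v t))\<^sup>2)" "integrable M (\<lambda>t. (norm (v t - h t))\<^sup>2)"
    "integrable M (\<lambda>t. (norm (u t - h t))\<^sup>2)"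
    using square_integrable_diff assms unfolding square_integrable_def by blast+
  have "(norm (u t - h t))\<^sup>2 \<le> 2 * (norm (u t - v t))\<^sup>2 + 2 * (norm (v t - h t))\<^sup>2" for t
    using norm_lin_square_le[of 1 "u t - v t" 1 "v t - h t"] by simp
  then have "(\<integral>t. (norm (u t - h t))\<^sup>2 \<partial>M) \<le> (\<integral>t. 2 * (norm (u t - v t))\<^sup>2 + 2 * (norm (v t - h t))\<^sup>2 \<partial>M)"
    using diffs_integrable by (intro integral_mono) auto
  then show ?thesis using diffs_integrable by simp
qed

lemma L2per_continuous:
  fixes f :: "real \<Rightarrow> 'a::{real_normed_field, euclidean_space}"
  shows "continuous_on Iper f \<Longrightarrow> L2per f"
  by (auto simp: square_integrable_def intro!: measurable_Lper_continuous integrable_Lper_continuous continuous_intros)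

lemma L2per_integrable:
  fixes f :: "real \<Rightarrow> 'a::{real_normed_field, euclidean_space}"
  shows "L2per f \<Longrightarrow> integrable Lper f"
  using square_integrable_mult[OF _ L2per_continuous[of "\<lambda>_. 1"]] by auto

lemma abs_integral_Lper_le:
  assumes "L2per f" shows "\<bar>\<integral>t. f t \<partial>Lper\<bar> \<le> sqrt (2 * pi * (\<integral>t. (f t)\<^sup>2 \<partial>Lper))"
proof -
  let ?m = "\<integral>t. f t \<partial>Lper"
  have f_integrable: "integrable Lper f" "integrable Lper (\<lambda>t. (f t)\<^sup>2)"
    using L2per_integrable[OF assms] assms by (auto simp: square_integrable_def)
  have "0 \<le> (\<integral>t. (f t - ?m / (2 * pi))\<^sup>2 \<partial>Lper)" by (rule Bochner_Integration.integral_nonneg) simp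
  also have "\<dots> = (\<integral>t. (f t)\<^sup>2 - (?m / pi) * f t + (?m / (2 * pi))\<^sup>2 \<partial>Lper)"
    by (rule Bochner_Integration.integral_cong) (auto simp: power2_eq_square algebra_simps)
  also have "\<dots> = (\<integral>t. (f t)\<^sup>2 \<partial>Lper) - (?m / pi) * ?m + 2 * pi * (?m / (2 * pi))\<^sup>2"
    using f_integrable by simp
  also have "\<dots> = (\<integral>t. (f t)\<^sup>2 \<partial>Lper) - ?m\<^sup>2 / (2 * pi)"
    by (simp add: power2_eq_square field_simps)
  finally have "?m\<^sup>2 \<le> 2 * pi * (\<integral>t. (f t)\<^sup>2 \<partial>Lper)" by (simp add: field_simps)
  then show ?thesis by (metis real_sqrt_abs real_sqrt_le_mono)
qed

lemma dominated_convergence_L2per: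
  fixes u :: "real \<Rightarrow> 'a::{real_normed_field, banach, second_countable_topology}"
  assumes "\<And>n. h n \<in> borel_measurable Lper" "u \<in> borel_measurable Lper"
    and "integrable Lper b" "\<And>n t. t \<in> Iper \<Longrightarrow> (norm (u t - h n t))\<^sup>2 \<le> b t"
    and h_tendsto: "AE t in Lper. (\<lambda>n. h n t) \<longlonglongrightarrow> u t"
  shows "(\<lambda>n. \<integral>t. (norm (u t - h n t))\<^sup>2 \<partial>Lper) \<longlonglongrightarrow> 0"
proof -
  have "(\<lambda>n. \<integral>t. (norm (u t - h n t))\<^sup>2 \<partial>Lper) \<longlonglongrightarrow> (\<integral>t. 0 \<partial>Lper)"
  proof (rule integral_dominated_convergence[where w = b])
    show "AE t in Lper. (\<lambda>n. (norm (u t - h n t))\<^sup>2) \<longlonglongrightarrow> 0"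
      using h_tendsto
    proof (rule AE_mp, intro AE_I2 impI)
      fix t assume "(\<lambda>n. h n t) \<longlonglongrightarrow> u t"
      then have "(\<lambda>n. (norm (u t - h n t))\<^sup>2) \<longlonglongrightarrow> (norm (u t - u t))\<^sup>2" by (intro tendsto_intros)
      then show "(\<lambda>n. (norm (u t - h n t))\<^sup>2) \<longlonglongrightarrow> 0" by simp
    qed
  qed (use assms in auto)
  then show ?thesis by simp
qed

subsection \<open>Trigonometric polynomials\<close>

lemma trig1_vector_derivative: "(trig1 m has_vector_derivative \<i> * of_int m * trig1 m t) (at t)"
proof -
  have "((\<lambda>t. exp (\<i> * of_int m * of_real t)) has_vector_derivative
     (1 * (\<i> * of_int m)) * exp (\<i> * of_int m * of_real t)) (at t)"
    by (rule has_vector_derivative_real_field) (auto intro!: derivative_eq_intros)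
  then show ?thesis by (simp add: trig1_def[abs_def] cis_conv_exp mult_ac)
qed

lemma trig1_continuous: "continuous_on A (trig1 m)"
  unfolding trig1_def by (intro continuous_intros)

lemma trig1_periodic: "trig1 m (t + 2 * pi) = trig1 m t"
  using cis_multiple_2pi[of "real_of_int m"]
  by (simp add: trig1_def distrib_left cis_mult[symmetric] mult_ac)

lemma trig1_mult: "trig1 m t * trig1 k t = trig1 (m + k) t"
  by (simp add: trig1_def cis_mult algebra_simps)

lemma trig1_cnj: "cnj (trig1 m t) = trig1 (- m) t"
  by (simp add: trig1_def cis_cnj)

lemma L2per_trig1: "L2per (\<lambda>t. c * trig1 m t)"
  by (intro L2per_continuous continuous_intros trig1_continuous)

lemma integral_trig1: "(\<integral>t. trig1 m t \<partial>Lper) = (if m = 0 then 2 * pi else 0)"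
proof (cases "m = 0")
  case True then show ?thesis by (simp add: trig1_def scaleR_conv_of_real)
next
  case False
  have "integral\<^sup>L Lper (\<lambda>t. \<i> * of_int m * trig1 m t) = trig1 m (2 * pi) - trig1 m 0"
    by (rule integral_Lper_vector_derivative) (auto intro!: trig1_vector_derivative continuous_intros trig1_continuous)
  also have "\<dots> = 0" using trig1_periodic[of m 0] by simp
  finally show ?thesis using False by simp
qed

definition trig_poly :: "nat \<Rightarrow> (int \<Rightarrow> complex) \<Rightarrow> real \<Rightarrow> complex" where
  "trig_poly k a t = (\<Sum>m\<in>{-int k..int k}. a m * trig1 m t)"

definition fourier_coeff :: "(real \<Rightarrow> complex) \<Rightarrow> int \<Rightarrow> complex" where
  "fourier_coeff u m = complex_of_real (1 / (2 * pi)) * (\<integral>t. u t * trig1 (- m) t \<partial>Lper)"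

lemma trig_poly_continuous: "continuous_on A (trig_poly k a)"
  unfolding trig_poly_def by (intro continuous_intros trig1_continuous)

lemma L2per_trig_poly: "L2per (trig_poly k a)"
  by (rule L2per_continuous[OF trig_poly_continuous])

lemma trig_poly_extend: "k \<le> l \<Longrightarrow> trig_poly k a = trig_poly l (\<lambda>m. if \<bar>m\<bar> \<le> int k then a m else 0)"
  unfolding trig_poly_def fun_eq_iff by (intro allI sum.mono_neutral_cong_left) auto

lemma integral_trig_poly_trig1:
  assumes "m \<in> {-int k..int k}"
  shows "(\<integral>t. trig_poly k a t * trig1 (- m) t \<partial>Lper) = complex_of_real (2 * pi) * a m"
proof -
  have "(\<integral>t. trig_poly k a t * trig1 (- m) t \<partial>Lper) = (\<integral>t. (\<Sum>j\<in>{-int k..int k}. a j * trig1 (j - m) t) \<partial>Lper)"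
    by (simp add: trig_poly_def sum_distrib_right mult.assoc trig1_mult)
  also have "\<dots> = (\<Sum>j\<in>{-int k..int k}. a j * (\<integral>t. trig1 (j - m) t \<partial>Lper))"
    by (subst Bochner_Integration.integral_sum)
      (auto intro!: integrable_Lper_continuous continuous_intros trig1_continuous)
  also have "\<dots> = (\<Sum>j\<in>{-int k..int k}. if j = m then complex_of_real (2 * pi) * a j else 0)"
    by (rule sum.cong) (auto simp: integral_trig1)
  also have "\<dots> = complex_of_real (2 * pi) * a m" using assms by simp
  finally show ?thesis .
qed

lemma fourier_residual_orthogonal:
  assumes u: "L2per u"
  shows "(\<integral>t. (u t - trig_poly k (fourier_coeff u) t) * cnj (trig_poly k b t) \<partial>Lper) = 0"
proof -
  let ?R = "\<lambda>t. u t - trig_poly k (fourier_coeff u) t"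
  have residual: "L2per ?R" by (intro square_integrable_diff u L2per_trig_poly)
  have orthogonal_trig1: "(\<integral>t. ?R t * trig1 (- m) t \<partial>Lper) = 0" if "m \<in> {-int k..int k}" for m
  proof -
    have "(\<integral>t. ?R t * trig1 (- m) t \<partial>Lper) =
      (\<integral>t. u t * trig1 (- m) t \<partial>Lper) - (\<integral>t. trig_poly k (fourier_coeff u) t * trig1 (- m) t \<partial>Lper)"
      unfolding left_diff_distrib using L2per_trig1[of 1]
      by (intro Bochner_Integration.integral_diff square_integrable_mult u L2per_trig_poly) auto
    also have "\<dots> = 0" using integral_trig_poly_trig1[OF that, of "fourier_coeff u"] by (simp add: fourier_coeff_def)
    finally show ?thesis .
  qed
  have cnj_trig_poly: "cnj (trig_poly k b t) = (\<Sum>m\<in>{-int k..int k}. cnj (b m) * trig1 (- m) t)" for t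
    by (simp add: trig_poly_def trig1_cnj)
  have "(\<integral>t. ?R t * cnj (trig_poly k b t) \<partial>Lper) = (\<integral>t. (\<Sum>m\<in>{-int k..int k}. cnj (b m) * (?R t * trig1 (- m) t)) \<partial>Lper)"
    unfolding cnj_trig_poly by (simp add: sum_distrib_left mult_ac)
  also have "\<dots> = (\<Sum>m\<in>{-int k..int k}. cnj (b m) * (\<integral>t. ?R t * trig1 (- m) t \<partial>Lper))"
    using L2per_trig1[of 1] by (subst Bochner_Integration.integral_sum)
      (auto intro!: integrable_mult_right square_integrable_mult[OF residual])
  also have "\<dots> = 0" by (intro sum.neutral) (simp add: orthogonal_trig1)
  finally show ?thesis .
qed

lemma fourier_best_approximation:
  assumes u: "L2per u"
  shows "(\<integral>t. (cmod (u t - trig_poly k (fourier_coeff u) t))\<^sup>2 \<partial>Lper) \<le> (\<integral>t. (cmod (u t - trig_poly k a t))\<^sup>2 \<partial>Lper)"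
proof -
  let ?R = "\<lambda>t. u t - trig_poly k (fourier_coeff u) t" and ?D = "trig_poly k (\<lambda>m. fourier_coeff u m - a m)"
  have residual: "L2per ?R" by (intro square_integrable_diff u L2per_trig_poly)
  have integrable_parts: "integrable Lper (\<lambda>t. ?R t * cnj (?D t))"
    "integrable Lper (\<lambda>t. (cmod (?R t))\<^sup>2)" "integrable Lper (\<lambda>t. (cmod (?D t))\<^sup>2)"
    using residual L2per_trig_poly square_integrable_mult[OF residual square_integrable_cnj[OF L2per_trig_poly]]
    by (auto simp: square_integrable_def)
  have "(cmod (u t - trig_poly k a t))\<^sup>2 = (cmod (?R t))\<^sup>2 + (cmod (?D t))\<^sup>2 + 2 * Re (?R t * cnj (?D t))" for t
  proof -
    have "u t - trig_poly k a t = ?R t + ?D t" by (simp add: trig_poly_def sum_subtractf left_diff_distrib)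
    then show ?thesis
      by (simp only: cmod_power2 plus_complex.simps complex_cnj times_complex.simps cnj.simps)
        (simp add: power2_eq_square algebra_simps)
  qed
  then have "(\<integral>t. (cmod (u t - trig_poly k a t))\<^sup>2 \<partial>Lper) =
    (\<integral>t. (cmod (?R t))\<^sup>2 \<partial>Lper) + (\<integral>t. (cmod (?D t))\<^sup>2 \<partial>Lper) + 2 * Re (\<integral>t. ?R t * cnj (?D t) \<partial>Lper)"
    using integrable_parts by (simp del: times_complex.sel minus_complex.sel complex_cnj cnj.sel)
  then show ?thesis by (simp add: fourier_residual_orthogonal[OF u])
qed

inductive trig_polynomial :: "(real \<Rightarrow> complex) \<Rightarrow> bool" where
  monomial: "trig_polynomial (\<lambda>t. c * trig1 m t)"
| add: "trig_polynomial p \<Longrightarrow> trig_polynomial q \<Longrightarrow> trig_polynomial (\<lambda>t. p t + q t)"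

lemma trig_polynomial_eq_trig_poly: "trig_polynomial p \<Longrightarrow> \<exists>k a. p = trig_poly k a"
proof (induction rule: trig_polynomial.induct)
  case (monomial c m)
  have "(\<lambda>t. c * trig1 m t) = trig_poly (nat \<bar>m\<bar>) (\<lambda>j. if j = m then c else 0)"
    by (auto simp: trig_poly_def fun_eq_iff if_distrib[of "\<lambda>x. x * _"] cong: if_cong)
  then show ?case by blast
next
  case (add p q)
  then obtain k a l b where "p = trig_poly k a" "q = trig_poly l b" by blast
  then obtain c d where "p = trig_poly (max k l) c" "q = trig_poly (max k l) d"
    using trig_poly_extend[of k "max k l"] trig_poly_extend[of l "max k l"] by (meson max.cobounded1 max.cobounded2)
  then have "(\<lambda>t. p t + q t) = trig_poly (max k l) (\<lambda>m. c m + d m)"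
    by (simp add: trig_poly_def fun_eq_iff sum.distrib distrib_right)
  then show ?case by blast
qed

lemma trig_polynomial_mult:
  assumes "trig_polynomial p" "trig_polynomial q" shows "trig_polynomial (\<lambda>t. p t * q t)"
  using assms
proof (induction rule: trig_polynomial.induct)
  case (monomial c m)
  from monomial show ?case
  proof (induction rule: trig_polynomial.induct)
    case (monomial d l)
    have "(\<lambda>t. c * trig1 m t * (d * trig1 l t)) = (\<lambda>t. (c * d) * trig1 (m + l) t)"
      by (simp add: trig1_mult[symmetric] mult_ac)
    then show ?case using trig_polynomial.monomial[of "c * d" "m + l"] by simp
  qed (simp add: distrib_left trig_polynomial.add)
qed (simp add: distrib_right trig_polynomial.add)

lemma trig_polynomial_const: "trig_polynomial (\<lambda>t. c)"
  using trig_polynomial.monomial[of c 0] by (simp add: trig1_def)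

lemma trig_polynomial_cmult: "trig_polynomial p \<Longrightarrow> trig_polynomial (\<lambda>t. c * p t)"
  by (intro trig_polynomial_mult trig_polynomial_const)

lemma trig_polynomial_continuous: "trig_polynomial p \<Longrightarrow> continuous_on A p"
  using trig_polynomial_eq_trig_poly trig_poly_continuous by metis

lemma trig_polynomial_of_polynomial_on_circle:
  assumes "real_polynomial_function (p :: complex \<Rightarrow> real)"
  shows "trig_polynomial (\<lambda>t. complex_of_real (p (cis t)))"
  using assms
proof (induction rule: real_polynomial_function.induct)
  case (linear f)
  interpret bounded_linear f by fact
  have "complex_of_real (f (cis t))
      = (f 1 / 2 - \<i> * f \<i> / 2) * trig1 1 t + (f 1 / 2 + \<i> * f \<i> / 2) * trig1 (-1) t" for t
  proof -
    have "cis t = cos t *\<^sub>R 1 + sin t *\<^sub>R \<i>" by (simp add: complex_eq_iff)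
    then have "f (cis t) = cos t * f 1 + sin t * f \<i>" by (simp only: add scaleR) simp
    then show ?thesis by (simp add: trig1_def complex_eq_iff algebra_simps)
  qed
  then show ?case by (simp only: trig_polynomial.intros)
next
  case (mult f g) then show ?case using trig_polynomial_mult by (simp del: complex_of_real_def)
qed (auto simp: trig_polynomial_const intro: trig_polynomial.add)

subsection \<open>Completeness of the trigonometric system\<close>

definition trig_approximable :: "(real \<Rightarrow> complex) \<Rightarrow> bool" where
  "trig_approximable u \<longleftrightarrow> L2per u \<and> (\<forall>e>0. \<exists>p. trig_polynomial p \<and> (\<integral>t. (cmod (u t - p t))\<^sup>2 \<partial>Lper) < e)"

lemma trig_approximable_lin:
  assumes u: "trig_approximable u" and v: "trig_approximable v"
  shows "trig_approximable (\<lambda>t. a * u t + b * v t)"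
  unfolding trig_approximable_def
proof (intro conjI allI impI)
  show "L2per (\<lambda>t. a * u t + b * v t)" using assms by (simp add: trig_approximable_def square_integrable_lin)
  fix e :: real assume "0 < e"
  define \<delta> where "\<delta> = e / (4 * ((cmod a)\<^sup>2 + (cmod b)\<^sup>2 + 1))"
  have pos: "0 < (cmod a)\<^sup>2 + (cmod b)\<^sup>2 + 1" by (simp add: add_nonneg_pos)
  with \<open>0 < e\<close> have \<delta>: "0 < \<delta>" by (simp add: \<delta>_def)
  obtain p q where p: "trig_polynomial p" "(\<integral>t. (cmod (u t - p t))\<^sup>2 \<partial>Lper) < \<delta>"
    and q: "trig_polynomial q" "(\<integral>t. (cmod (v t - q t))\<^sup>2 \<partial>Lper) < \<delta>"
    using u v \<delta> unfolding trig_approximable_def by blast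
  have "L2per p" "L2per q" using p(1) q(1) by (auto intro: L2per_continuous trig_polynomial_continuous)
  then have diffs: "L2per (\<lambda>t. u t - p t)" "L2per (\<lambda>t. v t - q t)"
    using u v by (auto simp: trig_approximable_def intro: square_integrable_diff)
  have regroup: "a * u t + b * v t - (a * p t + b * q t) = a * (u t - p t) + b * (v t - q t)" for t
    by (simp add: algebra_simps)
  have "(\<integral>t. (cmod (a * u t + b * v t - (a * p t + b * q t)))\<^sup>2 \<partial>Lper) \<le>
    (\<integral>t. 2 * (cmod a)\<^sup>2 * (cmod (u t - p t))\<^sup>2 + 2 * (cmod b)\<^sup>2 * (cmod (v t - q t))\<^sup>2 \<partial>Lper)"
    unfolding regroup using diffs square_integrable_lin[OF diffs, of a b]
    by (intro integral_mono norm_lin_square_le) (auto simp: square_integrable_def)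
  also have "\<dots> = 2 * (cmod a)\<^sup>2 * (\<integral>t. (cmod (u t - p t))\<^sup>2 \<partial>Lper) + 2 * (cmod b)\<^sup>2 * (\<integral>t. (cmod (v t - q t))\<^sup>2 \<partial>Lper)"
    using diffs by (simp add: square_integrable_def)
  also have "\<dots> \<le> 2 * (cmod a)\<^sup>2 * \<delta> + 2 * (cmod b)\<^sup>2 * \<delta>"
    using p(2) q(2) by (intro add_mono mult_left_mono) auto
  also have "\<dots> < 4 * ((cmod a)\<^sup>2 + (cmod b)\<^sup>2 + 1) * \<delta>" using \<delta> by (simp add: distrib_right add_nonneg_pos)
  also have "\<dots> = e" using pos by (simp add: \<delta>_def)
  finally show "\<exists>r. trig_polynomial r \<and> (\<integral>t. (cmod (a * u t + b * v t - r t))\<^sup>2 \<partial>Lper) < e"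
    using trig_polynomial.add[OF trig_polynomial_cmult[OF p(1), of a] trig_polynomial_cmult[OF q(1), of b]] by blast
qed

lemma trig_approximable_limit:
  assumes u: "L2per u" and h: "\<And>n. trig_approximable (h n)"
    and lim: "(\<lambda>n. \<integral>t. (cmod (u t - h n t))\<^sup>2 \<partial>Lper) \<longlonglongrightarrow> 0"
  shows "trig_approximable u"
  unfolding trig_approximable_def
proof (intro conjI allI impI u)
  fix e :: real assume e: "e > 0"
  then have "\<forall>\<^sub>F n in sequentially. (\<integral>t. (cmod (u t - h n t))\<^sup>2 \<partial>Lper) < e / 4"
    using lim by (intro order_tendstoD) auto
  then obtain n where n: "(\<integral>t. (cmod (u t - h n t))\<^sup>2 \<partial>Lper) < e / 4" by (auto simp: eventually_sequentially)
  obtain p where p: "trig_polynomial p" "(\<integral>t. (cmod (h n t - p t))\<^sup>2 \<partial>Lper) < e / 4"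
    using h[of n] e unfolding trig_approximable_def by (meson divide_pos_pos zero_less_numeral)
  have "(\<integral>t. (cmod (u t - p t))\<^sup>2 \<partial>Lper) < e"
    using integral_norm_diff_square_le[OF u _ L2per_continuous[OF trig_polynomial_continuous[OF p(1)]], of "h n"]
      h[of n] n p(2) by (auto simp: trig_approximable_def)
  then show "\<exists>p. trig_polynomial p \<and> (\<integral>t. (cmod (u t - p t))\<^sup>2 \<partial>Lper) < e" using p(1) by blast
qed

lemma continuous_loop_factors_through_circle:
  assumes g: "continuous_on Iper g" "g 0 = g (2 * pi)"
  obtains F where "continuous_on (sphere 0 1) F" "\<And>t. t \<in> Iper \<Longrightarrow> F (cis t) = g t"
proof -
  have Arg2pi_cis: "g (Arg2pi (cis t)) = g t" if "t \<in> Iper" for t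
  proof (cases "t = 2 * pi")
    case True
    have "Arg2pi 1 = 0" by (simp add: Arg2pi_eq_0)
    then show ?thesis using True g(2) by simp
  next
    case False
    then have "Arg2pi (cis t) = t" using that by (intro Arg2pi_unique[of 1]) (auto simp: Iper_def cis_conv_exp)
    then show ?thesis by simp
  qed
  have "cis ` Iper = sphere 0 1"
  proof (intro equalityI subsetI)
    fix z :: complex assume "z \<in> sphere 0 1"
    then have "z = cis (Arg2pi z)" using Arg2pi[of z] by (simp add: is_Arg_def cis_conv_exp)
    then show "z \<in> cis ` Iper" using Arg2pi[of z] by (force simp: Iper_def)
  qed auto
  then have "quotient_map (top_of_set Iper) (top_of_set (sphere 0 1)) cis"
    by (intro T1_Spaces.continuous_imp_quotient_map)
      (auto simp: compact_space_subtopology compact_Iper Hausdorff_space_subtopology intro!: continuous_intros)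
  moreover have "continuous_on Iper (\<lambda>t. g (Arg2pi (cis t)))"
    using continuous_on_cong[of Iper Iper "\<lambda>t. g (Arg2pi (cis t))" g] Arg2pi_cis g(1) by simp
  ultimately have "continuous_on (sphere 0 1) (\<lambda>z. g (Arg2pi z))"
    using continuous_compose_quotient_map[of "top_of_set Iper"
      "top_of_set (sphere 0 1)" cis euclidean "\<lambda>z. g (Arg2pi z)"]
    by (simp add: o_def)
  then show ?thesis using that Arg2pi_cis by blast
qed

lemma trig_approximable_continuous_loop:
  assumes g: "continuous_on Iper (g :: real \<Rightarrow> real)" "g 0 = g (2 * pi)"
  shows "trig_approximable (\<lambda>t. complex_of_real (g t))"
  unfolding trig_approximable_def
proof (intro conjI allI impI)
  obtain F where F: "continuous_on (sphere 0 1) F" "\<And>t. t \<in> Iper \<Longrightarrow> F (cis t) = g t"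
    using continuous_loop_factors_through_circle[OF g] by blast
  show "L2per (\<lambda>t. complex_of_real (g t))" by (intro L2per_continuous continuous_intros g)
  fix e :: real assume e: "e > 0"
  define d where "d = sqrt (e / 8)"
  have d: "d > 0" using e by (simp add: d_def)
  obtain p where p: "real_polynomial_function p" "\<And>x. x \<in> sphere 0 1 \<Longrightarrow> \<bar>F x - p x\<bar> < d"
    using Stone_Weierstrass_real_polynomial_function[OF _ F(1) d] by auto
  note trig = trig_polynomial_of_polynomial_on_circle[OF p(1)]
  have "(\<integral>t. (cmod (complex_of_real (g t) - complex_of_real (p (cis t))))\<^sup>2 \<partial>Lper) \<le> (\<integral>t. d\<^sup>2 \<partial>Lper)"
  proof (rule integral_mono)
    show "integrable Lper (\<lambda>t. (cmod (complex_of_real (g t) - complex_of_real (p (cis t))))\<^sup>2)"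
      by (intro integrable_Lper_continuous continuous_intros g trig_polynomial_continuous[OF trig])
    fix t assume "t \<in> space Lper"
    then have "\<bar>g t - p (cis t)\<bar> \<le> d" using p(2)[of "cis t"] F(2)[of t] by simp
    then have "cmod (complex_of_real (g t) - complex_of_real (p (cis t))) \<le> d" by (metis norm_of_real of_real_diff)
    then show "(cmod (complex_of_real (g t) - complex_of_real (p (cis t))))\<^sup>2 \<le> d\<^sup>2" by (intro power_mono) auto
  qed simp
  also have "\<dots> = 2 * pi * (e / 8)" using e by (simp add: d_def)
  also have "\<dots> < e" using e pi_less_4 by (simp add: field_simps)
  finally show "\<exists>q. trig_polynomial q \<and> (\<integral>t. (cmod (complex_of_real (g t) - q t))\<^sup>2 \<partial>Lper) < e" using trig by blast
qed

lemma AE_limit_of_continuous: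
  assumes "u \<in> borel_measurable Lper"
  obtains g where "\<And>n::nat. continuous_on UNIV (g n :: real \<Rightarrow> real)" "AE t in Lper. (\<lambda>n. g n t) \<longlonglongrightarrow> u t"
proof -
  have "(\<lambda>x. if x \<in> Iper then u x else 0) \<in> borel_measurable lebesgue"
    using assms by (simp only: borel_measurable_if[OF sets_Iper(1)])
  then have "(\<lambda>x. if x \<in> Iper then u x else 0) measurable_on UNIV"
    by (intro lebesgue_measurable_imp_measurable_on) auto
  then obtain N g where N: "negligible N" and g: "\<And>n. continuous_on UNIV (g n)"
    and lim: "\<And>x. x \<notin> N \<Longrightarrow> (\<lambda>n. g n x) \<longlonglongrightarrow> (if x \<in> Iper then u x else 0)"
    unfolding measurable_on_def by auto
  have "N \<inter> Iper \<in> null_sets Lper"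
    using N by (auto simp: null_sets_restrict_space negligible_iff_null_sets[symmetric] intro: negligible_subset)
  then have "AE t in Lper. (\<lambda>n. g n t) \<longlonglongrightarrow> u t" by (rule AE_I') (use lim in force)
  then show ?thesis using that g by blast
qed

lemma AE_Lper_interior: "AE t in Lper. 0 < t \<and> t < 2 * pi"
proof (rule AE_I')
  show "{0, 2 * pi} \<in> null_sets Lper"
    by (auto simp: null_sets_restrict_space Iper_def negligible_iff_null_sets[symmetric])
qed (auto simp: Iper_def)

lemma boundary_cutoff_tendsto:
  assumes "t \<in> {0<..<2 * pi}"
  shows "(\<lambda>n. min 1 (real n * (t * (2 * pi - t)))) \<longlonglongrightarrow> 1"
proof -
  have t_pos: "0 < t * (2 * pi - t)" using assms by simp
  then obtain N where N: "1 < real N * (t * (2 * pi - t))" using ex_less_of_nat_mult by blast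
  have "min 1 (real n * (t * (2 * pi - t))) = 1" if "N \<le> n" for n
  proof -
    have "real N * (t * (2 * pi - t)) \<le> real n * (t * (2 * pi - t))"
      using that t_pos by (intro mult_right_mono) auto
    then show ?thesis using N by linarith
  qed
  then show ?thesis by (intro tendsto_eventually eventually_sequentiallyI[of N]) auto
qed

lemma trig_approximable_bounded:
  assumes u: "u \<in> borel_measurable Lper" "\<And>t. \<bar>u t\<bar> \<le> B"
  shows "trig_approximable (\<lambda>t. complex_of_real (u t))"
proof -
  obtain g where g: "\<And>n::nat. continuous_on UNIV (g n)" "AE t in Lper. (\<lambda>n. g n t) \<longlonglongrightarrow> u t"
    using AE_limit_of_continuous[OF u(1)] by blast
  define h where "h n t = max (- B) (min B (g n t)) * min 1 (real n * (t * (2 * pi - t)))" for n t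
  have h_cont: "continuous_on Iper (h n)" for n
    unfolding h_def using continuous_on_subset[OF g(1)] by (intro continuous_intros) auto
  have B: "0 \<le> B" using u(2)[of 0] by linarith
  have h_bound: "\<bar>h n t\<bar> \<le> B" if "t \<in> Iper" for n t
  proof -
    have "0 \<le> real n * (t * (2 * pi - t))" using that by (simp add: Iper_def)
    then have "\<bar>h n t\<bar> \<le> B * 1" unfolding h_def abs_mult using B by (intro mult_mono) auto
    then show ?thesis by simp
  qed
  show ?thesis
  proof (rule trig_approximable_limit)
    have "integrable Lper (\<lambda>t. (u t)\<^sup>2)"
    proof (rule Lper.integrable_const_bound)
      show "AE t in Lper. norm ((u t)\<^sup>2) \<le> B\<^sup>2" using u(2)
        by (simp add: abs_le_square_iff[symmetric] abs_of_nonneg[OF B])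
    qed (use u(1) in measurable)
    then show "L2per (\<lambda>t. complex_of_real (u t))" using u(1) by (simp add: square_integrable_def)
    show "trig_approximable (\<lambda>t. complex_of_real (h n t))" for n
      by (rule trig_approximable_continuous_loop[OF h_cont]) (simp add: h_def)
    show "(\<lambda>n. \<integral>t. (cmod (complex_of_real (u t) - complex_of_real (h n t)))\<^sup>2 \<partial>Lper) \<longlonglongrightarrow> 0"
    proof (rule dominated_convergence_L2per[where b = "\<lambda>_. (2 * B)\<^sup>2"])
      show "(\<lambda>t. complex_of_real (h n t)) \<in> borel_measurable Lper" for n
        by (intro measurable_Lper_continuous continuous_intros h_cont)
      show "(\<lambda>t. complex_of_real (u t)) \<in> borel_measurable Lper" using u(1) by measurable
      show "(cmod (complex_of_real (u t) - complex_of_real (h n t)))\<^sup>2 \<le> (2 * B)\<^sup>2" if "t \<in> Iper" for n t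
      proof (rule power_mono)
        have "\<bar>u t - h n t\<bar> \<le> 2 * B" using u(2)[of t] h_bound[OF that, of n] by linarith
        then show "cmod (complex_of_real (u t) - complex_of_real (h n t)) \<le> 2 * B" by (metis norm_of_real of_real_diff)
      qed simp
      show "AE t in Lper. (\<lambda>n. complex_of_real (h n t)) \<longlonglongrightarrow> complex_of_real (u t)"
        using g(2) AE_Lper_interior
      proof eventually_elim
        case (elim t)
        then have "(\<lambda>n. h n t) \<longlonglongrightarrow> max (- B) (min B (u t)) * 1"
          unfolding h_def by (intro tendsto_intros boundary_cutoff_tendsto) auto
        moreover have "max (- B) (min B (u t)) = u t" using u(2)[of t] by (auto simp: max_def min_def)
        ultimately show ?case by (simp add: tendsto_of_real)
      qed
    qed simp
  qed
qed

lemma trig_approximable_real: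
  fixes u :: "real \<Rightarrow> real"
  assumes u: "L2per u" shows "trig_approximable (\<lambda>t. complex_of_real (u t))"
proof -
  define clamp where "clamp k y = max (- real k) (min (real k) y)" for k :: nat and y :: real
  have u_measurable [measurable]: "u \<in> borel_measurable Lper" using u by (simp add: square_integrable_def)
  show ?thesis
  proof (rule trig_approximable_limit)
    show "L2per (\<lambda>t. complex_of_real (u t))" using u by simp
    show "trig_approximable (\<lambda>t. complex_of_real (clamp k (u t)))" for k
      by (rule trig_approximable_bounded[where B = "real k"]) (auto simp: clamp_def)
    show "(\<lambda>k. \<integral>t. (cmod (complex_of_real (u t) - complex_of_real (clamp k (u t))))\<^sup>2 \<partial>Lper) \<longlonglongrightarrow> 0"
    proof (rule dominated_convergence_L2per[where b = "\<lambda>t. (norm (u t))\<^sup>2"])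
      show "(\<lambda>t. complex_of_real (clamp k (u t))) \<in> borel_measurable Lper" for k unfolding clamp_def by measurable
      show "(cmod (complex_of_real (u t) - complex_of_real (clamp k (u t))))\<^sup>2 \<le> (norm (u t))\<^sup>2" for k t
      proof (rule power_mono)
        have "\<bar>u t - clamp k (u t)\<bar> \<le> \<bar>u t\<bar>" unfolding clamp_def by linarith
        then show "cmod (complex_of_real (u t) - complex_of_real (clamp k (u t))) \<le> norm (u t)"
          by (metis norm_of_real of_real_diff real_norm_def)
      qed simp
      show "AE t in Lper. (\<lambda>k. complex_of_real (clamp k (u t))) \<longlonglongrightarrow> complex_of_real (u t)"
      proof (rule AE_I2)
        fix t
        obtain K :: nat where "\<bar>u t\<bar> \<le> real K" using real_arch_simple by blast
        then show "(\<lambda>k. complex_of_real (clamp k (u t))) \<longlonglongrightarrow> complex_of_real (u t)"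
          by (intro tendsto_eventually eventually_sequentiallyI[of K]) (auto simp: clamp_def)
      qed
    qed (use u in \<open>auto simp: square_integrable_def\<close>)
  qed
qed

lemma trig_approximable_L2per:
  assumes u: "L2per u" shows "trig_approximable u"
proof -
  have "(\<lambda>t. complex_of_real (Re (u t))) = (\<lambda>t. 1 / 2 * u t + 1 / 2 * cnj (u t))"
    "(\<lambda>t. complex_of_real (Im (u t))) = (\<lambda>t. - \<i> / 2 * u t + \<i> / 2 * cnj (u t))"
    by (simp_all add: fun_eq_iff complex_eq_iff)
  then have "L2per (\<lambda>t. complex_of_real (Re (u t)))" "L2per (\<lambda>t. complex_of_real (Im (u t)))"
    using square_integrable_lin[OF u square_integrable_cnj[OF u]] by (simp_all only:)
  then have "L2per (\<lambda>t. Re (u t))" "L2per (\<lambda>t. Im (u t))" by simp_all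
  from trig_approximable_lin[OF this[THEN trig_approximable_real], of 1 \<i>]
  show ?thesis by (simp add: complex_eq[symmetric])
qed

theorem fourier_series_L2:
  assumes u: "L2per u"
  shows "(\<lambda>k. \<integral>t. (cmod (u t - trig_poly k (fourier_coeff u) t))\<^sup>2 \<partial>Lper) \<longlonglongrightarrow> 0"
proof (rule LIMSEQ_I)
  fix r :: real assume "0 < r"
  then obtain k a where trig_approx: "(\<integral>t. (cmod (u t - trig_poly k a t))\<^sup>2 \<partial>Lper) < r"
    using trig_approximable_L2per[OF u] trig_polynomial_eq_trig_poly unfolding trig_approximable_def by metis
  have "norm ((\<integral>t. (cmod (u t - trig_poly l (fourier_coeff u) t))\<^sup>2 \<partial>Lper) - 0) < r" if "k \<le> l" for l
    using fourier_best_approximation[OF u, of l "\<lambda>m. if \<bar>m\<bar> \<le> int k then a m else 0"]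
      trig_poly_extend[OF that, of a] trig_approx by simp
  then show "\<exists>k. \<forall>l\<ge>k. norm ((\<integral>t. (cmod (u t - trig_poly l (fourier_coeff u) t))\<^sup>2 \<partial>Lper) - 0) < r" by blast
qed

section \<open>The periodic Sobolev space and its dual\<close>

subsection \<open>Weak derivatives\<close>

lemma wderiv1_C1:
  fixes f f' :: "real \<Rightarrow> complex"
  assumes f: "\<And>t. (f has_vector_derivative f' t) (at t)" "f (2 * pi) = f 0" and f': "continuous_on UNIV f'"
  shows "wderiv1 f f'"
proof -
  have "continuous_on UNIV f"
    using f(1) by (meson continuous_at_imp_continuous_on has_vector_derivative_continuous)
  then have f_cont: "continuous_on A f" "continuous_on A f'" for A using f' continuous_on_subset by blast+
  have "L2per f" "L2per f'" by (intro L2per_continuous f_cont)+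
  moreover have "(\<integral>t. f t * (\<i> * of_int m * trig1 m t) \<partial>Lper) = - (\<integral>t. f' t * trig1 m t \<partial>Lper)" for m
  proof -
    have "(\<integral>t. f t * (\<i> * of_int m * trig1 m t) + f' t * trig1 m t \<partial>Lper)
       = f (2 * pi) * trig1 m (2 * pi) - f 0 * trig1 m 0"
      by (rule integral_Lper_vector_derivative)
        (auto intro!: derivative_eq_intros f trig1_vector_derivative continuous_intros trig1_continuous f_cont)
    also have "\<dots> = 0" using trig1_periodic[of m 0] f(2) by simp
    also have "(\<integral>t. f t * (\<i> * of_int m * trig1 m t) + f' t * trig1 m t \<partial>Lper)
      = (\<integral>t. f t * (\<i> * of_int m * trig1 m t) \<partial>Lper) + (\<integral>t. f' t * trig1 m t \<partial>Lper)"
      by (intro Bochner_Integration.integral_add integrable_Lper_continuous continuous_intros f_cont trig1_continuous)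
    finally show ?thesis by (simp add: eq_neg_iff_add_eq_0)
  qed
  ultimately show ?thesis by (simp add: wderiv1_def square_integrable_def)
qed

lemma wderiv1_L2per: "wderiv1 f g \<Longrightarrow> L2per f" "wderiv1 f g \<Longrightarrow> L2per g"
  by (auto simp: wderiv1_def square_integrable_def)

lemma wderiv1_lin:
  assumes f_deriv: "wderiv1 f g" and h_deriv: "wderiv1 h k"
  shows "wderiv1 (\<lambda>t. a * f t + b * h t) (\<lambda>t. a * g t + b * k t)"
proof -
  have "L2per (\<lambda>t. a * f t + b * h t)" "L2per (\<lambda>t. a * g t + b * k t)"
    using assms by (auto intro: square_integrable_lin wderiv1_L2per)
  moreover have "(\<integral>t. (a * f t + b * h t) * (\<i> * of_int m * trig1 m t) \<partial>Lper)
      = - (\<integral>t. (a * g t + b * k t) * trig1 m t \<partial>Lper)" for m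
  proof -
    have products_integrable: "integrable Lper (\<lambda>t. f t * (\<i> * of_int m * trig1 m t))"
      "integrable Lper (\<lambda>t. h t * (\<i> * of_int m * trig1 m t))"
      "integrable Lper (\<lambda>t. g t * trig1 m t)" "integrable Lper (\<lambda>t. k t * trig1 m t)"
      using L2per_trig1[of 1 m] assms by (auto intro!: square_integrable_mult L2per_trig1 intro: wderiv1_L2per)
    then have "(\<integral>t. (a * f t + b * h t) * (\<i> * of_int m * trig1 m t) \<partial>Lper) =
      a * (\<integral>t. f t * (\<i> * of_int m * trig1 m t) \<partial>Lper) + b * (\<integral>t. h t * (\<i> * of_int m * trig1 m t) \<partial>Lper)"
      by (simp add: distrib_right mult.assoc)
    also have "\<dots> = - (a * (\<integral>t. g t * trig1 m t \<partial>Lper) + b * (\<integral>t. k t * trig1 m t \<partial>Lper))"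
      using assms by (simp add: wderiv1_def)
    also have "\<dots> = - (\<integral>t. (a * g t + b * k t) * trig1 m t \<partial>Lper)"
      using products_integrable by (simp add: distrib_right mult.assoc)
    finally show ?thesis .
  qed
  ultimately show ?thesis by (simp add: wderiv1_def square_integrable_def)
qed

lemma wderiv1_cong:
  assumes "wderiv1 f g" "\<And>t. t \<in> Iper \<Longrightarrow> f t = f2 t" "\<And>t. t \<in> Iper \<Longrightarrow> g t = g2 t"
  shows "wderiv1 f2 g2"
proof -
  have measurable_eq: "f \<in> borel_measurable Lper \<longleftrightarrow> f2 \<in> borel_measurable Lper"
    "g \<in> borel_measurable Lper \<longleftrightarrow> g2 \<in> borel_measurable Lper"
    using assms(2,3) by (auto intro!: measurable_cong)
  have integrable_eq: "integrable Lper (\<lambda>t. (cmod (f t))\<^sup>2) \<longleftrightarrow> integrable Lper (\<lambda>t. (cmod (f2 t))\<^sup>2)"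
    "integrable Lper (\<lambda>t. (cmod (g t))\<^sup>2) \<longleftrightarrow> integrable Lper (\<lambda>t. (cmod (g2 t))\<^sup>2)"
    using assms(2,3) by (auto intro!: Bochner_Integration.integrable_cong)
  have integral_eq: "(\<integral>t. f t * c t \<partial>Lper) = (\<integral>t. f2 t * c t \<partial>Lper)"
    "(\<integral>t. g t * c t \<partial>Lper) = (\<integral>t. g2 t * c t \<partial>Lper)" for c
    using assms(2,3) by (auto intro!: Bochner_Integration.integral_cong)
  show ?thesis using assms(1) unfolding wderiv1_def measurable_eq integrable_eq integral_eq .
qed

lemma wderiv1_cnj:
  assumes "wderiv1 f g" shows "wderiv1 (\<lambda>t. cnj (f t)) (\<lambda>t. cnj (g t))"
proof -
  have "(\<integral>t. cnj (f t) * (\<i> * of_int m * trig1 m t) \<partial>Lper) = - (\<integral>t. cnj (g t) * trig1 m t \<partial>Lper)" for m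
  proof -
    have "(\<integral>t. cnj (f t) * (\<i> * of_int m * trig1 m t) \<partial>Lper) = (\<integral>t. cnj (f t * (\<i> * of_int (-m) * trig1 (-m) t)) \<partial>Lper)"
      by (rule Bochner_Integration.integral_cong) (auto simp: trig1_cnj)
    also have "\<dots> = cnj (\<integral>t. f t * (\<i> * of_int (-m) * trig1 (-m) t) \<partial>Lper)" by (rule Bochner_Integration.integral_cnj)
    also have "\<dots> = cnj (- (\<integral>t. g t * trig1 (-m) t \<partial>Lper))" using assms by (simp only: wderiv1_def)
    also have "\<dots> = - (\<integral>t. cnj (g t * trig1 (-m) t) \<partial>Lper)"
      by (simp only: complex_cnj_minus Bochner_Integration.integral_cnj)
    finally show ?thesis by (simp add: trig1_cnj)
  qed
  moreover have "L2per (\<lambda>t. cnj (f t))" "L2per (\<lambda>t. cnj (g t))"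
    using assms by (auto intro: square_integrable_cnj wderiv1_L2per)
  ultimately show ?thesis by (simp add: wderiv1_def square_integrable_def)
qed

definition weak_deriv :: "(real \<Rightarrow> real) \<Rightarrow> (real \<Rightarrow> real) \<Rightarrow> bool" where
  "weak_deriv f g \<longleftrightarrow> wderiv1 (\<lambda>t. complex_of_real (f t)) (\<lambda>t. complex_of_real (g t))"

lemma weak_deriv_L2per: assumes "weak_deriv f g" shows "L2per f" "L2per g"
  using wderiv1_L2per[OF assms[unfolded weak_deriv_def]] by simp_all

lemma weak_deriv_lin:
  assumes "weak_deriv f g" "weak_deriv h k"
  shows "weak_deriv (\<lambda>t. a * f t + b * h t) (\<lambda>t. a * g t + b * k t)"
  using wderiv1_lin[OF assms[unfolded weak_deriv_def], of a b] by (simp add: weak_deriv_def)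

lemma weak_deriv_diff:
  "weak_deriv f g \<Longrightarrow> weak_deriv h k \<Longrightarrow> weak_deriv (\<lambda>t. f t - h t) (\<lambda>t. g t - k t)"
  using weak_deriv_lin[of f g h k 1 "-1"] by simp

lemma weak_deriv_Re:
  assumes "wderiv1 (\<lambda>t. complex_of_real (f t)) g" shows "weak_deriv f (\<lambda>t. Re (g t))"
proof -
  have "(\<lambda>t. 1/2 * complex_of_real (f t) + 1/2 * cnj (complex_of_real (f t))) = (\<lambda>t. complex_of_real (f t))"
    "(\<lambda>t. 1/2 * g t + 1/2 * cnj (g t)) = (\<lambda>t. complex_of_real (Re (g t)))"
    by (auto simp: complex_eq_iff fun_eq_iff)
  then show ?thesis using wderiv1_lin[OF assms wderiv1_cnj[OF assms], of "1/2" "1/2"] by (simp only: weak_deriv_def)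
qed

lemma H1per_iff_weak_deriv: "H1per f \<longleftrightarrow> (\<exists>g. weak_deriv f g)"
  unfolding H1per_def by (metis weak_deriv_Re weak_deriv_def)

lemma weak_deriv_H1per: "weak_deriv f g \<Longrightarrow> H1per f"
  by (auto simp: H1per_iff_weak_deriv)

lemma H1per_lin: "H1per f \<Longrightarrow> H1per h \<Longrightarrow> H1per (\<lambda>t. a * f t + b * h t)"
  unfolding H1per_iff_weak_deriv using weak_deriv_lin by blast

lemma C1per_weak_deriv:
  assumes "C1per f f'" shows "weak_deriv f f'"
  unfolding weak_deriv_def
proof (rule wderiv1_C1)
  show "((\<lambda>t. complex_of_real (f t)) has_vector_derivative complex_of_real (f' t)) (at t)" for t
    using C1per_DERIV[OF assms]
    by (intro has_vector_derivative_of_real) (simp add: has_real_derivative_iff_has_vector_derivative)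
  show "continuous_on UNIV (\<lambda>t. complex_of_real (f' t))" by (intro continuous_intros C1per_continuous[OF assms])
  show "complex_of_real (f (2 * pi)) = complex_of_real (f 0)" using C1per_periodic[OF assms, of 0] by simp
qed

lemma C1per_H1per: "C1per f f' \<Longrightarrow> H1per f"
  using C1per_weak_deriv weak_deriv_H1per by blast

definition h1norm :: "(real \<Rightarrow> real) \<Rightarrow> (real \<Rightarrow> real) \<Rightarrow> real" where
  "h1norm f g = sqrt ((\<integral>t. (f t)\<^sup>2 \<partial>Lper) + (\<integral>t. (g t)\<^sup>2 \<partial>Lper))"

lemma h1norm_nonneg [simp]: "0 \<le> h1norm f g"
  by (simp add: h1norm_def)

lemma h1norm_square: "(h1norm f g)\<^sup>2 = (\<integral>t. (f t)\<^sup>2 \<partial>Lper) + (\<integral>t. (g t)\<^sup>2 \<partial>Lper)"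
  by (simp add: h1norm_def)

lemma integral_square_le_h1norm:
  "(\<integral>t. (f t)\<^sup>2 \<partial>Lper) \<le> (h1norm f g)\<^sup>2" "(\<integral>t. (g t)\<^sup>2 \<partial>Lper) \<le> (h1norm f g)\<^sup>2"
  by (simp_all add: h1norm_square)

lemma h1norm_cmult: "h1norm (\<lambda>t. c * f t) (\<lambda>t. c * g t) = \<bar>c\<bar> * h1norm f g"
  by (simp add: h1norm_def power_mult_distrib distrib_left[symmetric] real_sqrt_mult)

lemma h1norm_diff_le:
  assumes "L2per a" "L2per b" "L2per a'" "L2per b'"
  shows "h1norm (\<lambda>t. a t - b t) (\<lambda>t. a' t - b' t) \<le> 2 * h1norm a a' + 2 * h1norm b b'"
proof -
  have zero: "L2per (\<lambda>_. 0 :: real)" by (rule L2per_continuous) simp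
  have "(h1norm (\<lambda>t. a t - b t) (\<lambda>t. a' t - b' t))\<^sup>2 \<le> 2 * (h1norm a a')\<^sup>2 + 2 * (h1norm b b')\<^sup>2"
    using integral_norm_diff_square_le[OF assms(1) zero assms(2)]
      integral_norm_diff_square_le[OF assms(3) zero assms(4)]
    by (simp add: h1norm_square)
  also have "\<dots> \<le> (2 * h1norm a a' + 2 * h1norm b b')\<^sup>2" by (simp add: power2_eq_square algebra_simps)
  finally show ?thesis by (rule power2_le_imp_le) simp
qed

lemma C1per_abs_le_h1norm:
  assumes "C1per f f'" shows "\<bar>f t\<bar> \<le> 2 * h1norm f f'"
proof -
  obtain s where s: "s \<in> Iper" "f s = f t" using periodic_value_on_Iper[of f, OF C1per_periodic[OF assms]] by metis
  have "\<bar>f s\<bar>\<^sup>2 \<le> 2 * (h1norm f f')\<^sup>2" using C1per_square_le[OF assms s(1)] by (simp add: h1norm_square)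
  also have "\<dots> \<le> (2 * h1norm f f')\<^sup>2" by (simp add: power_mult_distrib)
  finally have "\<bar>f s\<bar> \<le> 2 * h1norm f f'" by (rule power2_le_imp_le) simp
  then show ?thesis by (simp add: s(2))
qed

lemma h1norm_shift:
  assumes "C1per f f'" shows "h1norm (\<lambda>t. f (t - a)) (\<lambda>t. f' (t - a)) = h1norm f f'"
  using integral_Lper_shift[of "\<lambda>t. (f t)\<^sup>2" a] integral_Lper_shift[of "\<lambda>t. (f' t)\<^sup>2" a] C1per_continuous[OF assms]
    C1per_periodic[OF assms] C1per_deriv_periodic[OF assms]
  by (simp add: h1norm_def continuous_on_power)

subsection \<open>Approximation by trigonometric polynomials\<close>

inductive real_trig_polynomial :: "(real \<Rightarrow> real) \<Rightarrow> bool" where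
  cos: "real_trig_polynomial (\<lambda>t. cos (real_of_int m * t))"
| sin: "real_trig_polynomial (\<lambda>t. sin (real_of_int m * t))"
| lin: "real_trig_polynomial f \<Longrightarrow> real_trig_polynomial h \<Longrightarrow> real_trig_polynomial (\<lambda>t. a * f t + b * h t)"

lemma real_trig_polynomial_sum:
  "finite A \<Longrightarrow> (\<And>i. i \<in> A \<Longrightarrow> real_trig_polynomial (f i)) \<Longrightarrow> real_trig_polynomial (\<lambda>t. \<Sum>i\<in>A. f i t)"
proof (induction rule: finite_induct)
  case empty
  then show ?case
    using real_trig_polynomial.lin[OF real_trig_polynomial.sin[of 0] real_trig_polynomial.sin[of 0]] by simp
next
  case (insert x F)
  have "real_trig_polynomial (\<lambda>t. 1 * f x t + 1 * (\<Sum>i\<in>F. f i t))"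
    using insert by (intro real_trig_polynomial.lin) auto
  then show ?case using insert by simp
qed

lemma real_trig_polynomial_Re_trig_poly: "real_trig_polynomial (\<lambda>t. Re (trig_poly k a t))"
proof -
  have "(\<lambda>t. Re (trig_poly k a t)) =
    (\<lambda>t. \<Sum>m\<in>{-int k..int k}. Re (a m) * cos (real_of_int m * t) + (- Im (a m)) * sin (real_of_int m * t))"
    by (auto simp: trig_poly_def trig1_def intro!: sum.cong)
  then show ?thesis
    by (simp only:) (intro real_trig_polynomial_sum real_trig_polynomial.intros finite_atLeastAtMost_int)
qed

lemma C1per_Re_trig_poly: "C1per (\<lambda>t. Re (trig_poly k a t)) (\<lambda>t. Re (trig_poly k (\<lambda>m. \<i> * of_int m * a m) t))"
  unfolding C1per_def
proof (intro conjI allI)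
  fix t
  have "(trig_poly k a has_vector_derivative trig_poly k (\<lambda>m. \<i> * of_int m * a m) t) (at t)"
    unfolding trig_poly_def[abs_def]
    by (rule has_vector_derivative_sum) (auto intro!: derivative_eq_intros trig1_vector_derivative)
  then show "((\<lambda>t. Re (trig_poly k a t)) has_real_derivative Re (trig_poly k (\<lambda>m. \<i> * of_int m * a m) t)) (at t)"
    unfolding has_real_derivative_iff_has_vector_derivative
    by (rule bounded_linear.has_vector_derivative[OF bounded_linear_Re])
  show "continuous_on UNIV (\<lambda>t. Re (trig_poly k (\<lambda>m. \<i> * of_int m * a m) t))"
    by (intro continuous_intros trig_poly_continuous)
  show "Re (trig_poly k a (t + 2 * pi)) = Re (trig_poly k a t)" by (simp add: trig_poly_def trig1_periodic)
qed

lemma C1per_trig_basis: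
  "C1per (\<lambda>t. cos (real_of_int m * t)) (\<lambda>t. - real_of_int m * sin (real_of_int m * t))"
  "C1per (\<lambda>t. sin (real_of_int m * t)) (\<lambda>t. real_of_int m * cos (real_of_int m * t))"
  using trig1_periodic[of m]
  by (auto simp: C1per_def trig1_def complex_eq_iff intro!: derivative_eq_intros continuous_intros)

lemma real_trig_polynomial_H1per: "real_trig_polynomial f \<Longrightarrow> H1per f"
  by (induction rule: real_trig_polynomial.induct) (auto intro: H1per_lin C1per_H1per C1per_trig_basis)

lemma fourier_coeff_wderiv1:
  assumes "wderiv1 f g" shows "fourier_coeff g m = \<i> * of_int m * fourier_coeff f m"
proof -
  have "(\<integral>t. f t * (\<i> * of_int (-m) * trig1 (-m) t) \<partial>Lper) = - (\<integral>t. g t * trig1 (-m) t \<partial>Lper)"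
    using assms unfolding wderiv1_def by blast
  moreover have "(\<integral>t. f t * (\<i> * of_int (-m) * trig1 (-m) t) \<partial>Lper) = - (\<i> * of_int m * (\<integral>t. f t * trig1 (-m) t \<partial>Lper))"
    by (simp add: mult_ac)
  ultimately show ?thesis by (simp add: fourier_coeff_def)
qed

definition h1_approx :: "(real \<Rightarrow> real) \<Rightarrow> (real \<Rightarrow> real) \<Rightarrow> (nat \<Rightarrow> real \<Rightarrow> real) \<Rightarrow> (nat \<Rightarrow> real \<Rightarrow> real) \<Rightarrow> bool" where
  "h1_approx f g T T' \<longleftrightarrow> weak_deriv f g \<and> (\<forall>k. C1per (T k) (T' k)) \<and>
     (\<lambda>k. h1norm (\<lambda>t. f t - T k t) (\<lambda>t. g t - T' k t)) \<longlonglongrightarrow> 0"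

lemma h1_approx_weak_deriv: "h1_approx f g T T' \<Longrightarrow> weak_deriv f g"
  and h1_approx_C1per: "h1_approx f g T T' \<Longrightarrow> C1per (T k) (T' k)"
  and h1_approx_tendsto: "h1_approx f g T T' \<Longrightarrow> (\<lambda>k. h1norm (\<lambda>t. f t - T k t) (\<lambda>t. g t - T' k t)) \<longlonglongrightarrow> 0"
  by (auto simp: h1_approx_def)

lemma h1_approx_L2per:
  assumes "h1_approx f g T T'" shows "L2per f" "L2per g" "L2per (T k)" "L2per (T' k)"
  using weak_deriv_L2per[OF h1_approx_weak_deriv[OF assms]]
    weak_deriv_L2per[OF C1per_weak_deriv[OF h1_approx_C1per[OF assms]]]
  by blast+

lemma fourier_real_part_tendsto:
  assumes "L2per q"
  shows "(\<lambda>k. \<integral>t. (q t - Re (trig_poly k (fourier_coeff (\<lambda>t. complex_of_real (q t))) t))\<^sup>2 \<partial>Lper) \<longlonglongrightarrow> 0"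
proof (rule tendsto_sandwich[OF _ _ tendsto_const fourier_series_L2])
  let ?S = "\<lambda>k. trig_poly k (fourier_coeff (\<lambda>t. complex_of_real (q t)))"
  show q: "L2per (\<lambda>t. complex_of_real (q t))" using assms by simp
  have "(\<integral>t. (q t - Re (?S k t))\<^sup>2 \<partial>Lper) \<le> (\<integral>t. (cmod (complex_of_real (q t) - ?S k t))\<^sup>2 \<partial>Lper)" for k
  proof (rule integral_mono')
    show "integrable Lper (\<lambda>t. (cmod (complex_of_real (q t) - ?S k t))\<^sup>2)"
      using square_integrable_diff[OF q L2per_trig_poly] by (auto simp: square_integrable_def)
    fix t
    have "\<bar>Re (complex_of_real (q t) - ?S k t)\<bar>\<^sup>2 \<le> (cmod (complex_of_real (q t) - ?S k t))\<^sup>2"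
      by (intro power_mono abs_Re_le_cmod) auto
    then show "(q t - Re (?S k t))\<^sup>2 \<le> (cmod (complex_of_real (q t) - ?S k t))\<^sup>2" by simp
  qed simp
  then show "\<forall>\<^sub>F k in sequentially. (\<integral>t. (q t - Re (?S k t))\<^sup>2 \<partial>Lper)
      \<le> (\<integral>t. (cmod (complex_of_real (q t) - ?S k t))\<^sup>2 \<partial>Lper)"
    by simp
qed simp

lemma weak_deriv_trig_approx:
  assumes g: "weak_deriv f g"
  obtains T T' where "h1_approx f g T T'" "\<And>k. real_trig_polynomial (T k)"
proof -
  let ?a = "fourier_coeff (\<lambda>t. complex_of_real (f t))"
  have g_coeff: "(\<lambda>m. \<i> * of_int m * ?a m) = fourier_coeff (\<lambda>t. complex_of_real (g t))"
    using fourier_coeff_wderiv1[OF g[unfolded weak_deriv_def]] by auto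
  have "(\<lambda>k. h1norm (\<lambda>t. f t - Re (trig_poly k ?a t))
      (\<lambda>t. g t - Re (trig_poly k (\<lambda>m. \<i> * of_int m * ?a m) t))) \<longlonglongrightarrow> sqrt (0 + 0)"
    unfolding h1norm_def g_coeff using weak_deriv_L2per[OF g]
    by (intro tendsto_real_sqrt tendsto_add fourier_real_part_tendsto)
  then have "h1_approx f g (\<lambda>k t. Re (trig_poly k ?a t)) (\<lambda>k t. Re (trig_poly k (\<lambda>m. \<i> * of_int m * ?a m) t))"
    using g by (simp add: h1_approx_def C1per_Re_trig_poly)
  then show ?thesis by (rule that[OF _ real_trig_polynomial_Re_trig_poly])
qed

lemma h1_approx_uniformly_Cauchy:
  assumes approx: "h1_approx f g T T'" shows "uniformly_Cauchy_on A T"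
  unfolding uniformly_Cauchy_on_def
proof (intro allI impI)
  let ?d = "\<lambda>k. h1norm (\<lambda>t. f t - T k t) (\<lambda>t. g t - T' k t)"
  note L2 = h1_approx_L2per[OF approx]
  have dist_le: "dist (T k x) (T j x) \<le> 4 * ?d k + 4 * ?d j" for k j x
  proof -
    have "h1norm (\<lambda>t. (f t - T j t) - (f t - T k t)) (\<lambda>t. (g t - T' j t) - (g t - T' k t)) \<le> 2 * ?d j + 2 * ?d k"
      by (intro h1norm_diff_le square_integrable_diff L2)
    then show ?thesis
      using C1per_abs_le_h1norm[OF C1per_diff[OF h1_approx_C1per[OF approx, of k]
        h1_approx_C1per[OF approx, of j]], of x]
      by (simp add: dist_real_def)
  qed
  fix e :: real assume e: "e > 0"
  then have "\<forall>\<^sub>F k in sequentially. ?d k < e / 8" using h1_approx_tendsto[OF approx] by (intro order_tendstoD) auto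
  then obtain M where M: "\<And>k. k \<ge> M \<Longrightarrow> ?d k < e / 8" by (auto simp: eventually_sequentially)
  have "dist (T k x) (T j x) < e" if "M \<le> k" "M \<le> j" for k j x
    using dist_le[of k x j] M[OF that(1)] M[OF that(2)] by linarith
  then show "\<exists>M. \<forall>x\<in>A. \<forall>k\<ge>M. \<forall>j\<ge>M. dist (T k x) (T j x) < e" by blast
qed

lemma uniform_limit_integral_square_tendsto:
  fixes F :: "real \<Rightarrow> real"
  assumes "uniform_limit Iper T F sequentially" "\<And>k. continuous_on Iper (T k)" "continuous_on Iper F"
  shows "(\<lambda>k. \<integral>t. (T k t - F t)\<^sup>2 \<partial>Lper) \<longlonglongrightarrow> 0"
proof (rule LIMSEQ_I)
  fix e :: real assume e: "e > 0"
  define d where "d = sqrt (e / (4 * pi))"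
  have d: "d > 0" using e by (simp add: d_def)
  have "\<forall>\<^sub>F k in sequentially. \<forall>x\<in>Iper. dist (T k x) (F x) < d" using assms(1) d by (auto simp: uniform_limit_iff)
  then obtain K where K: "\<And>k x. k \<ge> K \<Longrightarrow> x \<in> Iper \<Longrightarrow> \<bar>T k x - F x\<bar> < d"
    by (auto simp: eventually_sequentially dist_real_def)
  have "norm ((\<integral>t. (T k t - F t)\<^sup>2 \<partial>Lper) - 0) < e" if k: "k \<ge> K" for k
  proof -
    have "(\<integral>t. (T k t - F t)\<^sup>2 \<partial>Lper) \<le> (\<integral>t. d\<^sup>2 \<partial>Lper)"
    proof (rule integral_mono)
      show "(T k t - F t)\<^sup>2 \<le> d\<^sup>2" if "t \<in> space Lper" for t
        using K[OF k, of t] that d by (simp add: abs_le_square_iff[symmetric])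
    qed (intro integrable_Lper_continuous continuous_intros assms)+
    also have "\<dots> = e / 2" using e by (simp add: d_def)
    finally show ?thesis using e by simp
  qed
  then show "\<exists>K. \<forall>k\<ge>K. norm ((\<integral>t. (T k t - F t)\<^sup>2 \<partial>Lper) - 0) < e" by blast
qed

lemma h1_approx_uniform_limit:
  assumes approx: "h1_approx f g T T'" and f: "continuous_on Iper f"
  shows "uniform_limit Iper T f sequentially"
proof -
  note T_cont = C1per_continuous(1)[OF h1_approx_C1per[OF approx]]
  obtain F where F: "uniform_limit Iper T F sequentially"
    using Cauchy_uniformly_convergent[OF h1_approx_uniformly_Cauchy[OF approx]]
    by (auto simp: uniformly_convergent_on_def)
  have F_cont: "continuous_on Iper F" by (rule uniform_limit_theorem[OF _ F]) (simp_all add: T_cont)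
  note to_F = uniform_limit_integral_square_tendsto[OF F T_cont F_cont]
  have to_f: "(\<lambda>k. \<integral>t. (f t - T k t)\<^sup>2 \<partial>Lper) \<longlonglongrightarrow> 0"
  proof (rule Lim_null_comparison[OF always_eventually[OF allI]])
    show "norm (\<integral>t. (f t - T k t)\<^sup>2 \<partial>Lper) \<le> (h1norm (\<lambda>t. f t - T k t) (\<lambda>t. g t - T' k t))\<^sup>2" for k
      by (simp add: integral_square_le_h1norm)
    show "(\<lambda>k. (h1norm (\<lambda>t. f t - T k t) (\<lambda>t. g t - T' k t))\<^sup>2) \<longlonglongrightarrow> 0"
      using tendsto_power[OF h1_approx_tendsto[OF approx], of 2] by simp
  qed
  have "(\<integral>t. (f t - F t)\<^sup>2 \<partial>Lper) \<le> 2 * (\<integral>t. (f t - T k t)\<^sup>2 \<partial>Lper) + 2 * (\<integral>t. (T k t - F t)\<^sup>2 \<partial>Lper)" for k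
    using integral_norm_diff_square_le[OF h1_approx_L2per(1,3)[OF approx] L2per_continuous[OF F_cont], of k] by simp
  then have "(\<integral>t. (f t - F t)\<^sup>2 \<partial>Lper) \<le> 2 * 0 + 2 * 0"
    by (intro LIMSEQ_le_const[of "\<lambda>k. 2 * (\<integral>t. (f t - T k t)\<^sup>2 \<partial>Lper) + 2 * (\<integral>t. (T k t - F t)\<^sup>2 \<partial>Lper)"]
        tendsto_intros to_f to_F) auto
  then have "(\<integral>t. (f t - F t)\<^sup>2 \<partial>Lper) = 0" by (simp add: antisym)
  moreover have "continuous_on Iper (\<lambda>t. (f t - F t)\<^sup>2)" by (intro continuous_intros f F_cont)
  ultimately have "F x = f x" if "x \<in> Iper" for x
    using integral_Lper_eq_0_continuous[of "\<lambda>t. (f t - F t)\<^sup>2" x] that by simp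
  then show ?thesis using F uniform_limit_cong'[of Iper T T F f sequentially] by auto
qed

lemma h1_approx_bounded:
  assumes approx: "h1_approx f g T T'"
  obtains R where "0 \<le> R" "\<And>k. h1norm (T k) (T' k) \<le> R"
proof -
  let ?d = "\<lambda>k. h1norm (\<lambda>t. f t - T k t) (\<lambda>t. g t - T' k t)"
  have "Bseq ?d" using h1_approx_tendsto[OF approx] by (intro convergent_imp_Bseq convergentI)
  then obtain D where D: "\<And>k. ?d k \<le> D" by (auto simp: Bseq_def)
  note L2 = h1_approx_L2per[OF approx]
  have "h1norm (T k) (T' k) \<le> 2 * h1norm f g + 2 * D" for k
  proof -
    have "h1norm (\<lambda>t. f t - (f t - T k t)) (\<lambda>t. g t - (g t - T' k t)) \<le> 2 * h1norm f g + 2 * ?d k"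
      by (intro h1norm_diff_le square_integrable_diff L2)
    then show ?thesis using D[of k] by simp
  qed
  moreover have "0 \<le> D" using D[of 0] h1norm_nonneg order_trans by blast
  ultimately show ?thesis using that[of "2 * h1norm f g + 2 * D"] by simp
qed

lemma Dper_D:
  assumes "Dper \<rho>"
  shows "H1per \<rho>" "continuous_on Iper \<rho>" "\<And>t. t \<in> Iper \<Longrightarrow> 0 < \<rho> t" "(\<integral>t. \<rho> t \<partial>Lper) = 1"
  using assms by (auto simp: Dper_def)

lemma Dper_approx:
  assumes \<rho>: "Dper \<rho>"
  obtains g T T' m M where "h1_approx \<rho> g T T'" "0 < m" "\<And>k t. m \<le> T k t" "\<And>k t. T k t \<le> M"
proof -
  obtain g T T' where approx: "h1_approx \<rho> g T T'"
    using Dper_D(1)[OF \<rho>] weak_deriv_trig_approx by (metis H1per_iff_weak_deriv)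
  note \<rho>_cont = Dper_D(2)[OF \<rho>]
  obtain x0 where x0: "x0 \<in> Iper" "\<And>t. t \<in> Iper \<Longrightarrow> \<rho> x0 \<le> \<rho> t"
    using continuous_attains_inf[OF compact_Iper _ \<rho>_cont] zero_in_Iper by blast
  obtain M where M: "\<And>t. t \<in> Iper \<Longrightarrow> \<bar>\<rho> t\<bar> \<le> M" using continuous_on_Iper_bounded[OF \<rho>_cont] by blast
  define m where "m = \<rho> x0 / 2"
  have m: "0 < m" using Dper_D(3)[OF \<rho> x0(1)] by (simp add: m_def)
  obtain N where N: "\<And>k t. k \<ge> N \<Longrightarrow> t \<in> Iper \<Longrightarrow> \<bar>T k t - \<rho> t\<bar> < m"
    using uniform_limitD[OF h1_approx_uniform_limit[OF approx \<rho>_cont] m]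
    by (auto simp: eventually_sequentially dist_real_def)
  have bounds: "m \<le> T (k + N) t \<and> T (k + N) t \<le> M + m" for k t
  proof -
    obtain s where s: "s \<in> Iper" "T (k + N) s = T (k + N) t"
      using periodic_value_on_Iper[of "T (k + N)", OF C1per_periodic[OF h1_approx_C1per[OF approx]]] by metis
    have "\<rho> x0 = 2 * m" by (simp add: m_def)
    then show ?thesis using N[of "k + N" s] x0(2)[OF s(1)] M[OF s(1)] s by linarith
  qed
  have "h1_approx \<rho> g (\<lambda>k. T (k + N)) (\<lambda>k. T' (k + N))"
    using approx LIMSEQ_ignore_initial_segment[OF h1_approx_tendsto[OF approx], of N] by (simp add: h1_approx_def)
  then show ?thesis using that m bounds by blast
qed

subsection \<open>Bounded functionals\<close>

definition H1_linear :: "((real \<Rightarrow> real) \<Rightarrow> real) \<Rightarrow> bool" where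
  "H1_linear V \<longleftrightarrow> (\<forall>f h a b. H1per f \<longrightarrow> H1per h \<longrightarrow> V (\<lambda>t. a * f t + b * h t) = a * V f + b * V h)"

definition H1_dual_le :: "real \<Rightarrow> ((real \<Rightarrow> real) \<Rightarrow> real) \<Rightarrow> bool" where
  "H1_dual_le C V \<longleftrightarrow> H1_linear V \<and> 0 \<le> C \<and> (\<forall>f g. weak_deriv f g \<longrightarrow> \<bar>V f\<bar> \<le> C * h1norm f g)"

lemma H1_linearD: "H1_linear V \<Longrightarrow> H1per f \<Longrightarrow> H1per h \<Longrightarrow> V (\<lambda>t. a * f t + b * h t) = a * V f + b * V h"
  unfolding H1_linear_def by blast

lemma H1_linear_cmult: "H1_linear V \<Longrightarrow> H1per f \<Longrightarrow> V (\<lambda>t. c * f t) = c * V f"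
  using H1_linearD[of V f f c 0] by simp

lemma H1_linear_diff: "H1_linear V \<Longrightarrow> H1per f \<Longrightarrow> H1per h \<Longrightarrow> V (\<lambda>t. f t - h t) = V f - V h"
  using H1_linearD[of V f h 1 "-1"] by simp

lemma H1_linear_sum:
  assumes V: "H1_linear V" and "finite A" and f: "\<And>i. i \<in> A \<Longrightarrow> H1per (f i)"
  shows "H1per (\<lambda>t. \<Sum>i\<in>A. f i t) \<and> V (\<lambda>t. \<Sum>i\<in>A. f i t) = (\<Sum>i\<in>A. V (f i))"
  using assms(2) f
proof (induction rule: finite_induct)
  case empty
  have "H1per (\<lambda>t. 0)" by (rule C1per_H1per[OF C1per_const])
  then show ?case using H1_linear_cmult[OF V, of "\<lambda>t. 0" 0] by simp
next
  case (insert x F)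
  have "H1per (f x)" "H1per (\<lambda>t. \<Sum>i\<in>F. f i t)" using insert by auto
  then show ?case
    using H1per_lin[of "f x" "\<lambda>t. \<Sum>i\<in>F. f i t" 1 1] H1_linearD[OF V, of "f x" "\<lambda>t. \<Sum>i\<in>F. f i t" 1 1] insert by simp
qed

lemma H1_dual_leD:
  "H1_dual_le C V \<Longrightarrow> H1_linear V" "H1_dual_le C V \<Longrightarrow> 0 \<le> C" "H1_dual_le C V \<Longrightarrow> weak_deriv f g \<Longrightarrow> \<bar>V f\<bar> \<le> C * h1norm f g"
  by (auto simp: H1_dual_le_def)

lemma Hminus_iff_H1_dual_le: "Hminus V \<longleftrightarrow> (\<exists>C. H1_dual_le C V)"
proof
  assume V: "Hminus V"
  then obtain B where B: "\<And>f g. wderiv1 (\<lambda>t. complex_of_real (f t)) g \<Longrightarrow>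
      \<bar>V f\<bar> \<le> B * sqrt ((\<integral>t. (f t)\<^sup>2 \<partial>Lper) + (\<integral>t. (cmod (g t))\<^sup>2 \<partial>Lper))"
    unfolding Hminus_def by blast
  have "\<bar>V f\<bar> \<le> max B 0 * h1norm f g" if "weak_deriv f g" for f g
    using B[OF that[unfolded weak_deriv_def]] mult_right_mono[OF max.cobounded1[of B 0] h1norm_nonneg[of f g]]
    by (simp add: h1norm_def)
  then have "H1_dual_le (max B 0) V" using V by (auto simp: H1_dual_le_def H1_linear_def Hminus_def)
  then show "\<exists>C. H1_dual_le C V" ..
next
  assume "\<exists>C. H1_dual_le C V"
  then obtain C where C: "H1_dual_le C V" ..
  have "\<bar>V f\<bar> \<le> C * sqrt ((\<integral>t. (f t)\<^sup>2 \<partial>Lper) + (\<integral>t. (cmod (g t))\<^sup>2 \<partial>Lper))"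
    if wderiv: "wderiv1 (\<lambda>t. complex_of_real (f t)) g" for f g
  proof -
    have "(\<integral>t. (Re (g t))\<^sup>2 \<partial>Lper) \<le> (\<integral>t. (cmod (g t))\<^sup>2 \<partial>Lper)"
      using wderiv1_L2per(2)[OF wderiv] by (intro integral_mono') (auto simp: square_integrable_def cmod_power2)
    then have "C * h1norm f (\<lambda>t. Re (g t)) \<le> C * sqrt ((\<integral>t. (f t)\<^sup>2 \<partial>Lper) + (\<integral>t. (cmod (g t))\<^sup>2 \<partial>Lper))"
      unfolding h1norm_def using H1_dual_leD(2)[OF C] by (intro mult_left_mono real_sqrt_le_mono add_left_mono) auto
    then show ?thesis using H1_dual_leD(3)[OF C weak_deriv_Re[OF wderiv]] by linarith
  qed
  then show "Hminus V" unfolding Hminus_def using H1_dual_leD(1)[OF C] by (auto simp: H1_linear_def)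
qed

lemma H1_dual_le_add:
  assumes "H1_dual_le C V" "H1_dual_le D W" shows "H1_dual_le (C + D) (\<lambda>f. V f + W f)"
  unfolding H1_dual_le_def
proof (intro conjI allI impI)
  show "H1_linear (\<lambda>f. V f + W f)"
    using assms by (simp add: H1_dual_le_def H1_linear_def algebra_simps)
  show "0 \<le> C + D" using assms by (simp add: H1_dual_le_def)
  show "\<bar>V f + W f\<bar> \<le> (C + D) * h1norm f g" if "weak_deriv f g" for f g
    using assms[THEN H1_dual_leD(3), OF that] by (simp add: distrib_right)
qed

lemma L2per_mult_continuous:
  assumes u: "continuous_on Iper u" and f: "L2per f"
  shows "L2per (\<lambda>t. u t * f t :: real)"
proof -
  obtain U where U: "\<And>t. t \<in> Iper \<Longrightarrow> \<bar>u t\<bar> \<le> U" using continuous_on_Iper_bounded[OF u] by blast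
  have [measurable]: "u \<in> borel_measurable Lper" "f \<in> borel_measurable Lper"
    using f by (auto simp: square_integrable_def measurable_Lper_continuous[OF u])
  have "integrable Lper (\<lambda>t. (u t * f t)\<^sup>2)"
  proof (rule Bochner_Integration.integrable_bound)
    show "integrable Lper (\<lambda>t. U\<^sup>2 * (f t)\<^sup>2)" using f by (simp add: square_integrable_def)
    have "(u t * f t)\<^sup>2 \<le> U\<^sup>2 * (f t)\<^sup>2" if "t \<in> Iper" for t
      using power_mono[OF U[OF that] abs_ge_zero, of 2] by (simp add: power_mult_distrib mult_right_mono)
    then show "AE t in Lper. norm ((u t * f t)\<^sup>2) \<le> norm (U\<^sup>2 * (f t)\<^sup>2)" by (intro AE_I2) simp
  qed measurable
  then show ?thesis by (simp add: square_integrable_def)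
qed

lemma H1_dual_le_integral:
  assumes u: "continuous_on Iper u" "\<And>t. t \<in> Iper \<Longrightarrow> \<bar>u t\<bar> \<le> U" "0 \<le> U"
  shows "H1_dual_le (U * sqrt (2 * pi)) (\<lambda>f. \<integral>t. u t * f t \<partial>Lper)"
  unfolding H1_dual_le_def H1_linear_def
proof (intro conjI allI impI)
  note u_mult = L2per_mult_continuous[OF u(1)]
  show "(\<integral>t. u t * (a * f t + b * h t) \<partial>Lper) = a * (\<integral>t. u t * f t \<partial>Lper) + b * (\<integral>t. u t * h t \<partial>Lper)"
    if "H1per f" "H1per h" for f h a b
  proof -
    have "integrable Lper (\<lambda>t. u t * f t)" "integrable Lper (\<lambda>t. u t * h t)"
      using that by (auto simp: H1per_iff_weak_deriv intro: L2per_integrable u_mult weak_deriv_L2per)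
    then show ?thesis by (simp add: distrib_left mult.left_commute)
  qed
  fix f g assume "weak_deriv f g"
  then have f: "L2per f" by (rule weak_deriv_L2per)
  have "(\<integral>t. (u t * f t)\<^sup>2 \<partial>Lper) \<le> (\<integral>t. U\<^sup>2 * (f t)\<^sup>2 \<partial>Lper)"
  proof (rule integral_mono)
    show "(u t * f t)\<^sup>2 \<le> U\<^sup>2 * (f t)\<^sup>2" if "t \<in> space Lper" for t
      using power_mono[OF u(2) abs_ge_zero, of t 2] that by (simp add: power_mult_distrib mult_right_mono)
  qed (use f u_mult[OF f] in \<open>auto simp: square_integrable_def\<close>)
  also have "\<dots> \<le> U\<^sup>2 * (h1norm f g)\<^sup>2" by (simp add: mult_left_mono integral_square_le_h1norm)
  finally have "sqrt (2 * pi * (\<integral>t. (u t * f t)\<^sup>2 \<partial>Lper)) \<le> sqrt (2 * pi * (U\<^sup>2 * (h1norm f g)\<^sup>2))" by simp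
  also have "\<dots> = U * sqrt (2 * pi) * h1norm f g" using u(3) by (simp add: real_sqrt_mult)
  finally show "\<bar>\<integral>t. u t * f t \<partial>Lper\<bar> \<le> U * sqrt (2 * pi) * h1norm f g"
    using abs_integral_Lper_le[OF u_mult[OF f]] by linarith
qed (use u(3) in simp)

lemma Hminus_integral:
  assumes "continuous_on Iper u" shows "Hminus (\<lambda>f. \<integral>t. u t * f t \<partial>Lper)"
  using continuous_on_Iper_bounded[OF assms] H1_dual_le_integral[OF assms] Hminus_iff_H1_dual_le by metis

lemma Hminus_add: "Hminus V \<Longrightarrow> Hminus W \<Longrightarrow> Hminus (\<lambda>f. V f + W f)"
  unfolding Hminus_iff_H1_dual_le using H1_dual_le_add by blast

lemma Hminus_H1_linear: "Hminus V \<Longrightarrow> H1_linear V"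
  using Hminus_iff_H1_dual_le H1_dual_leD(1) by blast

lemma H1_dual_le_approx_error:
  assumes V: "H1_dual_le C V" and approx: "h1_approx f g T T'"
  shows "\<bar>V f - V (T k)\<bar> \<le> C * h1norm (\<lambda>t. f t - T k t) (\<lambda>t. g t - T' k t)"
proof -
  have wderiv: "weak_deriv f g" "weak_deriv (T k) (T' k)"
    using h1_approx_weak_deriv[OF approx] C1per_weak_deriv[OF h1_approx_C1per[OF approx]] by auto
  have "V (\<lambda>t. f t - T k t) = V f - V (T k)"
    using H1_linear_diff[OF H1_dual_leD(1)[OF V] weak_deriv_H1per weak_deriv_H1per] wderiv by blast
  then show ?thesis using H1_dual_leD(3)[OF V weak_deriv_diff[OF wderiv]] by simp
qed

lemma Hminus_h1_approx_tendsto: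
  assumes V: "Hminus V" and approx: "h1_approx f g T T'"
  shows "(\<lambda>k. V (T k)) \<longlonglongrightarrow> V f"
proof -
  obtain C where C: "H1_dual_le C V" using V by (auto simp: Hminus_iff_H1_dual_le)
  have "(\<lambda>k. V (T k) - V f) \<longlonglongrightarrow> 0"
  proof (rule Lim_null_comparison[OF always_eventually[OF allI]])
    show "norm (V (T k) - V f) \<le> C * h1norm (\<lambda>t. f t - T k t) (\<lambda>t. g t - T' k t)" for k
      using H1_dual_le_approx_error[OF C approx, of k] by (simp add: abs_minus_commute)
    show "(\<lambda>k. C * h1norm (\<lambda>t. f t - T k t) (\<lambda>t. g t - T' k t)) \<longlonglongrightarrow> 0"
      using tendsto_mult_right_zero[OF h1_approx_tendsto[OF approx]] .
  qed
  then show ?thesis by (rule LIM_zero_cancel)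
qed

lemma Hminus_eqI:
  assumes "Hminus V" "Hminus W" "\<And>f f'. C1per f f' \<Longrightarrow> V f = W f" "H1per f"
  shows "V f = W f"
proof -
  obtain g T T' where approx: "h1_approx f g T T'"
    using assms(4) weak_deriv_trig_approx by (metis H1per_iff_weak_deriv)
  have "(\<lambda>k. V (T k)) = (\<lambda>k. W (T k))" using assms(3) h1_approx_C1per[OF approx] by blast
  then show ?thesis using assms(1,2)[THEN Hminus_h1_approx_tendsto, OF approx] LIMSEQ_unique by metis
qed

lemma H1_dual_leI_C1per:
  assumes V: "Hminus V" and C: "0 \<le> C" and unit_ball_bound: "\<And>f f'. C1per f f' \<Longrightarrow> h1norm f f' \<le> 1 \<Longrightarrow> V f \<le> C"
  shows "H1_dual_le (2 * C) V"
proof -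
  note lin = Hminus_H1_linear[OF V]
  have upper: "V f \<le> C * s" if f: "C1per f f'" and s: "h1norm f f' < s" for f f' s
  proof -
    have "0 < s" using s h1norm_nonneg[of f f'] by linarith
    have "h1norm (\<lambda>t. 1 / s * f t) (\<lambda>t. 1 / s * f' t) \<le> 1"
      unfolding h1norm_cmult using s \<open>0 < s\<close> by simp
    then have "V (\<lambda>t. 1 / s * f t) \<le> C" by (rule unit_ball_bound[OF C1per_cmult[OF f]])
    then have "1 / s * V f \<le> C" unfolding H1_linear_cmult[OF lin C1per_H1per[OF f]] .
    then show ?thesis using \<open>0 < s\<close> by (simp add: field_simps)
  qed
  have abs_le: "\<bar>V f\<bar> \<le> C * h1norm f f'" if f: "C1per f f'" for f f'
  proof -
    have "\<bar>V f\<bar> \<le> C * s" if "h1norm f f' < s" for s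
      using upper[OF f that] upper[OF C1per_cmult[OF f, of "-1"], of s] that h1norm_cmult[of "-1" f f']
        H1_linear_cmult[OF lin C1per_H1per[OF f], of "-1"] by simp
    then have "\<forall>\<^sub>F s in at_right (h1norm f f'). \<bar>V f\<bar> \<le> C * s"
      using eventually_at_right_less by (rule eventually_mono[rotated])
    moreover have "((\<lambda>s. C * s) \<longlongrightarrow> C * h1norm f f') (at_right (h1norm f f'))" by (intro tendsto_intros)
    ultimately show ?thesis by (intro tendsto_lowerbound) auto
  qed
  have "\<bar>V f\<bar> \<le> 2 * C * h1norm f g" if wderiv: "weak_deriv f g" for f g
  proof -
    obtain T T' where approx: "h1_approx f g T T'" using weak_deriv_trig_approx[OF wderiv] by metis
    let ?d = "\<lambda>k. h1norm (\<lambda>t. f t - T k t) (\<lambda>t. g t - T' k t)"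
    note L2 = h1_approx_L2per[OF approx]
    have "\<bar>V (T k)\<bar> \<le> C * (2 * h1norm f g + 2 * ?d k)" for k
    proof -
      have "h1norm (\<lambda>t. f t - (f t - T k t)) (\<lambda>t. g t - (g t - T' k t)) \<le> 2 * h1norm f g + 2 * ?d k"
        by (intro h1norm_diff_le square_integrable_diff L2)
      then have "C * h1norm (T k) (T' k) \<le> C * (2 * h1norm f g + 2 * ?d k)" using C by (simp add: mult_left_mono)
      then show ?thesis using abs_le[OF h1_approx_C1per[OF approx]] by (rule order_trans[rotated])
    qed
    moreover have "(\<lambda>k. C * (2 * h1norm f g + 2 * ?d k)) \<longlonglongrightarrow> C * (2 * h1norm f g + 2 * 0)"
      by (intro tendsto_intros h1_approx_tendsto[OF approx])
    moreover have "(\<lambda>k. \<bar>V (T k)\<bar>) \<longlonglongrightarrow> \<bar>V f\<bar>" by (intro tendsto_intros Hminus_h1_approx_tendsto[OF V approx])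
    ultimately have "\<bar>V f\<bar> \<le> C * (2 * h1norm f g + 2 * 0)" by (intro LIMSEQ_le) auto
    then show ?thesis by simp
  qed
  then show ?thesis using lin C by (simp add: H1_dual_le_def)
qed

subsection \<open>Weak sequential compactness\<close>

lemma coordinatewise_bounded_convergent_subsequence:
  fixes x :: "nat \<Rightarrow> nat \<Rightarrow> real"
  assumes "\<And>j k. \<bar>x j k\<bar> \<le> B k"
  obtains r l where "strict_mono r" "\<And>k. (\<lambda>j. x (r j) k) \<longlonglongrightarrow> l k"
proof -
  have box_compact: "compact (PiE UNIV (\<lambda>k. {- B k..B k}))"
    using compactin_PiE[of "\<lambda>_. euclidean" UNIV "\<lambda>k. {- B k..B k}"] by (simp add: euclidean_product_topology)
  have "x j \<in> PiE UNIV (\<lambda>k. {- B k..B k})" for j using assms[of j] by (auto simp: abs_le_iff minus_le_iff)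
  then obtain l r where "strict_mono r" "(x \<circ> r) \<longlonglongrightarrow> l"
    using seq_compactE[OF box_compact[unfolded compact_eq_seq_compact_metric], of x] by metis
  moreover have "(\<lambda>j. x (r j) k) \<longlonglongrightarrow> l k" for k
    using continuous_on_tendsto_compose[OF continuous_on_product_coordinates[of k] \<open>(x \<circ> r) \<longlonglongrightarrow> l\<close>] by (simp add: o_def)
  ultimately show ?thesis using that by blast
qed

lemma H1_dual_le_convergent_of_trig:
  assumes V: "\<And>j. H1_dual_le C (V j)"
    and trig: "\<And>f. real_trig_polynomial f \<Longrightarrow> convergent (\<lambda>j. V j f)" and f: "H1per f"
  shows "convergent (\<lambda>j::nat. V j f)"
proof -
  obtain g T T' where approx: "h1_approx f g T T'" and T: "\<And>k. real_trig_polynomial (T k)"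
    using f weak_deriv_trig_approx by (metis H1per_iff_weak_deriv)
  let ?e = "\<lambda>k. C * h1norm (\<lambda>t. f t - T k t) (\<lambda>t. g t - T' k t)"
  note err = H1_dual_le_approx_error[OF V approx]
  have e_tendsto: "?e \<longlonglongrightarrow> 0" using tendsto_mult_right_zero[OF h1_approx_tendsto[OF approx]] .
  have "Cauchy (\<lambda>j. V j f)"
  proof (rule metric_CauchyI)
    fix \<eta> :: real assume \<eta>: "0 < \<eta>"
    then have "\<forall>\<^sub>F k in sequentially. ?e k < \<eta> / 4" using e_tendsto by (intro order_tendstoD) auto
    then obtain k where k: "?e k < \<eta> / 4" by (auto simp: eventually_sequentially)
    have "Cauchy (\<lambda>j. V j (T k))" using trig[OF T] by (simp add: Cauchy_convergent_iff)
    then obtain M where M: "\<And>i j. i \<ge> M \<Longrightarrow> j \<ge> M \<Longrightarrow> dist (V i (T k)) (V j (T k)) < \<eta> / 4"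
      using \<eta> unfolding Cauchy_def by (meson divide_pos_pos zero_less_numeral)
    have "dist (V i f) (V j f) < \<eta>" if "M \<le> i" "M \<le> j" for i j
      using M[OF that] err[of i k] err[of j k] k unfolding dist_real_def by linarith
    then show "\<exists>M. \<forall>i\<ge>M. \<forall>j\<ge>M. dist (V i f) (V j f) < \<eta>" by blast
  qed
  then show ?thesis by (simp add: Cauchy_convergent_iff)
qed

lemma H1_dual_le_limit:
  assumes V: "\<And>j. H1_dual_le C (V j)" and lim: "\<And>f. H1per f \<Longrightarrow> (\<lambda>j::nat. V j f) \<longlonglongrightarrow> W f"
  shows "H1_dual_le C W"
  unfolding H1_dual_le_def H1_linear_def
proof (intro conjI allI impI)
  fix f h a b assume in_H1: "H1per f" "H1per h"
  have "(\<lambda>j. V j (\<lambda>t. a * f t + b * h t)) = (\<lambda>j. a * V j f + b * V j h)"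
    using H1_linearD[OF H1_dual_leD(1)[OF V] in_H1] by auto
  moreover have "(\<lambda>j. a * V j f + b * V j h) \<longlonglongrightarrow> a * W f + b * W h" by (intro tendsto_intros lim in_H1)
  ultimately show "W (\<lambda>t. a * f t + b * h t) = a * W f + b * W h"
    using lim[OF H1per_lin[OF in_H1]] LIMSEQ_unique by metis
next
  fix f g assume wderiv: "weak_deriv f g"
  have "(\<lambda>j. \<bar>V j f\<bar>) \<longlonglongrightarrow> \<bar>W f\<bar>" by (intro tendsto_intros lim weak_deriv_H1per[OF wderiv])
  then show "\<bar>W f\<bar> \<le> C * h1norm f g" by (rule LIMSEQ_le_const2) (use H1_dual_leD(3)[OF V wderiv] in auto)
qed (rule H1_dual_leD(2)[OF V])

theorem H1_dual_le_weakly_compact: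
  assumes V: "\<And>j. H1_dual_le C (V j)"
  obtains r W where "strict_mono (r :: nat \<Rightarrow> nat)" "H1_dual_le C W" "\<And>f. H1per f \<Longrightarrow> (\<lambda>j. V (r j) f) \<longlonglongrightarrow> W f"
proof -
  define basis where "basis k = (case (from_nat k :: int \<times> bool) of (m, is_cos) \<Rightarrow>
    if is_cos then (\<lambda>t::real. cos (real_of_int m * t)) else (\<lambda>t. sin (real_of_int m * t)))" for k
  have basis_weak_deriv: "\<exists>g. weak_deriv (basis k) g" for k
    unfolding basis_def by (auto split: prod.split intro: C1per_weak_deriv C1per_trig_basis)
  then obtain g where g: "\<And>k. weak_deriv (basis k) (g k)" by metis
  obtain r l where r: "strict_mono r" and basis_lim: "\<And>k. (\<lambda>j. V (r j) (basis k)) \<longlonglongrightarrow> l k"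
    using coordinatewise_bounded_convergent_subsequence[of "\<lambda>j k. V j (basis k)", OF H1_dual_leD(3)[OF V g]] by blast
  have trig_convergent: "convergent (\<lambda>j. V (r j) f)" if "real_trig_polynomial f" for f
    using that
  proof (induction rule: real_trig_polynomial.induct)
    case (cos m) then show ?case using basis_lim[of "to_nat (m, True)"] by (auto simp: basis_def convergent_def)
  next
    case (sin m) then show ?case using basis_lim[of "to_nat (m, False)"] by (auto simp: basis_def convergent_def)
  next
    case (lin f h a b)
    have "(\<lambda>j. V (r j) (\<lambda>t. a * f t + b * h t)) = (\<lambda>j. a * V (r j) f + b * V (r j) h)"
      using lin.hyps by (auto intro!: H1_linearD[OF H1_dual_leD(1)[OF V]] real_trig_polynomial_H1per)
    then show ?case using lin.IH
      by (simp add: convergent_add convergent_mult_const_iff convergent_mult convergent_const)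
  qed
  define W where "W f = lim (\<lambda>j. V (r j) f)" for f
  have lim: "(\<lambda>j. V (r j) f) \<longlonglongrightarrow> W f" if "H1per f" for f
    using H1_dual_le_convergent_of_trig[of C "\<lambda>j. V (r j)", OF V trig_convergent that]
    by (simp add: W_def convergent_LIMSEQ_iff)
  show ?thesis using that[OF r H1_dual_le_limit[of C "\<lambda>j. V (r j)", OF V lim] lim] by blast
qed

section \<open>Slater determinants of disjointly supported orbitals\<close>

interpretation Lprod: product_sigma_finite "\<lambda>_::nat. Lper"
  by (simp add: product_sigma_finite_def Lper.sigma_finite_measure_axioms)

text \<open>The orbitals carry a slot index as well, so that the same sum also yields the partial derivatives.\<close>

definition orbital_product :: "nat \<Rightarrow> (nat \<Rightarrow> nat \<Rightarrow> real \<Rightarrow> complex) \<Rightarrow> (nat \<Rightarrow> nat) \<Rightarrow> (nat \<Rightarrow> real) \<Rightarrow> complex" where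
  "orbital_product n f p x = (\<Prod>i<n. f i (p i) (x i))"

definition slater :: "nat \<Rightarrow> (nat \<Rightarrow> nat \<Rightarrow> real \<Rightarrow> complex) \<Rightarrow> (nat \<Rightarrow> real) \<Rightarrow> complex" where
  "slater n f x
    = complex_of_real (1 / sqrt (fact n)) * (\<Sum>p | p permutes {..<n}. of_int (sign p) * orbital_product n f p x)"

definition slater_grad :: "nat \<Rightarrow> (nat \<Rightarrow> real \<Rightarrow> complex) \<Rightarrow> (nat \<Rightarrow> real \<Rightarrow> complex) \<Rightarrow> nat \<Rightarrow> (nat \<Rightarrow> real) \<Rightarrow> complex" where
  "slater_grad n f f' j = slater n (\<lambda>i. if i = j then f' else f)"

definition disjoint_orbitals :: "nat \<Rightarrow> (nat \<Rightarrow> real \<Rightarrow> 'a::mult_zero) \<Rightarrow> (nat \<Rightarrow> real \<Rightarrow> 'a) \<Rightarrow> bool" where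
  "disjoint_orbitals n f h \<longleftrightarrow> (\<forall>k<n. \<forall>l<n. \<forall>t\<in>Iper. k \<noteq> l \<longrightarrow> f k t * h l t = 0)"

lemma finite_permutations_lessThan: "finite {p. p permutes {..<n::nat}}"
  by (rule finite_permutations) simp

lemma permutes_less: "p permutes {..<n::nat} \<Longrightarrow> i < n \<Longrightarrow> p i < n"
  using permutes_in_image[of p "{..<n}" i] by auto

lemma space_muN: "space (muN n) = PiE {..<n} (\<lambda>_. Iper)"
  by (simp add: muN_def space_PiM)

lemma space_muN_D: "x \<in> space (muN n) \<Longrightarrow> i < n \<Longrightarrow> x i \<in> Iper"
  by (auto simp: space_muN)

lemma trigN_prod: "trigN n m x = (\<Prod>i<n. trig1 (m i) (x i))"
  unfolding trigN_def by (induction n) (auto simp: trig1_def cis_mult[symmetric])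

lemma orbital_product_measurable:
  assumes "\<And>i k. i < n \<Longrightarrow> k < n \<Longrightarrow> f i k \<in> borel_measurable Lper" "p permutes {..<n}"
  shows "orbital_product n f p \<in> borel_measurable (muN n)"
  unfolding orbital_product_def muN_def
proof (rule borel_measurable_prod)
  fix i assume i: "i \<in> {..<n}"
  show "(\<lambda>x. f i (p i) (x i)) \<in> borel_measurable (Pi\<^sub>M {..<n} (\<lambda>_. Lper))"
    using assms i permutes_less by (intro measurable_compose[OF measurable_component_singleton[OF i]]) auto
qed

lemma orbital_product_norm_square:
  assumes f: "\<And>i k. i < n \<Longrightarrow> k < n \<Longrightarrow> L2per (f i k)" and p: "p permutes {..<n}"
  shows "integrable (muN n) (\<lambda>x. (cmod (orbital_product n f p x))\<^sup>2)"
    "(\<integral>x. (cmod (orbital_product n f p x))\<^sup>2 \<partial>muN n) = (\<Prod>i<n. \<integral>t. (cmod (f i (p i) t))\<^sup>2 \<partial>Lper)"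
proof -
  have factor: "(cmod (orbital_product n f p x))\<^sup>2 = (\<Prod>i<n. (cmod (f i (p i) (x i)))\<^sup>2)" for x
    by (simp add: orbital_product_def prod_norm[symmetric] prod_power_distrib)
  have orbital_integrable: "integrable Lper (\<lambda>t. (cmod (f i (p i) t))\<^sup>2)" if "i \<in> {..<n}" for i
    using f[of i "p i"] permutes_less[OF p] that by (auto simp: square_integrable_def)
  show "integrable (muN n) (\<lambda>x. (cmod (orbital_product n f p x))\<^sup>2)"
    unfolding factor muN_def by (rule Lprod.product_integrable_prod) (use orbital_integrable in auto)
  show "(\<integral>x. (cmod (orbital_product n f p x))\<^sup>2 \<partial>muN n) = (\<Prod>i<n. \<integral>t. (cmod (f i (p i) t))\<^sup>2 \<partial>Lper)"
    unfolding factor muN_def by (rule Lprod.product_integral_prod) (use orbital_integrable in auto)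
qed

lemma slater_norm_square_le: "(cmod (slater n f x))\<^sup>2 \<le> (\<Sum>p | p permutes {..<n}. (cmod (orbital_product n f p x))\<^sup>2)"
proof -
  let ?P = "{p. p permutes {..<n}}"
  have "cmod (slater n f x) \<le> (1 / sqrt (fact n)) * (\<Sum>p\<in>?P. cmod (orbital_product n f p x))"
    unfolding slater_def norm_mult norm_of_real
    using norm_sum[of "\<lambda>p. of_int (sign p) * orbital_product n f p x" ?P]
    by (auto simp: norm_mult sign_def if_distrib[of abs] if_distrib[of real_of_int]
      cong: if_cong intro!: divide_right_mono)
  then have "(cmod (slater n f x))\<^sup>2 \<le> ((1 / sqrt (fact n)) * (\<Sum>p\<in>?P. cmod (orbital_product n f p x)))\<^sup>2"
    by (intro power_mono) auto
  also have "\<dots> = (1 / fact n) * (\<Sum>p\<in>?P. cmod (orbital_product n f p x))\<^sup>2"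
    by (simp add: power_mult_distrib power_divide)
  also have "\<dots> \<le> (1 / fact n) * ((\<Sum>p\<in>?P. (cmod (orbital_product n f p x))\<^sup>2) * real (card ?P))"
    by (intro mult_left_mono sum_squared_le_sum_of_squares finite_permutations_lessThan) auto
  also have "\<dots> = (\<Sum>p\<in>?P. (cmod (orbital_product n f p x))\<^sup>2)"
    by (subst card_permutations[of "{..<n}" n]) auto
  finally show ?thesis .
qed

lemma slater_square_integrable:
  assumes f: "\<And>i k. i < n \<Longrightarrow> k < n \<Longrightarrow> L2per (f i k)"
  shows "square_integrable (muN n) (slater n f)"
    "(\<integral>x. (cmod (slater n f x))\<^sup>2 \<partial>muN n) \<le> (\<Sum>p | p permutes {..<n}. \<Prod>i<n. \<integral>t. (cmod (f i (p i) t))\<^sup>2 \<partial>Lper)"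
proof -
  note products = orbital_product_norm_square[OF f]
  have sum_integrable: "integrable (muN n) (\<lambda>x. \<Sum>p | p permutes {..<n}. (cmod (orbital_product n f p x))\<^sup>2)"
    using products(1) by (intro Bochner_Integration.integrable_sum) auto
  have slater_measurable: "slater n f \<in> borel_measurable (muN n)"
    unfolding slater_def using orbital_product_measurable[of n f] f
    by (intro borel_measurable_times borel_measurable_const borel_measurable_sum) (auto simp: square_integrable_def)
  have slater_integrable: "integrable (muN n) (\<lambda>x. (cmod (slater n f x))\<^sup>2)"
    by (rule Bochner_Integration.integrable_bound[OF sum_integrable])
      (use slater_measurable slater_norm_square_le[of n f] in \<open>auto intro!: AE_I2 order_trans[OF slater_norm_square_le] abs_ge_self\<close>)
  with slater_measurable show "square_integrable (muN n) (slater n f)" by (simp add: square_integrable_def)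
  have "(\<integral>x. (cmod (slater n f x))\<^sup>2 \<partial>muN n)
      \<le> (\<integral>x. (\<Sum>p | p permutes {..<n}. (cmod (orbital_product n f p x))\<^sup>2) \<partial>muN n)"
    by (intro integral_mono slater_integrable sum_integrable slater_norm_square_le)
  also have "\<dots> = (\<Sum>p | p permutes {..<n}. \<Prod>i<n. \<integral>t. (cmod (f i (p i) t))\<^sup>2 \<partial>Lper)"
    using products by (simp add: Bochner_Integration.integral_sum)
  finally show "(\<integral>x. (cmod (slater n f x))\<^sup>2 \<partial>muN n)
      \<le> (\<Sum>p | p permutes {..<n}. \<Prod>i<n. \<integral>t. (cmod (f i (p i) t))\<^sup>2 \<partial>Lper)" .
qed

lemma integral_sum_permutation_products:
  fixes h :: "(nat \<Rightarrow> nat) \<Rightarrow> nat \<Rightarrow> real \<Rightarrow> complex"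
  assumes "\<And>p i. p permutes {..<n} \<Longrightarrow> i < n \<Longrightarrow> integrable Lper (h p i)"
  shows "(\<integral>x. (\<Sum>p | p permutes {..<n}. c p * (\<Prod>i<n. h p i (x i))) \<partial>muN n) =
    (\<Sum>p | p permutes {..<n}. c p * (\<Prod>i<n. \<integral>t. h p i t \<partial>Lper))"
proof -
  have "integrable (muN n) (\<lambda>x. \<Prod>i<n. h p i (x i))"
    "(\<integral>x. (\<Prod>i<n. h p i (x i)) \<partial>muN n) = (\<Prod>i<n. \<integral>t. h p i t \<partial>Lper)" if "p permutes {..<n}" for p
    unfolding muN_def using assms[OF that]
    by (auto intro!: Lprod.product_integrable_prod Lprod.product_integral_prod)
  then show ?thesis by (simp add: Bochner_Integration.integral_sum)
qed

lemma integral_slater_mult_product: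
  assumes "\<And>i k. i < n \<Longrightarrow> k < n \<Longrightarrow> L2per (f i k)" "\<And>i. i < n \<Longrightarrow> L2per (h i)"
  shows "(\<integral>x. slater n f x * (\<Prod>i<n. h i (x i)) \<partial>muN n) =
    complex_of_real (1 / sqrt (fact n)) * (\<Sum>p | p permutes {..<n}. of_int (sign p)
      * (\<Prod>i<n. \<integral>t. f i (p i) t * h i t \<partial>Lper))"
proof -
  have "(\<integral>x. slater n f x * (\<Prod>i<n. h i (x i)) \<partial>muN n) =
    (\<integral>x. complex_of_real (1 / sqrt (fact n)) *
      (\<Sum>p | p permutes {..<n}. of_int (sign p) * (\<Prod>i<n. f i (p i) (x i) * h i (x i))) \<partial>muN n)"
    by (simp add: slater_def orbital_product_def sum_distrib_right prod.distrib mult.assoc)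
  also have "\<dots> = complex_of_real (1 / sqrt (fact n))
      * (\<Sum>p | p permutes {..<n}. of_int (sign p) * (\<Prod>i<n. \<integral>t. f i (p i) t * h i t \<partial>Lper))"
    unfolding integral_mult_right_zero using assms permutes_less
    by (subst integral_sum_permutation_products) (auto intro!: square_integrable_mult)
  finally show ?thesis .
qed

lemma slater_integration_by_parts:
  assumes wderiv: "\<And>k. k < n \<Longrightarrow> wderiv1 (f k) (f' k)" and j: "j < n"
  shows "(\<integral>x. slater n (\<lambda>i. f) x * (\<i> * of_int (m j) * trigN n m x) \<partial>muN n)
      = - (\<integral>x. slater_grad n f f' j x * trigN n m x \<partial>muN n)"
proof -
  have L2: "L2per (f k)" "L2per (f' k)" if "k < n" for k using wderiv[OF that] wderiv1_L2per by auto
  define h where "h i t = (if i = j then \<i> * of_int (m j) else 1) * trig1 (m i) t" for i t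
  let ?F = "\<lambda>i. if i = j then f' else f"
  have h_prod: "\<i> * of_int (m j) * trigN n m x = (\<Prod>i<n. h i (x i))" for x
    using j by (simp add: h_def trigN_prod prod.distrib prod.delta)
  have by_parts: "(\<Prod>i<n. \<integral>t. f (p i) t * h i t \<partial>Lper) = - (\<Prod>i<n. \<integral>t. ?F i (p i) t * trig1 (m i) t \<partial>Lper)"
    if p: "p permutes {..<n}" for p
  proof -
    have "(\<Prod>i<n. \<integral>t. f (p i) t * h i t \<partial>Lper) =
      (\<integral>t. f (p j) t * h j t \<partial>Lper) * (\<Prod>i\<in>{..<n}-{j}. \<integral>t. f (p i) t * h i t \<partial>Lper)"
      using j by (subst prod.remove[of _ j]) auto
    also have "(\<integral>t. f (p j) t * h j t \<partial>Lper) = - (\<integral>t. f' (p j) t * trig1 (m j) t \<partial>Lper)"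
      using wderiv[OF permutes_less[OF p j]] unfolding wderiv1_def h_def by simp
    also have "(\<Prod>i\<in>{..<n}-{j}. \<integral>t. f (p i) t * h i t \<partial>Lper) = (\<Prod>i\<in>{..<n}-{j}. \<integral>t. ?F i (p i) t * trig1 (m i) t \<partial>Lper)"
      by (intro prod.cong) (auto simp: h_def)
    also have "- (\<integral>t. f' (p j) t * trig1 (m j) t \<partial>Lper) * \<dots> = - (\<Prod>i<n. \<integral>t. ?F i (p i) t * trig1 (m i) t \<partial>Lper)"
      using j by (subst prod.remove[of "{..<n}" j]) auto
    finally show ?thesis .
  qed
  have "(\<integral>x. slater n (\<lambda>i. f) x * (\<i> * of_int (m j) * trigN n m x) \<partial>muN n) =
    complex_of_real (1 / sqrt (fact n)) * (\<Sum>p | p permutes {..<n}. of_int (sign p)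
      * (\<Prod>i<n. \<integral>t. f (p i) t * h i t \<partial>Lper))"
    unfolding h_prod using L2 by (intro integral_slater_mult_product) (auto simp: h_def L2per_trig1)
  also have "\<dots> = - (complex_of_real (1 / sqrt (fact n))
      * (\<Sum>p | p permutes {..<n}. of_int (sign p) * (\<Prod>i<n. \<integral>t. ?F i (p i) t * trig1 (m i) t \<partial>Lper)))"
    by (simp add: by_parts sum_negf)
  also have "\<dots> = - (\<integral>x. slater n ?F x * (\<Prod>i<n. trig1 (m i) (x i)) \<partial>muN n)"
    using L2 by (subst integral_slater_mult_product) (auto intro: L2per_trig1[of 1, simplified])
  finally show ?thesis by (simp add: slater_grad_def trigN_prod)
qed

lemma slater_wgradN:
  assumes wderiv: "\<And>k. k < n \<Longrightarrow> wderiv1 (f k) (f' k)"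
  shows "wgradN n (slater n (\<lambda>i. f)) (slater_grad n f f')"
proof -
  have "square_integrable (muN n) (slater n (\<lambda>i. f))" "square_integrable (muN n) (slater_grad n f f' j)" for j
    using wderiv[THEN wderiv1_L2per(1)] wderiv[THEN wderiv1_L2per(2)] unfolding slater_grad_def
    by (auto intro!: slater_square_integrable)
  then show ?thesis unfolding wgradN_def square_integrable_def
    using slater_integration_by_parts[where n = n and f = f and f' = f', OF wderiv] by simp
qed

lemma slater_antisym: "antisymN n (slater n (\<lambda>i. f))"
  unfolding antisymN_def
proof (intro allI impI AE_I2)
  fix \<tau> x assume \<tau>: "\<tau> permutes {..<n}"
  have "(\<Sum>p | p permutes {..<n}. of_int (sign p) * orbital_product n (\<lambda>i. f) p (x \<circ> \<tau>)) =
    (\<Sum>p | p permutes {..<n}. of_int (sign (p \<circ> \<tau>)) * orbital_product n (\<lambda>i. f) (p \<circ> \<tau>) (x \<circ> \<tau>))"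
    by (rule sum_permutations_compose_right[OF \<tau>])
  also have "\<dots> = (\<Sum>p | p permutes {..<n}. of_int (sign \<tau>) * (of_int (sign p) * orbital_product n (\<lambda>i. f) p x))"
  proof (rule sum.cong[OF refl])
    fix p assume "p \<in> {p. p permutes {..<n}}"
    then have "permutation p" "permutation \<tau>" using \<tau> by (auto simp: permutation_permutes)
    then have "sign (p \<circ> \<tau>) = sign p * sign \<tau>" by (rule sign_compose)
    moreover have "orbital_product n (\<lambda>i. f) (p \<circ> \<tau>) (x \<circ> \<tau>) = orbital_product n (\<lambda>i. f) p x"
      unfolding orbital_product_def using prod.permute[OF \<tau>, of "\<lambda>k. f (p k) (x k)"] by (simp add: o_def)
    ultimately show "of_int (sign (p \<circ> \<tau>)) * orbital_product n (\<lambda>i. f) (p \<circ> \<tau>) (x \<circ> \<tau>) =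
      of_int (sign \<tau>) * (of_int (sign p) * orbital_product n (\<lambda>i. f) p x)" by simp
  qed
  finally show "slater n (\<lambda>i. f) (x \<circ> \<tau>) = of_int (sign \<tau>) * slater n (\<lambda>i. f) x"
    unfolding slater_def by (simp add: sum_distrib_left mult_ac)
qed

lemma orbital_product_disjoint:
  assumes disjoint: "disjoint_orbitals n f h" and x: "\<And>i. i < n \<Longrightarrow> x i \<in> Iper"
    and pq: "p permutes {..<n}" "q permutes {..<n}" "p \<noteq> q"
  shows "cnj (orbital_product n (\<lambda>i. f) p x) * orbital_product n (\<lambda>i. h) q x = 0"
proof -
  obtain i where i: "p i \<noteq> q i" using pq(3) by auto
  then have "i < n" using pq(1,2) by (metis lessThan_iff permutes_not_in)
  then have "f (p i) (x i) * h (q i) (x i) = 0" using disjoint x pq(1,2) permutes_less i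
    unfolding disjoint_orbitals_def by blast
  then have "\<exists>i\<in>{..<n}. cnj (f (p i) (x i)) * h (q i) (x i) = 0" using \<open>i < n\<close> by auto
  then show ?thesis by (simp add: orbital_product_def prod.distrib[symmetric])
qed

lemma cnj_slater_mult_slater_disjoint:
  assumes disjoint: "disjoint_orbitals n f h" and x: "\<And>i. i < n \<Longrightarrow> x i \<in> Iper"
  shows "cnj (slater n (\<lambda>i. f) x) * slater n (\<lambda>i. h) x =
    (\<Sum>p | p permutes {..<n}. complex_of_real (1 / fact n) * (\<Prod>i<n. cnj (f (p i) (x i)) * h (p i) (x i)))"
proof -
  let ?P = "{p. p permutes {..<n}}" and ?F = "\<lambda>p. orbital_product n (\<lambda>i. f) p x"
    and ?H = "\<lambda>p. orbital_product n (\<lambda>i. h) p x"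
  have normalisation: "complex_of_real (1 / sqrt (fact n)) * complex_of_real (1 / sqrt (fact n))
      = complex_of_real (1 / fact n)"
    unfolding of_real_mult[symmetric] by (simp add: real_sqrt_mult_self)
  have regroup: "(c * A) * (c * B) = (c * c) * (A * B)" for c A B :: complex by (simp add: mult_ac)
  have "cnj (slater n (\<lambda>i. f) x) = complex_of_real (1 / sqrt (fact n)) * (\<Sum>p\<in>?P. of_int (sign p) * cnj (?F p))"
    by (simp add: slater_def)
  then have "cnj (slater n (\<lambda>i. f) x) * slater n (\<lambda>i. h) x = complex_of_real (1 / fact n) *
      ((\<Sum>p\<in>?P. of_int (sign p) * cnj (?F p)) * (\<Sum>q\<in>?P. of_int (sign q) * ?H q))"
    by (simp only: slater_def[of n "\<lambda>i. h"] regroup normalisation)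
  also have "(\<Sum>p\<in>?P. of_int (sign p) * cnj (?F p)) * (\<Sum>q\<in>?P. of_int (sign q) * ?H q) =
     (\<Sum>p\<in>?P. \<Sum>q\<in>?P. if q = p then cnj (?F p) * ?H p else 0)"
    unfolding sum_product
  proof (intro sum.cong refl)
    fix p q assume pq: "p \<in> ?P" "q \<in> ?P"
    have "of_int (sign p) * of_int (sign p) = (1::complex)" by (metis (no_types) of_int_1 of_int_mult sign_idempotent)
    then have "of_int (sign p) * cnj (?F p) * (of_int (sign p) * ?H p) = cnj (?F p) * ?H p" by (simp add: mult_ac)
    moreover have "cnj (?F p) * ?H q = 0" if "p \<noteq> q" using orbital_product_disjoint[OF disjoint x _ _ that] pq by simp
    ultimately show "of_int (sign p) * cnj (?F p) * (of_int (sign q) * ?H q) = (if q = p then cnj (?F p) * ?H p else 0)"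
      by auto
  qed
  also have "\<dots> = (\<Sum>p\<in>?P. \<Prod>i<n. cnj (f (p i) (x i)) * h (p i) (x i))"
    using finite_permutations_lessThan by (simp add: sum.delta' orbital_product_def prod.distrib)
  finally show ?thesis by (simp add: sum_distrib_left)
qed

lemma innerN_slater_disjoint:
  assumes f: "\<And>k. k < n \<Longrightarrow> L2per (f k)" and h: "\<And>k. k < n \<Longrightarrow> L2per (h k)" and disjoint: "disjoint_orbitals n f h"
  shows "innerN n (slater n (\<lambda>i. f)) (slater n (\<lambda>i. h)) = (\<Prod>k<n. \<integral>t. cnj (f k t) * h k t \<partial>Lper)"
proof -
  let ?P = "{p. p permutes {..<n}}"
  have "innerN n (slater n (\<lambda>i. f)) (slater n (\<lambda>i. h)) =
    (\<integral>x. (\<Sum>p\<in>?P. complex_of_real (1 / fact n) * (\<Prod>i<n. cnj (f (p i) (x i)) * h (p i) (x i))) \<partial>muN n)"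
    unfolding innerN_def
    by (intro Bochner_Integration.integral_cong refl cnj_slater_mult_slater_disjoint disjoint space_muN_D)
  also have "\<dots> = (\<Sum>p\<in>?P. complex_of_real (1 / fact n) * (\<Prod>i<n. \<integral>t. cnj (f (p i) t) * h (p i) t \<partial>Lper))"
    using f h permutes_less
    by (intro integral_sum_permutation_products) (auto intro!: square_integrable_mult square_integrable_cnj)
  also have "\<dots> = (\<Sum>p\<in>?P. complex_of_real (1 / fact n) * (\<Prod>k<n. \<integral>t. cnj (f k t) * h k t \<partial>Lper))"
  proof (intro sum.cong refl arg_cong2[where f = times])
    fix p assume "p \<in> ?P"
    then show "(\<Prod>i<n. \<integral>t. cnj (f (p i) t) * h (p i) t \<partial>Lper) = (\<Prod>k<n. \<integral>t. cnj (f k t) * h k t \<partial>Lper)"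
      using prod.permute[of p "{..<n}" "\<lambda>k. \<integral>t. cnj (f k t) * h k t \<partial>Lper"] by (simp add: o_def)
  qed
  also have "\<dots> = (\<Prod>k<n. \<integral>t. cnj (f k t) * h k t \<partial>Lper)"
    by (simp add: card_permutations[of "{..<n}" n])
  finally show ?thesis .
qed

lemma slater_norm_square_disjoint:
  assumes disjoint: "disjoint_orbitals n f f" and x: "\<And>i. i < n \<Longrightarrow> x i \<in> Iper"
  shows "(cmod (slater n (\<lambda>i. f) x))\<^sup>2 = (\<Sum>p | p permutes {..<n}. 1 / fact n * (\<Prod>i<n. (cmod (f (p i) (x i)))\<^sup>2))"
proof -
  have "complex_of_real ((cmod (slater n (\<lambda>i. f) x))\<^sup>2) = cnj (slater n (\<lambda>i. f) x) * slater n (\<lambda>i. f) x"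
    by (simp add: complex_norm_square mult.commute del: of_real_power)
  also have "\<dots> = complex_of_real (\<Sum>p | p permutes {..<n}. 1 / fact n * (\<Prod>i<n. (cmod (f (p i) (x i)))\<^sup>2))"
    using cnj_slater_mult_slater_disjoint[OF disjoint x]
    by (simp add: complex_norm_square mult.commute del: of_real_power)
  finally show ?thesis by (simp only: of_real_eq_iff)
qed

lemma sum_permutations_at:
  fixes \<eta> :: "nat \<Rightarrow> real"
  assumes "j < n"
  shows "real n * (\<Sum>p | p permutes {..<n}. \<eta> (p j)) = fact n * (\<Sum>k<n. \<eta> k)"
proof -
  let ?P = "{p. p permutes {..<n}}"
  have "(\<Sum>p\<in>?P. \<eta> (p i)) = (\<Sum>p\<in>?P. \<eta> (p j))" if "i < n" for i
  proof -
    have "Transposition.transpose i j permutes {..<n}" using that assms by (intro permutes_swap_id) auto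
    from sum_permutations_compose_right[OF this, of "\<lambda>p. \<eta> (p i)"] show ?thesis by simp
  qed
  then have "real n * (\<Sum>p\<in>?P. \<eta> (p j)) = (\<Sum>i<n. \<Sum>p\<in>?P. \<eta> (p i))" by simp
  also have "\<dots> = (\<Sum>p\<in>?P. \<Sum>i<n. \<eta> (p i))" by (rule sum.swap)
  also have "\<dots> = (\<Sum>p\<in>?P. \<Sum>k<n. \<eta> k)"
  proof (rule sum.cong[OF refl])
    fix p assume "p \<in> ?P"
    then show "(\<Sum>i<n. \<eta> (p i)) = (\<Sum>k<n. \<eta> k)" using sum.permute[of p "{..<n}" \<eta>] by (simp add: o_def)
  qed
  also have "\<dots> = fact n * (\<Sum>k<n. \<eta> k)" by (simp add: card_permutations[of "{..<n}" n])
  finally show ?thesis .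
qed

lemma nn_integral_unit_orbitals:
  fixes f :: "nat \<Rightarrow> real \<Rightarrow> complex"
  assumes "finite J" "\<And>i. i \<in> J \<Longrightarrow> L2per (f i)" "\<And>i. i \<in> J \<Longrightarrow> (\<integral>t. (cmod (f i t))\<^sup>2 \<partial>Lper) = 1"
  shows "(\<lambda>y. \<Prod>i\<in>J. ennreal ((cmod (f i (y i)))\<^sup>2)) \<in> borel_measurable (Pi\<^sub>M J (\<lambda>_. Lper))"
    "(\<integral>\<^sup>+y. (\<Prod>i\<in>J. ennreal ((cmod (f i (y i)))\<^sup>2)) \<partial>Pi\<^sub>M J (\<lambda>_. Lper)) = 1"
proof -
  have factor_measurable: "(\<lambda>t. ennreal ((cmod (f i t))\<^sup>2)) \<in> borel_measurable Lper" if "i \<in> J" for i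
    using assms(2)[OF that] by (auto simp: square_integrable_def)
  show "(\<lambda>y. \<Prod>i\<in>J. ennreal ((cmod (f i (y i)))\<^sup>2)) \<in> borel_measurable (Pi\<^sub>M J (\<lambda>_. Lper))"
  proof (rule borel_measurable_prod_ennreal)
    fix i assume i: "i \<in> J"
    then show "(\<lambda>y. ennreal ((cmod (f i (y i)))\<^sup>2)) \<in> borel_measurable (Pi\<^sub>M J (\<lambda>_. Lper))"
      by (intro measurable_compose[OF measurable_component_singleton[OF i] factor_measurable])
  qed
  have "(\<integral>\<^sup>+y. (\<Prod>i\<in>J. ennreal ((cmod (f i (y i)))\<^sup>2)) \<partial>Pi\<^sub>M J (\<lambda>_. Lper))
      = (\<Prod>i\<in>J. \<integral>\<^sup>+t. ennreal ((cmod (f i t))\<^sup>2) \<partial>Lper)"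
    by (intro Lprod.product_nn_integral_prod assms(1) factor_measurable)
  also have "\<dots> = 1"
    using assms(2,3) by (intro prod.neutral ballI, subst nn_integral_eq_integral) (auto simp: square_integrable_def)
  finally show "(\<integral>\<^sup>+y. (\<Prod>i\<in>J. ennreal ((cmod (f i (y i)))\<^sup>2)) \<partial>Pi\<^sub>M J (\<lambda>_. Lper)) = 1" .
qed

lemma densN_slater_disjoint:
  assumes n_pos: "1 \<le> n" and f: "\<And>k. k < n \<Longrightarrow> L2per (f k)" "\<And>k. k < n \<Longrightarrow> (\<integral>t. (cmod (f k t))\<^sup>2 \<partial>Lper) = 1"
    and disjoint: "disjoint_orbitals n f f" and t: "t \<in> Iper"
  shows "densN n (slater n (\<lambda>i. f)) t = ennreal (\<Sum>k<n. (cmod (f k t))\<^sup>2)"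
proof -
  let ?P = "{p. p permutes {..<n}}" and ?J = "{1..<n}" and ?M = "PiM {1..<n} (\<lambda>_. Lper)"
  let ?w = "\<lambda>p. 1 / fact n * (cmod (f (p 0) t))\<^sup>2" and ?Q = "\<lambda>p y. \<Prod>i\<in>?J. ennreal ((cmod (f (p i) (y i)))\<^sup>2)"
  have split: "{..<n} = insert 0 ?J" using n_pos by auto
  have products: "?Q p \<in> borel_measurable ?M" "(\<integral>\<^sup>+y. ?Q p y \<partial>?M) = 1" if "p \<in> ?P" for p
    using nn_integral_unit_orbitals[of ?J "\<lambda>i. f (p i)"] f permutes_less that by auto
  have "(\<integral>\<^sup>+ y. ennreal ((cmod (slater n (\<lambda>i. f) (y(0 := t))))\<^sup>2) \<partial>?M) = (\<integral>\<^sup>+ y. (\<Sum>p\<in>?P. ennreal (?w p) * ?Q p y) \<partial>?M)"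
  proof (rule nn_integral_cong)
    fix y assume "y \<in> space ?M"
    then have in_Iper: "(y(0 := t)) i \<in> Iper" if "i < n" for i using t that by (auto simp: space_PiM PiE_def Pi_def)
    have "(\<Prod>i<n. (cmod (f (p i) ((y(0 := t)) i)))\<^sup>2) = (cmod (f (p 0) t))\<^sup>2 * (\<Prod>i\<in>?J. (cmod (f (p i) (y i)))\<^sup>2)" for p
      unfolding split by (auto intro!: prod.cong)
    then have "ennreal ((cmod (slater n (\<lambda>i. f) (y(0 := t))))\<^sup>2)
        = ennreal (\<Sum>p\<in>?P. ?w p * (\<Prod>i\<in>?J. (cmod (f (p i) (y i)))\<^sup>2))"
      by (simp only: slater_norm_square_disjoint[OF disjoint in_Iper] mult.assoc)
    also have "\<dots> = (\<Sum>p\<in>?P. ennreal (?w p * (\<Prod>i\<in>?J. (cmod (f (p i) (y i)))\<^sup>2)))"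
      by (intro sum_ennreal[symmetric] mult_nonneg_nonneg prod_nonneg) auto
    also have "\<dots> = (\<Sum>p\<in>?P. ennreal (?w p) * ?Q p y)"
      by (intro sum.cong refl, subst ennreal_mult) (auto simp: prod_nonneg prod_ennreal)
    finally show "ennreal ((cmod (slater n (\<lambda>i. f) (y(0 := t))))\<^sup>2) = (\<Sum>p\<in>?P. ennreal (?w p) * ?Q p y)" .
  qed
  also have "\<dots> = (\<Sum>p\<in>?P. ennreal (?w p))"
    using products by (subst nn_integral_sum) (auto simp: nn_integral_cmult)
  finally have "densN n (slater n (\<lambda>i. f)) t = ennreal (real n) * ennreal (1 / fact n * (\<Sum>p\<in>?P. (cmod (f (p 0) t))\<^sup>2))"
    unfolding densN_def by (simp add: sum_distrib_left sum_ennreal)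
  also have "\<dots> = ennreal (1 / fact n * (real n * (\<Sum>p\<in>?P. (cmod (f (p 0) t))\<^sup>2)))"
    by (subst ennreal_mult[symmetric]) (auto intro!: divide_nonneg_nonneg sum_nonneg)
  also have "1 / fact n * (real n * (\<Sum>p\<in>?P. (cmod (f (p 0) t))\<^sup>2)) = (\<Sum>k<n. (cmod (f k t))\<^sup>2)"
    using sum_permutations_at[of 0 n "\<lambda>k. (cmod (f k t))\<^sup>2"] n_pos by simp
  finally show ?thesis .
qed

section \<open>Mixed states with a prescribed density\<close>

definition unit_orbital :: "(real \<Rightarrow> real) \<Rightarrow> (real \<Rightarrow> real) \<Rightarrow> bool" where
  "unit_orbital \<phi> \<phi>' \<longleftrightarrow> C1per \<phi> \<phi>' \<and> (\<forall>t. 0 \<le> \<phi> t) \<and> (\<integral>t. (\<phi> t)\<^sup>2 \<partial>Lper) = 1"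

definition orbital_density :: "nat \<Rightarrow> (nat \<Rightarrow> real \<Rightarrow> real) \<Rightarrow> real \<Rightarrow> real" where
  "orbital_density n \<phi> t = (1 / real n) * (\<Sum>j<n. (\<phi> j t)\<^sup>2)"

lemma unit_orbitalD:
  assumes "unit_orbital \<phi> \<phi>'" shows "C1per \<phi> \<phi>'" "0 \<le> \<phi> t" "(\<integral>t. (\<phi> t)\<^sup>2 \<partial>Lper) = 1"
  using assms by (auto simp: unit_orbital_def)

lemma unit_orbital_square_integrable: "unit_orbital \<phi> \<phi>' \<Longrightarrow> integrable Lper (\<lambda>t. (\<phi> t)\<^sup>2)"
  by (intro integrable_Lper_continuous continuous_intros C1per_continuous unit_orbitalD)

lemma sum_square_disjoint:
  fixes a :: "nat \<Rightarrow> real"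
  assumes "\<And>i j. i < n \<Longrightarrow> j < n \<Longrightarrow> i \<noteq> j \<Longrightarrow> a i * a j = 0"
  shows "(\<Sum>i<n. a i)\<^sup>2 = (\<Sum>i<n. (a i)\<^sup>2)"
proof -
  have "(\<Sum>i<n. a i)\<^sup>2 = (\<Sum>i<n. \<Sum>j<n. a i * a j)" by (simp add: power2_eq_square sum_product)
  also have "\<dots> = (\<Sum>i<n. \<Sum>j<n. if j = i then (a i)\<^sup>2 else 0)"
    using assms by (intro sum.cong refl) (auto simp: power2_eq_square)
  finally show ?thesis by (simp add: sum.delta')
qed

lemma adm_orbital_density:
  assumes n_pos: "1 \<le> n" and unit: "\<And>j. j < n \<Longrightarrow> unit_orbital (\<phi> j) (\<phi>' j)" and disjoint: "disjoint_orbitals n \<phi> \<phi>"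
  shows "adm (orbital_density n \<phi>)"
  unfolding adm_def
proof (intro conjI ballI)
  let ?\<psi> = "\<lambda>t. (1 / sqrt (real n)) * (\<Sum>j<n. \<phi> j t)" and ?\<psi>' = "\<lambda>t. (1 / sqrt (real n)) * (\<Sum>j<n. \<phi>' j t)"
  show "0 \<le> orbital_density n \<phi> t" for t by (simp add: orbital_density_def sum_nonneg)
  have "C1per ?\<psi> ?\<psi>'" using unit_orbitalD(1)[OF unit] by (intro C1per_cmult C1per_sum) auto
  then have "wderiv1 (\<lambda>t. complex_of_real (?\<psi> t)) (\<lambda>t. complex_of_real (?\<psi>' t))"
    using C1per_weak_deriv by (simp only: weak_deriv_def)
  then have "wderiv1 (\<lambda>t. complex_of_real (sqrt (orbital_density n \<phi> t))) (\<lambda>t. complex_of_real (?\<psi>' t))"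
  proof (rule wderiv1_cong)
    fix t assume t: "t \<in> Iper"
    have "orbital_density n \<phi> t = (1 / real n) * (\<Sum>j<n. \<phi> j t)\<^sup>2"
      using sum_square_disjoint[of n "\<lambda>j. \<phi> j t"] disjoint t by (simp add: orbital_density_def disjoint_orbitals_def)
    moreover have "(\<Sum>j<n. \<phi> j t) \<ge> 0" using unit_orbitalD(2)[OF unit] by (auto intro: sum_nonneg)
    ultimately show "complex_of_real (?\<psi> t) = complex_of_real (sqrt (orbital_density n \<phi> t))"
      by (simp add: real_sqrt_mult real_sqrt_divide)
  qed simp
  then show "H1per (\<lambda>t. sqrt (orbital_density n \<phi> t))" by (auto simp: H1per_def)
  show "(\<integral>t. orbital_density n \<phi> t \<partial>Lper) = 1"
    unfolding orbital_density_def using unit_orbital_square_integrable[OF unit] unit_orbitalD(3)[OF unit] n_pos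
    by (simp add: Bochner_Integration.integral_sum)
qed

subsection \<open>Orthonormal orbitals with equal density\<close>

text \<open>Multiplying an orbital by a phase running through its mass coordinate produces infinitely many orthonormal
  orbitals with the same density.\<close>

definition phase_orbital :: "(real \<Rightarrow> real) \<Rightarrow> (real \<Rightarrow> real) \<Rightarrow> nat \<Rightarrow> real \<Rightarrow> complex" where
  "phase_orbital \<phi> s k t = complex_of_real (\<phi> t) * trig1 (int k) (2 * pi * s t)"

definition phase_orbital_deriv :: "(real \<Rightarrow> real) \<Rightarrow> (real \<Rightarrow> real) \<Rightarrow> (real \<Rightarrow> real) \<Rightarrow> nat \<Rightarrow> real \<Rightarrow> complex" where
  "phase_orbital_deriv \<phi> \<phi>' s k t = complex_of_real (\<phi>' t) * trig1 (int k) (2 * pi * s t)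
     + complex_of_real (\<phi> t) * ((2 * pi * (\<phi> t)\<^sup>2) *\<^sub>R (\<i> * of_int (int k) * trig1 (int k) (2 * pi * s t)))"

lemma phase_orbital_0: "phase_orbital \<phi> s 0 t = complex_of_real (\<phi> t)"
  and phase_orbital_deriv_0: "phase_orbital_deriv \<phi> \<phi>' s 0 t = complex_of_real (\<phi>' t)"
  by (simp_all add: phase_orbital_def phase_orbital_deriv_def trig1_def)

lemma unit_orbital_mass_coordinate:
  assumes "unit_orbital \<phi> \<phi>'" obtains s where "mass_coordinate (\<lambda>t. (\<phi> t)\<^sup>2) s"
  using mass_coordinate_exists[of "\<lambda>t. (\<phi> t)\<^sup>2"] C1per_continuous(1)[OF C1per_square[OF unit_orbitalD(1)[OF assms]]]
    C1per_periodic[OF unit_orbitalD(1)[OF assms]] unit_orbitalD(3)[OF assms] by metis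

lemma phase_orbital_wderiv1:
  assumes \<phi>: "C1per \<phi> \<phi>'" and coord: "mass_coordinate (\<lambda>t. (\<phi> t)\<^sup>2) s"
  shows "wderiv1 (phase_orbital \<phi> s k) (phase_orbital_deriv \<phi> \<phi>' s k)"
proof (rule wderiv1_C1)
  fix t
  have "((\<lambda>t. complex_of_real (\<phi> t)) has_vector_derivative complex_of_real (\<phi>' t)) (at t)"
    using C1per_DERIV[OF \<phi>]
    by (intro has_vector_derivative_of_real) (simp add: has_real_derivative_iff_has_vector_derivative)
  moreover have "((\<lambda>t. 2 * pi * s t) has_vector_derivative 2 * pi * (\<phi> t)\<^sup>2) (at t)"
    unfolding has_real_derivative_iff_has_vector_derivative[symmetric]
    by (intro DERIV_cmult mass_coordinate.coordinate_DERIV[OF coord])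
  from vector_diff_chain_at[OF this trig1_vector_derivative]
  have "((\<lambda>t. trig1 (int k) (2 * pi * s t)) has_vector_derivative
    (2 * pi * (\<phi> t)\<^sup>2) *\<^sub>R (\<i> * of_int (int k) * trig1 (int k) (2 * pi * s t))) (at t)" by (simp only: o_def)
  ultimately show "(phase_orbital \<phi> s k has_vector_derivative phase_orbital_deriv \<phi> \<phi>' s k t) (at t)"
    unfolding phase_orbital_def[abs_def] phase_orbital_deriv_def
    by (rule has_vector_derivative_eq_rhs[OF has_vector_derivative_mult]) simp
  show "continuous_on UNIV (phase_orbital_deriv \<phi> \<phi>' s k)" unfolding phase_orbital_deriv_def[abs_def]
    by (intro continuous_intros C1per_continuous[OF \<phi>] mass_coordinate.coordinate_continuous[OF coord]
        continuous_on_compose2[OF trig1_continuous[of UNIV]]) auto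
  show "phase_orbital \<phi> s k (2 * pi) = phase_orbital \<phi> s k 0"
    using C1per_periodic[OF \<phi>, of 0] trig1_periodic[of "int k" 0]
    by (simp add: phase_orbital_def mass_coordinate.coordinate_2pi[OF coord] mass_coordinate.coordinate_0[OF coord])
qed

lemma phase_orbital_orthonormal:
  assumes coord: "mass_coordinate (\<lambda>t. (\<phi> t)\<^sup>2) s"
  shows "(\<integral>t. cnj (phase_orbital \<phi> s k t) * phase_orbital \<phi> s l t \<partial>Lper) = (if k = l then 1 else 0)"
proof -
  have "cnj (phase_orbital \<phi> s k t) * phase_orbital \<phi> s l t
      = (\<phi> t)\<^sup>2 *\<^sub>R trig1 (int l - int k) (2 * pi * s t - 0)" for t
    by (simp add: phase_orbital_def trig1_cnj trig1_mult[of "int l" _ "- int k", symmetric, simplified]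
        power2_eq_square scaleR_conv_of_real)
  then have "(\<integral>t. cnj (phase_orbital \<phi> s k t) * phase_orbital \<phi> s l t \<partial>Lper) =
    (\<integral>t. (\<phi> t)\<^sup>2 *\<^sub>R trig1 (int l - int k) (2 * pi * s t - 0) \<partial>Lper)" by (simp only:)
  also have "\<dots> = (1 / (2 * pi)) *\<^sub>R (\<integral>t. trig1 (int l - int k) t \<partial>Lper)"
    by (rule mass_coordinate.integral_compose_coordinate[OF coord trig1_continuous trig1_periodic])
  finally show ?thesis by (simp add: integral_trig1 scaleR_conv_of_real)
qed

lemma innerN_self: "innerN n \<Psi> \<Psi> = complex_of_real (\<integral>x. (cmod (\<Psi> x))\<^sup>2 \<partial>muN n)"
  unfolding innerN_def integral_complex_of_real[symmetric] complex_norm_square by (simp add: mult.commute)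

abbreviation (input) phase_slater ::
  "nat \<Rightarrow> (nat \<Rightarrow> real \<Rightarrow> real) \<Rightarrow> (nat \<Rightarrow> real \<Rightarrow> real) \<Rightarrow> nat \<Rightarrow> (nat \<Rightarrow> real) \<Rightarrow> complex" where
  "phase_slater n \<phi> s k \<equiv> slater n (\<lambda>_ j. phase_orbital (\<phi> j) (s j) k)"

abbreviation (input) phase_slater_grad :: "nat \<Rightarrow> (nat \<Rightarrow> real \<Rightarrow> real) \<Rightarrow> (nat \<Rightarrow> real \<Rightarrow> real) \<Rightarrow> (nat \<Rightarrow> real \<Rightarrow> real)
    \<Rightarrow> nat \<Rightarrow> nat \<Rightarrow> (nat \<Rightarrow> real) \<Rightarrow> complex" where
  "phase_slater_grad n \<phi> \<phi>' s k \<equiv>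
    slater_grad n (\<lambda>j. phase_orbital (\<phi> j) (s j) k) (\<lambda>j. phase_orbital_deriv (\<phi> j) (\<phi>' j) (s j) k)"

lemma suminf_ennreal_point_mass: "(\<Sum>k. ennreal (if k = 0 then 1 else 0) * c k) = c (0::nat)"
  by (subst suminf_finite[of "{0}"]) auto

lemma mixed_phase_slater:
  assumes n_pos: "1 \<le> n" and unit: "\<And>j. j < n \<Longrightarrow> unit_orbital (\<phi> j) (\<phi>' j)" and disjoint: "disjoint_orbitals n \<phi> \<phi>"
    and coord: "\<And>j. j < n \<Longrightarrow> mass_coordinate (\<lambda>t. (\<phi> j t)\<^sup>2) (s j)"
  shows "mixed n (orbital_density n \<phi>) (\<lambda>k. if k = 0 then 1 else 0) (phase_slater n \<phi> s) (phase_slater_grad n \<phi> \<phi>' s)"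
  unfolding mixed_def
proof (intro conjI allI)
  let ?f = "\<lambda>k j. phase_orbital (\<phi> j) (s j) k"
  have wderiv: "wderiv1 (?f k j) (phase_orbital_deriv (\<phi> j) (\<phi>' j) (s j) k)" if "j < n" for k j
    by (rule phase_orbital_wderiv1[OF unit_orbitalD(1)[OF unit] coord]) (use that in auto)
  have disjoint: "disjoint_orbitals n (?f k) (?f l)" for k l
    using disjoint by (auto simp: disjoint_orbitals_def phase_orbital_def)
  show "(\<lambda>k::nat. if k = 0 then 1 else 0 :: real) sums 1" using sums_single[of 0 "\<lambda>_. 1::real"] by simp
  show "antisymN n (phase_slater n \<phi> s k)" for k by (rule slater_antisym)
  show "wgradN n (phase_slater n \<phi> s k) (phase_slater_grad n \<phi> \<phi>' s k)" for k by (intro slater_wgradN wderiv)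
  show "innerN n (phase_slater n \<phi> s k) (phase_slater n \<phi> s l) = (if k = l then 1 else 0)" for k l
  proof -
    have "innerN n (phase_slater n \<phi> s k) (phase_slater n \<phi> s l) = (\<Prod>j<n. \<integral>t. cnj (?f k j t) * ?f l j t \<partial>Lper)"
      by (intro innerN_slater_disjoint wderiv1_L2per(1)[OF wderiv] disjoint)
    also have "\<dots> = (\<Prod>j<n. if k = l then 1 else 0)" by (intro prod.cong refl phase_orbital_orthonormal coord) auto
    finally show ?thesis using n_pos by (auto simp: power_0_left)
  qed
  have "densN n (phase_slater n \<phi> s 0) t = ennreal (real n * orbital_density n \<phi> t)" if "t \<in> Iper" for t
  proof -
    have "densN n (phase_slater n \<phi> s 0) t = ennreal (\<Sum>j<n. (cmod (?f 0 j t))\<^sup>2)"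
      using that unit_orbitalD(3)[OF unit]
      by (intro densN_slater_disjoint n_pos wderiv1_L2per(1)[OF wderiv] disjoint) (auto simp: phase_orbital_0)
    then show ?thesis using n_pos by (simp add: phase_orbital_0 orbital_density_def)
  qed
  then show "AE t in Lper. (\<Sum>k. ennreal (if k = 0 then 1 else 0) * densN n (phase_slater n \<phi> s k) t) =
    ennreal (real n * orbital_density n \<phi> t)"
    by (intro AE_I2) (simp add: suminf_ennreal_point_mass)
qed simp

subsection \<open>Energy of a Slater determinant\<close>

lemma cN_permute:
  assumes perm: "\<sigma> permutes {..<n}"
  shows "cN n w (x \<circ> \<sigma>) = cN n w x"
proof -
  let ?g = "\<lambda>k. \<Sum>j\<in>{..<n} - {k}. w (x k, x j)"
  have "cN n w (x \<circ> \<sigma>) = (\<Sum>i<n. ?g (\<sigma> i))"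
    unfolding cN_def
  proof (rule sum.cong[OF refl])
    fix i assume i: "i \<in> {..<n}"
    have "bij_betw \<sigma> ({..<n} - {i}) ({..<n} - {\<sigma> i})"
      using permutes_imp_bij[OF perm] i by (intro bij_betw_DiffI) (auto simp: bij_betw_def inj_on_def)
    from sum.reindex_bij_betw[OF this, of "\<lambda>l. w (x (\<sigma> i), x l)"]
    show "(\<Sum>j\<in>{..<n} - {i}. w ((x \<circ> \<sigma>) i, (x \<circ> \<sigma>) j)) = ?g (\<sigma> i)" by simp
  qed
  also have "\<dots> = (\<Sum>i<n. ?g i)" using sum.permute[OF perm, of ?g] by (simp add: o_def)
  finally show ?thesis by (simp add: cN_def)
qed

lemma cN_le_on_slater_support:
  assumes x: "x \<in> space (muN n)" "slater n (\<lambda>i. f) x \<noteq> 0"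
    and S: "\<And>y. (\<And>j. j < n \<Longrightarrow> y j \<in> Iper) \<Longrightarrow> (\<And>j. j < n \<Longrightarrow> f j (y j) \<noteq> 0) \<Longrightarrow> cN n w y \<le> S"
  shows "cN n w x \<le> S"
proof -
  obtain p where p: "p permutes {..<n}" "orbital_product n (\<lambda>i. f) p x \<noteq> 0"
    using x(2) unfolding slater_def by (metis (mono_tags, lifting) mem_Collect_eq mult_eq_0_iff sum.neutral)
  have inv_p: "inv p permutes {..<n}" by (rule permutes_inv[OF p(1)])
  have "(x \<circ> inv p) j \<in> Iper" "f j ((x \<circ> inv p) j) \<noteq> 0" if j: "j < n" for j
  proof -
    have inv_less: "inv p j < n" using permutes_less[OF inv_p j] .
    then show "(x \<circ> inv p) j \<in> Iper" using space_muN_D[OF x(1)] by simp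
    have "f (p (inv p j)) (x (inv p j)) \<noteq> 0" using p(2) inv_less by (auto simp: orbital_product_def)
    then show "f j ((x \<circ> inv p) j) \<noteq> 0" using permutes_inverses(1)[OF p(1)] by simp
  qed
  then have "cN n w (x \<circ> inv p) \<le> S" by (rule S)
  then show ?thesis by (simp add: cN_permute[OF inv_p])
qed

lemma energyN_le:
  assumes L2: "square_integrable (muN n) \<Psi>" "\<And>j. j < n \<Longrightarrow> square_integrable (muN n) (G j)"
    and S: "0 \<le> S" "\<And>x. x \<in> space (muN n) \<Longrightarrow> \<Psi> x \<noteq> 0 \<Longrightarrow> cN n w x \<le> ennreal S" and \<epsilon>: "0 \<le> \<epsilon>"
  shows "energyN n w \<epsilon> \<Psi> G \<le> ennreal (\<epsilon> * (\<Sum>j<n. \<integral>x. (cmod (G j x))\<^sup>2 \<partial>muN n) + S * (\<integral>x. (cmod (\<Psi> x))\<^sup>2 \<partial>muN n))"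
proof -
  let ?K = "\<lambda>x. \<Sum>j<n. (cmod (G j x))\<^sup>2" and ?P = "\<lambda>x. (cmod (\<Psi> x))\<^sup>2"
  have parts_integrable: "integrable (muN n) (\<lambda>x. (cmod (G j x))\<^sup>2)" "integrable (muN n) ?P" if "j < n" for j
    using L2 that by (auto simp: square_integrable_def)
  have K_integrable: "integrable (muN n) ?K" "integrable (muN n) ?P"
    using parts_integrable L2(1) by (auto simp: square_integrable_def intro: Bochner_Integration.integrable_sum)
  have "energyN n w \<epsilon> \<Psi> G \<le> (\<integral>\<^sup>+ x. ennreal (\<epsilon> * ?K x + S * ?P x) \<partial>muN n)"
    unfolding energyN_def
  proof (rule nn_integral_mono)
    fix x assume x: "x \<in> space (muN n)"
    have "cN n w x * ennreal (?P x) \<le> ennreal S * ennreal (?P x)"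
      using S(2)[OF x] by (cases "\<Psi> x = 0") (auto intro: mult_right_mono)
    then have "ennreal (\<epsilon> * ?K x) + cN n w x * ennreal (?P x) \<le> ennreal (\<epsilon> * ?K x) + ennreal S * ennreal (?P x)"
      by (rule add_left_mono)
    also have "\<dots> = ennreal (\<epsilon> * ?K x + S * ?P x)"
      using \<epsilon> S(1) by (simp add: ennreal_plus ennreal_mult sum_nonneg)
    finally show "ennreal (\<epsilon> * ?K x) + cN n w x * ennreal (?P x) \<le> ennreal (\<epsilon> * ?K x + S * ?P x)" .
  qed
  also have "\<dots> = ennreal (\<integral> x. \<epsilon> * ?K x + S * ?P x \<partial>muN n)"
    using \<epsilon> S(1) K_integrable by (intro nn_integral_eq_integral AE_I2) (simp_all add: sum_nonneg)
  also have "(\<integral> x. \<epsilon> * ?K x + S * ?P x \<partial>muN n) = \<epsilon> * (\<Sum>j<n. \<integral>x. (cmod (G j x))\<^sup>2 \<partial>muN n) + S * (\<integral>x. ?P x \<partial>muN n)"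
    using parts_integrable K_integrable by (simp add: Bochner_Integration.integral_sum)
  finally show ?thesis .
qed

lemma slater_grad_kinetic_le:
  assumes f: "\<And>k. k < n \<Longrightarrow> L2per (f k)" "\<And>k. k < n \<Longrightarrow> (\<integral>t. (cmod (f k t))\<^sup>2 \<partial>Lper) = 1"
    and f': "\<And>k. k < n \<Longrightarrow> L2per (f' k)"
  shows "(\<Sum>j<n. \<integral>x. (cmod (slater_grad n f f' j x))\<^sup>2 \<partial>muN n) \<le> fact n * (\<Sum>k<n. \<integral>t. (cmod (f' k t))\<^sup>2 \<partial>Lper)"
proof -
  let ?P = "{p. p permutes {..<n}}"
  define T where "T k = (\<integral>t. (cmod (f' k t))\<^sup>2 \<partial>Lper)" for k
  have "(\<integral>x. (cmod (slater_grad n f f' j x))\<^sup>2 \<partial>muN n) \<le> (\<Sum>p\<in>?P. T (p j))" if j: "j < n" for j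
  proof -
    have "(\<integral>x. (cmod (slater_grad n f f' j x))\<^sup>2 \<partial>muN n) \<le>
      (\<Sum>p\<in>?P. \<Prod>i<n. \<integral>t. (cmod ((if i = j then f' else f) (p i) t))\<^sup>2 \<partial>Lper)"
      unfolding slater_grad_def by (rule slater_square_integrable(2)) (use f f' in auto)
    also have "\<dots> = (\<Sum>p\<in>?P. T (p j))"
    proof (rule sum.cong[OF refl])
      fix p assume "p \<in> ?P"
      then have "(\<Prod>i<n. \<integral>t. (cmod ((if i = j then f' else f) (p i) t))\<^sup>2 \<partial>Lper) = (\<Prod>i<n. if i = j then T (p j) else 1)"
        using permutes_less f(2) by (intro prod.cong refl) (auto simp: T_def)
      then show "(\<Prod>i<n. \<integral>t. (cmod ((if i = j then f' else f) (p i) t))\<^sup>2 \<partial>Lper) = T (p j)"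
        using j by (simp add: prod.delta)
    qed
    finally show ?thesis .
  qed
  then have "(\<Sum>j<n. \<integral>x. (cmod (slater_grad n f f' j x))\<^sup>2 \<partial>muN n) \<le> (\<Sum>j<n. \<Sum>p\<in>?P. T (p j))"
    by (intro sum_mono) auto
  also have "\<dots> = (\<Sum>j<n. (1 / real n) * (real n * (\<Sum>p\<in>?P. T (p j))))" by (intro sum.cong) auto
  also have "\<dots> = (\<Sum>j<n. (1 / real n) * (fact n * (\<Sum>k<n. T k)))"
    by (intro sum.cong arg_cong2[where f = times] refl sum_permutations_at) auto
  also have "\<dots> = fact n * (\<Sum>k<n. T k)" by (cases "n = 0") simp_all
  finally show ?thesis by (simp only: T_def)
qed

lemma Feps_orbital_density_le:
  assumes n_pos: "1 \<le> n" and unit: "\<And>j. j < n \<Longrightarrow> unit_orbital (\<phi> j) (\<phi>' j)" and disjoint: "disjoint_orbitals n \<phi> \<phi>"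
    and S: "0 \<le> S" "\<And>x. (\<And>j. j < n \<Longrightarrow> x j \<in> Iper) \<Longrightarrow> (\<And>j. j < n \<Longrightarrow> \<phi> j (x j) \<noteq> 0) \<Longrightarrow> cN n w x \<le> ennreal S"
    and \<epsilon>: "0 \<le> \<epsilon>"
  shows "Feps n w \<epsilon> (orbital_density n \<phi>) \<le> ennreal (\<epsilon> * (fact n * (\<Sum>j<n. \<integral>t. (\<phi>' j t)\<^sup>2 \<partial>Lper)) + S)"
proof -
  have "\<exists>c. mass_coordinate (\<lambda>t. (\<phi> j t)\<^sup>2) c" if "j < n" for j
    using unit_orbital_mass_coordinate[OF unit[OF that]] by blast
  then obtain s where coord: "\<And>j. j < n \<Longrightarrow> mass_coordinate (\<lambda>t. (\<phi> j t)\<^sup>2) (s j)" by metis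
  define \<Psi> where "\<Psi> = phase_slater n \<phi> s"
  define G where "G = phase_slater_grad n \<phi> \<phi>' s"
  have mixed: "mixed n (orbital_density n \<phi>) (\<lambda>k. if k = 0 then 1 else 0) \<Psi> G"
    unfolding \<Psi>_def G_def by (rule mixed_phase_slater[OF n_pos unit disjoint coord])
  have L2: "square_integrable (muN n) (\<Psi> 0)" "\<And>j. j < n \<Longrightarrow> square_integrable (muN n) (G 0 j)"
    using mixed by (auto simp: mixed_def wgradN_def square_integrable_def)
  have "complex_of_real (\<integral>x. (cmod (\<Psi> 0 x))\<^sup>2 \<partial>muN n) = complex_of_real 1"
    using mixed unfolding innerN_self[symmetric] mixed_def by simp
  then have norm: "(\<integral>x. (cmod (\<Psi> 0 x))\<^sup>2 \<partial>muN n) = 1" by (simp only: of_real_eq_iff)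
  have \<phi>_L2: "L2per (\<phi> j)" "L2per (\<phi>' j)" if "j < n" for j
    using unit_orbitalD(1)[OF unit[OF that]] by (auto intro: L2per_continuous C1per_continuous)
  have kinetic: "(\<Sum>j<n. \<integral>x. (cmod (G 0 j x))\<^sup>2 \<partial>muN n) \<le> fact n * (\<Sum>j<n. \<integral>t. (\<phi>' j t)\<^sup>2 \<partial>Lper)"
    using slater_grad_kinetic_le[of n "\<lambda>j t. complex_of_real (\<phi> j t)" "\<lambda>j t. complex_of_real (\<phi>' j t)"]
      \<phi>_L2 unit_orbitalD(3)[OF unit]
    by (simp add: G_def phase_orbital_0[abs_def] phase_orbital_deriv_0[abs_def])
  have "Feps n w \<epsilon> (orbital_density n \<phi>) \<le> (\<Sum>k. ennreal (if k = 0 then 1 else 0) * energyN n w \<epsilon> (\<Psi> k) (G k))"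
    unfolding Feps_def by (rule INF_lower2[of "(\<lambda>k. if k = 0 then 1 else 0, \<Psi>, G)"]) (use mixed in auto)
  also have "\<dots> = energyN n w \<epsilon> (\<Psi> 0) (G 0)" by (rule suminf_ennreal_point_mass)
  also have "\<dots> \<le> ennreal (\<epsilon> * (\<Sum>j<n. \<integral>x. (cmod (G 0 j x))\<^sup>2 \<partial>muN n) + S * 1)"
    unfolding norm[symmetric]
  proof (rule energyN_le[OF L2 S(1) _ \<epsilon>])
    fix x assume x: "x \<in> space (muN n)" "\<Psi> 0 x \<noteq> 0"
    show "cN n w x \<le> ennreal S"
      by (rule cN_le_on_slater_support[OF x(1) x(2)[unfolded \<Psi>_def]]) (auto intro: S(2) simp: phase_orbital_0)
  qed
  also have "\<dots> \<le> ennreal (\<epsilon> * (fact n * (\<Sum>j<n. \<integral>t. (\<phi>' j t)\<^sup>2 \<partial>Lper)) + S)"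
    using kinetic \<epsilon> by (intro ennreal_leI add_mono mult_left_mono) auto
  finally show ?thesis .
qed

section \<open>Comparison of the quantum and the classical energy\<close>

abbreviation Bper :: "real measure" where "Bper \<equiv> restrict_space lborel Iper"

lemma nn_integral_Bper: "nn_integral Bper f = nn_integral Lper f"
  by (simp add: nn_integral_restrict_space nn_integral_completion)

lemma space_Bper [simp]: "space Bper = Iper" by (simp add: space_restrict_space)

lemma id_measurable_Lper_Bper: "(\<lambda>x. x) \<in> measurable Lper Bper"
proof (rule measurable_restrict_space3)
  show "(\<lambda>x. x) \<in> measurable lebesgue lborel" by (rule measurable_completion) simp
qed auto

lemma id_measurable_Bper_borel: "(\<lambda>x. x) \<in> measurable Bper borel"
  by (rule measurable_restrict_space1) simp

lemma borel_measurable_Bper_continuous: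
  fixes f :: "real \<Rightarrow> 'a::{second_countable_topology, t2_space}"
  assumes "continuous_on Iper f" shows "f \<in> borel_measurable Bper"
proof -
  have "sets (restrict_space borel Iper) = sets Bper" by (simp add: sets_restrict_space)
  then show ?thesis using borel_measurable_continuous_on_restrict[OF assms] measurable_cong_sets by blast
qed

lemma component_measurable_Bper: "j < n \<Longrightarrow> (\<lambda>x. x j) \<in> measurable (Pi\<^sub>M {..<n} (\<lambda>_. Bper)) Bper"
  by (intro measurable_component_singleton) auto

lemma component_measurable_muN: "j < n \<Longrightarrow> (\<lambda>x. x j) \<in> measurable (muN n) Lper"
  unfolding muN_def by (intro measurable_component_singleton) auto

lemma id_measurable_muN_Bper: "(\<lambda>x. x) \<in> measurable (muN n) (Pi\<^sub>M {..<n} (\<lambda>_. Bper))"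
proof (rule measurable_PiM_single'[where f = "\<lambda>i x. x i"])
  show "(\<lambda>x. x i) \<in> measurable (muN n) Bper" if "i \<in> {..<n}" for i
    using measurable_compose[OF component_measurable_muN id_measurable_Lper_Bper] that by simp
  show "(\<lambda>x i. x i) \<in> space (muN n) \<rightarrow> (\<Pi>\<^sub>E i\<in>{..<n}. space Bper)" by (simp add: space_muN)
qed

lemma cN_measurable:
  assumes "assumptionA w"
  shows "cN n w \<in> borel_measurable (Pi\<^sub>M {..<n} (\<lambda>_. Bper))"
proof -
  have w_measurable: "w \<in> borel_measurable (restrict_space borel (Iper \<times> Iper))"
    using assms by (intro borel_measurable_continuous_on_restrict) (simp add: assumptionA_def)
  have "(\<lambda>x. w (x i, x j)) \<in> borel_measurable (Pi\<^sub>M {..<n} (\<lambda>_. Bper))" if ij: "i < n" "j < n" for i j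
  proof (rule measurable_compose[OF _ w_measurable], rule measurable_restrict_space2)
    show "(\<lambda>x. (x i, x j)) \<in> space (Pi\<^sub>M {..<n} (\<lambda>_. Bper)) \<rightarrow> Iper \<times> Iper"
      using ij by (auto simp: space_PiM)
    show "(\<lambda>x. (x i, x j)) \<in> borel_measurable (Pi\<^sub>M {..<n} (\<lambda>_. Bper))"
      using ij by (intro borel_measurable_Pair measurable_compose[OF
        component_measurable_Bper id_measurable_Bper_borel])
  qed
  then show ?thesis unfolding cN_def by (intro borel_measurable_sum) auto
qed

subsection \<open>One-particle marginals of an antisymmetric function\<close>

lemma muN_permute_measurable:
  assumes perm: "\<sigma> permutes {..<n}"
  shows "(\<lambda>x. x \<circ> \<sigma>) \<in> measurable (muN n) (muN n)"
proof -
  have "(\<lambda>x i. x (\<sigma> i)) \<in> measurable (muN n) (Pi\<^sub>M {..<n} (\<lambda>_. Lper))"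
  proof (rule measurable_PiM_single')
    show "(\<lambda>x. x (\<sigma> i)) \<in> measurable (muN n) Lper" if "i \<in> {..<n}" for i
      using permutes_less[OF perm] that by (intro component_measurable_muN) simp
    show "(\<lambda>x i. x (\<sigma> i)) \<in> space (muN n) \<rightarrow> (\<Pi>\<^sub>E i\<in>{..<n}. space Lper)"
      using permutes_less[OF perm] permutes_not_in[OF perm] by (auto simp: space_muN PiE_def Pi_def extensional_def)
  qed
  then show ?thesis by (simp add: muN_def o_def)
qed

lemma PiE_comp_permutes_iff:
  assumes perm: "\<sigma> permutes S"
  shows "x \<circ> \<sigma> \<in> Pi\<^sub>E S A \<longleftrightarrow> x \<in> Pi\<^sub>E S (A \<circ> inv \<sigma>)"
proof -
  have "(\<forall>i\<in>S. x (\<sigma> i) \<in> A i) \<longleftrightarrow> (\<forall>i\<in>S. x i \<in> A (inv \<sigma> i))"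
  proof (intro iffI ballI)
    show "x i \<in> A (inv \<sigma> i)" if "\<forall>i\<in>S. x (\<sigma> i) \<in> A i" "i \<in> S" for i
      using that permutes_in_image[OF permutes_inv[OF perm], of i] permutes_inverses(1)[OF perm, of i]
      by (metis (no_types))
    show "x (\<sigma> i) \<in> A i" if "\<forall>i\<in>S. x i \<in> A (inv \<sigma> i)" "i \<in> S" for i
      using that permutes_in_image[OF perm, of i] permutes_inverses(2)[OF perm, of i] by (metis (no_types))
  qed
  moreover have "(\<forall>i. i \<notin> S \<longrightarrow> x (\<sigma> i) = undefined) \<longleftrightarrow> (\<forall>i. i \<notin> S \<longrightarrow> x i = undefined)"
    using permutes_not_in[OF perm] by auto
  ultimately show ?thesis unfolding PiE_iff extensional_def o_def mem_Collect_eq by simp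
qed

lemma muN_permute_distr:
  assumes perm: "\<sigma> permutes {..<n}"
  shows "distr (muN n) (muN n) (\<lambda>x. x \<circ> \<sigma>) = muN n"
  unfolding muN_def
proof (rule Lprod.PiM_eqI)
  fix A :: "nat \<Rightarrow> real set" assume A: "\<And>i. i \<in> {..<n} \<Longrightarrow> A i \<in> sets Lper"
  let ?M = "Pi\<^sub>M {..<n} (\<lambda>_. Lper)"
  have inv_s: "inv \<sigma> permutes {..<n}" by (rule permutes_inv[OF perm])
  have A_inv: "(A \<circ> inv \<sigma>) i \<in> sets Lper" if "i \<in> {..<n}" for i
    using A permutes_less[OF inv_s] that by simp
  then have "Pi\<^sub>E {..<n} (A \<circ> inv \<sigma>) \<subseteq> space ?M"
    using sets.sets_into_space by (intro sets.sets_into_space sets_PiM_I_finite) auto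
  then have vimage: "(\<lambda>x. x \<circ> \<sigma>) -` (Pi\<^sub>E {..<n} A) \<inter> space ?M = Pi\<^sub>E {..<n} (A \<circ> inv \<sigma>)"
    unfolding vimage_def PiE_comp_permutes_iff[OF perm] by blast
  have "Pi\<^sub>E {..<n} A \<in> sets ?M" using A by (intro sets_PiM_I_finite) auto
  then have "emeasure (distr ?M ?M (\<lambda>x. x \<circ> \<sigma>)) (Pi\<^sub>E {..<n} A) = emeasure ?M (Pi\<^sub>E {..<n} (A \<circ> inv \<sigma>))"
    using muN_permute_measurable[OF perm] vimage by (simp add: emeasure_distr muN_def)
  also have "\<dots> = (\<Prod>i\<in>{..<n}. emeasure Lper ((A \<circ> inv \<sigma>) i))"
    using A_inv by (intro Lprod.emeasure_PiM) auto
  also have "\<dots> = (\<Prod>i\<in>{..<n}. emeasure Lper (A i))"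
    using prod.permute[OF inv_s, of "\<lambda>i. emeasure Lper (A i)"] by (simp add: o_def)
  finally show "emeasure (distr ?M ?M (\<lambda>x. x \<circ> \<sigma>)) (Pi\<^sub>E {..<n} A) = (\<Prod>i\<in>{..<n}. emeasure Lper (A i))" .
qed simp_all

lemma antisym_marginals_agree:
  assumes anti: "antisymN n \<Psi>" and meas [measurable]: "\<Psi> \<in> borel_measurable (muN n)" and j: "j < n"
    and h: "h \<in> borel_measurable Lper"
  shows "(\<integral>\<^sup>+x. h (x j) * ennreal ((cmod (\<Psi> x))\<^sup>2) \<partial>muN n) = (\<integral>\<^sup>+x. h (x 0) * ennreal ((cmod (\<Psi> x))\<^sup>2) \<partial>muN n)"
proof -
  let ?swap = "Transposition.transpose 0 j" and ?p = "\<lambda>x. ennreal ((cmod (\<Psi> x))\<^sup>2)"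
  have swap_permutes: "?swap permutes {..<n}" using j by (intro permutes_swap_id) auto
  have "(\<lambda>x. h (x 0)) \<in> borel_measurable (muN n)"
    using j by (intro measurable_compose[OF component_measurable_muN h]) simp
  then have integrand: "(\<lambda>x. h (x 0) * ?p x) \<in> borel_measurable (muN n)" by measurable
  have "(\<integral>\<^sup>+x. h (x 0) * ?p x \<partial>muN n) = (\<integral>\<^sup>+x. h (x 0) * ?p x \<partial>distr (muN n) (muN n) (\<lambda>x. x \<circ> ?swap))"
    by (simp only: muN_permute_distr[OF swap_permutes])
  also have "\<dots> = (\<integral>\<^sup>+x. h ((x \<circ> ?swap) 0) * ?p (x \<circ> ?swap) \<partial>muN n)"
    by (intro nn_integral_distr muN_permute_measurable[OF swap_permutes]) (use integrand in simp)
  also have "\<dots> = (\<integral>\<^sup>+x. h (x j) * ?p x \<partial>muN n)"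
  proof (rule nn_integral_cong_AE)
    have "AE x in muN n. \<Psi> (x \<circ> ?swap) = of_int (sign ?swap) * \<Psi> x" using anti swap_permutes
      unfolding antisymN_def by blast
    then show "AE x in muN n. h ((x \<circ> ?swap) 0) * ?p (x \<circ> ?swap) = h (x j) * ?p x"
      by eventually_elim (simp add: norm_mult sign_def)
  qed
  finally show ?thesis by simp
qed

lemma nn_integral_densN:
  assumes n_pos: "1 \<le> n" and meas: "\<Psi> \<in> borel_measurable (muN n)" and h: "h \<in> borel_measurable Lper"
  shows "densN n \<Psi> \<in> borel_measurable Lper" (is ?measurable)
    and "ennreal (real n) * (\<integral>\<^sup>+x. h (x 0) * ennreal ((cmod (\<Psi> x))\<^sup>2) \<partial>muN n)
        = (\<integral>\<^sup>+t. densN n \<Psi> t * h t \<partial>Lper)" (is ?integral)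
proof -
  let ?C = "Pi\<^sub>M {1..<n} (\<lambda>_. Lper)" and ?p = "\<lambda>x. ennreal ((cmod (\<Psi> x))\<^sup>2)"
  have indices: "{..<n} = insert 0 {1..<n}" using n_pos by auto
  interpret C: sigma_finite_measure ?C by (rule Lprod.sigma_finite) simp
  have "(\<lambda>(t, y). y(0 := t)) \<in> measurable (Lper \<Otimes>\<^sub>M ?C) (muN n)"
    unfolding muN_def indices case_prod_beta' by (rule measurable_fun_upd[where J = "{1..<n}"]) auto
  moreover have p: "?p \<in> borel_measurable (muN n)" using meas by measurable
  ultimately have pair: "(\<lambda>(t, y). ?p (y(0 := t))) \<in> borel_measurable (Lper \<Otimes>\<^sub>M ?C)"
    using measurable_compose[of "\<lambda>(t, y). y(0 := t)" _ _ ?p] by (simp add: case_prod_beta')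
  have slice: "(\<lambda>t. \<integral>\<^sup>+y. ?p (y(0 := t)) \<partial>?C) \<in> borel_measurable Lper"
    by (rule C.borel_measurable_nn_integral[OF pair])
  then show ?measurable unfolding densN_def by measurable
  have "(\<lambda>x. h (x 0)) \<in> borel_measurable (muN n)"
    using n_pos by (intro measurable_compose[OF component_measurable_muN h]) simp
  then have "(\<lambda>x. h (x 0) * ?p x) \<in> borel_measurable (muN n)" using p by (rule borel_measurable_times_ennreal)
  then have "(\<integral>\<^sup>+x. h (x 0) * ?p x \<partial>muN n) = (\<integral>\<^sup>+t. (\<integral>\<^sup>+y. h ((y(0 := t)) 0) * ?p (y(0 := t)) \<partial>?C) \<partial>Lper)"
    unfolding muN_def indices by (intro Lprod.product_nn_integral_insert_rev) auto
  also have "\<dots> = (\<integral>\<^sup>+t. h t * (\<integral>\<^sup>+y. ?p (y(0 := t)) \<partial>?C) \<partial>Lper)"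
  proof (rule nn_integral_cong)
    fix t assume t: "t \<in> space Lper"
    have "(\<lambda>y. ?p (y(0 := t))) \<in> borel_measurable ?C"
      using measurable_compose[OF measurable_Pair1'[OF t] pair] by simp
    then show "(\<integral>\<^sup>+y. h ((y(0 := t)) 0) * ?p (y(0 := t)) \<partial>?C) = h t * (\<integral>\<^sup>+y. ?p (y(0 := t)) \<partial>?C)"
      by (simp add: nn_integral_cmult)
  qed
  finally have "ennreal (real n) * (\<integral>\<^sup>+x. h (x 0) * ?p x \<partial>muN n) =
      ennreal (real n) * (\<integral>\<^sup>+t. h t * (\<integral>\<^sup>+y. ?p (y(0 := t)) \<partial>?C) \<partial>Lper)" by simp
  also have "\<dots> = (\<integral>\<^sup>+t. ennreal (real n) * (h t * (\<integral>\<^sup>+y. ?p (y(0 := t)) \<partial>?C)) \<partial>Lper)"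
    using slice h by (intro nn_integral_cmult[symmetric] borel_measurable_times_ennreal)
  finally show ?integral by (simp add: densN_def mult_ac)
qed

subsection \<open>The coupling carried by a mixed state\<close>

definition mixed_measure :: "nat \<Rightarrow> (nat \<Rightarrow> real) \<Rightarrow> (nat \<Rightarrow> (nat \<Rightarrow> real) \<Rightarrow> complex) \<Rightarrow> (nat \<Rightarrow> real) measure" where
  "mixed_measure n lam \<Psi> =
     distr (density (muN n) (\<lambda>x. \<Sum>k. ennreal (lam k) * ennreal ((cmod (\<Psi> k x))\<^sup>2))) (Pi\<^sub>M {..<n} (\<lambda>_. Bper)) (\<lambda>x. x)"

lemma nn_integral_mixed_measure:
  assumes meas [measurable]: "\<And>k. \<Psi> k \<in> borel_measurable (muN n)"
    and f: "f \<in> borel_measurable (Pi\<^sub>M {..<n} (\<lambda>_. Bper))"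
  shows "(\<integral>\<^sup>+x. f x \<partial>mixed_measure n lam \<Psi>) =
    (\<Sum>k. ennreal (lam k) * (\<integral>\<^sup>+x. f x * ennreal ((cmod (\<Psi> k x))\<^sup>2) \<partial>muN n))"
proof -
  let ?p = "\<lambda>k x. ennreal ((cmod (\<Psi> k x))\<^sup>2)"
  have [measurable]: "f \<in> borel_measurable (muN n)" using measurable_compose[OF id_measurable_muN_Bper f] by simp
  have "(\<integral>\<^sup>+x. f x \<partial>mixed_measure n lam \<Psi>) = (\<integral>\<^sup>+x. f x \<partial>density (muN n) (\<lambda>x. \<Sum>k. ennreal (lam k) * ?p k x))"
    unfolding mixed_measure_def using id_measurable_muN_Bper f by (intro nn_integral_distr) simp_all
  also have "\<dots> = (\<integral>\<^sup>+x. (\<Sum>k. ennreal (lam k) * ?p k x) * f x \<partial>muN n)" by (intro nn_integral_density) measurable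
  also have "\<dots> = (\<integral>\<^sup>+x. (\<Sum>k. ennreal (lam k) * (f x * ?p k x)) \<partial>muN n)"
    by (intro nn_integral_cong) (simp add: ennreal_suminf_multc[symmetric] mult_ac)
  also have "\<dots> = (\<Sum>k. \<integral>\<^sup>+x. ennreal (lam k) * (f x * ?p k x) \<partial>muN n)"
    by (intro nn_integral_suminf) measurable
  also have "\<dots> = (\<Sum>k. ennreal (lam k) * (\<integral>\<^sup>+x. f x * ?p k x \<partial>muN n))"
    by (intro suminf_cong nn_integral_cmult) measurable
  finally show ?thesis .
qed

lemma mixedD:
  assumes "mixed n \<rho> lam \<Psi> G"
  shows "lam sums 1" "0 \<le> lam k" "\<Psi> k \<in> borel_measurable (muN n)" "antisymN n (\<Psi> k)"
    and "(\<integral>\<^sup>+x. ennreal ((cmod (\<Psi> k x))\<^sup>2) \<partial>muN n) = 1"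
    and "AE t in Lper. (\<Sum>k. ennreal (lam k) * densN n (\<Psi> k) t) = ennreal (real n * \<rho> t)"
proof -
  show "lam sums 1" "0 \<le> lam k" "\<Psi> k \<in> borel_measurable (muN n)" "antisymN n (\<Psi> k)"
    "AE t in Lper. (\<Sum>k. ennreal (lam k) * densN n (\<Psi> k) t) = ennreal (real n * \<rho> t)"
    using assms by (simp_all add: mixed_def wgradN_def)
  have "integrable (muN n) (\<lambda>x. (cmod (\<Psi> k x))\<^sup>2)" using assms by (simp add: mixed_def wgradN_def)
  moreover have "complex_of_real (\<integral>x. (cmod (\<Psi> k x))\<^sup>2 \<partial>muN n) = complex_of_real 1"
    using assms by (simp add: innerN_self[symmetric] mixed_def)
  then have "(\<integral>x. (cmod (\<Psi> k x))\<^sup>2 \<partial>muN n) = 1" by (simp only: of_real_eq_iff)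
  ultimately show "(\<integral>\<^sup>+x. ennreal ((cmod (\<Psi> k x))\<^sup>2) \<partial>muN n) = 1" by (subst nn_integral_eq_integral) auto
qed

lemma mixed_measure_marginal:
  assumes n_pos: "1 \<le> n" and mixed: "mixed n \<rho> lam \<Psi> G" and j: "j < n" and h: "h \<in> borel_measurable Bper"
    and \<rho>: "continuous_on Iper \<rho>"
  shows "(\<integral>\<^sup>+x. h (x j) \<partial>mixed_measure n lam \<Psi>) = (\<integral>\<^sup>+t. ennreal (\<rho> t) * h t \<partial>Bper)"
proof -
  let ?p = "\<lambda>k x. ennreal ((cmod (\<Psi> k x))\<^sup>2)"
  have h_Lper [measurable]: "h \<in> borel_measurable Lper"
    using measurable_compose[OF id_measurable_Lper_Bper h] by simp
  have densN_meas [measurable]: "densN n (\<Psi> k) \<in> borel_measurable Lper" for k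
    by (rule nn_integral_densN(1)[OF n_pos mixedD(3)[OF mixed] h_Lper])
  have "(\<integral>\<^sup>+x. h (x j) \<partial>mixed_measure n lam \<Psi>) = (\<Sum>k. ennreal (lam k) * (\<integral>\<^sup>+x. h (x j) * ?p k x \<partial>muN n))"
    using measurable_compose[OF component_measurable_Bper[OF j] h] mixedD(3)[OF mixed]
    by (rule nn_integral_mixed_measure[rotated])
  also have "\<dots> = (\<Sum>k. ennreal (lam k) * (\<integral>\<^sup>+x. h (x 0) * ?p k x \<partial>muN n))"
    by (simp only: antisym_marginals_agree[OF mixedD(4)[OF mixed] mixedD(3)[OF mixed] j h_Lper])
  finally have "ennreal (real n) * (\<integral>\<^sup>+x. h (x j) \<partial>mixed_measure n lam \<Psi>) =
      (\<Sum>k. ennreal (lam k) * (ennreal (real n) * (\<integral>\<^sup>+x. h (x 0) * ?p k x \<partial>muN n)))"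
    by (simp only: ennreal_suminf_cmult[symmetric] mult.left_commute)
  also have "\<dots> = (\<Sum>k. ennreal (lam k) * (\<integral>\<^sup>+t. densN n (\<Psi> k) t * h t \<partial>Lper))"
    by (simp only: nn_integral_densN(2)[OF n_pos mixedD(3)[OF mixed] h_Lper])
  also have "\<dots> = (\<integral>\<^sup>+t. (\<Sum>k. ennreal (lam k) * (densN n (\<Psi> k) t * h t)) \<partial>Lper)"
    by (simp add: nn_integral_suminf nn_integral_cmult)
  also have "\<dots> = (\<integral>\<^sup>+t. ennreal (real n) * (ennreal (\<rho> t) * h t) \<partial>Lper)"
  proof (rule nn_integral_cong_AE)
    show "AE t in Lper. (\<Sum>k. ennreal (lam k) * (densN n (\<Psi> k) t * h t)) = ennreal (real n) * (ennreal (\<rho> t) * h t)"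
      using mixedD(6)[OF mixed]
      by eventually_elim (simp add: mult.assoc[symmetric] ennreal_suminf_multc ennreal_mult')
  qed
  also have "\<dots> = ennreal (real n) * (\<integral>\<^sup>+t. ennreal (\<rho> t) * h t \<partial>Bper)"
    unfolding nn_integral_Bper[symmetric] using borel_measurable_Bper_continuous[OF \<rho>] h
    by (intro nn_integral_cmult) simp
  finally show ?thesis using n_pos by (simp add: ennreal_mult_cancel_left)
qed

lemma coupling_mixed_measure:
  assumes n_pos: "1 \<le> n" and mixed: "mixed n \<rho> lam \<Psi> G" and \<rho>: "continuous_on Iper \<rho>"
  shows "coupling n \<rho> (mixed_measure n lam \<Psi>)"
  unfolding coupling_def
proof (intro conjI allI impI)
  let ?\<gamma> = "mixed_measure n lam \<Psi>"
  show sets_mixed: "sets ?\<gamma> = sets (Pi\<^sub>M {..<n} (\<lambda>_. Bper))" by (simp add: mixed_measure_def)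
  show "prob_space ?\<gamma>"
  proof
    have "emeasure ?\<gamma> (space ?\<gamma>) = (\<integral>\<^sup>+x. 1 \<partial>?\<gamma>)" by simp
    also have "\<dots> = (\<Sum>k. ennreal (lam k))"
      using mixedD(3,5)[OF mixed] by (subst nn_integral_mixed_measure) auto
    also have "\<dots> = 1"
      using suminf_ennreal2[OF mixedD(2)[OF mixed] sums_summable[OF mixedD(1)[OF mixed]]]
        sums_unique[OF mixedD(1)[OF mixed]] by simp
    finally show "emeasure ?\<gamma> (space ?\<gamma>) = 1" .
  qed
  fix j assume j: "j < n"
  have component: "(\<lambda>x. x j) \<in> measurable ?\<gamma> Bper"
    using component_measurable_Bper[OF j] by (simp only: measurable_cong_sets[OF sets_mixed refl])
  show "distr ?\<gamma> Bper (\<lambda>x. x j) = density Bper (\<lambda>t. ennreal (\<rho> t))"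
  proof (rule measure_eqI)
    fix E assume "E \<in> sets (distr ?\<gamma> Bper (\<lambda>x. x j))"
    then have E: "E \<in> sets Bper" by simp
    have "emeasure (distr ?\<gamma> Bper (\<lambda>x. x j)) E = (\<integral>\<^sup>+t. indicator E t \<partial>distr ?\<gamma> Bper (\<lambda>x. x j))" using E by simp
    also have "\<dots> = (\<integral>\<^sup>+x. indicator E (x j) \<partial>?\<gamma>)" using component E by (intro nn_integral_distr) auto
    also have "\<dots> = (\<integral>\<^sup>+t. ennreal (\<rho> t) * indicator E t \<partial>Bper)"
      using E by (intro mixed_measure_marginal[OF n_pos mixed j _ \<rho>]) auto
    also have "\<dots> = emeasure (density Bper (\<lambda>t. ennreal (\<rho> t))) E"
      using borel_measurable_Bper_continuous[OF \<rho>] E by (simp add: emeasure_density)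
    finally show "emeasure (distr ?\<gamma> Bper (\<lambda>x. x j)) E = emeasure (density Bper (\<lambda>t. ennreal (\<rho> t))) E" .
  qed simp
qed

theorem FOT_le_Feps:
  assumes n_pos: "1 \<le> n" and w: "assumptionA w" and \<rho>: "continuous_on Iper \<rho>"
  shows "FOT n w \<rho> \<le> Feps n w \<epsilon> \<rho>"
  unfolding Feps_def
proof (rule INF_greatest)
  fix st assume "st \<in> {(lam, \<Psi>, G). mixed n \<rho> lam \<Psi> G}"
  then obtain lam \<Psi> G where st: "st = (lam, \<Psi>, G)" and mixed: "mixed n \<rho> lam \<Psi> G" by auto
  have "FOT n w \<rho> \<le> (\<integral>\<^sup>+x. cN n w x \<partial>mixed_measure n lam \<Psi>)"
    unfolding FOT_def using coupling_mixed_measure[OF n_pos mixed \<rho>] by (intro INF_lower) simp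
  also have "\<dots> = (\<Sum>k. ennreal (lam k) * (\<integral>\<^sup>+x. cN n w x * ennreal ((cmod (\<Psi> k x))\<^sup>2) \<partial>muN n))"
    by (rule nn_integral_mixed_measure[OF mixedD(3)[OF mixed] cN_measurable[OF w]])
  also have "\<dots> \<le> (\<Sum>k. ennreal (lam k) * energyN n w \<epsilon> (\<Psi> k) (G k))"
    unfolding energyN_def by (intro suminf_le mult_left_mono nn_integral_mono) auto
  finally show "FOT n w \<rho> \<le> (case st of (lam, \<Psi>, G) \<Rightarrow> \<Sum>k. ennreal (lam k) * energyN n w \<epsilon> (\<Psi> k) (G k))"
    by (simp add: st)
qed

section \<open>The distance on the circle\<close>

lemma distT_eq_round: "distT t = \<bar>t - 2 * pi * of_int (round (t / (2 * pi)))\<bar>"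
  and round_remainder_le_pi: "\<bar>t - 2 * pi * of_int (round (t / (2 * pi)))\<bar> \<le> pi"
proof -
  define k where "k = round (t / (2 * pi))"
  define s where "s = t - 2 * pi * of_int k"
  have "\<bar>of_int k - t / (2 * pi)\<bar> \<le> 1/2" unfolding k_def by (rule of_int_round_abs_le)
  then have "\<bar>t / (2 * pi) - of_int k\<bar> * (2 * pi) \<le> (1/2) * (2 * pi)"
    by (intro mult_right_mono) (auto simp: abs_minus_commute)
  moreover have "\<bar>t / (2 * pi) - of_int k\<bar> * (2 * pi) = \<bar>s\<bar>"
    unfolding s_def using abs_mult_pos[of "2 * pi" "t / (2 * pi) - of_int k"] by (simp add: field_simps)
  ultimately have s: "\<bar>s\<bar> \<le> pi" by simp
  then show "\<bar>t - 2 * pi * of_int (round (t / (2 * pi)))\<bar> \<le> pi" by (simp add: s_def k_def)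
  have "distT t = \<bar>s\<bar>" unfolding distT_def
  proof (rule cInf_eq_minimum)
    show "\<bar>s\<bar> \<in> {\<bar>t - 2 * pi * real_of_int k\<bar> | k. True}" by (auto simp: s_def)
    fix x assume "x \<in> {\<bar>t - 2 * pi * real_of_int k\<bar> | k. True}"
    then obtain j :: int where x: "x = \<bar>t - 2 * pi * real_of_int j\<bar>" by auto
    show "\<bar>s\<bar> \<le> x"
    proof (cases "j = k")
      case False
      then have "2 * pi * 1 \<le> 2 * pi * \<bar>real_of_int k - real_of_int j\<bar>" by (intro mult_left_mono, linarith, simp)
      then have "2 * pi \<le> \<bar>2 * pi * (real_of_int k - real_of_int j)\<bar>" by (simp add: abs_mult)
      moreover have "t - 2 * pi * real_of_int j = s + 2 * pi * (real_of_int k - real_of_int j)"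
        by (simp add: s_def algebra_simps)
      ultimately show ?thesis using s x by linarith
    qed (simp add: x s_def)
  qed
  then show "distT t = \<bar>t - 2 * pi * of_int (round (t / (2 * pi)))\<bar>" by (simp add: s_def k_def)
qed

lemma distT_attained: "\<exists>k. distT t = \<bar>t - 2 * pi * real_of_int k\<bar>"
  using distT_eq_round by blast

lemma distT_le: "distT t \<le> \<bar>t - 2 * pi * real_of_int k\<bar>"
  unfolding distT_def by (rule cInf_lower) (auto intro: bdd_belowI[of _ 0])

lemma distT_arccos: "distT t = arccos (cos t)"
proof -
  define k where "k = round (t / (2 * pi))"
  have "cos (t - 2 * pi * of_int k) = cos t"
    using cos_diff[of t "2 * pi * of_int k"] cos_int_2pin[of k] sin_int_2pin[of k] by (simp add: mult_ac)
  then have "cos t = cos \<bar>t - 2 * pi * of_int k\<bar>" by simp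
  then show ?thesis
    using round_remainder_le_pi[of t] arccos_cos[of "\<bar>t - 2 * pi * of_int k\<bar>"] by (simp add: distT_eq_round k_def)
qed

lemma distT_nonneg: "0 \<le> distT t" and distT_le_pi: "distT t \<le> pi"
  unfolding distT_arccos by (auto intro: arccos_lbound arccos_ubound)

lemma distT_minus: "distT (- t) = distT t" by (simp add: distT_arccos)

lemma distT_commute: "distT (x - y) = distT (y - x)"
  using distT_minus[of "x - y"] by simp

lemma distT_le_abs: "distT t \<le> \<bar>t\<bar>" using distT_le[of t 0] by simp

lemma distT_add_le: "distT (x + y) \<le> distT x + distT y"
proof -
  obtain k l where "distT x = \<bar>x - 2 * pi * real_of_int k\<bar>" "distT y = \<bar>y - 2 * pi * real_of_int l\<bar>"
    using distT_attained by metis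
  moreover have "distT (x + y) \<le> \<bar>x + y - 2 * pi * real_of_int (k + l)\<bar>" by (rule distT_le)
  moreover have "x + y - 2 * pi * real_of_int (k + l) = (x - 2 * pi * real_of_int k) + (y - 2 * pi * real_of_int l)"
    by (simp add: algebra_simps)
  ultimately show ?thesis by linarith
qed

lemma distT_triangle: "distT (x - z) \<le> distT (x - y) + distT (y - z)"
  using distT_add_le[of "x - y" "y - z"] by simp

lemma continuous_on_distT:
  fixes f :: "'a::t2_space \<Rightarrow> real"
  shows "continuous_on A f \<Longrightarrow> continuous_on A (\<lambda>x. distT (f x))"
  unfolding distT_arccos by (intro continuous_intros) (auto simp: abs_le_iff)

lemma distT_less_iff_cos: "0 \<le> b \<Longrightarrow> b \<le> pi \<Longrightarrow> distT t < b \<longleftrightarrow> cos b < cos t"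
  using cos_mono_less_eq[of b "distT t"] distT_nonneg[of t] distT_le_pi[of t] by (simp add: distT_arccos)

lemma distT_multiple_ge:
  assumes "0 < m" "real j * m \<le> 2 * pi - m" "j \<ge> 1"
  shows "m \<le> distT (real j * m)"
proof -
  obtain k where k: "distT (real j * m) = \<bar>real j * m - 2 * pi * real_of_int k\<bar>" using distT_attained by blast
  have first_multiple: "m \<le> real j * m" using assms by simp
  show ?thesis
  proof (cases "k \<le> 0")
    case True
    then have "2 * pi * real_of_int k \<le> 0" by (simp add: mult_le_0_iff)
    then show ?thesis using k first_multiple assms by linarith
  next
    case False
    then have "2 * pi * 1 \<le> 2 * pi * real_of_int k" by (intro mult_left_mono) auto
    then show ?thesis using k assms by linarith
  qed
qed

section \<open>The interaction cost\<close>

locale cost =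
  fixes n :: nat and w :: "real \<times> real \<Rightarrow> ennreal"
  assumes n_pos: "1 \<le> n" and w_assumptionA: "assumptionA w"
begin

lemma w_sym: "x \<in> Iper \<Longrightarrow> y \<in> Iper \<Longrightarrow> w (x, y) = w (y, x)"
  using w_assumptionA by (simp add: assumptionA_def)

lemma w_continuous: "continuous_on (Iper \<times> Iper) w"
  using w_assumptionA by (simp add: assumptionA_def)

lemma w_eq_top_iff: "x \<in> Iper \<Longrightarrow> y \<in> Iper \<Longrightarrow> w (x, y) = top \<longleftrightarrow> distT (x - y) = 0"
  using w_assumptionA unfolding assumptionA_def set_eq_iff by (auto simp: infinity_ennreal_def)

definition separated_pairs :: "real \<Rightarrow> (real \<times> real) set" where
  "separated_pairs a = {p \<in> Iper \<times> Iper. a \<le> distT (fst p - snd p)}"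

lemma compact_separated_pairs: "compact (separated_pairs a)"
proof -
  have square: "compact (Iper \<times> Iper)" by (intro compact_Times compact_Iper)
  have "continuous_on (Iper \<times> Iper) (\<lambda>p. distT (fst p - snd p))" by (intro continuous_on_distT continuous_intros)
  then have "closed (Iper \<times> Iper \<inter> (\<lambda>p. distT (fst p - snd p)) -` {a..})"
    by (intro continuous_closed_preimage compact_imp_closed[OF square]) auto
  then have "compact (Iper \<times> Iper \<inter> (Iper \<times> Iper \<inter> (\<lambda>p. distT (fst p - snd p)) -` {a..}))"
    by (rule compact_Int_closed[OF square])
  moreover have "Iper \<times> Iper \<inter> (Iper \<times> Iper \<inter> (\<lambda>p. distT (fst p - snd p)) -` {a..}) = separated_pairs a"
    by (auto simp: separated_pairs_def)
  ultimately show ?thesis by simp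
qed

lemma w_finite_separated: "0 < a \<Longrightarrow> (x, y) \<in> separated_pairs a \<Longrightarrow> w (x, y) < top"
  using w_eq_top_iff[of x y] by (auto simp: separated_pairs_def less_top[symmetric])

abbreviation w_real :: "real \<times> real \<Rightarrow> real" where "w_real p \<equiv> enn2real (w p)"

lemma w_real_continuous_separated:
  assumes a: "0 < a" shows "continuous_on (separated_pairs a) w_real"
  unfolding continuous_on_def
proof safe
  fix x y assume xy: "(x, y) \<in> separated_pairs a"
  obtain r where r: "w (x, y) = ennreal r" "0 \<le> r" using w_finite_separated[OF a xy] by (cases "w (x, y)") auto
  have "continuous_on (separated_pairs a) w"
    by (rule continuous_on_subset[OF w_continuous]) (auto simp: separated_pairs_def)
  then have "(w \<longlongrightarrow> ennreal r) (at (x, y) within separated_pairs a)"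
    using xy by (simp add: continuous_on_def r(1)[symmetric])
  then show "(w_real \<longlongrightarrow> w_real (x, y)) (at (x, y) within separated_pairs a)"
    using tendsto_enn2real[OF _ r(2)] r by fastforce
qed

lemma w_bounded_separated:
  assumes a: "0 < a"
  obtains W where "0 \<le> W" "\<And>x y. x \<in> Iper \<Longrightarrow> y \<in> Iper \<Longrightarrow> a \<le> distT (x - y) \<Longrightarrow> w (x, y) \<le> ennreal W"
proof -
  have "bounded (w_real ` separated_pairs a)"
    by (intro compact_imp_bounded compact_continuous_image w_real_continuous_separated[OF a] compact_separated_pairs)
  then obtain B where B: "\<And>p. p \<in> separated_pairs a \<Longrightarrow> \<bar>w_real p\<bar> \<le> B" by (auto simp: bounded_iff)
  show ?thesis
  proof (rule that[of "max B 0"])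
    fix x y assume "x \<in> Iper" "y \<in> Iper" "a \<le> distT (x - y)"
    then have xy: "(x, y) \<in> separated_pairs a" by (simp add: separated_pairs_def)
    then have "w (x, y) = ennreal (w_real (x, y))" using w_finite_separated[OF a] by simp
    also have "\<dots> \<le> ennreal (max B 0)" using B[OF xy] by (intro ennreal_leI) auto
    finally show "w (x, y) \<le> ennreal (max B 0)" .
  qed simp
qed

lemma separated_if_w_bounded:
  obtains a where "0 < a" "\<And>x y. x \<in> Iper \<Longrightarrow> y \<in> Iper \<Longrightarrow> w (x, y) \<le> ennreal C \<Longrightarrow> a \<le> distT (x - y)"
proof -
  define T where "T = {p \<in> Iper \<times> Iper. w p \<le> ennreal C}"
  have square: "compact (Iper \<times> Iper)" by (intro compact_Times compact_Iper)
  have "compact (Iper \<times> Iper \<inter> (Iper \<times> Iper \<inter> w -` {..ennreal C}))"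
    by (intro compact_Int_closed[OF square] continuous_closed_preimage[OF w_continuous]
      compact_imp_closed[OF square]) simp
  moreover have "Iper \<times> Iper \<inter> (Iper \<times> Iper \<inter> w -` {..ennreal C}) = T" by (auto simp: T_def)
  ultimately have T_compact: "compact T" by simp
  show ?thesis
  proof (cases "T = {}")
    case True
    show ?thesis by (rule that[of 1]) (use True in \<open>auto simp: T_def\<close>)
  next
    case False
    have "continuous_on T (\<lambda>p. distT (fst p - snd p))" by (intro continuous_on_distT continuous_intros)
    then obtain p where p: "p \<in> T" "\<And>q. q \<in> T \<Longrightarrow> distT (fst p - snd p) \<le> distT (fst q - snd q)"
      using continuous_attains_inf[OF T_compact False] by blast
    have "w (fst p, snd p) \<noteq> top" using p(1) by (auto simp: T_def top_unique)
    then have "distT (fst p - snd p) \<noteq> 0" using w_eq_top_iff[of "fst p" "snd p"] p(1) by (auto simp: T_def)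
    then have "0 < distT (fst p - snd p)" using distT_nonneg[of "fst p - snd p"] by simp
    then show ?thesis
    proof (rule that)
      fix x y assume "x \<in> Iper" "y \<in> Iper" "w (x, y) \<le> ennreal C"
      then show "distT (fst p - snd p) \<le> distT (x - y)" using p(2)[of "(x, y)"] by (auto simp: T_def)
    qed
  qed
qed

lemma distT_stable:
  assumes "a \<le> distT (x - y)" "\<bar>x' - x\<bar> < a / 4" "\<bar>y' - y\<bar> < a / 4"
  shows "a / 2 \<le> distT (x' - y')"
proof -
  have "distT (x - y) \<le> distT (x - x') + distT (x' - y') + distT (y' - y)"
    using distT_triangle[of x y x'] distT_triangle[of x' y y'] by simp
  moreover have "distT (x - x') \<le> \<bar>x' - x\<bar>" using distT_le_abs[of "x - x'"] by (simp add: abs_minus_commute)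
  ultimately show ?thesis using distT_le_abs[of "y' - y"] assms by linarith
qed

lemma w_real_uniformly_continuous_separated:
  assumes a: "0 < a" and e: "0 < e"
  obtains d where "0 < d" "\<And>x x' y y'. x \<in> Iper \<Longrightarrow> x' \<in> Iper \<Longrightarrow> y \<in> Iper \<Longrightarrow> y' \<in> Iper \<Longrightarrow>
    a \<le> distT (x - y) \<Longrightarrow> \<bar>x' - x\<bar> < d \<Longrightarrow> \<bar>y' - y\<bar> < d \<Longrightarrow>
    a / 2 \<le> distT (x' - y') \<and> \<bar>w_real (x', y') - w_real (x, y)\<bar> < e"
proof -
  have "uniformly_continuous_on (separated_pairs (a/2)) w_real"
    by (rule compact_uniformly_continuous[OF w_real_continuous_separated compact_separated_pairs]) (use a in simp)
  then obtain d where d: "0 < d"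
    "\<And>p q. p \<in> separated_pairs (a/2) \<Longrightarrow> q \<in> separated_pairs (a/2) \<Longrightarrow> dist q p < d \<Longrightarrow> dist (w_real q) (w_real p) < e"
    using e unfolding uniformly_continuous_on_def by metis
  show ?thesis
  proof (rule that[of "min (d/2) (a/4)"])
    show "0 < min (d/2) (a/4)" using d a by simp
    fix x x' y y'
    assume mem: "x \<in> Iper" "x' \<in> Iper" "y \<in> Iper" "y' \<in> Iper" and sep: "a \<le> distT (x - y)"
      and close: "\<bar>x' - x\<bar> < min (d/2) (a/4)" "\<bar>y' - y\<bar> < min (d/2) (a/4)"
    have sep': "a / 2 \<le> distT (x' - y')" using close by (intro distT_stable[OF sep]) auto
    have "dist (x', y') (x, y) \<le> dist x' x + dist y' y"
      unfolding dist_Pair_Pair by (rule sqrt_sum_squares_le_sum) auto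
    also have "\<dots> < d" using close by (simp add: dist_real_def)
    finally have "dist (w_real (x', y')) (w_real (x, y)) < e"
      using mem sep sep' a by (intro d) (auto simp: separated_pairs_def)
    then show "a / 2 \<le> distT (x' - y') \<and> \<bar>w_real (x', y') - w_real (x, y)\<bar> < e"
      using sep' by (simp add: dist_real_def)
  qed
qed

lemma w_le_cN: assumes "i < n" "j < n" "i \<noteq> j" shows "w (x i, x j) \<le> cN n w x"
proof -
  have "w (x i, x j) \<le> (\<Sum>j\<in>{..<n} - {i}. w (x i, x j))"
    using assms by (intro member_le_sum) auto
  also have "\<dots> \<le> cN n w x" unfolding cN_def
    using assms by (intro member_le_sum[where f="\<lambda>i. \<Sum>j\<in>{..<n} - {i}. w (x i, x j)"]) auto
  finally show ?thesis .
qed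

definition real_cost :: "(nat \<Rightarrow> real) \<Rightarrow> real" where
  "real_cost x = (\<Sum>i<n. \<Sum>j\<in>{..<n} - {i}. w_real (x i, x j))"

definition separated :: "real \<Rightarrow> (nat \<Rightarrow> real) \<Rightarrow> bool" where
  "separated a x \<longleftrightarrow> (\<forall>i<n. \<forall>j<n. i \<noteq> j \<longrightarrow> a \<le> distT (x i - x j))"

lemma cN_eq_real_cost:
  assumes "\<And>i. i < n \<Longrightarrow> x i \<in> Iper" "separated a x" "0 < a"
  shows "cN n w x = ennreal (real_cost x)"
proof -
  have "cN n w x = (\<Sum>i<n. \<Sum>j\<in>{..<n} - {i}. ennreal (w_real (x i, x j)))"
    unfolding cN_def
  proof (intro sum.cong refl)
    fix i j assume "i \<in> {..<n}" "j \<in> {..<n} - {i}"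
    then have "(x i, x j) \<in> separated_pairs a" using assms by (auto simp: separated_pairs_def separated_def)
    then show "w (x i, x j) = ennreal (w_real (x i, x j))" using w_finite_separated[OF assms(3)] by simp
  qed
  also have "\<dots> = ennreal (real_cost x)" unfolding real_cost_def by (simp add: sum_ennreal sum_nonneg)
  finally show ?thesis .
qed

lemma cN_bounded_separated:
  assumes a: "0 < a"
  obtains S where "0 \<le> S" "\<And>x. (\<And>i. i < n \<Longrightarrow> x i \<in> Iper) \<Longrightarrow> separated a x \<Longrightarrow> cN n w x \<le> ennreal S"
proof -
  obtain W where W: "0 \<le> W" "\<And>x y. x \<in> Iper \<Longrightarrow> y \<in> Iper \<Longrightarrow> a \<le> distT (x - y) \<Longrightarrow> w (x, y) \<le> ennreal W"
    using w_bounded_separated[OF a] by metis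
  show ?thesis
  proof (rule that[of "real n * (real n * W)"])
    fix x assume x: "\<And>i. i < n \<Longrightarrow> x i \<in> Iper" "separated a x"
    have "cN n w x \<le> (\<Sum>i<n. \<Sum>j\<in>{..<n} - {i}. ennreal W)"
      unfolding cN_def using x by (intro sum_mono W) (auto simp: separated_def)
    also have "\<dots> \<le> (\<Sum>i<n. \<Sum>j<n. ennreal W)" by (intro sum_mono sum_mono2) auto
    also have "\<dots> = ennreal (real n * (real n * W))" using W(1) by (simp add: ennreal_mult ennreal_of_nat_eq_real_of_nat)
    finally show "cN n w x \<le> ennreal (real n * (real n * W))" .
  qed (use W in simp)
qed

lemma separated_if_cN_bounded:
  obtains a where "0 < a" "\<And>x. (\<And>i. i < n \<Longrightarrow> x i \<in> Iper) \<Longrightarrow> cN n w x \<le> ennreal C \<Longrightarrow> separated a x"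
proof -
  obtain a where a: "0 < a" "\<And>x y. x \<in> Iper \<Longrightarrow> y \<in> Iper \<Longrightarrow> w (x, y) \<le> ennreal C \<Longrightarrow> a \<le> distT (x - y)"
    using separated_if_w_bounded by metis
  show ?thesis
  proof (rule that[OF a(1)])
    fix x assume x: "\<And>i. i < n \<Longrightarrow> x i \<in> Iper" "cN n w x \<le> ennreal C"
    show "separated a x" unfolding separated_def
      using x a(2) w_le_cN[of _ _ x] by (meson order_trans)
  qed
qed

lemma real_cost_uniformly_continuous_separated:
  assumes a: "0 < a" and e: "0 < e"
  obtains d where "0 < d" "\<And>x y. (\<And>i. i < n \<Longrightarrow> x i \<in> Iper) \<Longrightarrow> (\<And>i. i < n \<Longrightarrow> y i \<in> Iper) \<Longrightarrow> separated a x \<Longrightarrow>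
     (\<And>i. i < n \<Longrightarrow> \<bar>y i - x i\<bar> < d) \<Longrightarrow> separated (a/2) y \<and> \<bar>real_cost y - real_cost x\<bar> < e"
proof -
  define e' where "e' = e / (real n * real n + 1)"
  have e': "0 < e'" using e by (simp add: e'_def add_nonneg_pos)
  obtain d where d: "0 < d" "\<And>x x' y y'. x \<in> Iper \<Longrightarrow> x' \<in> Iper \<Longrightarrow> y \<in> Iper \<Longrightarrow> y' \<in> Iper \<Longrightarrow> a \<le> distT (x - y) \<Longrightarrow>
      \<bar>x' - x\<bar> < d \<Longrightarrow> \<bar>y' - y\<bar> < d \<Longrightarrow> a / 2 \<le> distT (x' - y') \<and> \<bar>w_real (x', y') - w_real (x, y)\<bar> < e'"
    using w_real_uniformly_continuous_separated[OF a e'] by metis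
  show ?thesis
  proof (rule that[OF d(1)])
    fix x y
    assume mem: "\<And>i. i < n \<Longrightarrow> x i \<in> Iper" "\<And>i. i < n \<Longrightarrow> y i \<in> Iper"
      and sep: "separated a x" and close: "\<And>i. i < n \<Longrightarrow> \<bar>y i - x i\<bar> < d"
    have pairs: "a / 2 \<le> distT (y i - y j) \<and> \<bar>w_real (y i, y j) - w_real (x i, x j)\<bar> < e'"
      if "i < n" "j < n" "i \<noteq> j" for i j
      using mem sep close that by (intro d(2)) (auto simp: separated_def)
    have "\<bar>real_cost y - real_cost x\<bar> \<le> (\<Sum>i<n. \<Sum>j\<in>{..<n} - {i}. \<bar>w_real (y i, y j) - w_real (x i, x j)\<bar>)"
      unfolding real_cost_def sum_subtractf[symmetric]
      by (intro order_trans[OF sum_abs] sum_mono) (auto intro: sum_abs)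
    also have "\<dots> \<le> (\<Sum>i<n. \<Sum>j\<in>{..<n} - {i}. e')" using pairs by (intro sum_mono) (auto intro: less_imp_le)
    also have "\<dots> \<le> (\<Sum>i<n. \<Sum>j<n. e')" using e' by (intro sum_mono sum_mono2) auto
    also have "\<dots> < (real n * real n + 1) * e'" using e' by (simp add: algebra_simps)
    also have "\<dots> = e" unfolding e'_def by (simp add: add_nonneg_eq_0_iff)
    finally show "separated (a/2) y \<and> \<bar>real_cost y - real_cost x\<bar> < e" using pairs by (auto simp: separated_def)
  qed
qed

end

section \<open>Square partitions of unity on the circle\<close>

definition arc_bump :: "real \<Rightarrow> real \<Rightarrow> real" where "arc_bump b t = (max 0 (cos t - cos b))\<^sup>2"

definition arc_bump_deriv :: "real \<Rightarrow> real \<Rightarrow> real" where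
  "arc_bump_deriv b t = 2 * max 0 (cos t - cos b) * (- sin t)"

lemma DERIV_pos_part_square: "((\<lambda>y. (max 0 y)\<^sup>2) has_real_derivative 2 * max 0 y) (at (y::real))"
proof (cases y "0::real" rule: linorder_cases)
  case less
  have "((\<lambda>y. 0) has_real_derivative 2 * max 0 y) (at y)" using less by simp
  then show ?thesis
    by (rule has_field_derivative_transform_within_open[where S = "{..<0}"]) (use less in auto)
next
  case greater
  have "((\<lambda>y. y\<^sup>2) has_real_derivative 2 * max 0 y) (at y)" using greater by (auto intro!: derivative_eq_intros)
  then show ?thesis
    by (rule has_field_derivative_transform_within_open[where S = "{0<..}"]) (use greater in auto)
next
  case equal
  have "((\<lambda>h. ((max 0 (0 + h))\<^sup>2 - (max 0 0)\<^sup>2) / h) \<longlongrightarrow> 0) (at (0::real))"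
  proof (rule Lim_null_comparison[where g = "\<lambda>h. \<bar>h\<bar>"])
    show "\<forall>\<^sub>F h in at (0::real). norm (((max 0 (0 + h))\<^sup>2 - (max 0 0)\<^sup>2) / h) \<le> \<bar>h\<bar>"
      by (rule always_eventually) (auto simp: max_def power2_eq_square)
    show "((\<lambda>h. \<bar>h\<bar>) \<longlongrightarrow> 0) (at (0::real))" by (rule tendsto_eq_intros | simp)+
  qed
  then show ?thesis unfolding equal DERIV_def by simp
qed

lemma C1per_arc_bump: "C1per (arc_bump b) (arc_bump_deriv b)"
  unfolding C1per_def
proof (intro conjI allI)
  fix t
  show "(arc_bump b has_real_derivative arc_bump_deriv b t) (at t)" unfolding arc_bump_def arc_bump_deriv_def
    by (rule DERIV_chain2[OF DERIV_pos_part_square]) (auto intro!: derivative_eq_intros)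
  show "continuous_on UNIV (arc_bump_deriv b)" unfolding arc_bump_deriv_def by (intro continuous_intros)
  show "arc_bump b (t + 2 * pi) = arc_bump b t" by (simp add: arc_bump_def)
qed

lemma arc_bump_nonneg: "0 \<le> arc_bump b t" by (simp add: arc_bump_def)

lemma arc_bump_pos_iff: "0 \<le> b \<Longrightarrow> b \<le> pi \<Longrightarrow> 0 < arc_bump b t \<longleftrightarrow> distT t < b"
  by (auto simp: distT_less_iff_cos arc_bump_def max_def)

definition grid_point :: "nat \<Rightarrow> nat \<Rightarrow> real" where "grid_point N i = 2 * pi * real i / real N"

text \<open>The radius exceeds half the mesh, so the windows cover the circle, and falls short of the mesh, so the windows
  of every third index are disjoint.\<close>
definition window_radius :: "nat \<Rightarrow> real" where "window_radius N = 4 * pi / (3 * real N)"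

definition window_norm :: "nat \<Rightarrow> real \<Rightarrow> real" where
  "window_norm N t = (\<Sum>i<N. (arc_bump (window_radius N) (t - grid_point N i))\<^sup>2)"

definition window :: "nat \<Rightarrow> nat \<Rightarrow> real \<Rightarrow> real" where
  "window N i t = arc_bump (window_radius N) (t - grid_point N i) / sqrt (window_norm N t)"

lemma nearby_grid_point:
  assumes N: "1 \<le> N"
  obtains i where "i < N" "distT (t - grid_point N i) \<le> pi / real N"
proof -
  have N_pos: "real N > 0" using N by simp
  define j where "j = round (t * real N / (2 * pi))"
  have index: "0 \<le> j mod int N" "j mod int N < int N" using N by auto
  have j: "real_of_int j = real (nat (j mod int N)) + real N * real_of_int (j div int N)"
  proof -
    have "j = int (nat (j mod int N)) + int N * (j div int N)" using index by simp
    then show ?thesis by (metis of_int_add of_int_mult of_int_of_nat_eq)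
  qed
  have "\<bar>of_int j - t * real N / (2 * pi)\<bar> * (2 * pi / real N) \<le> 1/2 * (2 * pi / real N)"
    unfolding j_def using N_pos by (intro mult_right_mono of_int_round_abs_le) auto
  then have "\<bar>(of_int j - t * real N / (2 * pi)) * (2 * pi / real N)\<bar> \<le> pi / real N"
    using N_pos by (simp only: abs_mult) simp
  moreover have "(of_int j - t * real N / (2 * pi)) * (2 * pi / real N)
      = - ((t - grid_point N (nat (j mod int N))) - 2 * pi * of_int (j div int N))"
    using N_pos by (simp add: j grid_point_def field_simps)
  ultimately have "\<bar>(t - grid_point N (nat (j mod int N))) - 2 * pi * of_int (j div int N)\<bar> \<le> pi / real N"
    by (simp only: abs_minus_cancel)
  then show ?thesis
    using index distT_le[of "t - grid_point N (nat (j mod int N))" "j div int N"]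
    by (intro that[of "nat (j mod int N)"]) (auto simp: nat_less_iff)
qed

context
  fixes N :: nat
  assumes two_le_N: "2 \<le> N"
begin

lemma window_radius_bounds: "0 \<le> window_radius N" "window_radius N \<le> pi"
proof -
  have "4 * pi \<le> pi * (3 * real N)" using two_le_N pi_gt_zero by simp
  then show "0 \<le> window_radius N" "window_radius N \<le> pi"
    using two_le_N by (auto simp: window_radius_def divide_le_eq)
qed

lemma window_norm_pos: "0 < window_norm N t"
proof -
  have N_pos: "1 \<le> N" using two_le_N by simp
  obtain i where i: "i < N" "distT (t - grid_point N i) \<le> pi / real N"
    using nearby_grid_point[OF N_pos] by blast
  have "pi / real N < window_radius N" using N_pos by (simp add: window_radius_def field_simps)
  then have "0 < arc_bump (window_radius N) (t - grid_point N i)"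
    using i(2) window_radius_bounds by (simp add: arc_bump_pos_iff)
  then have "0 < (arc_bump (window_radius N) (t - grid_point N i))\<^sup>2" by simp
  also have "\<dots> \<le> window_norm N t" unfolding window_norm_def using i(1) by (intro member_le_sum) auto
  finally show ?thesis .
qed

lemma C1per_window: "\<exists>f'. C1per (window N i) f'"
proof -
  have bump: "C1per (\<lambda>t. arc_bump (window_radius N) (t - grid_point N i))
      (\<lambda>t. arc_bump_deriv (window_radius N) (t - grid_point N i))" for i
    by (intro C1per_shift C1per_arc_bump)
  have "C1per (window_norm N) (\<lambda>t. \<Sum>i<N. 2 * arc_bump (window_radius N) (t - grid_point N i)
      * arc_bump_deriv (window_radius N) (t - grid_point N i))"
    unfolding window_norm_def[abs_def] by (intro C1per_sum C1per_square bump) simp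
  from C1per_inverse[OF C1per_sqrt[OF this window_norm_pos]] window_norm_pos
  obtain h' where h': "C1per (\<lambda>t. inverse (sqrt (window_norm N t))) h'" by auto
  show ?thesis unfolding window_def[abs_def] divide_inverse by (rule exI, rule C1per_mult[OF bump h'])
qed

lemma window_continuous: "continuous_on A (window N i)"
  using C1per_window C1per_continuous(1) by blast

lemma window_nonneg: "0 \<le> window N i t"
  using window_norm_pos[of t] by (simp add: window_def arc_bump_nonneg less_imp_le)

lemma sum_window_square: "(\<Sum>i<N. (window N i t)\<^sup>2) = 1"
proof -
  have "(\<Sum>i<N. (window N i t)\<^sup>2) = (\<Sum>i<N. (arc_bump (window_radius N) (t - grid_point N i))\<^sup>2 / window_norm N t)"
    using window_norm_pos[of t] by (simp add: window_def power_divide)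
  also have "\<dots> = window_norm N t / window_norm N t"
    unfolding sum_divide_distrib[symmetric] window_norm_def[of N t, symmetric] ..
  finally show ?thesis using window_norm_pos[of t] by simp
qed

lemma window_le_1: assumes "i < N" shows "window N i t \<le> 1"
proof -
  have "(window N i t)\<^sup>2 \<le> (\<Sum>i<N. (window N i t)\<^sup>2)" using assms by (intro member_le_sum) auto
  then show ?thesis using power2_le_imp_le[of "window N i t" 1] by (simp add: sum_window_square)
qed

lemma window_support: "window N i t \<noteq> 0 \<Longrightarrow> distT (t - grid_point N i) < window_radius N"
  using arc_bump_pos_iff[OF window_radius_bounds, of "t - grid_point N i"]
    arc_bump_nonneg[of "window_radius N" "t - grid_point N i"] by (auto simp: window_def)

lemma window_support_interval:
  assumes t: "t \<in> Iper" and i: "i < N" "i \<noteq> 0" and "window N i t \<noteq> 0"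
  shows "\<bar>t - grid_point N i\<bar> < window_radius N"
proof -
  let ?c = "grid_point N i"
  obtain k where "distT (t - ?c) = \<bar>t - ?c - 2 * pi * real_of_int k\<bar>" using distT_attained by blast
  then have near: "\<bar>t - ?c - 2 * pi * real_of_int k\<bar> < window_radius N" using window_support[OF assms(4)] by simp
  have "window_radius N < 2 * pi / real N" using two_le_N by (simp add: window_radius_def field_simps)
  moreover have "2 * pi * 1 \<le> 2 * pi * real i" "2 * pi * real i \<le> 2 * pi * (real N - 1)"
    using i by (auto intro!: mult_left_mono)
  then have "2 * pi * 1 / real N \<le> ?c" "?c \<le> 2 * pi * (real N - 1) / real N"
    unfolding grid_point_def by (intro divide_right_mono; simp)+
  then have "2 * pi / real N \<le> ?c" "?c \<le> 2 * pi - 2 * pi / real N" using two_le_N by (simp_all add: field_simps)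
  moreover have "0 \<le> t" "t \<le> 2 * pi" using t by (auto simp: Iper_def)
  ultimately have "\<bar>2 * pi * real_of_int k\<bar> < 2 * pi" using near unfolding abs_less_iff by linarith
  then have "k = 0" by (simp add: abs_mult)
  then show ?thesis using near by simp
qed

lemma window_norm_shift: "window_norm N (t - grid_point N i) = window_norm N t"
proof -
  let ?F = "\<lambda>t i. (arc_bump (window_radius N) (t - grid_point N i))\<^sup>2"
  have shift_one: "window_norm N (t - grid_point N 1) = window_norm N t" for t
  proof -
    have "t - grid_point N 1 - grid_point N i = t - grid_point N (Suc i)" for i
      using two_le_N by (simp add: grid_point_def field_simps)
    then have "window_norm N (t - grid_point N 1) = (\<Sum>i<N. ?F t (Suc i))" unfolding window_norm_def by (simp only:)
    moreover have "(\<Sum>i<Suc N. ?F t i) = ?F t 0 + (\<Sum>i<N. ?F t (Suc i))" by (rule sum.lessThan_Suc_shift)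
    moreover have "(\<Sum>i<Suc N. ?F t i) = (\<Sum>i<N. ?F t i) + ?F t N" by simp
    moreover have "?F t N = ?F t 0"
      using C1per_periodic[OF C1per_arc_bump, of _ "t - 2 * pi"] two_le_N by (simp add: grid_point_def)
    ultimately show ?thesis unfolding window_norm_def by linarith
  qed
  show ?thesis
  proof (induction i)
    case 0 then show ?case by (simp add: grid_point_def)
  next
    case (Suc i)
    have "t - grid_point N (Suc i) = (t - grid_point N i) - grid_point N 1"
      using two_le_N by (simp add: grid_point_def field_simps)
    then show ?case using shift_one[of "t - grid_point N i"] Suc by (simp only:)
  qed
qed

lemma window_shift: "window N i t = window N 0 (t - grid_point N i)"
  by (simp add: window_def window_norm_shift) (simp add: grid_point_def)

lemma integral_window_square: "(\<integral>t. (window N i t)\<^sup>2 \<partial>Lper) = 2 * pi / real N"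
proof -
  have cont: "continuous_on A (\<lambda>t. (window N i t)\<^sup>2)" for A i by (intro continuous_intros window_continuous)
  have periodic: "(window N 0 (t + 2 * pi))\<^sup>2 = (window N 0 t)\<^sup>2" for t
    using C1per_window[of 0] C1per_periodic by metis
  have shift: "(\<integral>t. (window N i t)\<^sup>2 \<partial>Lper) = (\<integral>t. (window N 0 t)\<^sup>2 \<partial>Lper)" for i
    unfolding window_shift[of i] by (rule integral_Lper_shift[OF cont periodic])
  have "real N * (\<integral>t. (window N 0 t)\<^sup>2 \<partial>Lper) = (\<Sum>i<N. \<integral>t. (window N 0 t)\<^sup>2 \<partial>Lper)" by simp
  also have "\<dots> = (\<Sum>i<N. \<integral>t. (window N i t)\<^sup>2 \<partial>Lper)" by (rule sum.cong[OF refl shift[symmetric]])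
  also have "\<dots> = (\<integral>t. (\<Sum>i<N. (window N i t)\<^sup>2) \<partial>Lper)"
    by (rule Bochner_Integration.integral_sum[symmetric]) (intro integrable_Lper_continuous cont)
  also have "\<dots> = 2 * pi" by (simp add: sum_window_square)
  finally show ?thesis using two_le_N unfolding shift[of i] by (simp add: field_simps)
qed

end

section \<open>Cutting a density into separated orbitals\<close>

lemma grid_class_distT_ge:
  assumes "j < n" "k < n" "j \<noteq> k"
  shows "2 * pi / real n \<le> distT (grid_point (2 * n) (2 * j + r) - grid_point (2 * n) (2 * k + r))"
  using assms
proof (induction j k rule: linorder_less_wlog[case_names less refl sym])
  case (less k j)
  have "grid_point (2 * n) (2 * j + r) - grid_point (2 * n) (2 * k + r) = real (j - k) * (2 * pi / real n)"
    using less by (simp add: grid_point_def of_nat_diff field_simps)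
  moreover have "(real (j - k) + 1) * (2 * pi / real n) \<le> real n * (2 * pi / real n)"
    using less by (intro mult_right_mono) auto
  then have "real (j - k) * (2 * pi / real n) + 1 * (2 * pi / real n) \<le> 2 * pi"
    unfolding distrib_right using less by simp
  then have "2 * pi / real n \<le> distT (real (j - k) * (2 * pi / real n))"
    using less by (intro distT_multiple_ge) simp_all
  ultimately show ?case by (simp add: distT_commute)
qed (auto simp: distT_commute)

lemma grid_class_arcs_separated:
  assumes jk: "j < n" "k < n" "j \<noteq> k"
    and x: "distT (x - grid_point (2 * n) (2 * j + r)) < window_radius (2 * n)"
    and y: "distT (y - grid_point (2 * n) (2 * k + r)) < window_radius (2 * n)"
  shows "window_radius (2 * n) \<le> distT (x - y)"
proof -
  let ?a = "grid_point (2 * n) (2 * j + r)" and ?b = "grid_point (2 * n) (2 * k + r)"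
  have "2 * pi / real n \<le> distT (?a - ?b)" by (rule grid_class_distT_ge[OF jk])
  moreover have "distT (?a - ?b) \<le> distT (x - ?a) + distT (x - y) + distT (y - ?b)"
    using distT_triangle[of ?a ?b x] distT_triangle[of x ?b y] distT_commute[of ?a x] by linarith
  moreover have "2 * pi / real n - 2 * window_radius (2 * n) = window_radius (2 * n)"
    using jk by (simp add: window_radius_def field_simps)
  ultimately show ?thesis using x y by linarith
qed

lemma (in mass_coordinate) coordinate_shift_int: "s (t + 2 * pi * of_int k) = s t + of_int k"
proof -
  have "(\<lambda>t. s t - t / (2 * pi)) (t + 2 * pi * of_int k) = (\<lambda>t. s t - t / (2 * pi)) t"
    by (rule periodic_shift_int) (simp add: coordinate_shift add_divide_distrib)
  then show ?thesis by (simp add: add_divide_distrib)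
qed

lemma (in mass_coordinate) distT_coordinate_le:
  assumes bound: "\<And>t. \<bar>g t\<bar> \<le> M"
  shows "distT (2 * pi * s x - 2 * pi * s y) \<le> 2 * pi * M * distT (x - y)"
proof -
  obtain k where k: "distT (x - y) = \<bar>x - y - 2 * pi * real_of_int k\<bar>" using distT_attained by blast
  have "norm (s x - s (y + 2 * pi * of_int k)) \<le> M * norm (x - (y + 2 * pi * of_int k))"
    by (rule field_differentiable_bound[of UNIV s g]) (use coordinate_DERIV bound in auto)
  then have lipschitz: "\<bar>s x - s y - of_int k\<bar> \<le> M * distT (x - y)"
    by (simp add: coordinate_shift_int k diff_diff_eq)
  have "distT (2 * pi * s x - 2 * pi * s y) \<le> \<bar>2 * pi * s x - 2 * pi * s y - 2 * pi * of_int k\<bar>" by (rule distT_le)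
  also have "\<dots> = 2 * pi * \<bar>s x - s y - of_int k\<bar>"
    by (simp only: right_diff_distrib[symmetric] abs_mult) simp
  also have "\<dots> \<le> 2 * pi * (M * distT (x - y))" by (intro mult_left_mono lipschitz) simp
  finally show ?thesis by (simp only: mult.assoc)
qed

definition separated_orbitals :: "nat \<Rightarrow> real \<Rightarrow> (nat \<Rightarrow> real \<Rightarrow> real) \<Rightarrow> bool" where
  "separated_orbitals n a \<phi> \<longleftrightarrow>
     (\<forall>i<n. \<forall>j<n. \<forall>x\<in>Iper. \<forall>y\<in>Iper. i \<noteq> j \<longrightarrow> \<phi> i x \<noteq> 0 \<longrightarrow> \<phi> j y \<noteq> 0 \<longrightarrow> a \<le> distT (x - y))"

lemma separated_orbitals_disjoint:
  assumes "separated_orbitals n a \<phi>" "0 < a" shows "disjoint_orbitals n \<phi> \<phi>"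
  unfolding disjoint_orbitals_def
proof (intro allI impI ballI)
  fix i j t assume "i < n" "j < n" "i \<noteq> j" "t \<in> Iper"
  then have "\<phi> i t \<noteq> 0 \<Longrightarrow> \<phi> j t \<noteq> 0 \<Longrightarrow> a \<le> distT (t - t)"
    using assms(1) unfolding separated_orbitals_def by blast
  then show "\<phi> i t * \<phi> j t = 0" using assms(2) distT_le_abs[of 0] by fastforce
qed

text \<open>The orbitals $\sqrt{N g}\, W_i$, with the windows $W_i$ equally spaced in the mass coordinate of the density $g$,
  all have mass one.\<close>

locale window_orbitals = mass_coordinate g s for g s +
  fixes N :: nat and g' W' :: "real \<Rightarrow> real" and m M \<Lambda> :: real
  assumes two_le_N: "2 \<le> N"
    and density_C1: "C1per g g'"
    and window_C1: "C1per (window N 0) W'"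
    and window_deriv_le: "\<And>t. \<bar>W' t\<bar> \<le> \<Lambda>"
    and lower_pos: "0 < m"
    and density_lower: "\<And>t. m \<le> g t"
    and density_upper: "\<And>t. g t \<le> M"
begin

definition orbital :: "nat \<Rightarrow> real \<Rightarrow> real" where
  "orbital i t = sqrt (real N) * (sqrt (g t) * window N 0 (2 * pi * s t - grid_point N i))"

definition orbital_deriv :: "nat \<Rightarrow> real \<Rightarrow> real" where
  "orbital_deriv i t = sqrt (real N) * (inverse (sqrt (g t)) / 2 * g' t * window N 0 (2 * pi * s t - grid_point N i)
     + sqrt (g t) * (W' (2 * pi * s t - grid_point N i) * (2 * pi * g t)))"

lemma density_pos: "0 < g t"
  using density_lower[of t] lower_pos by linarith

lemma upper_pos: "0 < M"
  using density_pos[of 0] density_upper[of 0] by linarith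

lemma orbital_eq_window: "orbital i t = sqrt (real N) * (sqrt (g t) * window N i (2 * pi * s t))"
  by (simp add: orbital_def window_shift[OF two_le_N, of i])

lemma orbital_square: "(orbital i t)\<^sup>2 = real N * (g t * (window N 0 (2 * pi * s t - grid_point N i))\<^sup>2)"
  using density_pos[of t] by (simp add: orbital_def power_mult_distrib less_imp_le)

lemma C1per_orbital: "C1per (orbital i) (orbital_deriv i)"
  unfolding orbital_def[abs_def] orbital_deriv_def[abs_def]
  by (intro C1per_cmult C1per_mult C1per_sqrt C1per_compose_coordinate density_C1 density_pos window_C1)

lemma unit_orbital_window: "unit_orbital (orbital i) (orbital_deriv i)"
proof -
  have "0 \<le> orbital i t" for t
    using window_nonneg[OF two_le_N] density_pos[of t] by (simp add: orbital_eq_window less_imp_le)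
  moreover have "(\<integral>t. g t *\<^sub>R (window N 0 (2 * pi * s t - grid_point N i))\<^sup>2 \<partial>Lper) =
      (1 / (2 * pi)) *\<^sub>R (\<integral>t. (window N 0 t)\<^sup>2 \<partial>Lper)"
    by (rule integral_compose_coordinate)
      (simp_all add: C1per_periodic[OF window_C1] continuous_intros window_continuous[OF two_le_N])
  then have "(\<integral>t. (orbital i t)\<^sup>2 \<partial>Lper) = 1"
    using two_le_N by (simp add: orbital_square integral_window_square[OF two_le_N])
  ultimately show ?thesis using C1per_orbital by (simp add: unit_orbital_def)
qed

lemma density_eq_mean_orbital_square: "g t = (\<Sum>i<N. (1 / real N) * (orbital i t)\<^sup>2)"
proof -
  have "(\<Sum>i<N. (1 / real N) * (orbital i t)\<^sup>2) = g t * (\<Sum>i<N. (window N i (2 * pi * s t))\<^sup>2)"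
    using two_le_N by (simp add: orbital_square window_shift[OF two_le_N, symmetric] sum_distrib_left)
  then show ?thesis by (simp add: sum_window_square[OF two_le_N])
qed

lemma orbital_support: "orbital i t \<noteq> 0 \<Longrightarrow> distT (2 * pi * s t - grid_point N i) < window_radius N"
  by (auto intro!: window_support[OF two_le_N] simp: orbital_eq_window)

lemma orbital_deriv_square_le:
  assumes i: "i < N"
  shows "(orbital_deriv i t)\<^sup>2 \<le> 2 * real N * (1 / (4 * m) * (g' t)\<^sup>2 + M * (2 * pi * M * \<Lambda>)\<^sup>2)"
proof -
  let ?W = "window N 0 (2 * pi * s t - grid_point N i)"
  let ?dW = "W' (2 * pi * s t - grid_point N i) * (2 * pi * g t)"
  let ?a = "inverse (sqrt (g t)) / 2 * g' t * ?W" and ?b = "sqrt (g t) * ?dW"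
  have "?W\<^sup>2 \<le> 1"
    using window_le_1[OF two_le_N i] window_nonneg[OF two_le_N, of i]
    by (simp add: window_shift[OF two_le_N, of i, symmetric] power_le_one)
  moreover have "(inverse (sqrt (g t)) / 2)\<^sup>2 \<le> 1 / (4 * m)"
    using density_lower[of t] lower_pos density_pos[of t] by (simp add: power_divide power_inverse field_simps)
  ultimately have "(inverse (sqrt (g t)) / 2)\<^sup>2 * ?W\<^sup>2 * (g' t)\<^sup>2 \<le> 1 / (4 * m) * 1 * (g' t)\<^sup>2"
    using lower_pos by (intro mult_right_mono mult_mono) auto
  then have a_le: "?a\<^sup>2 \<le> 1 / (4 * m) * (g' t)\<^sup>2" by (simp only: power_mult_distrib mult_ac mult_1)
  have "0 \<le> \<Lambda>" using window_deriv_le[of 0] by linarith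
  then have "\<bar>?dW\<bar> \<le> \<Lambda> * (2 * pi * M)"
    unfolding abs_mult using density_pos[of t] density_upper[of t] window_deriv_le by (intro mult_mono) auto
  then have "\<bar>?dW\<bar>\<^sup>2 \<le> (2 * pi * M * \<Lambda>)\<^sup>2" by (intro power_mono) (simp_all add: mult_ac)
  then have "g t * ?dW\<^sup>2 \<le> M * (2 * pi * M * \<Lambda>)\<^sup>2"
    using density_upper[of t] upper_pos by (intro mult_mono) (simp_all only: power2_abs zero_le_power2 less_imp_le)
  moreover have "?b\<^sup>2 = g t * ?dW\<^sup>2" using density_pos[of t] by (simp add: power_mult_distrib less_imp_le)
  ultimately have b_le: "?b\<^sup>2 \<le> M * (2 * pi * M * \<Lambda>)\<^sup>2" by (simp only:)
  have "(orbital_deriv i t)\<^sup>2 = real N * (?a + ?b)\<^sup>2" by (simp add: orbital_deriv_def power_mult_distrib)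
  also have "\<dots> \<le> real N * (2 * (?a\<^sup>2 + ?b\<^sup>2))"
    using sum_squares_bound[of ?a ?b] by (intro mult_left_mono) (simp_all add: power2_sum)
  also have "\<dots> \<le> real N * (2 * (1 / (4 * m) * (g' t)\<^sup>2 + M * (2 * pi * M * \<Lambda>)\<^sup>2))"
    by (intro mult_left_mono add_mono a_le b_le) auto
  finally show ?thesis by (simp only: mult_ac)
qed

definition kinetic_constant :: real where
  "kinetic_constant = 2 * real N * (1 / (4 * m) + 2 * pi * (M * (2 * pi * M * \<Lambda>)\<^sup>2))"

lemma kinetic_constant_nonneg: "0 \<le> kinetic_constant"
  using lower_pos upper_pos by (simp add: kinetic_constant_def)

lemma orbital_kinetic_le:
  assumes i: "i < N"
  shows "(\<integral>t. (orbital_deriv i t)\<^sup>2 \<partial>Lper) \<le> kinetic_constant * (1 + (\<integral>t. (g' t)\<^sup>2 \<partial>Lper))"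
proof -
  let ?c = "M * (2 * pi * M * \<Lambda>)\<^sup>2" and ?J = "\<integral>t. (g' t)\<^sup>2 \<partial>Lper"
  have integrable: "integrable Lper (\<lambda>t. (g' t)\<^sup>2)" "integrable Lper (\<lambda>t. c)" for c :: real
    by (intro integrable_Lper_continuous continuous_intros C1per_continuous[OF density_C1])+
  have "(\<integral>t. (orbital_deriv i t)\<^sup>2 \<partial>Lper) \<le> (\<integral>t. 2 * real N * (1 / (4 * m) * (g' t)\<^sup>2 + ?c) \<partial>Lper)"
    by (intro integral_mono orbital_deriv_square_le[OF i] integrable_Lper_continuous continuous_intros
        C1per_continuous[OF C1per_orbital] C1per_continuous[OF density_C1])
  also have "\<dots> = 2 * real N * (1 / (4 * m) * ?J + 2 * pi * ?c)" using integrable by simp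
  also have "\<dots> \<le> 2 * real N * ((1 / (4 * m) + 2 * pi * ?c) * (1 + ?J))"
  proof (intro mult_left_mono)
    have "0 \<le> 1 / (4 * m)" "0 \<le> 2 * pi * ?c * ?J" using lower_pos upper_pos by auto
    then show "1 / (4 * m) * ?J + 2 * pi * ?c \<le> (1 / (4 * m) + 2 * pi * ?c) * (1 + ?J)"
      by (simp only: distrib_left distrib_right mult_1_right)
  qed simp
  finally show ?thesis by (simp only: kinetic_constant_def mult.assoc)
qed

end

lemma window_orbitals_exist:
  assumes N: "2 \<le> N" and g: "C1per g g'" "\<And>t. m \<le> g t" "\<And>t. g t \<le> M" "(\<integral>t. g t \<partial>Lper) = 1"
    and W: "C1per (window N 0) W'" "\<And>t. \<bar>W' t\<bar> \<le> \<Lambda>" and m: "0 < m"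
  obtains s where "window_orbitals g s N g' W' m M \<Lambda>"
proof -
  obtain s where coord: "mass_coordinate g s"
    using mass_coordinate_exists[OF C1per_continuous(1)[OF g(1)] C1per_periodic[OF g(1)] g(4)] .
  show ?thesis
    by (rule that, rule window_orbitals.intro[OF coord], unfold_locales) (use N g W m in auto)
qed

lemma normalised_density_bounds:
  assumes h: "C1per h h'" "\<And>t. m \<le> h t" "\<And>t. h t \<le> M" and m: "0 < m"
  obtains c where "2 * pi * m \<le> c" "c \<le> 2 * pi * M" "(\<integral>t. 1 / c * h t \<partial>Lper) = 1"
    "\<And>t. m / (2 * pi * M) \<le> 1 / c * h t" "\<And>t. 1 / c * h t \<le> M / (2 * pi * m)"
proof -
  define c where "c = (\<integral>t. h t \<partial>Lper)"
  have integrable: "integrable Lper h" "integrable Lper (\<lambda>t. a)" for a :: real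
    by (intro integrable_Lper_continuous continuous_intros C1per_continuous[OF h(1)])+
  have "(\<integral>t. m \<partial>Lper) \<le> c" unfolding c_def by (intro integral_mono integrable h)
  moreover have "c \<le> (\<integral>t. M \<partial>Lper)" unfolding c_def by (intro integral_mono integrable h)
  ultimately have c: "2 * pi * m \<le> c" "c \<le> 2 * pi * M" by simp_all
  moreover have c_pos: "0 < c" using c m by (smt (verit) mult_pos_pos pi_gt_zero)
  moreover have "m / (2 * pi * M) \<le> h t / c" "h t / c \<le> M / (2 * pi * m)" for t
    using h(2,3)[of t] c c_pos m by (auto intro!: frac_le)
  moreover have "(\<integral>t. 1 / c * h t \<partial>Lper) = 1" using c_pos by (simp add: c_def[symmetric])
  ultimately show ?thesis by (intro that[of c]) simp_all
qed

lemma separated_orbitals_parity_class: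
  assumes n_pos: "1 \<le> n" and W: "window_orbitals g s (2 * n) g' W' m M \<Lambda>"
  shows "separated_orbitals n (1 / (3 * real n * M)) (\<lambda>j. window_orbitals.orbital g s (2 * n) (2 * j + r))"
  unfolding separated_orbitals_def
proof (intro allI impI ballI)
  interpret window_orbitals g s "2 * n" g' W' m M \<Lambda> by (rule W)
  fix i j x y
  assume ij: "i < n" "j < n" "i \<noteq> j" and x: "orbital (2 * i + r) x \<noteq> 0" and y: "orbital (2 * j + r) y \<noteq> 0"
  have "window_radius (2 * n) \<le> distT (2 * pi * s x - 2 * pi * s y)"
    by (rule grid_class_arcs_separated[OF ij orbital_support orbital_support]) (use x y in auto)
  also have "\<dots> \<le> 2 * pi * M * distT (x - y)"
    using density_pos density_upper by (intro distT_coordinate_le) (simp add: less_imp_le)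
  finally show "1 / (3 * real n * M) \<le> distT (x - y)" using n_pos upper_pos by (simp add: window_radius_def field_simps)
qed

section \<open>Uniform bounds on dual potentials\<close>

context cost
begin

definition slater_bound :: "real \<Rightarrow> ((real \<Rightarrow> real) \<Rightarrow> real) \<Rightarrow> bool" where
  "slater_bound \<epsilon> V \<longleftrightarrow> (\<forall>\<phi> \<phi>' S. (\<forall>j<n. unit_orbital (\<phi> j) (\<phi>' j)) \<longrightarrow> disjoint_orbitals n \<phi> \<phi> \<longrightarrow> 0 \<le> S \<longrightarrow>
     (\<forall>x. (\<forall>j<n. x j \<in> Iper \<and> \<phi> j (x j) \<noteq> 0) \<longrightarrow> cN n w x \<le> ennreal S) \<longrightarrow>
     (\<Sum>j<n. V (\<lambda>t. (\<phi> j t)\<^sup>2)) \<le> \<epsilon> * (fact n * (\<Sum>j<n. \<integral>t. (\<phi>' j t)\<^sup>2 \<partial>Lper)) + S)"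

lemma slater_boundD_separated:
  assumes V: "slater_bound \<epsilon> V" and unit: "\<And>j. j < n \<Longrightarrow> unit_orbital (\<phi> j) (\<phi>' j)"
    and sep: "separated_orbitals n a \<phi>" and a: "0 < a"
    and S: "0 \<le> S" "\<And>x. (\<And>j. j < n \<Longrightarrow> x j \<in> Iper) \<Longrightarrow> (\<And>j. j < n \<Longrightarrow> \<phi> j (x j) \<noteq> 0) \<Longrightarrow> separated a x \<Longrightarrow> cN n w x \<le> ennreal S"
  shows "(\<Sum>j<n. V (\<lambda>t. (\<phi> j t)\<^sup>2)) \<le> \<epsilon> * (fact n * (\<Sum>j<n. \<integral>t. (\<phi>' j t)\<^sup>2 \<partial>Lper)) + S"
proof -
  have "cN n w x \<le> ennreal S" if "\<forall>j<n. x j \<in> Iper \<and> \<phi> j (x j) \<noteq> 0" for x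
    using that sep by (intro S(2)) (auto simp: separated_def separated_orbitals_def)
  then show ?thesis
    using V unit separated_orbitals_disjoint[OF sep a] S(1) unfolding slater_bound_def by blast
qed

lemma slater_bound_window_density_le:
  assumes W: "window_orbitals g s (2 * n) g' W' m M \<Lambda>" and \<epsilon>: "0 \<le> \<epsilon>" and V: "H1_linear V" "slater_bound \<epsilon> V"
    and S: "0 \<le> S" "\<And>x. (\<And>i. i < n \<Longrightarrow> x i \<in> Iper) \<Longrightarrow> separated (1 / (3 * real n * M)) x \<Longrightarrow> cN n w x \<le> ennreal S"
  shows "real n * V g
      \<le> \<epsilon> * (fact n * (real n * (window_orbitals.kinetic_constant (2 * n) m M \<Lambda> * (1 + (\<integral>t. (g' t)\<^sup>2 \<partial>Lper))))) + S"
proof -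
  interpret window_orbitals g s "2 * n" g' W' m M \<Lambda> by (rule W)
  let ?V = "\<lambda>i. V (\<lambda>t. (orbital i t)\<^sup>2)"
  define E where "E = \<epsilon> * (fact n * (real n * (kinetic_constant * (1 + (\<integral>t. (g' t)\<^sup>2 \<partial>Lper))))) + S"
  have class_le: "(\<Sum>j<n. ?V (2 * j + r)) \<le> E" if r: "r < 2" for r
  proof -
    have "(\<Sum>j<n. ?V (2 * j + r)) \<le> \<epsilon> * (fact n * (\<Sum>j<n. \<integral>t. (orbital_deriv (2 * j + r) t)\<^sup>2 \<partial>Lper)) + S"
      using n_pos upper_pos
      by (intro slater_boundD_separated[OF V(2) unit_orbital_window separated_orbitals_parity_class[OF n_pos W]] S) auto
    also have "\<dots> \<le> \<epsilon> * (fact n * (\<Sum>j<n. kinetic_constant * (1 + (\<integral>t. (g' t)\<^sup>2 \<partial>Lper)))) + S"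
      using \<epsilon> r by (intro add_right_mono mult_left_mono sum_mono orbital_kinetic_le) auto
    finally show ?thesis by (simp add: E_def)
  qed
  have "V g = V (\<lambda>t. \<Sum>i<2 * n. (1 / real (2 * n)) * (orbital i t)\<^sup>2)"
    using density_eq_mean_orbital_square by (intro arg_cong[where f = V]) blast
  also have "\<dots> = (\<Sum>i<2 * n. V (\<lambda>t. (1 / real (2 * n)) * (orbital i t)\<^sup>2))"
    by (intro conjunct2[OF H1_linear_sum[OF V(1)]] C1per_H1per[OF C1per_cmult[OF C1per_square[OF C1per_orbital]]]) simp
  also have "\<dots> = (\<Sum>i<2 * n. (1 / real (2 * n)) * ?V i)"
    by (intro sum.cong refl H1_linear_cmult[OF V(1)] C1per_H1per[OF C1per_square[OF C1per_orbital]])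
  also have "\<dots> = (1 / real (2 * n)) * (\<Sum>i<2 * n. if even i then ?V i else ?V i)" by (simp add: sum_distrib_left)
  also have "\<dots> = (1 / real (2 * n)) * ((\<Sum>j<n. ?V (2 * j)) + (\<Sum>j<n. ?V (2 * j + 1)))"
    by (simp only: sum_split_even_odd)
  finally have "2 * (real n * V g) = (\<Sum>j<n. ?V (2 * j)) + (\<Sum>j<n. ?V (2 * j + 1))" using n_pos by simp
  then show ?thesis using class_le[of 0] class_le[of 1] by (simp add: E_def)
qed

lemma slater_bound_density_le:
  assumes m: "0 < m" "m \<le> M" and R: "0 \<le> R"
  obtains B where "0 \<le> B" "\<And>\<epsilon> V g g'. 0 \<le> \<epsilon> \<Longrightarrow> \<epsilon> \<le> 1 \<Longrightarrow> H1_linear V \<Longrightarrow> slater_bound \<epsilon> V \<Longrightarrow> C1per g g' \<Longrightarrow>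
     (\<And>t. m \<le> g t) \<Longrightarrow> (\<And>t. g t \<le> M) \<Longrightarrow> (\<integral>t. g t \<partial>Lper) = 1 \<Longrightarrow> (\<integral>t. (g' t)\<^sup>2 \<partial>Lper) \<le> R \<Longrightarrow> V g \<le> B"
proof -
  have two_le: "2 \<le> 2 * n" using n_pos by simp
  obtain W' where W': "C1per (window (2 * n) 0) W'" using C1per_window[OF two_le] by blast
  obtain \<Lambda> where \<Lambda>: "\<And>t. \<bar>W' t\<bar> \<le> \<Lambda>" using C1per_bounded[OF W'] by metis
  obtain S where S: "0 \<le> S"
    "\<And>x. (\<And>i. i < n \<Longrightarrow> x i \<in> Iper) \<Longrightarrow> separated (1 / (3 * real n * M)) x \<Longrightarrow> cN n w x \<le> ennreal S"
    using cN_bounded_separated[of "1 / (3 * real n * M)"] n_pos m by auto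
  define K where "K = window_orbitals.kinetic_constant (2 * n) m M \<Lambda>"
  define B where "B = fact n * (real n * (\<bar>K\<bar> * (1 + R))) + S"
  have B_nonneg: "0 \<le> B" using R S(1) by (simp add: B_def)
  show ?thesis
  proof (rule that[OF B_nonneg])
    fix \<epsilon> V g g'
    assume \<epsilon>: "0 \<le> \<epsilon>" "\<epsilon> \<le> 1" and V: "H1_linear V" "slater_bound \<epsilon> V" and g: "C1per g g'"
      "\<And>t. m \<le> g t" "\<And>t. g t \<le> M" "(\<integral>t. g t \<partial>Lper) = 1" and kinetic: "(\<integral>t. (g' t)\<^sup>2 \<partial>Lper) \<le> R"
    obtain s where windows: "window_orbitals g s (2 * n) g' W' m M \<Lambda>"
      using window_orbitals_exist[OF two_le g W' \<Lambda> m(1)] by blast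
    interpret window_orbitals g s "2 * n" g' W' m M \<Lambda> by (rule windows)
    have "\<epsilon> * (fact n * (real n * (K * (1 + (\<integral>t. (g' t)\<^sup>2 \<partial>Lper))))) \<le> 1 * (fact n * (real n * (\<bar>K\<bar> * (1 + R))))"
      using \<epsilon> kinetic_constant_nonneg kinetic unfolding K_def[symmetric] by (intro mult_mono add_mono) auto
    moreover have "real n * V g \<le> \<epsilon> * (fact n * (real n * (K * (1 + (\<integral>t. (g' t)\<^sup>2 \<partial>Lper))))) + S"
      unfolding K_def by (rule slater_bound_window_density_le[OF windows \<epsilon>(1) V S(1)]) (rule S(2))
    ultimately have "real n * V g \<le> B" unfolding B_def by linarith
    moreover have "V g \<le> real n * V g" if "0 < V g" using that n_pos by simp
    ultimately show "V g \<le> B" using B_nonneg by linarith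
  qed
qed

lemma slater_bound_positive_function_le:
  assumes m: "0 < m" "m \<le> M" and R: "0 \<le> R"
  obtains B where "0 \<le> B" "\<And>\<epsilon> V h h'. 0 \<le> \<epsilon> \<Longrightarrow> \<epsilon> \<le> 1 \<Longrightarrow> H1_linear V \<Longrightarrow> slater_bound \<epsilon> V \<Longrightarrow> C1per h h' \<Longrightarrow>
     (\<And>t. m \<le> h t) \<Longrightarrow> (\<And>t. h t \<le> M) \<Longrightarrow> (\<integral>t. (h' t)\<^sup>2 \<partial>Lper) \<le> R \<Longrightarrow> V h \<le> B"
proof -
  define m\<^sub>1 where "m\<^sub>1 = m / (2 * pi * M)"
  define M\<^sub>1 where "M\<^sub>1 = M / (2 * pi * m)"
  have bounds: "0 < m\<^sub>1" "m\<^sub>1 \<le> M\<^sub>1" "0 \<le> R / (2 * pi * m)\<^sup>2"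
    using m R unfolding m\<^sub>1_def M\<^sub>1_def by (simp_all add: frac_le)
  obtain B where B: "0 \<le> B" "\<And>\<epsilon> V g g'. 0 \<le> \<epsilon> \<Longrightarrow> \<epsilon> \<le> 1 \<Longrightarrow> H1_linear V \<Longrightarrow> slater_bound \<epsilon> V \<Longrightarrow> C1per g g' \<Longrightarrow>
     (\<And>t. m\<^sub>1 \<le> g t) \<Longrightarrow> (\<And>t. g t \<le> M\<^sub>1) \<Longrightarrow> (\<integral>t. g t \<partial>Lper) = 1 \<Longrightarrow>
     (\<integral>t. (g' t)\<^sup>2 \<partial>Lper) \<le> R / (2 * pi * m)\<^sup>2 \<Longrightarrow> V g \<le> B"
    using slater_bound_density_le[OF bounds] by auto
  show ?thesis
  proof (rule that[of "2 * pi * M * B"])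
    show "0 \<le> 2 * pi * M * B" using B(1) m by simp
    fix \<epsilon> V h h'
    assume \<epsilon>: "0 \<le> \<epsilon>" "\<epsilon> \<le> 1" and V: "H1_linear V" "slater_bound \<epsilon> V" and h: "C1per h h'"
      and h_bounds: "\<And>t. m \<le> h t" "\<And>t. h t \<le> M" and kinetic: "(\<integral>t. (h' t)\<^sup>2 \<partial>Lper) \<le> R"
    obtain c where c: "2 * pi * m \<le> c" "c \<le> 2 * pi * M" and mass: "(\<integral>t. 1 / c * h t \<partial>Lper) = 1"
      and g_bounds: "\<And>t. m\<^sub>1 \<le> 1 / c * h t" "\<And>t. 1 / c * h t \<le> M\<^sub>1"
      using normalised_density_bounds[OF h h_bounds m(1)] unfolding m\<^sub>1_def M\<^sub>1_def by metis
    have c_pos: "0 < c" using c(1) m by (smt (verit) mult_pos_pos pi_gt_zero)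
    let ?g = "\<lambda>t. 1 / c * h t" and ?g' = "\<lambda>t. 1 / c * h' t"
    have "(1 / c)\<^sup>2 * (\<integral>t. (h' t)\<^sup>2 \<partial>Lper) \<le> (1 / (2 * pi * m))\<^sup>2 * R"
      using c m c_pos kinetic R by (intro mult_mono power_mono divide_left_mono) auto
    then have "(\<integral>t. (?g' t)\<^sup>2 \<partial>Lper) \<le> R / (2 * pi * m)\<^sup>2" by (simp add: power_mult_distrib power_divide)
    then have "V ?g \<le> B" by (rule B(2)[OF \<epsilon> V C1per_cmult[OF h] g_bounds mass])
    then have "c * V ?g \<le> c * B" using c_pos by (intro mult_left_mono) auto
    moreover have "V h = c * V ?g" using H1_linear_cmult[OF V(1) C1per_H1per[OF h], of "1 / c"] c_pos by simp
    ultimately have "V h \<le> c * B" by (simp only:)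
    also have "\<dots> \<le> 2 * pi * M * B" using c B(1) by (intro mult_right_mono)
    finally show "V h \<le> 2 * pi * M * B" .
  qed
qed

theorem slater_bound_uniform_dual_bound:
  assumes \<rho>: "Dper \<rho>"
  obtains C where "\<And>\<epsilon> V. 0 \<le> \<epsilon> \<Longrightarrow> \<epsilon> \<le> 1 \<Longrightarrow> Hminus V \<Longrightarrow> slater_bound \<epsilon> V \<Longrightarrow> 0 \<le> V \<rho> \<Longrightarrow> H1_dual_le C V"
proof -
  obtain g T T' m M where approx: "h1_approx \<rho> g T T'" and m: "0 < m" and T: "\<And>k t. m \<le> T k t" "\<And>k t. T k t \<le> M"
    using Dper_approx[OF \<rho>] by metis
  obtain R where R: "\<And>k. h1norm (T k) (T' k) \<le> R" using h1_approx_bounded[OF approx] by metis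
  define \<delta> where "\<delta> = m / 4"
  have \<delta>: "0 < \<delta>" using m by (simp add: \<delta>_def)
  have "m / 2 \<le> M + m / 2" using m T[of 0 0] by simp
  then obtain B where B: "0 \<le> B" "\<And>\<epsilon> V h h'. 0 \<le> \<epsilon> \<Longrightarrow> \<epsilon> \<le> 1 \<Longrightarrow> H1_linear V \<Longrightarrow> slater_bound \<epsilon> V \<Longrightarrow> C1per h h' \<Longrightarrow>
     (\<And>t. m / 2 \<le> h t) \<Longrightarrow> (\<And>t. h t \<le> M + m / 2) \<Longrightarrow> (\<integral>t. (h' t)\<^sup>2 \<partial>Lper) \<le> (2 * R + 2 * \<delta>)\<^sup>2 \<Longrightarrow> V h \<le> B"
    using slater_bound_positive_function_le[of "m / 2" "M + m / 2" "(2 * R + 2 * \<delta>)\<^sup>2"] m by auto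
  show ?thesis
  proof (rule that[of "2 * (B / \<delta>)"], rule H1_dual_leI_C1per)
    fix \<epsilon> V f f'
    assume \<epsilon>: "0 \<le> \<epsilon>" "\<epsilon> \<le> 1" and V: "Hminus V" "slater_bound \<epsilon> V" "0 \<le> V \<rho>" and f: "C1per f f'" "h1norm f f' \<le> 1"
    note lin = Hminus_H1_linear[OF V(1)] and T_C1 = h1_approx_C1per[OF approx]
    have "V (T k) + \<delta> * V f \<le> B" for k
    proof -
      let ?h = "\<lambda>t. T k t - (- \<delta>) * f t" and ?h' = "\<lambda>t. T' k t - (- \<delta>) * f' t"
      have h: "C1per ?h ?h'" by (intro C1per_diff C1per_cmult T_C1 f)
      have perturbation: "\<bar>\<delta> * f t\<bar> \<le> m / 2" for t
        using mult_left_mono[of "\<bar>f t\<bar>" 2 \<delta>] C1per_abs_le_h1norm[OF f(1), of t] f(2) \<delta> by (simp add: abs_mult \<delta>_def)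
      have h_bounds: "m / 2 \<le> ?h t" "?h t \<le> M + m / 2" for t
        using T[of k t] perturbation[of t] unfolding abs_le_iff by (simp_all add: field_simps)
      have "h1norm ?h ?h' \<le> 2 * h1norm (T k) (T' k) + 2 * h1norm (\<lambda>t. (- \<delta>) * f t) (\<lambda>t. (- \<delta>) * f' t)"
        by (intro h1norm_diff_le L2per_continuous continuous_intros C1per_continuous[OF T_C1] C1per_continuous[OF f(1)])
      also have "\<dots> \<le> 2 * R + 2 * \<delta>"
        unfolding h1norm_cmult using R[of k] \<delta> f(2) by (intro add_mono mult_left_mono) (simp_all add: mult_left_le)
      finally have "(h1norm ?h ?h')\<^sup>2 \<le> (2 * R + 2 * \<delta>)\<^sup>2" by (intro power_mono) auto
      then have "(\<integral>t. (?h' t)\<^sup>2 \<partial>Lper) \<le> (2 * R + 2 * \<delta>)\<^sup>2"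
        by (rule order_trans[OF integral_square_le_h1norm(2)])
      then have "V ?h \<le> B" by (rule B(2)[OF \<epsilon> lin V(2) h h_bounds])
      then show ?thesis
        using H1_linear_diff[OF lin C1per_H1per[OF T_C1] C1per_H1per[OF C1per_cmult[OF f(1)]], of k "- \<delta>"]
          H1_linear_cmult[OF lin C1per_H1per[OF f(1)], of "- \<delta>"] by simp
    qed
    moreover have "(\<lambda>k. V (T k) + \<delta> * V f) \<longlonglongrightarrow> V \<rho> + \<delta> * V f"
      by (intro tendsto_intros Hminus_h1_approx_tendsto[OF V(1) approx])
    ultimately have "V \<rho> + \<delta> * V f \<le> B" by (intro LIMSEQ_le_const2) auto
    then show "V f \<le> B / \<delta>" using V(3) \<delta> by (simp add: field_simps)
  qed (use B \<delta> in auto)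
qed

lemma slater_bound_limit:
  assumes V: "\<And>j. slater_bound (\<epsilon> j) (V j)" and \<epsilon>: "\<epsilon> \<longlonglongrightarrow> 0"
    and lim: "\<And>f. H1per f \<Longrightarrow> (\<lambda>j::nat. V j f) \<longlonglongrightarrow> W f"
  shows "slater_bound 0 W"
  unfolding slater_bound_def
proof (intro allI impI)
  fix \<phi> \<phi>' S
  assume unit: "\<forall>j<n. unit_orbital (\<phi> j) (\<phi>' j)" and disjoint: "disjoint_orbitals n \<phi> \<phi>" and S: "0 \<le> S"
    and cost: "\<forall>x. (\<forall>j<n. x j \<in> Iper \<and> \<phi> j (x j) \<noteq> 0) \<longrightarrow> cN n w x \<le> ennreal S"
  let ?K = "fact n * (\<Sum>j<n. \<integral>t. (\<phi>' j t)\<^sup>2 \<partial>Lper)"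
  have "(\<Sum>j<n. V i (\<lambda>t. (\<phi> j t)\<^sup>2)) \<le> \<epsilon> i * ?K + S" for i
    using V[of i] unit disjoint S cost unfolding slater_bound_def by blast
  moreover have "(\<lambda>i. \<Sum>j<n. V i (\<lambda>t. (\<phi> j t)\<^sup>2)) \<longlonglongrightarrow> (\<Sum>j<n. W (\<lambda>t. (\<phi> j t)\<^sup>2))"
    using unit by (intro tendsto_sum lim C1per_H1per[OF C1per_square[OF unit_orbitalD(1)]]) auto
  moreover have "(\<lambda>i. \<epsilon> i * ?K + S) \<longlonglongrightarrow> 0 * ?K + S" by (intro tendsto_intros \<epsilon>)
  ultimately show "(\<Sum>j<n. W (\<lambda>t. (\<phi> j t)\<^sup>2)) \<le> 0 * ?K + S" by (intro LIMSEQ_le) auto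
qed

end

section \<open>Maximal feasible potentials\<close>

lemma distT_shift_int: "distT (t + 2 * pi * of_int k) = distT t"
  by (rule periodic_shift_int) (simp add: distT_arccos)

lemma chain_near_Sup:
  fixes C :: "('a \<Rightarrow> real) set"
  assumes total: "\<And>f h. f \<in> C \<Longrightarrow> h \<in> C \<Longrightarrow> f \<le> h \<or> h \<le> f" and "C \<noteq> {}" and "0 < e"
  shows "\<exists>m\<in>C. \<forall>i<(n::nat). Sup ((\<lambda>f. f (x i)) ` C) < m (x i) + e"
proof (induction n)
  case 0
  then show ?case using \<open>C \<noteq> {}\<close> by blast
next
  case (Suc n)
  then obtain m where m: "m \<in> C" "\<And>i. i < n \<Longrightarrow> Sup ((\<lambda>f. f (x i)) ` C) < m (x i) + e" by blast
  have "Sup ((\<lambda>f. f (x n)) ` C) - e < Sup ((\<lambda>f. f (x n)) ` C)" using \<open>0 < e\<close> by simp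
  then obtain y where "y \<in> (\<lambda>f. f (x n)) ` C" "Sup ((\<lambda>f. f (x n)) ` C) - e < y"
    using less_cSupE[of _ "(\<lambda>f. f (x n)) ` C"] \<open>C \<noteq> {}\<close> by blast
  then obtain h where h: "h \<in> C" "Sup ((\<lambda>f. f (x n)) ` C) < h (x n) + e" by (auto simp only: diff_less_eq image_iff)
  from total[OF m(1) h(1)] show ?case
  proof
    assume "m \<le> h"
    then have "Sup ((\<lambda>f. f (x i)) ` C) < h (x i) + e" if "i < Suc n" for i
      using that m(2)[of i] h(2) le_funD[of m h "x i"] by (cases "i = n") auto
    then show ?thesis using h(1) by blast
  next
    assume "h \<le> m"
    then have "Sup ((\<lambda>f. f (x i)) ` C) < m (x i) + e" if "i < Suc n" for i
      using that m(2)[of i] h(2) le_funD[of h m "x i"] by (cases "i = n") auto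
    then show ?thesis using m(1) by blast
  qed
qed

context cost
begin

definition configurations :: "(nat \<Rightarrow> real) set" where
  "configurations = {x. (\<forall>i<n. x i \<in> Iper) \<and> (\<forall>i<n. \<forall>j<n. i \<noteq> j \<longrightarrow> 0 < distT (x i - x j))}"

lemma configuration_in_Iper: "x \<in> configurations \<Longrightarrow> i < n \<Longrightarrow> x i \<in> Iper"
  by (simp add: configurations_def)

lemma configuration_inj: "x \<in> configurations \<Longrightarrow> i < n \<Longrightarrow> j < n \<Longrightarrow> i \<noteq> j \<Longrightarrow> x i \<noteq> x j"
  using distT_le_abs[of 0] by (fastforce simp: configurations_def)

lemma configuration_separated:
  assumes "x \<in> configurations" obtains a where "0 < a" "separated a x"
proof -
  define P where "P = {p \<in> {..<n} \<times> {..<n}. fst p \<noteq> snd p}"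
  have P_finite: "finite P" unfolding P_def by auto
  let ?f = "\<lambda>p. distT (x (fst p) - x (snd p))"
  let ?a = "Min (insert 1 (?f ` P))"
  have "?a \<in> insert 1 (?f ` P)" using P_finite by (intro Min_in) auto
  then have "0 < ?a" using assms by (auto simp: configurations_def P_def)
  moreover have "separated ?a x" unfolding separated_def
  proof (intro allI impI)
    fix i j assume "i < n" "j < n" "i \<noteq> j"
    then have pair: "(i, j) \<in> P" by (simp add: P_def)
    have "?a \<le> ?f (i, j)" using P_finite by (intro Min_le[OF _ insertI2[OF imageI[OF pair]]]) simp
    then show "?a \<le> distT (x i - x j)" by simp
  qed
  ultimately show ?thesis by (rule that)
qed

lemma separated_configuration: "(\<And>i. i < n \<Longrightarrow> x i \<in> Iper) \<Longrightarrow> separated a x \<Longrightarrow> 0 < a \<Longrightarrow> x \<in> configurations"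
  by (auto simp: configurations_def separated_def intro: less_le_trans)

lemma cN_configuration: assumes "x \<in> configurations" shows "cN n w x = ennreal (real_cost x)"
  by (rule configuration_separated[OF assms]) (auto intro: cN_eq_real_cost configuration_in_Iper[OF assms])

lemma separated_if_cost_bounded:
  obtains a where "0 < a" "\<And>x. x \<in> configurations \<Longrightarrow> real_cost x \<le> C \<Longrightarrow> separated a x"
proof -
  obtain a where a: "0 < a" "\<And>x. (\<And>i. i < n \<Longrightarrow> x i \<in> Iper) \<Longrightarrow> cN n w x \<le> ennreal C \<Longrightarrow> separated a x"
    using separated_if_cN_bounded[of C] by blast
  show ?thesis
    by (rule that[OF a(1)]) (intro a(2) configuration_in_Iper, simp_all add: cN_configuration ennreal_leI)
qed

lemma real_cost_nonneg: "0 \<le> real_cost x" unfolding real_cost_def by (intro sum_nonneg) auto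

lemma cN_eq_top: assumes "\<And>i. i < n \<Longrightarrow> x i \<in> Iper" "x \<notin> configurations" shows "cN n w x = top"
proof -
  obtain i j where ij: "i < n" "j < n" "i \<noteq> j" "\<not> 0 < distT (x i - x j)" using assms by (auto simp: configurations_def)
  then have "distT (x i - x j) = 0" using distT_nonneg[of "x i - x j"] by linarith
  then have "w (x i, x j) = top" using w_eq_top_iff assms(1) ij by auto
  then show ?thesis using w_le_cN[OF ij(1,2,3), of x] by (simp add: top_unique)
qed

definition dual_feasible :: "(real \<Rightarrow> real) \<Rightarrow> bool" where
  "dual_feasible u \<longleftrightarrow> (\<forall>x\<in>configurations. (\<Sum>i<n. u (x i)) \<le> real_cost x)"

lemma dual_feasibleD: "dual_feasible u \<Longrightarrow> x \<in> configurations \<Longrightarrow> (\<Sum>i<n. u (x i)) \<le> real_cost x"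
  by (simp add: dual_feasible_def)

lemma dual_feasible_cong: "(\<And>t. t \<in> Iper \<Longrightarrow> u t = v t) \<Longrightarrow> dual_feasible u \<longleftrightarrow> dual_feasible v"
  unfolding dual_feasible_def
  by (intro ball_cong refl arg_cong2[where f = "(\<le>)"] sum.cong) (auto intro: configuration_in_Iper)

lemma sum_fun_upd:
  assumes "i < n" shows "(\<Sum>j<n. u ((x(i := s)) j)) = (\<Sum>j<n. u (x j)) - u (x i) + (u s :: real)"
proof -
  have "(\<Sum>j<n. u ((x(i := s)) j)) = u s + (\<Sum>j\<in>{..<n} - {i}. u (x j))"
    using assms by (subst sum.remove[of _ i]) auto
  moreover have "(\<Sum>j<n. u (x j)) = u (x i) + (\<Sum>j\<in>{..<n} - {i}. u (x j))" using assms by (subst sum.remove[of _ i]) auto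
  ultimately show ?thesis by simp
qed

subsection \<open>Upper bounds for feasible potentials\<close>

lemma separated_tuple_through:
  assumes t: "t \<in> Iper"
  obtains x where "x 0 = t" "\<And>i. x i \<in> Iper" "separated (2 * pi / real n) x"
proof -
  have "\<exists>y\<in>Iper. (\<exists>k::int. y = t + grid_point (2 * n) (2 * i) + 2 * pi * of_int k) \<and> (i = 0 \<longrightarrow> y = t)" for i
  proof (cases "i = 0")
    case True
    then show ?thesis using t by (intro bexI[of _ t]) (auto simp: grid_point_def intro: exI[of _ 0])
  next
    case False
    then show ?thesis using shift_into_Iper[of "t + grid_point (2 * n) (2 * i)"] by auto
  qed
  then obtain x where x: "\<And>i. x i \<in> Iper" "x 0 = t"
    "\<And>i. \<exists>k::int. x i = t + grid_point (2 * n) (2 * i) + 2 * pi * of_int k" by metis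
  have "separated (2 * pi / real n) x" unfolding separated_def
  proof (intro allI impI)
    fix i j assume ij: "i < n" "j < n" "i \<noteq> j"
    obtain k l where "x i = t + grid_point (2 * n) (2 * i) + 2 * pi * of_int k"
      "x j = t + grid_point (2 * n) (2 * j) + 2 * pi * of_int l"
      using x(3) by metis
    then have "x i - x j = (grid_point (2 * n) (2 * i) - grid_point (2 * n) (2 * j)) + 2 * pi * of_int (k - l)"
      by (simp add: algebra_simps)
    then have "distT (x i - x j) = distT (grid_point (2 * n) (2 * i) - grid_point (2 * n) (2 * j))"
      by (simp only: distT_shift_int)
    then show "2 * pi / real n \<le> distT (x i - x j)" using grid_class_distT_ge[OF ij, of 0] by simp
  qed
  then show ?thesis using that x by blast
qed

lemma dual_feasible_upper_bound:
  obtains S where "0 \<le> S" "\<And>u M t. dual_feasible u \<Longrightarrow> (\<And>s. s \<in> Iper \<Longrightarrow> - M \<le> u s) \<Longrightarrow>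
      0 \<le> M \<Longrightarrow> t \<in> Iper \<Longrightarrow> u t \<le> S + real n * M"
proof -
  have a: "0 < 2 * pi / real n" using n_pos by simp
  obtain S where S: "0 \<le> S" "\<And>x. (\<And>i. i < n \<Longrightarrow> x i \<in> Iper) \<Longrightarrow> separated (2 * pi / real n) x \<Longrightarrow> cN n w x \<le> ennreal S"
    using cN_bounded_separated[OF a] by blast
  show ?thesis
  proof (rule that[OF S(1)])
    fix u M t assume u: "dual_feasible u" "\<And>s. s \<in> Iper \<Longrightarrow> - M \<le> u s" and M: "0 \<le> M" and t: "t \<in> Iper"
    obtain x where x: "x 0 = t" "\<And>i. x i \<in> Iper" "separated (2 * pi / real n) x"
      using separated_tuple_through[OF t] by blast
    have config: "x \<in> configurations" by (rule separated_configuration[OF x(2,3) a])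
    have "ennreal (real_cost x) \<le> ennreal S" using S(2)[OF x(2,3)] cN_configuration[OF config] by simp
    then have "(\<Sum>i<n. u (x i)) \<le> S" using dual_feasibleD[OF u(1) config] S(1) by (simp add: ennreal_le_iff)
    moreover have "(\<Sum>i<n. u (x i)) = u t + (\<Sum>i\<in>{..<n} - {0}. u (x i))"
      using n_pos x(1) by (subst sum.remove[of _ 0]) auto
    moreover have "- (real n * M) \<le> (\<Sum>i\<in>{..<n} - {0}. - M)"
      using M n_pos by (simp add: card_Diff_singleton mult_right_mono)
    moreover have "(\<Sum>i\<in>{..<n} - {0}. - M) \<le> (\<Sum>i\<in>{..<n} - {0}. u (x i))" using u(2) x(2) by (intro sum_mono) auto
    ultimately show "u t \<le> S + real n * M" by linarith
  qed
qed

subsection \<open>Existence and continuity of maximal potentials\<close>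

definition dominating_potentials :: "(real \<Rightarrow> real) \<Rightarrow> (real \<Rightarrow> real) set" where
  "dominating_potentials v = {u. dual_feasible u \<and> (\<forall>t\<in>Iper. v t \<le> u t) \<and> (\<forall>t. t \<notin> Iper \<longrightarrow> u t = 0)}"

lemma dominating_potentialsD:
  assumes "u \<in> dominating_potentials v"
  shows "dual_feasible u" "t \<in> Iper \<Longrightarrow> v t \<le> u t" "t \<notin> Iper \<Longrightarrow> u t = 0"
  using assms by (auto simp: dominating_potentials_def)

lemma chain_Sup_dominating:
  assumes sub: "C \<subseteq> dominating_potentials v" and "C \<noteq> {}" and total: "\<And>a b. a \<in> C \<Longrightarrow> b \<in> C \<Longrightarrow> a \<le> b \<or> b \<le> a"
    and bound: "\<And>a t. a \<in> C \<Longrightarrow> t \<in> Iper \<Longrightarrow> a t \<le> B"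
  shows "\<exists>u\<in>dominating_potentials v. \<forall>a\<in>C. a \<le> u"
proof -
  define u where "u = (\<lambda>t. if t \<in> Iper then Sup ((\<lambda>a. a t) ` C) else 0)"
  have upper: "a t \<le> u t" if "a \<in> C" for a t
  proof (cases "t \<in> Iper")
    case True
    have "bdd_above ((\<lambda>a. a t) ` C)" using bound True by (intro bdd_aboveI[of _ B]) auto
    then show ?thesis unfolding u_def using that True by (auto intro: cSup_upper)
  next
    case False then show ?thesis using that sub by (auto simp: u_def dominating_potentialsD(3))
  qed
  have "dual_feasible u" unfolding dual_feasible_def
  proof (intro ballI, rule field_le_epsilon)
    fix x e assume x: "x \<in> configurations" and e: "(0::real) < e"
    have "0 < e / real n" using e n_pos by simp
    then obtain m where m: "m \<in> C" "\<And>i. i < n \<Longrightarrow> Sup ((\<lambda>a. a (x i)) ` C) < m (x i) + e / real n"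
      using chain_near_Sup[OF total \<open>C \<noteq> {}\<close>] by blast
    have "(\<Sum>i<n. u (x i)) \<le> (\<Sum>i<n. m (x i) + e / real n)"
      using m(2) configuration_in_Iper[OF x] by (intro sum_mono) (auto simp: u_def intro: less_imp_le)
    also have "\<dots> = (\<Sum>i<n. m (x i)) + e" using n_pos by (simp add: sum.distrib)
    also have "\<dots> \<le> real_cost x + e" using dual_feasibleD[OF dominating_potentialsD(1) x] m(1) sub by auto
    finally show "(\<Sum>i<n. u (x i)) \<le> real_cost x + e" .
  qed
  moreover have "v t \<le> u t" if "t \<in> Iper" for t
    using \<open>C \<noteq> {}\<close> sub upper dominating_potentialsD(2)[OF _ that] by (meson ex_in_conv order_trans subset_iff)
  ultimately show ?thesis using upper by (auto simp: dominating_potentials_def u_def le_fun_def)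
qed

lemma dominating_potentials_bounded:
  assumes v: "\<And>t. t \<in> Iper \<Longrightarrow> - M \<le> v t" and M: "0 \<le> M"
  shows "\<exists>B. \<forall>u\<in>dominating_potentials v. \<forall>t\<in>Iper. u t \<le> B"
proof -
  obtain S where S: "\<And>u t. dual_feasible u \<Longrightarrow> (\<And>s. s \<in> Iper \<Longrightarrow> - M \<le> u s) \<Longrightarrow> t \<in> Iper \<Longrightarrow> u t \<le> S + real n * M"
    using dual_feasible_upper_bound M by metis
  show ?thesis
  proof (intro exI ballI)
    fix u t assume u: "u \<in> dominating_potentials v" and t: "t \<in> Iper"
    have "- M \<le> u s" if "s \<in> Iper" for s using v[OF that] dominating_potentialsD(2)[OF u that] by linarith
    then show "u t \<le> S + real n * M" by (rule S[OF dominating_potentialsD(1)[OF u] _ t])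
  qed
qed

lemma exists_maximal_potential:
  assumes v: "dual_feasible v" "\<And>t. t \<in> Iper \<Longrightarrow> - M \<le> v t" and M: "0 \<le> M"
  obtains u where "u \<in> dominating_potentials v" "\<And>a. a \<in> dominating_potentials v \<Longrightarrow> u \<le> a \<Longrightarrow> a = u"
proof -
  let ?U = "dominating_potentials v"
  have "\<exists>B. \<forall>u\<in>?U. \<forall>t\<in>Iper. u t \<le> B" by (rule dominating_potentials_bounded[OF _ M]) (rule v(2))
  then obtain B where B: "\<And>u t. u \<in> ?U \<Longrightarrow> t \<in> Iper \<Longrightarrow> u t \<le> B" by blast
  have "(\<lambda>t. if t \<in> Iper then v t else 0) \<in> ?U"
    using v(1) dual_feasible_cong[of "\<lambda>t. if t \<in> Iper then v t else 0" v] by (simp add: dominating_potentials_def)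
  then have nonempty: "?U \<noteq> {}" by blast
  have "\<exists>u\<in>?U. \<forall>a\<in>?U. u \<le> a \<longrightarrow> a = u"
  proof (rule predicate_Zorn)
    show "partial_order_on ?U (relation_of (\<le>) ?U)" by (rule partial_order_on_relation_ofI) auto
    fix C assume chain: "C \<in> Chains (relation_of (\<le>) ?U)"
    then have sub: "C \<subseteq> ?U" by (auto simp: Chains_def relation_of_def)
    have total: "a \<le> b \<or> b \<le> a" if "a \<in> C" "b \<in> C" for a b
      using chain that by (auto simp: Chains_def relation_of_def)
    show "\<exists>u\<in>?U. \<forall>a\<in>C. a \<le> u"
    proof (cases "C = {}")
      case True then show ?thesis using nonempty by blast
    next
      case False then show ?thesis using total B sub by (intro chain_Sup_dominating[of C v B]) blast+
    qed
  qed
  then show ?thesis using that by blast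
qed

lemma maximal_potential_active:
  assumes u: "u \<in> dominating_potentials v" and max: "\<And>a. a \<in> dominating_potentials v \<Longrightarrow> u \<le> a \<Longrightarrow> a = u"
    and t: "t \<in> Iper" and e: "0 < e"
  shows "\<exists>x\<in>configurations. \<exists>i<n. x i = t \<and> real_cost x - e < (\<Sum>j<n. u (x j))"
proof (rule ccontr)
  assume "\<not> ?thesis"
  then have slack: "(\<Sum>j<n. u (x j)) \<le> real_cost x - e" if "x \<in> configurations" "i < n" "x i = t"
    for x i using that by force
  define u' where "u' = u(t := u t + e)"
  have "dual_feasible u'" unfolding dual_feasible_def
  proof
    fix x assume x: "x \<in> configurations"
    show "(\<Sum>i<n. u' (x i)) \<le> real_cost x"
    proof (cases "\<exists>i<n. x i = t")
      case False
      then have "(\<Sum>i<n. u' (x i)) = (\<Sum>i<n. u (x i))" by (intro sum.cong) (auto simp: u'_def)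
      then show ?thesis using dual_feasibleD[OF dominating_potentialsD(1)[OF u] x] by simp
    next
      case True
      then obtain i where i: "i < n" "x i = t" by blast
      have "(\<Sum>j<n. u' (x j)) = (\<Sum>j<n. u (x j) + (if j = i then e else 0))"
        using configuration_inj[OF x _ i(1)] i by (intro sum.cong) (auto simp: u'_def)
      also have "\<dots> = (\<Sum>j<n. u (x j)) + e" using i(1) by (simp add: sum.distrib)
      also have "\<dots> \<le> real_cost x" using slack[OF x i] by simp
      finally show ?thesis .
    qed
  qed
  then have "u' \<in> dominating_potentials v"
    using dominating_potentialsD[OF u] t e unfolding dominating_potentials_def
    by (auto simp: u'_def intro: add_increasing2)
  moreover have "u \<le> u'" using e by (auto simp: le_fun_def u'_def)
  ultimately have "u' t = u t" using max by blast
  then show False using e by (simp add: u'_def)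
qed

lemma continuous_on_if_active:
  assumes u: "dual_feasible u" "\<And>t. t \<in> Iper \<Longrightarrow> u t \<le> B"
    and active: "\<And>t e. t \<in> Iper \<Longrightarrow> 0 < e \<Longrightarrow> \<exists>x\<in>configurations. \<exists>i<n. x i = t \<and> real_cost x - e < (\<Sum>j<n. u (x j))"
  shows "continuous_on Iper u"
  unfolding continuous_on_iff
proof (intro ballI allI impI)
  fix t\<^sub>0 e\<^sub>0 :: real assume t\<^sub>0: "t\<^sub>0 \<in> Iper" and e\<^sub>0: "0 < e\<^sub>0"
  define e where "e = min 1 (e\<^sub>0 / 3)"
  have e: "0 < e" "e \<le> 1" "3 * e \<le> e\<^sub>0" using e\<^sub>0 by (auto simp: e_def)
  obtain a where a: "0 < a" "\<And>x. x \<in> configurations \<Longrightarrow> real_cost x \<le> real n * B + 1 \<Longrightarrow> separated a x"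
    using separated_if_cost_bounded[of "real n * B + 1"] by blast
  obtain d where d: "0 < d" "\<And>x y. (\<And>i. i < n \<Longrightarrow> x i \<in> Iper) \<Longrightarrow> (\<And>i. i < n \<Longrightarrow> y i \<in> Iper) \<Longrightarrow> separated a x \<Longrightarrow>
     (\<And>i. i < n \<Longrightarrow> \<bar>y i - x i\<bar> < d) \<Longrightarrow> separated (a/2) y \<and> \<bar>real_cost y - real_cost x\<bar> < e"
    using real_cost_uniformly_continuous_separated[OF a(1) e(1)] by blast
  have one_sided: "u s - u t < 2 * e" if t: "t \<in> Iper" and s: "s \<in> Iper" and close: "\<bar>s - t\<bar> < d" for s t
  proof -
    obtain x i where x: "x \<in> configurations" "i < n" "x i = t" "real_cost x - e < (\<Sum>j<n. u (x j))"
      using active[OF t e(1)] by blast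
    note x_Iper = configuration_in_Iper[OF x(1)]
    have "(\<Sum>j<n. u (x j)) \<le> (\<Sum>j<n. B)" using u(2) x_Iper by (intro sum_mono) auto
    then have sep: "separated a x" using x(4) e(2) by (intro a(2) x(1)) simp
    have y_Iper: "(x(i := s)) j \<in> Iper" if "j < n" for j using x_Iper[OF that] s by simp
    have "\<bar>(x(i := s)) j - x j\<bar> < d" for j using close d(1) x(3) by simp
    then have y: "separated (a/2) (x(i := s)) \<and> \<bar>real_cost (x(i := s)) - real_cost x\<bar> < e"
      by (intro d(2) x_Iper y_Iper sep)
    then have "x(i := s) \<in> configurations" using a(1) y_Iper by (intro separated_configuration[where a = "a/2"]) auto
    then have "(\<Sum>j<n. u (x j)) - u (x i) + u s \<le> real_cost (x(i := s))"
      using dual_feasibleD[OF u(1)] sum_fun_upd[OF x(2), of u x s] by metis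
    then show ?thesis using y x(4) unfolding x(3) abs_less_iff by linarith
  qed
  show "\<exists>d>0. \<forall>s\<in>Iper. dist s t\<^sub>0 < d \<longrightarrow> dist (u s) (u t\<^sub>0) < e\<^sub>0"
  proof (intro exI[of _ d] conjI ballI impI d(1))
    fix s assume s: "s \<in> Iper" "dist s t\<^sub>0 < d"
    have "u s - u t\<^sub>0 < 2 * e" "u t\<^sub>0 - u s < 2 * e"
      using one_sided[OF t\<^sub>0 s(1)] one_sided[OF s(1) t\<^sub>0] s(2) by (auto simp: dist_real_def abs_minus_commute)
    then show "dist (u s) (u t\<^sub>0) < e\<^sub>0" using e unfolding dist_real_def abs_less_iff by linarith
  qed
qed

text \<open>A maximal feasible potential is c-conjugate: at every point the constraint is nearly active along some
  configuration, where the point occurs only once because the cost is infinite on the diagonal.\<close>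

theorem continuous_potential_above:
  assumes v: "dual_feasible v" "\<And>t. t \<in> Iper \<Longrightarrow> - M \<le> v t" and M: "0 \<le> M"
  obtains u where "dual_feasible u" "\<And>t. t \<in> Iper \<Longrightarrow> v t \<le> u t" "continuous_on Iper u"
proof -
  obtain u where u: "u \<in> dominating_potentials v" and max: "\<And>a. a \<in> dominating_potentials v \<Longrightarrow> u \<le> a \<Longrightarrow> a = u"
    using exists_maximal_potential[OF v M] by blast
  have "\<exists>B. \<forall>u\<in>dominating_potentials v. \<forall>t\<in>Iper. u t \<le> B" by (rule dominating_potentials_bounded[OF _ M]) (rule v(2))
  then obtain B where "\<And>t. t \<in> Iper \<Longrightarrow> u t \<le> B" using u by blast
  then have "continuous_on Iper u"
    using maximal_potential_active[OF u max] by (intro continuous_on_if_active dominating_potentialsD(1)[OF u]) auto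
  then show ?thesis using that dominating_potentialsD[OF u] by blast
qed

end

section \<open>Weak duality\<close>

lemma ennreal_integral_le_nn_integral:
  fixes f :: "'a \<Rightarrow> real"
  assumes "integrable M f" shows "ennreal (\<integral>x. f x \<partial>M) \<le> (\<integral>\<^sup>+x. ennreal (f x) \<partial>M)"
proof -
  have finite: "(\<integral>\<^sup>+x. ennreal (f x) \<partial>M) < top" using assms by (simp add: real_integrable_def less_top)
  have "(\<integral>x. f x \<partial>M) \<le> enn2real (\<integral>\<^sup>+x. ennreal (f x) \<partial>M)" using real_lebesgue_integral_def[OF assms] by simp
  then have "ennreal (\<integral>x. f x \<partial>M) \<le> ennreal (enn2real (\<integral>\<^sup>+x. ennreal (f x) \<partial>M))" by (rule ennreal_leI)
  then show ?thesis using finite by simp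
qed

lemma
  fixes f :: "real \<Rightarrow> real"
  assumes f: "continuous_on Iper f"
  shows integrable_Bper_continuous: "integrable Bper f"
    and integral_Bper_eq_Lper: "(\<integral>t. f t \<partial>Bper) = (\<integral>t. f t \<partial>Lper)"
proof -
  note meas = borel_measurable_Bper_continuous[OF f]
  have "(\<lambda>t. f (id t)) \<in> borel_measurable Lper" using measurable_Lper_continuous[OF f] by simp
  have distr_eq: "distr Lper Bper (\<lambda>t. t) = Bper"
  proof (rule measure_eqI)
    fix A assume "A \<in> sets (distr Lper Bper (\<lambda>t. t))"
    then have A: "A \<in> sets Bper" by simp
    have "emeasure (distr Lper Bper (\<lambda>t. t)) A = (\<integral>\<^sup>+t. indicator A t \<partial>distr Lper Bper (\<lambda>t. t))" using A by simp
    also have "\<dots> = (\<integral>\<^sup>+t. indicator A t \<partial>Lper)" using A by (intro nn_integral_distr id_measurable_Lper_Bper) auto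
    also have "\<dots> = emeasure Bper A" using A by (simp add: nn_integral_Bper[symmetric])
    finally show "emeasure (distr Lper Bper (\<lambda>t. t)) A = emeasure Bper A" .
  qed simp
  show "integrable Bper f"
    using integrable_distr_eq[OF id_measurable_Lper_Bper meas] integrable_Lper_continuous[OF f] by (simp add: distr_eq)
  show "(\<integral>t. f t \<partial>Bper) = (\<integral>t. f t \<partial>Lper)"
    using integral_distr[OF id_measurable_Lper_Bper meas] by (simp add: distr_eq)
qed

lemma coupling_space:
  assumes "coupling n \<rho> \<gamma>" shows "space \<gamma> = PiE {..<n} (\<lambda>_. Iper)"
  using assms sets_eq_imp_space_eq[of \<gamma> "Pi\<^sub>M {..<n} (\<lambda>_. Bper)"] by (auto simp: coupling_def space_PiM)

lemma coupling_measurable_iff: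
  assumes "coupling n \<rho> \<gamma>" shows "f \<in> measurable \<gamma> M \<longleftrightarrow> f \<in> measurable (Pi\<^sub>M {..<n} (\<lambda>_. Bper)) M"
  using assms measurable_cong_sets[of \<gamma> "Pi\<^sub>M {..<n} (\<lambda>_. Bper)" M M] by (simp add: coupling_def)

lemma coupling_integral_component:
  assumes \<gamma>: "coupling n \<rho> \<gamma>" and \<rho>: "continuous_on Iper \<rho>" "\<And>t. t \<in> Iper \<Longrightarrow> 0 \<le> \<rho> t"
    and q: "continuous_on Iper q" and i: "i < n"
  shows "integrable \<gamma> (\<lambda>x. q (x i))" and "(\<integral>x. q (x i) \<partial>\<gamma>) = (\<integral>t. \<rho> t * q t \<partial>Lper)"
proof -
  have component: "(\<lambda>x. x i) \<in> measurable \<gamma> Bper"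
    by (simp add: coupling_measurable_iff[OF \<gamma>] component_measurable_Bper[OF i])
  have marginal: "distr \<gamma> Bper (\<lambda>x. x i) = density Bper \<rho>" using \<gamma> i by (simp add: coupling_def)
  note meas = borel_measurable_Bper_continuous[OF q] borel_measurable_Bper_continuous[OF \<rho>(1)]
  have nonneg: "AE t in Bper. 0 \<le> \<rho> t" using \<rho>(2) by (intro AE_I2) simp
  have prod: "continuous_on Iper (\<lambda>t. \<rho> t * q t)" by (intro continuous_intros \<rho> q)
  show "integrable \<gamma> (\<lambda>x. q (x i))"
    using integrable_distr_eq[OF component meas(1)] integrable_real_density[OF meas(2) nonneg meas(1)]
      integrable_Bper_continuous[OF prod] by (simp add: marginal)
  have "(\<integral>x. q (x i) \<partial>\<gamma>) = (\<integral>t. q t \<partial>density Bper \<rho>)"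
    using integral_distr[OF component meas(1)] by (simp add: marginal)
  also have "\<dots> = (\<integral>t. \<rho> t * q t \<partial>Bper)" by (rule integral_real_density[OF meas(2) nonneg meas(1)])
  finally show "(\<integral>x. q (x i) \<partial>\<gamma>) = (\<integral>t. \<rho> t * q t \<partial>Lper)" by (simp add: integral_Bper_eq_Lper[OF prod])
qed

context cost
begin

theorem FOT_weak_duality:
  assumes \<rho>: "continuous_on Iper \<rho>" "\<And>t. t \<in> Iper \<Longrightarrow> 0 \<le> \<rho> t"
    and q: "\<And>i. i < n \<Longrightarrow> continuous_on Iper (q i)"
    and cost_bound: "\<And>x. x \<in> configurations \<Longrightarrow> (\<Sum>i<n. q i (x i)) \<le> real_cost x"
  shows "ennreal (\<Sum>i<n. \<integral>t. \<rho> t * q i t \<partial>Lper) \<le> FOT n w \<rho>"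
  unfolding FOT_def
proof (rule INF_greatest)
  fix \<gamma> assume "\<gamma> \<in> {\<gamma>. coupling n \<rho> \<gamma>}"
  then have \<gamma>: "coupling n \<rho> \<gamma>" by simp
  note component = coupling_integral_component[OF \<gamma> \<rho> q]
  have "ennreal (\<Sum>i<n. \<integral>t. \<rho> t * q i t \<partial>Lper) = ennreal (\<integral>x. (\<Sum>i<n. q i (x i)) \<partial>\<gamma>)"
    using component by (subst Bochner_Integration.integral_sum) auto
  also have "\<dots> \<le> (\<integral>\<^sup>+x. ennreal (\<Sum>i<n. q i (x i)) \<partial>\<gamma>)"
    using component(1) by (intro ennreal_integral_le_nn_integral Bochner_Integration.integrable_sum) auto
  also have "\<dots> \<le> (\<integral>\<^sup>+x. cN n w x \<partial>\<gamma>)"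
  proof (rule nn_integral_mono)
    fix x assume x: "x \<in> space \<gamma>"
    show "ennreal (\<Sum>i<n. q i (x i)) \<le> cN n w x"
    proof (cases "x \<in> configurations")
      case True then show ?thesis using cost_bound by (simp add: cN_configuration ennreal_leI)
    next
      case False
      have "cN n w x = top" by (rule cN_eq_top[OF _ False]) (use x coupling_space[OF \<gamma>] in auto)
      then show ?thesis by simp
    qed
  qed
  finally show "ennreal (\<Sum>i<n. \<integral>t. \<rho> t * q i t \<partial>Lper) \<le> (\<integral>\<^sup>+x. cN n w x \<partial>\<gamma>)" .
qed

lemma dual_feasible_iff_cN:
  "dual_feasible u \<longleftrightarrow> (\<forall>x\<in>PiE {..<n} (\<lambda>_. Iper). 0 \<le> enn2ereal (cN n w x) - ereal (\<Sum>j<n. u (x j)))"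
proof (intro iffI ballI)
  fix x assume u: "dual_feasible u" and x: "x \<in> PiE {..<n} (\<lambda>_. Iper)"
  show "0 \<le> enn2ereal (cN n w x) - ereal (\<Sum>j<n. u (x j))"
  proof (cases "x \<in> configurations")
    case True
    then show ?thesis using dual_feasibleD[OF u] real_cost_nonneg[of x] by (simp add: cN_configuration)
  next
    case False
    have "cN n w x = top" by (rule cN_eq_top[OF _ False]) (use x in auto)
    then show ?thesis by simp
  qed
next
  assume feasible: "\<forall>x\<in>PiE {..<n} (\<lambda>_. Iper). 0 \<le> enn2ereal (cN n w x) - ereal (\<Sum>j<n. u (x j))"
  show "dual_feasible u" unfolding dual_feasible_def
  proof
    fix x assume x: "x \<in> configurations"
    let ?y = "restrict x {..<n}"
    have y: "?y \<in> configurations" "?y \<in> PiE {..<n} (\<lambda>_. Iper)" using x by (auto simp: configurations_def)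
    have "real_cost ?y = real_cost x" "(\<Sum>j<n. u (?y j)) = (\<Sum>j<n. u (x j))"
      unfolding real_cost_def by (auto intro!: sum.cong)
    then show "(\<Sum>i<n. u (x i)) \<le> real_cost x"
      using bspec[OF feasible y(2)] real_cost_nonneg[of x] by (simp add: cN_configuration[OF y(1)])
  qed
qed

end

section \<open>Local densities of the limit functional\<close>

text \<open>The infimum of the constants admissible on small intervals around a point is a pointwise upper envelope for a
  functional that has no values yet at points.\<close>

definition local_density_le :: "((real \<Rightarrow> real) \<Rightarrow> real) \<Rightarrow> real set \<Rightarrow> real \<Rightarrow> bool" where
  "local_density_le V A K \<longleftrightarrow> (\<forall>\<phi> \<phi>'. C1per \<phi> \<phi>' \<longrightarrow> (\<forall>t. 0 \<le> \<phi> t) \<longrightarrow> (\<forall>t\<in>Iper. \<phi> t \<noteq> 0 \<longrightarrow> t \<in> A) \<longrightarrow>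
     V (\<lambda>t. (\<phi> t)\<^sup>2) \<le> K * (\<integral>t. (\<phi> t)\<^sup>2 \<partial>Lper))"

lemma local_density_leD:
  "local_density_le V A K \<Longrightarrow> C1per \<phi> \<phi>' \<Longrightarrow> (\<And>t. 0 \<le> \<phi> t) \<Longrightarrow> (\<And>t. t \<in> Iper \<Longrightarrow> \<phi> t \<noteq> 0 \<Longrightarrow> t \<in> A) \<Longrightarrow>
     V (\<lambda>t. (\<phi> t)\<^sup>2) \<le> K * (\<integral>t. (\<phi> t)\<^sup>2 \<partial>Lper)"
  unfolding local_density_le_def by blast

lemma local_density_le_mono:
  assumes "local_density_le V B K" "A \<subseteq> B" "K \<le> L" shows "local_density_le V A L"
  unfolding local_density_le_def
proof (intro allI impI)
  fix \<phi> \<phi>' assume \<phi>: "C1per \<phi> \<phi>'" "\<forall>t. 0 \<le> \<phi> t" "\<forall>t\<in>Iper. \<phi> t \<noteq> 0 \<longrightarrow> t \<in> A"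
  then have "V (\<lambda>t. (\<phi> t)\<^sup>2) \<le> K * (\<integral>t. (\<phi> t)\<^sup>2 \<partial>Lper)" using assms(2) by (intro local_density_leD[OF assms(1)]) auto
  also have "\<dots> \<le> L * (\<integral>t. (\<phi> t)\<^sup>2 \<partial>Lper)" using assms(3) by (intro mult_right_mono) auto
  finally show "V (\<lambda>t. (\<phi> t)\<^sup>2) \<le> L * (\<integral>t. (\<phi> t)\<^sup>2 \<partial>Lper)" .
qed

lemma local_density_leI_unit_orbital:
  assumes V: "H1_linear V"
    and density_bound: "\<And>\<phi> \<phi>'. unit_orbital \<phi> \<phi>' \<Longrightarrow> (\<And>t. t \<in> Iper \<Longrightarrow> \<phi> t \<noteq> 0 \<Longrightarrow> t \<in> A) \<Longrightarrow> V (\<lambda>t. (\<phi> t)\<^sup>2) \<le> K"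
  shows "local_density_le V A K"
  unfolding local_density_le_def
proof (intro allI impI)
  fix \<phi> \<phi>' assume \<phi>: "C1per \<phi> \<phi>'" "\<forall>t. 0 \<le> \<phi> t" and supp: "\<forall>t\<in>Iper. \<phi> t \<noteq> 0 \<longrightarrow> t \<in> A"
  define I where "I = (\<integral>t. (\<phi> t)\<^sup>2 \<partial>Lper)"
  have square_H1: "H1per (\<lambda>t. (\<phi> t)\<^sup>2)" by (rule C1per_H1per[OF C1per_square[OF \<phi>(1)]])
  have cont: "continuous_on Iper (\<lambda>t. (\<phi> t)\<^sup>2)" by (intro continuous_intros C1per_continuous[OF \<phi>(1)])
  show "V (\<lambda>t. (\<phi> t)\<^sup>2) \<le> K * (\<integral>t. (\<phi> t)\<^sup>2 \<partial>Lper)"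
  proof (cases "I = 0")
    case True
    then have "(\<phi> t)\<^sup>2 = 0" if "t \<in> Iper" for t
      by (intro integral_Lper_eq_0_continuous[OF cont _ _ that]) (simp_all add: I_def)
    then have zero: "\<phi> t = 0" if "t \<in> Iper" for t using that by simp
    have "\<phi> t = 0" for t
      using periodic_value_on_Iper[of \<phi> t, OF C1per_periodic[OF \<phi>(1)]] zero by metis
    then have "V (\<lambda>t. (\<phi> t)\<^sup>2) = 0" using H1_linear_cmult[OF V square_H1, of 0] by simp
    then show ?thesis using True by (simp add: I_def)
  next
    case False
    have "0 \<le> I" unfolding I_def by simp
    then have I: "0 < I" using False by simp
    let ?\<xi> = "\<lambda>t. (1 / sqrt I) * \<phi> t"
    have \<xi>_square: "(\<lambda>t. (?\<xi> t)\<^sup>2) = (\<lambda>t. (1 / I) * (\<phi> t)\<^sup>2)" using I by (simp add: power_mult_distrib power_divide)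
    have "(\<integral>t. (?\<xi> t)\<^sup>2 \<partial>Lper) = 1" unfolding \<xi>_square using I by (simp add: I_def[symmetric])
    then have "unit_orbital ?\<xi> (\<lambda>t. (1 / sqrt I) * \<phi>' t)"
      unfolding unit_orbital_def using \<phi> I by (intro conjI C1per_cmult) auto
    then have "V (\<lambda>t. (?\<xi> t)\<^sup>2) \<le> K" using supp by (intro density_bound) auto
    then have "(1 / I) * V (\<lambda>t. (\<phi> t)\<^sup>2) \<le> K" unfolding \<xi>_square H1_linear_cmult[OF V square_H1] .
    then show ?thesis using I by (simp add: I_def[symmetric] field_simps)
  qed
qed

lemma unit_orbital_shift:
  assumes "unit_orbital \<phi> \<phi>'" shows "unit_orbital (\<lambda>t. \<phi> (t - a)) (\<lambda>t. \<phi>' (t - a))"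
proof -
  note C1 = unit_orbitalD(1)[OF assms]
  have "(\<integral>t. (\<phi> (t - a))\<^sup>2 \<partial>Lper) = (\<integral>t. (\<phi> t)\<^sup>2 \<partial>Lper)"
    by (rule integral_Lper_shift) (simp_all add: C1per_periodic[OF C1] C1per_continuous[OF C1] continuous_intros)
  then show ?thesis using assms C1per_shift[OF C1] by (simp add: unit_orbital_def)
qed

context cost
begin

definition arc :: "real \<Rightarrow> real set" where "arc a = {t. distT (t - a) < window_radius (2 * n)}"

lemma window_radius_pos: "0 < window_radius (2 * n)"
  using n_pos by (simp add: window_radius_def)

lemma arc_orbitals_separated:
  assumes supp: "\<And>j t. j < n \<Longrightarrow> t \<in> Iper \<Longrightarrow> \<phi> j t \<noteq> 0 \<Longrightarrow> t \<in> arc (a + grid_point (2 * n) (2 * j))"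
  shows "separated_orbitals n (window_radius (2 * n)) \<phi>"
  unfolding separated_orbitals_def
proof (intro allI impI ballI)
  fix i j x y assume "i < n" "j < n" "x \<in> Iper" "y \<in> Iper" "i \<noteq> j" "\<phi> i x \<noteq> 0" "\<phi> j y \<noteq> 0"
  then show "window_radius (2 * n) \<le> distT (x - y)"
    using grid_class_arcs_separated[of i n j "x - a" 0 "y - a"] supp by (auto simp: arc_def diff_diff_eq)
qed

lemma arc_orbitals_exist:
  obtains \<psi> \<psi>' where "\<And>j. unit_orbital (\<psi> j) (\<psi>' j)" "\<And>j t. \<psi> j t \<noteq> 0 \<Longrightarrow> t \<in> arc (grid_point (2 * n) (2 * j))"
proof -
  have two_le: "2 \<le> 2 * n" using n_pos by simp
  obtain W' where W': "\<And>i. C1per (window (2 * n) i) (W' i)" using C1per_window[OF two_le] by metis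
  let ?c = "sqrt (real n / pi)"
  have "unit_orbital (\<lambda>t. ?c * window (2 * n) (2 * j) t) (\<lambda>t. ?c * W' (2 * j) t)" for j
    unfolding unit_orbital_def using n_pos window_nonneg[OF two_le] integral_window_square[OF two_le]
    by (intro conjI C1per_cmult W') (auto simp: power_mult_distrib)
  then show ?thesis
    by (rule that) (auto simp: arc_def intro: window_support[OF two_le])
qed

lemma Feps_finite_somewhere: "\<exists>\<zeta>. adm \<zeta> \<and> (\<forall>\<epsilon>>0. Feps n w \<epsilon> \<zeta> < top)"
proof -
  obtain \<psi> \<psi>' where unit: "\<And>j. unit_orbital (\<psi> j) (\<psi>' j)"
    and arc: "\<And>j t. \<psi> j t \<noteq> 0 \<Longrightarrow> t \<in> arc (grid_point (2 * n) (2 * j))" using arc_orbitals_exist by metis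
  have sep: "separated_orbitals n (window_radius (2 * n)) \<psi>" using arc_orbitals_separated[of \<psi> 0] arc by simp
  note disjoint = separated_orbitals_disjoint[OF sep window_radius_pos]
  obtain S where S: "0 \<le> S" "\<And>x. (\<And>i. i < n \<Longrightarrow> x i \<in> Iper) \<Longrightarrow> separated (window_radius (2 * n)) x \<Longrightarrow> cN n w x \<le> ennreal S"
    using cN_bounded_separated[OF window_radius_pos] by blast
  have "Feps n w \<epsilon> (orbital_density n \<psi>) < top" if "0 < \<epsilon>" for \<epsilon>
  proof -
    have "Feps n w \<epsilon> (orbital_density n \<psi>) \<le> ennreal (\<epsilon> * (fact n * (\<Sum>j<n. \<integral>t. (\<psi>' j t)\<^sup>2 \<partial>Lper)) + S)"
      using sep that S
      by (intro Feps_orbital_density_le n_pos unit disjoint) (auto simp: separated_def separated_orbitals_def)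
    then show ?thesis by (rule le_less_trans) simp
  qed
  then show ?thesis using adm_orbital_density[OF n_pos unit disjoint] by blast
qed

end

locale limit_potential = cost +
  fixes \<rho> :: "real \<Rightarrow> real" and V :: "(real \<Rightarrow> real) \<Rightarrow> real" and C :: real
  assumes \<rho>_Dper: "Dper \<rho>"
    and V_dual: "H1_dual_le C V"
    and V_slater: "slater_bound 0 V"
    and FOT_le_V: "FOT n w \<rho> \<le> ennreal (real n * V \<rho>)"
    and V_\<rho>_nonneg: "0 \<le> V \<rho>"
begin

lemmas V_linear = H1_dual_leD(1)[OF V_dual]

text \<open>Complete a localised orbital to an n-tuple by translates of fixed orbitals; their values under V are
  bounded below, so the value of the localised density is bounded above.\<close>

lemma local_density_le_arc:
  obtains C\<^sub>a where "0 \<le> C\<^sub>a" "\<And>a. local_density_le V (arc a) C\<^sub>a"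
proof -
  obtain S where S: "0 \<le> S" "\<And>x. (\<And>i. i < n \<Longrightarrow> x i \<in> Iper) \<Longrightarrow> separated (window_radius (2 * n)) x \<Longrightarrow> cN n w x \<le> ennreal S"
    using cN_bounded_separated[OF window_radius_pos] by blast
  obtain \<psi> \<psi>' where unit: "\<And>j. unit_orbital (\<psi> j) (\<psi>' j)"
    and arc: "\<And>j t. \<psi> j t \<noteq> 0 \<Longrightarrow> t \<in> arc (grid_point (2 * n) (2 * j))" using arc_orbitals_exist by metis
  define q where "q j = C * h1norm (\<lambda>t. (\<psi> j t)\<^sup>2) (\<lambda>t. 2 * \<psi> j t * \<psi>' j t)" for j
  have q: "0 \<le> q j" for j using H1_dual_leD(2)[OF V_dual] by (simp add: q_def)
  have lower: "- q j \<le> V (\<lambda>t. (\<psi> j (t - a))\<^sup>2)" for j a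
  proof -
    note square = C1per_square[OF unit_orbitalD(1)[OF unit[of j]]]
    have "\<bar>V (\<lambda>t. (\<psi> j (t - a))\<^sup>2)\<bar> \<le> q j"
      using H1_dual_leD(3)[OF V_dual C1per_weak_deriv[OF C1per_shift[OF square, of a]]]
      by (simp add: q_def h1norm_shift[OF square])
    then show ?thesis by (simp add: abs_le_iff)
  qed
  show ?thesis
  proof (rule that[of "S + (\<Sum>j\<in>{..<n} - {0}. q j)"])
    show "0 \<le> S + (\<Sum>j\<in>{..<n} - {0}. q j)" using S(1) q by (simp add: sum_nonneg)
    fix a
    show "local_density_le V (arc a) (S + (\<Sum>j\<in>{..<n} - {0}. q j))"
    proof (rule local_density_leI_unit_orbital[OF V_linear])
      fix \<phi> \<phi>' assume \<phi>: "unit_orbital \<phi> \<phi>'" and supp: "\<And>t. t \<in> Iper \<Longrightarrow> \<phi> t \<noteq> 0 \<Longrightarrow> t \<in> arc a"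
      define \<Phi> where "\<Phi> = (\<lambda>j. if j = 0 then \<phi> else (\<lambda>t. \<psi> j (t - a)))"
      define \<Phi>' where "\<Phi>' = (\<lambda>j. if j = 0 then \<phi>' else (\<lambda>t. \<psi>' j (t - a)))"
      have "unit_orbital (\<Phi> j) (\<Phi>' j)" for j
        unfolding \<Phi>_def \<Phi>'_def using \<phi> unit_orbital_shift[OF unit] by simp
      moreover have "t \<in> arc (a + grid_point (2 * n) (2 * j))" if "t \<in> Iper" "\<Phi> j t \<noteq> 0" for j t
        using supp[of t] arc[of j "t - a"] that
        by (cases "j = 0") (auto simp: \<Phi>_def arc_def grid_point_def diff_diff_eq)
      then have "separated_orbitals n (window_radius (2 * n)) \<Phi>" by (intro arc_orbitals_separated)
      ultimately have "(\<Sum>j<n. V (\<lambda>t. (\<Phi> j t)\<^sup>2)) \<le> 0 * (fact n * (\<Sum>j<n. \<integral>t. (\<Phi>' j t)\<^sup>2 \<partial>Lper)) + S"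
        using window_radius_pos S by (intro slater_boundD_separated[OF V_slater]) auto
      moreover have "(\<Sum>j<n. V (\<lambda>t. (\<Phi> j t)\<^sup>2)) = V (\<lambda>t. (\<phi> t)\<^sup>2) + (\<Sum>j\<in>{..<n} - {0}. V (\<lambda>t. (\<psi> j (t - a))\<^sup>2))"
        using n_pos by (subst sum.remove[of _ 0]) (auto simp: \<Phi>_def)
      moreover have "(\<Sum>j\<in>{..<n} - {0}. - q j) \<le> (\<Sum>j\<in>{..<n} - {0}. V (\<lambda>t. (\<psi> j (t - a))\<^sup>2))"
        by (intro sum_mono lower)
      ultimately show "V (\<lambda>t. (\<phi> t)\<^sup>2) \<le> S + (\<Sum>j\<in>{..<n} - {0}. q j)" by (simp add: sum_negf)
    qed
  qed
qed

lemma localised_orbitals_cost_le: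
  assumes x: "x \<in> configurations" and e: "0 < e"
  obtains d where "0 < d" "\<And>\<phi> \<phi>'. (\<And>i. i < n \<Longrightarrow> unit_orbital (\<phi> i) (\<phi>' i)) \<Longrightarrow>
     (\<And>i t. i < n \<Longrightarrow> t \<in> Iper \<Longrightarrow> \<phi> i t \<noteq> 0 \<Longrightarrow> \<bar>t - x i\<bar> < d) \<Longrightarrow> (\<Sum>i<n. V (\<lambda>t. (\<phi> i t)\<^sup>2)) \<le> real_cost x + e"
proof -
  obtain a where a: "0 < a" "separated a x" using configuration_separated[OF x] by blast
  obtain d where d: "0 < d" "\<And>x y. (\<And>i. i < n \<Longrightarrow> x i \<in> Iper) \<Longrightarrow> (\<And>i. i < n \<Longrightarrow> y i \<in> Iper) \<Longrightarrow> separated a x \<Longrightarrow>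
     (\<And>i. i < n \<Longrightarrow> \<bar>y i - x i\<bar> < d) \<Longrightarrow> separated (a/2) y \<and> \<bar>real_cost y - real_cost x\<bar> < e"
    using real_cost_uniformly_continuous_separated[OF a(1) e] by blast
  show ?thesis
  proof (rule that[of "min d (a / 4)"])
    show "0 < min d (a / 4)" using d(1) a(1) by simp
    fix \<phi> \<phi>' assume unit: "\<And>i. i < n \<Longrightarrow> unit_orbital (\<phi> i) (\<phi>' i)"
      and supp: "\<And>i t. i < n \<Longrightarrow> t \<in> Iper \<Longrightarrow> \<phi> i t \<noteq> 0 \<Longrightarrow> \<bar>t - x i\<bar> < min d (a / 4)"
    have sep: "separated_orbitals n (a / 2) \<phi>" unfolding separated_orbitals_def
    proof (intro allI impI ballI)
      fix i j s t assume "i < n" "j < n" "s \<in> Iper" "t \<in> Iper" "i \<noteq> j" "\<phi> i s \<noteq> 0" "\<phi> j t \<noteq> 0"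
      then show "a / 2 \<le> distT (s - t)"
        using a(2) supp[of i s] supp[of j t] by (intro distT_stable[of a "x i" "x j"]) (auto simp: separated_def)
    qed
    have "(\<Sum>i<n. V (\<lambda>t. (\<phi> i t)\<^sup>2)) \<le> 0 * (fact n * (\<Sum>i<n. \<integral>t. (\<phi>' i t)\<^sup>2 \<partial>Lper)) + (real_cost x + e)"
    proof (rule slater_boundD_separated[OF V_slater unit sep])
      show "0 < a / 2" "0 \<le> real_cost x + e" using a(1) e real_cost_nonneg[of x] by auto
      fix y assume y: "\<And>j. j < n \<Longrightarrow> y j \<in> Iper" "\<And>j. j < n \<Longrightarrow> \<phi> j (y j) \<noteq> 0" "separated (a / 2) y"
      have "\<bar>y i - x i\<bar> < d" if "i < n" for i using supp[OF that y(1,2)[OF that]] by simp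
      then have close: "\<bar>real_cost y - real_cost x\<bar> < e"
        using d(2)[of x y, OF configuration_in_Iper[OF x] y(1) a(2)] by blast
      have "cN n w y = ennreal (real_cost y)" using a(1) by (intro cN_eq_real_cost[OF y(1,3)]) auto
      also have "\<dots> \<le> ennreal (real_cost x + e)" using close unfolding abs_less_iff by (intro ennreal_leI) linarith
      finally show "cN n w y \<le> ennreal (real_cost x + e)" .
    qed
    then show "(\<Sum>i<n. V (\<lambda>t. (\<phi> i t)\<^sup>2)) \<le> real_cost x + e" by simp
  qed
qed

definition envelope :: "real \<Rightarrow> real \<Rightarrow> real" where
  "envelope M x = Inf {K. - M \<le> K \<and> (\<exists>d>0. local_density_le V {t. \<bar>t - x\<bar> < d} K)}"

context
  fixes C\<^sub>a
  assumes C\<^sub>a: "0 \<le> C\<^sub>a" "\<And>a. local_density_le V (arc a) C\<^sub>a"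
begin

lemma local_density_le_interval: "local_density_le V {t. \<bar>t - x\<bar> < window_radius (2 * n)} C\<^sub>a"
  by (rule local_density_le_mono[OF C\<^sub>a(2)[of x]]) (auto simp: arc_def intro: le_less_trans[OF distT_le_abs])

lemma arc_bound_envelope_candidate:
  "C\<^sub>a \<in> {K. - (real n * C\<^sub>a) \<le> K \<and> (\<exists>d>0. local_density_le V {t. \<bar>t - x\<bar> < d} K)}"
proof -
  have "0 \<le> real n * C\<^sub>a" using C\<^sub>a(1) by simp
  then have "- (real n * C\<^sub>a) \<le> C\<^sub>a" using C\<^sub>a(1) by linarith
  then show ?thesis using local_density_le_interval window_radius_pos by blast
qed

lemma envelope_bounds:
  shows "- (real n * C\<^sub>a) \<le> envelope (real n * C\<^sub>a) x" "envelope (real n * C\<^sub>a) x \<le> C\<^sub>a"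
proof -
  show "- (real n * C\<^sub>a) \<le> envelope (real n * C\<^sub>a) x"
    unfolding envelope_def by (rule cInf_greatest) (use arc_bound_envelope_candidate[of x] in blast)+
  show "envelope (real n * C\<^sub>a) x \<le> C\<^sub>a"
    unfolding envelope_def
    by (rule cInf_lower[OF arc_bound_envelope_candidate bdd_belowI[of _ "- (real n * C\<^sub>a)"]]) simp
qed

lemma local_density_le_envelope:
  assumes e: "0 < e"
  shows "\<exists>d>0. local_density_le V {t. \<bar>t - x\<bar> < d} (envelope (real n * C\<^sub>a) x + e)"
proof -
  let ?A = "{K. - (real n * C\<^sub>a) \<le> K \<and> (\<exists>d>0. local_density_le V {t. \<bar>t - x\<bar> < d} K)}"
  have "?A \<noteq> {}" using arc_bound_envelope_candidate[of x] by blast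
  moreover have "Inf ?A < envelope (real n * C\<^sub>a) x + e" using e by (simp add: envelope_def)
  ultimately have "\<exists>K\<in>?A. K < envelope (real n * C\<^sub>a) x + e" by (rule cInf_lessD)
  then obtain K where K: "K \<in> ?A" "K < envelope (real n * C\<^sub>a) x + e" by (rule bexE)
  then obtain d where "0 < d" "local_density_le V {t. \<bar>t - x\<bar> < d} K" by blast
  then show ?thesis using local_density_le_mono[OF _ subset_refl less_imp_le[OF K(2)]] by blast
qed

lemma not_local_density_le_below_envelope:
  assumes "K < envelope M x" "- M \<le> K" "0 < d"
  shows "\<not> local_density_le V {t. \<bar>t - x\<bar> < d} K"
proof
  assume "local_density_le V {t. \<bar>t - x\<bar> < d} K"
  then have "envelope M x \<le> K" unfolding envelope_def using assms(2,3) by (intro cInf_lower bdd_belowI[of _ "- M"]) auto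
  then show False using assms(1) by simp
qed

lemma envelope_feasible: "dual_feasible (envelope (real n * C\<^sub>a))"
  unfolding dual_feasible_def
proof (intro ballI, rule field_le_epsilon)
  let ?v = "envelope (real n * C\<^sub>a)"
  fix x e\<^sub>0 assume x: "x \<in> configurations" and e\<^sub>0: "(0::real) < e\<^sub>0"
  define e where "e = e\<^sub>0 / 2"
  have e: "0 < e" "0 < e / real n" using e\<^sub>0 n_pos by (simp_all add: e_def)
  show "(\<Sum>i<n. ?v (x i)) \<le> real_cost x + e\<^sub>0"
  proof (cases "\<forall>i<n. - (real n * C\<^sub>a) \<le> ?v (x i) - e / real n")
    case True
    obtain d where d: "0 < d" "\<And>\<phi> \<phi>'. (\<And>i. i < n \<Longrightarrow> unit_orbital (\<phi> i) (\<phi>' i)) \<Longrightarrow>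
        (\<And>i t. i < n \<Longrightarrow> t \<in> Iper \<Longrightarrow> \<phi> i t \<noteq> 0 \<Longrightarrow> \<bar>t - x i\<bar> < d) \<Longrightarrow> (\<Sum>i<n. V (\<lambda>t. (\<phi> i t)\<^sup>2)) \<le> real_cost x + e"
      using localised_orbitals_cost_le[OF x e(1)] by blast
    have "\<exists>\<phi> \<phi>'. unit_orbital \<phi> \<phi>' \<and> (\<forall>t\<in>Iper. \<phi> t \<noteq> 0 \<longrightarrow> \<bar>t - x i\<bar> < d) \<and> ?v (x i) - e / real n < V (\<lambda>t. (\<phi> t)\<^sup>2)"
      if i: "i < n" for i
    proof (rule ccontr)
      assume "\<not> ?thesis"
      then have "local_density_le V {t. \<bar>t - x i\<bar> < d} (?v (x i) - e / real n)"
        by (intro local_density_leI_unit_orbital[OF V_linear]) (force simp: not_less)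
      then show False
        using not_local_density_le_below_envelope[of "?v (x i) - e / real n"
          "real n * C\<^sub>a" "x i" d] True i e d(1) by simp
    qed
    then obtain \<phi> \<phi>' where \<phi>: "\<And>i. i < n \<Longrightarrow> unit_orbital (\<phi> i) (\<phi>' i)"
      "\<And>i t. i < n \<Longrightarrow> t \<in> Iper \<Longrightarrow> \<phi> i t \<noteq> 0 \<Longrightarrow> \<bar>t - x i\<bar> < d"
      "\<And>i. i < n \<Longrightarrow> ?v (x i) - e / real n < V (\<lambda>t. (\<phi> i t)\<^sup>2)" by metis
    have "(\<Sum>i<n. ?v (x i)) \<le> (\<Sum>i<n. V (\<lambda>t. (\<phi> i t)\<^sup>2) + e / real n)"
      using \<phi>(3) by (intro sum_mono) (simp add: diff_less_eq less_imp_le)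
    also have "\<dots> = (\<Sum>i<n. V (\<lambda>t. (\<phi> i t)\<^sup>2)) + e" using n_pos by (simp add: sum.distrib)
    also have "\<dots> \<le> real_cost x + e\<^sub>0" using d(2)[of \<phi> \<phi>', OF \<phi>(1,2)] by (simp add: e_def)
    finally show ?thesis .
  next
    case False
    then obtain i where i: "i < n" "?v (x i) < - (real n * C\<^sub>a) + e / real n" by (auto simp: not_le)
    have "(\<Sum>j<n. ?v (x j)) = ?v (x i) + (\<Sum>j\<in>{..<n} - {i}. ?v (x j))" using i by (subst sum.remove[of _ i]) auto
    also have "(\<Sum>j\<in>{..<n} - {i}. ?v (x j)) \<le> (\<Sum>j\<in>{..<n} - {i}. C\<^sub>a)" by (intro sum_mono envelope_bounds)
    also have "\<dots> \<le> real n * C\<^sub>a" using C\<^sub>a(1) i(1) by (simp add: card_Diff_singleton mult_right_mono)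
    finally have "(\<Sum>j<n. ?v (x j)) \<le> e / real n" using i(2) by linarith
    also have "\<dots> \<le> e" using e n_pos by (simp add: divide_le_eq mult_le_cancel_left1)
    finally show ?thesis using real_cost_nonneg[of x] e by (simp add: e_def)
  qed
qed

end

end

section \<open>The limit functional is given by a Kantorovich potential\<close>

context limit_potential
begin

context
  fixes C\<^sub>a :: real and u :: "real \<Rightarrow> real"
  assumes C\<^sub>a: "0 \<le> C\<^sub>a" "\<And>a. local_density_le V (arc a) C\<^sub>a"
    and u_continuous: "continuous_on Iper u"
    and u_local: "\<And>t e. t \<in> Iper \<Longrightarrow> 0 < e \<Longrightarrow> \<exists>d>0. local_density_le V {s. \<bar>s - t\<bar> < d} (u t + e)"
begin

lemma local_integral_bound:
  assumes \<kappa>: "0 < \<kappa>"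
  shows "\<exists>\<eta>>0. \<forall>x\<in>Iper. \<forall>\<phi> \<phi>'. C1per \<phi> \<phi>' \<longrightarrow> (\<forall>t. 0 \<le> \<phi> t) \<longrightarrow> (\<forall>t\<in>Iper. \<phi> t \<noteq> 0 \<longrightarrow> \<bar>t - x\<bar> < \<eta>) \<longrightarrow>
     V (\<lambda>t. (\<phi> t)\<^sup>2) \<le> (\<integral>t. (u t + \<kappa>) * (\<phi> t)\<^sup>2 \<partial>Lper)"
proof -
  have "\<exists>d>0. local_density_le V {s. \<bar>s - t\<bar> < d} (u t + \<kappa> / 2) \<and> (\<forall>s\<in>Iper. \<bar>s - t\<bar> < d \<longrightarrow> u t + \<kappa> / 2 \<le> u s + \<kappa>)"
    if t: "t \<in> Iper" for t
  proof -
    have half_pos: "0 < \<kappa> / 2" using \<kappa> by simp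
    obtain d\<^sub>1 where d\<^sub>1: "0 < d\<^sub>1" "local_density_le V {s. \<bar>s - t\<bar> < d\<^sub>1} (u t + \<kappa> / 2)"
      using u_local[OF t half_pos] by blast
    obtain d\<^sub>2 where d\<^sub>2: "0 < d\<^sub>2" "\<And>s. s \<in> Iper \<Longrightarrow> dist s t < d\<^sub>2 \<Longrightarrow> dist (u s) (u t) < \<kappa> / 2"
      using u_continuous t half_pos unfolding continuous_on_iff by blast
    have "local_density_le V {s. \<bar>s - t\<bar> < min d\<^sub>1 d\<^sub>2} (u t + \<kappa> / 2)" by (rule local_density_le_mono[OF d\<^sub>1(2)]) auto
    moreover have "u t + \<kappa> / 2 \<le> u s + \<kappa>" if "s \<in> Iper" "\<bar>s - t\<bar> < min d\<^sub>1 d\<^sub>2" for s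
      using d\<^sub>2(2)[of s] that unfolding dist_real_def abs_less_iff by simp
    ultimately show ?thesis using d\<^sub>1(1) d\<^sub>2(1) by (intro exI[of _ "min d\<^sub>1 d\<^sub>2"]) auto
  qed
  then obtain d where d: "\<And>t. t \<in> Iper \<Longrightarrow> 0 < d t"
    "\<And>t. t \<in> Iper \<Longrightarrow> local_density_le V {s. \<bar>s - t\<bar> < d t} (u t + \<kappa> / 2)"
    "\<And>t s. t \<in> Iper \<Longrightarrow> s \<in> Iper \<Longrightarrow> \<bar>s - t\<bar> < d t \<Longrightarrow> u t + \<kappa> / 2 \<le> u s + \<kappa>" by metis
  have "Iper \<subseteq> \<Union>((\<lambda>t. ball t (d t)) ` Iper)" using d(1) by force
  then obtain \<eta> where \<eta>: "0 < \<eta>" "\<And>x. x \<in> Iper \<Longrightarrow> \<exists>G\<in>(\<lambda>t. ball t (d t)) ` Iper. ball x \<eta> \<subseteq> G"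
    by (rule Heine_Borel_lemma[OF compact_Iper]) auto
  show ?thesis
  proof (intro exI[of _ \<eta>] conjI \<eta>(1) ballI allI impI)
    fix x \<phi> \<phi>' assume x: "x \<in> Iper" and \<phi>: "C1per \<phi> \<phi>'" "\<forall>t. 0 \<le> \<phi> t"
      and supp: "\<forall>t\<in>Iper. \<phi> t \<noteq> 0 \<longrightarrow> \<bar>t - x\<bar> < \<eta>"
    obtain t where t: "t \<in> Iper" "ball x \<eta> \<subseteq> ball t (d t)" using \<eta>(2)[OF x] by auto
    have near: "\<bar>s - t\<bar> < d t" if "s \<in> Iper" "\<phi> s \<noteq> 0" for s
    proof -
      have "s \<in> ball x \<eta>" using supp that by (simp add: dist_real_def abs_minus_commute)
      then have "s \<in> ball t (d t)" using t(2) by blast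
      then show ?thesis by (simp add: dist_real_def abs_minus_commute)
    qed
    have "V (\<lambda>s. (\<phi> s)\<^sup>2) \<le> (u t + \<kappa> / 2) * (\<integral>s. (\<phi> s)\<^sup>2 \<partial>Lper)"
      using \<phi> near by (intro local_density_leD[OF d(2)[OF t(1)]]) auto
    also have "\<dots> = (\<integral>s. (u t + \<kappa> / 2) * (\<phi> s)\<^sup>2 \<partial>Lper)" by simp
    also have "\<dots> \<le> (\<integral>s. (u s + \<kappa>) * (\<phi> s)\<^sup>2 \<partial>Lper)"
    proof (rule integral_mono)
      show "(u t + \<kappa> / 2) * (\<phi> s)\<^sup>2 \<le> (u s + \<kappa>) * (\<phi> s)\<^sup>2" if "s \<in> space Lper" for s
        using d(3)[OF t(1), of s] near[of s] that by (cases "\<phi> s = 0") (auto intro: mult_right_mono)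
    qed (intro integrable_Lper_continuous continuous_intros u_continuous C1per_continuous[OF \<phi>(1)])+
    finally show "V (\<lambda>s. (\<phi> s)\<^sup>2) \<le> (\<integral>s. (u s + \<kappa>) * (\<phi> s)\<^sup>2 \<partial>Lper)" .
  qed
qed

lemma fine_windows_exist:
  assumes "0 < \<eta>" "0 < \<kappa>"
  shows "\<exists>N\<ge>2. window_radius N < \<eta> \<and> B * (2 * pi / real N) \<le> \<kappa>"
proof -
  have "(\<lambda>N. (4 * pi / 3) / real N) \<longlonglongrightarrow> 0" "(\<lambda>N. (B * (2 * pi)) / real N) \<longlonglongrightarrow> 0" by (rule lim_const_over_n)+
  then have "\<forall>\<^sub>F N in sequentially. (4 * pi / 3) / real N < \<eta>" "\<forall>\<^sub>F N in sequentially. (B * (2 * pi)) / real N < \<kappa>"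
    using assms by (auto dest: order_tendstoD(2))
  then have "\<forall>\<^sub>F N in sequentially. 2 \<le> N \<and> window_radius N < \<eta> \<and> B * (2 * pi / real N) \<le> \<kappa>"
    using eventually_ge_at_top[of 2] by eventually_elim (simp add: window_radius_def)
  then show ?thesis by (auto simp: eventually_sequentially)
qed

text \<open>The window around 0 is split between the two ends of the interval, where w and u need not be periodic; the bound
  on arcs makes its contribution negligible.\<close>

lemma boundary_window_bound:
  assumes N: "2 \<le> N" "window_radius N < window_radius (2 * n)"
    and \<phi>: "C1per \<phi> \<phi>'" "\<And>t. 0 \<le> \<phi> t" "\<And>t. (\<phi> t)\<^sup>2 \<le> F * (window N 0 t)\<^sup>2"
    and U: "0 \<le> U" "\<And>t. t \<in> Iper \<Longrightarrow> \<bar>u t\<bar> \<le> U" and F: "0 \<le> F"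
    and \<kappa>: "0 < \<kappa>" "((C\<^sub>a + U) * F) * (2 * pi / real N) \<le> \<kappa>"
  shows "V (\<lambda>t. (\<phi> t)\<^sup>2) \<le> (\<integral>t. (u t + \<kappa>) * (\<phi> t)\<^sup>2 \<partial>Lper) + \<kappa>"
proof -
  have integrable: "integrable Lper (\<lambda>t. (c * u t + d) * (\<phi> t)\<^sup>2)" for c d
    by (intro integrable_Lper_continuous continuous_intros u_continuous C1per_continuous[OF \<phi>(1)])
  have "t \<in> arc (grid_point N 0)" if "\<phi> t \<noteq> 0" for t
  proof -
    have "window N 0 t \<noteq> 0" using \<phi>(3)[of t] that by auto
    then show ?thesis using window_support[OF N(1), of 0 t] N(2) by (simp add: arc_def)
  qed
  then have "V (\<lambda>t. (\<phi> t)\<^sup>2) \<le> C\<^sub>a * (\<integral>t. (\<phi> t)\<^sup>2 \<partial>Lper)"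
    by (intro local_density_leD[OF C\<^sub>a(2) \<phi>(1)] \<phi>(2))
  also have "\<dots> = (\<integral>t. C\<^sub>a * (\<phi> t)\<^sup>2 \<partial>Lper)" by simp
  also have "\<dots> \<le> (\<integral>t. (u t + \<kappa>) * (\<phi> t)\<^sup>2 + (C\<^sub>a + U) * F * (window N 0 t)\<^sup>2 \<partial>Lper)"
  proof (rule integral_mono)
    show "integrable Lper (\<lambda>t. (u t + \<kappa>) * (\<phi> t)\<^sup>2 + (C\<^sub>a + U) * F * (window N 0 t)\<^sup>2)"
      by (intro integrable_Lper_continuous continuous_intros u_continuous C1per_continuous[OF \<phi>(1)]
        window_continuous[OF N(1)])
    fix t assume "t \<in> space Lper"
    then have "- U \<le> u t" using U(2)[of t] by (simp add: abs_le_iff)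
    then have "C\<^sub>a * (\<phi> t)\<^sup>2 \<le> ((u t + \<kappa>) + (C\<^sub>a + U)) * (\<phi> t)\<^sup>2" using \<kappa>(1) by (intro mult_right_mono) auto
    moreover have "(C\<^sub>a + U) * (\<phi> t)\<^sup>2 \<le> (C\<^sub>a + U) * (F * (window N 0 t)\<^sup>2)"
      using \<phi>(3)[of t] C\<^sub>a(1) U(1) by (intro mult_left_mono) auto
    ultimately show "C\<^sub>a * (\<phi> t)\<^sup>2 \<le> (u t + \<kappa>) * (\<phi> t)\<^sup>2 + (C\<^sub>a + U) * F * (window N 0 t)\<^sup>2"
      by (simp only: distrib_right mult.assoc)
  qed (use integrable[of 0 C\<^sub>a] in simp)
  also have "\<dots> = (\<integral>t. (u t + \<kappa>) * (\<phi> t)\<^sup>2 \<partial>Lper) + (C\<^sub>a + U) * F * (\<integral>t. (window N 0 t)\<^sup>2 \<partial>Lper)"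
    using integrable[of 1 \<kappa>] integrable_Lper_continuous[OF continuous_on_power[OF window_continuous[OF N(1)]]] by simp
  also have "\<dots> \<le> (\<integral>t. (u t + \<kappa>) * (\<phi> t)\<^sup>2 \<partial>Lper) + \<kappa>" using \<kappa>(2) by (simp add: integral_window_square[OF N(1)])
  finally show ?thesis .
qed

lemma V_window_decomposition:
  assumes N: "2 \<le> N" and \<phi>: "\<And>i. C1per (\<phi> i) (\<phi>' i)" "\<And>i t. (\<phi> i t)\<^sup>2 = f t * (window N i t)\<^sup>2"
  shows "(\<Sum>i<N. (\<phi> i t)\<^sup>2) = f t" and "V f = (\<Sum>i<N. V (\<lambda>t. (\<phi> i t)\<^sup>2))"
proof -
  show partition: "(\<Sum>i<N. (\<phi> i t)\<^sup>2) = f t" for t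
    by (simp add: \<phi>(2) sum_distrib_left[symmetric] sum_window_square[OF N])
  have "V f = V (\<lambda>t. \<Sum>i<N. (\<phi> i t)\<^sup>2)" by (simp only: partition)
  also have "\<dots> = (\<Sum>i<N. V (\<lambda>t. (\<phi> i t)\<^sup>2))"
    by (intro conjunct2[OF H1_linear_sum[OF V_linear]] C1per_H1per[OF C1per_square[OF \<phi>(1)]]) simp
  finally show "V f = (\<Sum>i<N. V (\<lambda>t. (\<phi> i t)\<^sup>2))" .
qed

lemma V_le_integral_plus:
  assumes f: "C1per f f'" "\<And>t. 0 < f t" and \<kappa>: "0 < \<kappa>"
  shows "V f \<le> (\<integral>t. (u t + \<kappa>) * f t \<partial>Lper) + \<kappa>"
proof -
  obtain U where U: "0 \<le> U" "\<And>t. t \<in> Iper \<Longrightarrow> \<bar>u t\<bar> \<le> U" using continuous_on_Iper_bounded[OF u_continuous] by metis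
  obtain F where F: "0 \<le> F" "\<And>t. \<bar>f t\<bar> \<le> F" using C1per_bounded[OF f(1)] by metis
  obtain \<eta> where \<eta>: "0 < \<eta>" "\<forall>x\<in>Iper. \<forall>\<phi> \<phi>'. C1per \<phi> \<phi>' \<longrightarrow> (\<forall>t. 0 \<le> \<phi> t) \<longrightarrow> (\<forall>t\<in>Iper. \<phi> t \<noteq> 0 \<longrightarrow> \<bar>t - x\<bar> < \<eta>) \<longrightarrow>
      V (\<lambda>t. (\<phi> t)\<^sup>2) \<le> (\<integral>t. (u t + \<kappa>) * (\<phi> t)\<^sup>2 \<partial>Lper)"
    using local_integral_bound[OF \<kappa>] by blast
  have "0 < min \<eta> (window_radius (2 * n))" using \<eta>(1) window_radius_pos by simp
  then obtain N where N: "2 \<le> N" "window_radius N < min \<eta> (window_radius (2 * n))"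
    "((C\<^sub>a + U) * F) * (2 * pi / real N) \<le> \<kappa>"
    using fine_windows_exist[OF _ \<kappa>] by blast
  obtain W' where W': "\<And>i. C1per (window N i) (W' i)" using C1per_window[OF N(1)] by metis
  define \<phi> where "\<phi> i t = sqrt (f t) * window N i t" for i t
  define \<phi>' where "\<phi>' i t = inverse (sqrt (f t)) / 2 * f' t * window N i t + sqrt (f t) * W' i t" for i t
  have \<phi>_C1: "C1per (\<phi> i) (\<phi>' i)" for i
    unfolding \<phi>_def[abs_def] \<phi>'_def[abs_def] by (intro C1per_mult C1per_sqrt f W')
  have \<phi>_nonneg: "0 \<le> \<phi> i t" for i t
    using window_nonneg[OF N(1)] f(2)[of t] by (simp add: \<phi>_def less_imp_le)
  have \<phi>_square: "(\<phi> i t)\<^sup>2 = f t * (window N i t)\<^sup>2" for i t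
    using f(2)[of t] by (simp add: \<phi>_def power_mult_distrib less_imp_le)
  have integrable: "integrable Lper (\<lambda>t. (u t + \<kappa>) * (\<phi> i t)\<^sup>2)" for i
    by (intro integrable_Lper_continuous continuous_intros u_continuous C1per_continuous[OF \<phi>_C1])
  have interior: "V (\<lambda>t. (\<phi> i t)\<^sup>2) \<le> (\<integral>t. (u t + \<kappa>) * (\<phi> i t)\<^sup>2 \<partial>Lper)" if i: "i < N" "i \<noteq> 0" for i
  proof -
    have "grid_point N i \<in> Iper" using i by (auto simp: grid_point_def Iper_def divide_le_eq)
    moreover have "\<bar>t - grid_point N i\<bar> < \<eta>" if "t \<in> Iper" "\<phi> i t \<noteq> 0" for t
      using window_support_interval[OF N(1) that(1) i] that(2) N(2) by (simp add: \<phi>_def)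
    ultimately show ?thesis using \<eta>(2) \<phi>_C1 \<phi>_nonneg by blast
  qed
  have boundary: "V (\<lambda>t. (\<phi> 0 t)\<^sup>2) \<le> (\<integral>t. (u t + \<kappa>) * (\<phi> 0 t)\<^sup>2 \<partial>Lper) + \<kappa>"
  proof (rule boundary_window_bound[OF N(1) _ \<phi>_C1 \<phi>_nonneg _ U F(1) \<kappa> N(3)])
    show "(\<phi> 0 t)\<^sup>2 \<le> F * (window N 0 t)\<^sup>2" for t
      unfolding \<phi>_square using F(2)[of t] by (intro mult_right_mono) auto
  qed (use N(2) in simp)
  have "V f = (\<Sum>i<N. V (\<lambda>t. (\<phi> i t)\<^sup>2))" by (rule V_window_decomposition(2)[OF N(1) \<phi>_C1 \<phi>_square])
  also have "\<dots> \<le> (\<Sum>i<N. (\<integral>t. (u t + \<kappa>) * (\<phi> i t)\<^sup>2 \<partial>Lper) + (if i = 0 then \<kappa> else 0))"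
    using interior boundary by (intro sum_mono) simp
  also have "\<dots> = (\<Sum>i<N. \<integral>t. (u t + \<kappa>) * (\<phi> i t)\<^sup>2 \<partial>Lper) + \<kappa>" using N(1) by (simp add: sum.distrib)
  also have "(\<Sum>i<N. \<integral>t. (u t + \<kappa>) * (\<phi> i t)\<^sup>2 \<partial>Lper) = (\<integral>t. (\<Sum>i<N. (u t + \<kappa>) * (\<phi> i t)\<^sup>2) \<partial>Lper)"
    using integrable by (intro Bochner_Integration.integral_sum[symmetric]) simp
  also have "\<dots> = (\<integral>t. (u t + \<kappa>) * f t \<partial>Lper)"
    by (simp add: sum_distrib_left[symmetric] V_window_decomposition(1)[OF N(1) \<phi>_C1 \<phi>_square])
  finally show ?thesis .
qed

lemma V_le_integral:
  assumes f: "C1per f f'" "\<And>t. 0 < f t"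
  shows "V f \<le> (\<integral>t. u t * f t \<partial>Lper)"
proof (rule field_le_epsilon)
  fix e :: real assume e: "0 < e"
  have "0 \<le> (\<integral>t. f t \<partial>Lper)" using f(2) by (intro integral_nonneg_AE AE_I2) (simp add: less_imp_le)
  moreover define \<kappa> where "\<kappa> = e / (1 + (\<integral>t. f t \<partial>Lper))"
  ultimately have "0 < \<kappa>" "\<kappa> * (1 + (\<integral>t. f t \<partial>Lper)) = e" using e by (simp_all add: \<kappa>_def)
  then have \<kappa>: "0 < \<kappa>" "\<kappa> * (\<integral>t. f t \<partial>Lper) + \<kappa> = e" by (simp_all only: distrib_left mult_1_right add.commute)
  have "V f \<le> (\<integral>t. (u t + \<kappa>) * f t \<partial>Lper) + \<kappa>" by (rule V_le_integral_plus[OF f \<kappa>(1)])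
  also have "(\<integral>t. (u t + \<kappa>) * f t \<partial>Lper) = (\<integral>t. u t * f t \<partial>Lper) + \<kappa> * (\<integral>t. f t \<partial>Lper)"
    using integrable_Lper_continuous[OF continuous_on_mult[OF u_continuous C1per_continuous(1)[OF f(1)]]]
      integrable_Lper_continuous[OF C1per_continuous(1)[OF f(1)]] by (simp add: distrib_right)
  finally show "V f \<le> (\<integral>t. u t * f t \<partial>Lper) + e" using \<kappa>(2) by simp
qed

end

end

lemma Hminus_eq_if_le_on_positive:
  assumes V: "Hminus V" and W: "Hminus W" and upper: "\<And>f f'. C1per f f' \<Longrightarrow> (\<And>t. 0 < f t) \<Longrightarrow> V f \<le> W f"
    and \<rho>: "Dper \<rho>" and at_\<rho>: "W \<rho> \<le> V \<rho>" and h: "H1per h"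
  shows "V h = W h"
proof (rule Hminus_eqI[OF V W _ h])
  fix h h' assume h: "C1per h h'"
  note linear = Hminus_H1_linear[OF V] Hminus_H1_linear[OF W]
  obtain g T T' m M where approx: "h1_approx \<rho> g T T'" and m: "0 < m" "\<And>k t. m \<le> T k t" using Dper_approx[OF \<rho>] by metis
  have perturbed: "c * V h \<le> c * W h" if small: "\<And>t. \<bar>c * h t\<bar> < m" for c
  proof -
    have "V (T k) + c * V h \<le> W (T k) + c * W h" for k
    proof -
      note T = h1_approx_C1per[OF approx, of k]
      have "0 < 1 * T k t + c * h t" for t using m(2)[of k t] small[of t] unfolding abs_less_iff by linarith
      then have "V (\<lambda>t. 1 * T k t + c * h t) \<le> W (\<lambda>t. 1 * T k t + c * h t)" by (rule upper[OF C1per_lin[OF T h]])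
      then show ?thesis
        unfolding linear[THEN H1_linearD, OF C1per_H1per[OF T] C1per_H1per[OF h]] by simp
    qed
    moreover have "(\<lambda>k. V (T k) + c * V h) \<longlonglongrightarrow> V \<rho> + c * V h" "(\<lambda>k. W (T k) + c * W h) \<longlonglongrightarrow> W \<rho> + c * W h"
      by (intro tendsto_intros Hminus_h1_approx_tendsto[OF V approx] Hminus_h1_approx_tendsto[OF W approx])+
    ultimately have "V \<rho> + c * V h \<le> W \<rho> + c * W h" by (intro LIMSEQ_le) auto
    then show ?thesis using at_\<rho> by simp
  qed
  obtain B where B: "0 \<le> B" "\<And>t. \<bar>h t\<bar> \<le> B" using C1per_bounded[OF h] by metis
  define c where "c = m / (B + 1)"
  have c: "0 < c" using m(1) B(1) by (simp add: c_def)
  have "\<bar>c * h t\<bar> < m" for t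
  proof -
    have "\<bar>c * h t\<bar> \<le> c * B" unfolding abs_mult using c B(2) by (intro mult_mono) auto
    also have "\<dots> < c * (B + 1)" using c by simp
    also have "\<dots> = m" using B(1) by (simp add: c_def)
    finally show ?thesis .
  qed
  then have "c * V h \<le> c * W h" "- c * V h \<le> - c * W h" by (intro perturbed; simp)+
  then show "V h = W h" using c by simp
qed

context limit_potential
begin

lemma exists_continuous_majorant:
  obtains u where "dual_feasible u" "continuous_on Iper u"
    "\<And>f f'. C1per f f' \<Longrightarrow> (\<And>t. 0 < f t) \<Longrightarrow> V f \<le> (\<integral>t. u t * f t \<partial>Lper)"
proof -
  obtain C\<^sub>a where C\<^sub>a: "0 \<le> C\<^sub>a" "\<And>a. local_density_le V (arc a) C\<^sub>a" using local_density_le_arc by blast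
  let ?v = "envelope (real n * C\<^sub>a)"
  have "0 \<le> real n * C\<^sub>a" using C\<^sub>a(1) by simp
  then obtain u where u: "dual_feasible u" "\<And>t. t \<in> Iper \<Longrightarrow> ?v t \<le> u t" "continuous_on Iper u"
    using continuous_potential_above[OF envelope_feasible[OF C\<^sub>a] envelope_bounds(1)[OF C\<^sub>a]] by blast
  have "\<exists>d>0. local_density_le V {s. \<bar>s - t\<bar> < d} (u t + e)" if "t \<in> Iper" "0 < e" for t e
    using local_density_le_envelope[OF C\<^sub>a that(2), of t] u(2)[OF that(1)]
    by (meson add_right_mono local_density_le_mono subset_refl)
  then show ?thesis using that u(1,3) V_le_integral[OF C\<^sub>a u(3)] by blast
qed

theorem represented_by_kantorovich_potential:
  "\<exists>u. regular_kantorovich_pot n w \<rho> u \<and> (\<forall>f. H1per f \<longrightarrow> V f = (\<integral>t. u t * f t \<partial>Lper))"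
proof -
  obtain u where u: "dual_feasible u" "continuous_on Iper u"
    and upper: "\<And>f f'. C1per f f' \<Longrightarrow> (\<And>t. 0 < f t) \<Longrightarrow> V f \<le> (\<integral>t. u t * f t \<partial>Lper)"
    using exists_continuous_majorant by blast
  note \<rho> = Dper_D[OF \<rho>_Dper]
  have "ennreal (\<Sum>i<n. \<integral>t. \<rho> t * u t \<partial>Lper) \<le> FOT n w \<rho>"
    using dual_feasibleD[OF u(1)] \<rho>(3)
    by (intro FOT_weak_duality[where q = "\<lambda>_. u"] \<rho>(2) u(2)) (auto intro: less_imp_le)
  then have weak_duality: "ennreal (real n * (\<integral>t. u t * \<rho> t \<partial>Lper)) \<le> FOT n w \<rho>" by (simp add: mult.commute)
  also note FOT_le_V
  finally have "real n * (\<integral>t. u t * \<rho> t \<partial>Lper) \<le> real n * V \<rho>" using V_\<rho>_nonneg by (subst (asm) ennreal_le_iff) auto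
  then have at_\<rho>: "(\<integral>t. u t * \<rho> t \<partial>Lper) \<le> V \<rho>" using n_pos by simp
  have V_Hminus: "Hminus V" using V_dual Hminus_iff_H1_dual_le by blast
  have V_eq: "V f = (\<integral>t. u t * f t \<partial>Lper)" if "H1per f" for f
    by (rule Hminus_eq_if_le_on_positive[where W = "\<lambda>f. \<integral>t. u t * f t \<partial>Lper"])
      (use V_Hminus Hminus_integral[OF u(2)] upper \<rho>_Dper at_\<rho> that in blast)+
  have "FOT n w \<rho> = ennreal (real n * (\<integral>t. \<rho> t * u t \<partial>Lper))"
    using weak_duality FOT_le_V V_eq[OF \<rho>(1)] by (simp add: mult.commute antisym)
  moreover have "0 \<le> (\<integral>t. \<rho> t * u t \<partial>Lper)" using V_\<rho>_nonneg V_eq[OF \<rho>(1)] by (simp add: mult.commute)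
  ultimately have "kantorovich_pot n w \<rho> u"
    unfolding kantorovich_pot_def dual_feasible_iff_cN[symmetric] using u \<rho>(2)
    by (auto intro!: integrable_Lper_continuous continuous_intros)
  then show ?thesis using V_eq u(2) by (auto simp: regular_kantorovich_pot_def)
qed

end

section \<open>Uniqueness of regular potentials\<close>

text \<open>The Riemann sums of the common supergradient p telescope, so nothing needs to be known about p.\<close>

lemma common_supergradient_partition_le:
  fixes u\<^sub>1 u\<^sub>2 p :: "real \<Rightarrow> real"
  assumes super: "\<And>s t. s \<in> {a..b} \<Longrightarrow> t \<in> {a..b} \<Longrightarrow> \<bar>s - t\<bar> < d \<Longrightarrow>
      u\<^sub>1 s - u\<^sub>1 t \<le> p t * (s - t) + e * \<bar>s - t\<bar> \<and> u\<^sub>2 s - u\<^sub>2 t \<le> p t * (s - t) + e * \<bar>s - t\<bar>"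
    and "a \<le> b" and N: "1 \<le> N" "(b - a) / real N < d"
  shows "(u\<^sub>1 b - u\<^sub>2 b) - (u\<^sub>1 a - u\<^sub>2 a) \<le> (p a - p b) * ((b - a) / real N) + 2 * e * (b - a)"
proof -
  let ?h = "\<lambda>t. u\<^sub>1 t - u\<^sub>2 t"
  define \<delta> where "\<delta> = (b - a) / real N"
  define \<tau> where "\<tau> i = a + real i * \<delta>" for i :: nat
  have \<delta>: "0 \<le> \<delta>" "\<delta> < d" "real N * \<delta> = b - a" using N \<open>a \<le> b\<close> by (simp_all add: \<delta>_def)
  have ends: "\<tau> 0 = a" "\<tau> N = b" using \<delta>(3) by (simp_all add: \<tau>_def)
  have \<tau>_mem: "\<tau> i \<in> {a..b}" if "i \<le> N" for i
    using mult_right_mono[of "real i" "real N" \<delta>] that \<delta> by (simp add: \<tau>_def)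
  have step: "?h (\<tau> (Suc i)) - ?h (\<tau> i) \<le> (p (\<tau> i) - p (\<tau> (Suc i))) * \<delta> + 2 * e * \<delta>" if i: "i < N" for i
  proof -
    have increment: "\<tau> (Suc i) - \<tau> i = \<delta>" "\<tau> i - \<tau> (Suc i) = - \<delta>" by (simp_all add: \<tau>_def algebra_simps)
    have mem: "\<tau> i \<in> {a..b}" "\<tau> (Suc i) \<in> {a..b}" using \<tau>_mem i by auto
    have "u\<^sub>1 (\<tau> (Suc i)) - u\<^sub>1 (\<tau> i) \<le> p (\<tau> i) * \<delta> + e * \<delta>"
      using super[OF mem(2,1)] \<delta> unfolding increment by simp
    moreover have "u\<^sub>2 (\<tau> i) - u\<^sub>2 (\<tau> (Suc i)) \<le> p (\<tau> (Suc i)) * (- \<delta>) + e * \<delta>"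
      using super[OF mem] \<delta> unfolding increment by simp
    ultimately show ?thesis by (simp add: left_diff_distrib)
  qed
  have "?h b - ?h a = (\<Sum>i<N. ?h (\<tau> (Suc i)) - ?h (\<tau> i))"
    using sum_lessThan_telescope[of "\<lambda>i. ?h (\<tau> i)" N] by (simp add: ends)
  also have "\<dots> \<le> (\<Sum>i<N. (p (\<tau> i) - p (\<tau> (Suc i))) * \<delta> + 2 * e * \<delta>)" using step by (intro sum_mono) auto
  also have "\<dots> = (\<Sum>i<N. p (\<tau> i) - p (\<tau> (Suc i))) * \<delta> + 2 * e * (real N * \<delta>)"
    by (simp add: sum.distrib sum_distrib_right)
  also have "\<dots> = (p a - p b) * \<delta> + 2 * e * (b - a)"
    using sum_lessThan_telescope'[of "\<lambda>i. p (\<tau> i)" N] by (simp add: ends \<delta>(3))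
  finally show ?thesis by (simp add: \<delta>_def)
qed

lemma common_supergradient_difference_le:
  fixes u\<^sub>1 u\<^sub>2 p :: "real \<Rightarrow> real"
  assumes super: "\<And>e. 0 < e \<Longrightarrow> \<exists>d>0. \<forall>s\<in>{a..b}. \<forall>t\<in>{a..b}. \<bar>s - t\<bar> < d \<longrightarrow>
      u\<^sub>1 s - u\<^sub>1 t \<le> p t * (s - t) + e * \<bar>s - t\<bar> \<and> u\<^sub>2 s - u\<^sub>2 t \<le> p t * (s - t) + e * \<bar>s - t\<bar>"
    and ab: "a < b"
  shows "u\<^sub>1 b - u\<^sub>2 b \<le> u\<^sub>1 a - u\<^sub>2 a"
proof -
  let ?h = "\<lambda>t. u\<^sub>1 t - u\<^sub>2 t"
  have fine_partition: "?h b - ?h a \<le> 2 * e * (b - a)" if e: "0 < e" for e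
  proof -
    obtain d where d: "0 < d" "\<And>s t. s \<in> {a..b} \<Longrightarrow> t \<in> {a..b} \<Longrightarrow> \<bar>s - t\<bar> < d \<Longrightarrow>
      u\<^sub>1 s - u\<^sub>1 t \<le> p t * (s - t) + e * \<bar>s - t\<bar> \<and> u\<^sub>2 s - u\<^sub>2 t \<le> p t * (s - t) + e * \<bar>s - t\<bar>"
      using super[OF e] by blast
    have mesh: "(\<lambda>N. (b - a) / real N) \<longlonglongrightarrow> 0" by (rule lim_const_over_n)
    have "\<forall>\<^sub>F N in sequentially. ?h b - ?h a \<le> (p a - p b) * ((b - a) / real N) + 2 * e * (b - a)"
      using order_tendstoD(2)[OF mesh d(1)] eventually_ge_at_top[of 1]
      by eventually_elim (intro common_supergradient_partition_le[OF d(2)] less_imp_le[OF ab])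
    moreover have "(\<lambda>N. (p a - p b) * ((b - a) / real N) + 2 * e * (b - a)) \<longlonglongrightarrow> (p a - p b) * 0 + 2 * e * (b - a)"
      by (intro tendsto_intros mesh)
    ultimately show ?thesis by (intro tendsto_lowerbound[of _ "2 * e * (b - a)"]) auto
  qed
  define c where "c = b - a"
  have "0 < c" using ab by (simp add: c_def)
  then have "?h b - ?h a \<le> e" if "0 < e" for e
    using fine_partition[of "e / (2 * c)", folded c_def] that by simp
  then have "?h b - ?h a \<le> 0" by (rule field_le_epsilon) simp
  then show ?thesis by simp
qed

subsection \<open>First variation of the cost\<close>

context cost
begin

lemma separated_pairs_offdiag: "0 < a \<Longrightarrow> separated_pairs a \<subseteq> offdiag"
  by (auto simp: separated_pairs_def offdiag_def)

lemma w_real_partial_derivative: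
  assumes "C1_offdiag w"
  obtains g where "continuous_on offdiag g"
    "\<And>J \<tau> z. (\<And>\<sigma>. \<sigma> \<in> J \<Longrightarrow> (\<sigma>, z) \<in> offdiag) \<Longrightarrow> \<tau> \<in> J \<Longrightarrow>
       ((\<lambda>\<sigma>. w_real (\<sigma>, z)) has_field_derivative g (\<tau>, z)) (at \<tau> within J)"
proof -
  obtain D :: "real \<times> real \<Rightarrow> ((real \<times> real) \<Rightarrow>\<^sub>L real)" where D: "continuous_on offdiag D"
    "\<And>p. p \<in> offdiag \<Longrightarrow> (w_real has_derivative blinfun_apply (D p)) (at p within offdiag)"
    using assms unfolding C1_offdiag_def by blast
  define g where "g p = blinfun_apply (D p) (1, 0)" for p
  show ?thesis
  proof (rule that[of g])
    show "continuous_on offdiag g" unfolding g_def[abs_def] by (intro continuous_intros D(1))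
    fix J \<tau> z assume J: "\<And>\<sigma>. \<sigma> \<in> J \<Longrightarrow> (\<sigma>, z) \<in> offdiag" and \<tau>: "\<tau> \<in> J"
    have image: "(\<lambda>\<sigma>. (\<sigma>, z)) ` J \<subseteq> offdiag" using J by blast
    have "((\<lambda>\<sigma>. (\<sigma>, z)) has_derivative (\<lambda>h. (h, 0))) (at \<tau> within J)" by (auto intro!: derivative_eq_intros)
    from diff_chain_within[OF this has_derivative_subset[OF D(2)[OF J[OF \<tau>]] image]]
    have "(w_real \<circ> (\<lambda>\<sigma>. (\<sigma>, z)) has_derivative blinfun_apply (D (\<tau>, z)) \<circ> (\<lambda>h. (h, 0))) (at \<tau> within J)" .
    moreover have "blinfun_apply (D (\<tau>, z)) (h, 0) = g (\<tau>, z) * h" for h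
      using blinfun.scaleR_right[of "D (\<tau>, z)" h "(1, 0)"] by (simp add: g_def)
    ultimately show "((\<lambda>\<sigma>. w_real (\<sigma>, z)) has_field_derivative g (\<tau>, z)) (at \<tau> within J)"
      by (simp add: has_field_derivative_def o_def)
  qed
qed

lemma w_real_linear_approximation:
  assumes w_C1: "C1_offdiag w" and a: "0 < a"
  obtains g where "\<And>e. 0 < e \<Longrightarrow> \<exists>d>0. \<forall>s\<in>Iper. \<forall>t\<in>Iper. \<forall>z\<in>Iper. a \<le> distT (t - z) \<longrightarrow> \<bar>s - t\<bar> < d \<longrightarrow>
     \<bar>w_real (s, z) - w_real (t, z) - g (t, z) * (s - t)\<bar> \<le> e * \<bar>s - t\<bar>"
proof -
  obtain g where g: "continuous_on offdiag g" "\<And>J \<tau> z. (\<And>\<sigma>. \<sigma> \<in> J \<Longrightarrow> (\<sigma>, z) \<in> offdiag) \<Longrightarrow> \<tau> \<in> J \<Longrightarrow>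
       ((\<lambda>\<sigma>. w_real (\<sigma>, z)) has_field_derivative g (\<tau>, z)) (at \<tau> within J)"
    using w_real_partial_derivative[OF w_C1] by blast
  have half_pos: "0 < a / 2" using a by simp
  have "uniformly_continuous_on (separated_pairs (a/2)) g"
    by (rule compact_uniformly_continuous[OF continuous_on_subset[OF g(1) separated_pairs_offdiag[OF half_pos]]
      compact_separated_pairs])
  note uniform = this[unfolded uniformly_continuous_on_def, rule_format]
  show ?thesis
  proof (rule that[of g])
    fix e :: real assume e: "0 < e"
    obtain d where d: "0 < d" "\<And>p q. p \<in> separated_pairs (a/2) \<Longrightarrow> q \<in> separated_pairs (a/2) \<Longrightarrow>
        dist q p < d \<Longrightarrow> dist (g q) (g p) < e"
      using uniform[OF e] by blast
    show "\<exists>d>0. \<forall>s\<in>Iper. \<forall>t\<in>Iper. \<forall>z\<in>Iper. a \<le> distT (t - z) \<longrightarrow> \<bar>s - t\<bar> < d \<longrightarrow>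
     \<bar>w_real (s, z) - w_real (t, z) - g (t, z) * (s - t)\<bar> \<le> e * \<bar>s - t\<bar>"
    proof (intro exI[of _ "min d (a / 4)"] conjI ballI impI)
      show "0 < min d (a / 4)" using d(1) a by simp
      fix s t z assume mem: "s \<in> Iper" "t \<in> Iper" "z \<in> Iper" and sep: "a \<le> distT (t - z)"
        and close: "\<bar>s - t\<bar> < min d (a / 4)"
      define J where "J = {min s t..max s t}"
      have J: "\<tau> \<in> Iper" "\<bar>\<tau> - t\<bar> < min d (a / 4)" if "\<tau> \<in> J" for \<tau>
        using that mem close by (auto simp: J_def Iper_def min_def max_def split: if_splits)
      have J_sep: "(\<tau>, z) \<in> separated_pairs (a/2)" if "\<tau> \<in> J" for \<tau>
        using distT_stable[OF sep, of \<tau> z] J[OF that] mem(3) a by (simp add: separated_pairs_def)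
      have derivative: "((\<lambda>\<tau>. w_real (\<tau>, z) - g (t, z) * \<tau>) has_field_derivative
          g (\<tau>, z) - g (t, z)) (at \<tau> within J)" if "\<tau> \<in> J" for \<tau>
        using J_sep separated_pairs_offdiag[OF half_pos] that by (auto intro!: derivative_eq_intros g(2))
      have oscillation: "norm (g (\<tau>, z) - g (t, z)) \<le> e" if "\<tau> \<in> J" for \<tau>
      proof -
        have "t \<in> J" by (auto simp: J_def)
        moreover have "dist (\<tau>, z) (t, z) < d" using J(2)[OF that] by (simp add: dist_Pair_Pair dist_real_def)
        ultimately show ?thesis using d(2)[OF J_sep J_sep] that by (fastforce simp: dist_real_def)
      qed
      have "norm ((w_real (s, z) - g (t, z) * s) - (w_real (t, z) - g (t, z) * t)) \<le> e * norm (s - t)"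
        by (rule field_differentiable_bound[of J, OF _ derivative oscillation]) (auto simp: J_def)
      then show "\<bar>w_real (s, z) - w_real (t, z) - g (t, z) * (s - t)\<bar> \<le> e * \<bar>s - t\<bar>" by (simp add: algebra_simps)
    qed
  qed
qed

lemma real_cost_split:
  "real_cost x = (\<Sum>j\<in>{..<n} - {0}. w_real (x 0, x j)) + (\<Sum>i\<in>{..<n} - {0}. w_real (x i, x 0))
     + (\<Sum>i\<in>{..<n} - {0}. \<Sum>j\<in>{..<n} - {i} - {0}. w_real (x i, x j))"
proof -
  have zero_mem: "0 \<in> {..<n}" using n_pos by simp
  have "real_cost x = (\<Sum>j\<in>{..<n} - {0}. w_real (x 0, x j)) + (\<Sum>i\<in>{..<n} - {0}. \<Sum>j\<in>{..<n} - {i}. w_real (x i, x j))"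
    unfolding real_cost_def by (rule sum.remove[OF _ zero_mem]) simp
  also have "(\<Sum>i\<in>{..<n} - {0}. \<Sum>j\<in>{..<n} - {i}. w_real (x i, x j)) =
      (\<Sum>i\<in>{..<n} - {0}. w_real (x i, x 0) + (\<Sum>j\<in>{..<n} - {i} - {0}. w_real (x i, x j)))"
    using zero_mem by (intro sum.cong refl sum.remove) auto
  finally show ?thesis by (simp add: sum.distrib)
qed

lemma real_cost_fun_upd:
  assumes x: "\<And>i. i < n \<Longrightarrow> x i \<in> Iper" and s: "s \<in> Iper"
  shows "real_cost (x(0 := s)) - real_cost x = (\<Sum>j\<in>{..<n} - {0}. 2 * (w_real (s, x j) - w_real (x 0, x j)))"
proof -
  let ?y = "x(0 := s)"
  have "(\<Sum>j\<in>{..<n} - {0}. w_real (?y 0, ?y j)) = (\<Sum>j\<in>{..<n} - {0}. w_real (s, x j))" by (rule sum.cong) auto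
  moreover have "(\<Sum>i\<in>{..<n} - {0}. w_real (?y i, ?y 0)) = (\<Sum>i\<in>{..<n} - {0}. w_real (s, x i))"
    using x s w_sym by (intro sum.cong) auto
  moreover have "(\<Sum>i\<in>{..<n} - {0}. w_real (x i, x 0)) = (\<Sum>i\<in>{..<n} - {0}. w_real (x 0, x i))"
    using x n_pos w_sym by (intro sum.cong) auto
  moreover have "(\<Sum>i\<in>{..<n} - {0}. \<Sum>j\<in>{..<n} - {i} - {0}. w_real (?y i, ?y j)) =
      (\<Sum>i\<in>{..<n} - {0}. \<Sum>j\<in>{..<n} - {i} - {0}. w_real (x i, x j))"
    by (intro sum.cong) auto
  ultimately show ?thesis unfolding real_cost_split[of ?y] real_cost_split[of x]
    by (simp add: sum_subtractf sum_distrib_left[symmetric])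
qed

lemma separated_fun_upd:
  assumes "separated a x" "\<bar>s - x 0\<bar> < a / 4" shows "separated (a / 2) (x(0 := s))"
  unfolding separated_def
proof (intro allI impI)
  fix i j assume ij: "i < n" "j < n" "i \<noteq> j"
  have "0 < a" using assms(2) abs_ge_zero[of "s - x 0"] by linarith
  then have "\<bar>(x(0 := s)) k - x k\<bar> < a / 4" for k using assms(2) by (cases "k = 0") auto
  then show "a / 2 \<le> distT ((x(0 := s)) i - (x(0 := s)) j)"
    using assms(1) ij by (intro distT_stable[of a "x i" "x j"]) (auto simp only: separated_def)
qed

lemma real_cost_supergradient:
  assumes w_C1: "C1_offdiag w" and a: "0 < a"
  obtains g where "\<And>e. 0 < e \<Longrightarrow> \<exists>d>0. \<forall>s\<in>Iper. \<forall>x\<in>configurations. separated a x \<longrightarrow> \<bar>s - x 0\<bar> < d \<longrightarrow>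
     x(0 := s) \<in> configurations \<and>
     real_cost (x(0 := s)) - real_cost x \<le> (\<Sum>j\<in>{..<n} - {0}. 2 * g (x 0, x j)) * (s - x 0) + e * \<bar>s - x 0\<bar>"
proof -
  obtain g where g: "\<And>e. 0 < e \<Longrightarrow> \<exists>d>0. \<forall>s\<in>Iper. \<forall>t\<in>Iper. \<forall>z\<in>Iper. a \<le> distT (t - z) \<longrightarrow> \<bar>s - t\<bar> < d \<longrightarrow>
     \<bar>w_real (s, z) - w_real (t, z) - g (t, z) * (s - t)\<bar> \<le> e * \<bar>s - t\<bar>"
    using w_real_linear_approximation[OF w_C1 a] by blast
  show ?thesis
  proof (rule that[of g])
    fix e :: real assume e: "0 < e"
    have "0 < e / (2 * real n)" using e n_pos by simp
    then obtain d where d: "0 < d" "\<And>s t z. s \<in> Iper \<Longrightarrow> t \<in> Iper \<Longrightarrow> z \<in> Iper \<Longrightarrow> a \<le> distT (t - z) \<Longrightarrow> \<bar>s - t\<bar> < d \<Longrightarrow>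
        \<bar>w_real (s, z) - w_real (t, z) - g (t, z) * (s - t)\<bar> \<le> e / (2 * real n) * \<bar>s - t\<bar>"
      using g by meson
    show "\<exists>d>0. \<forall>s\<in>Iper. \<forall>x\<in>configurations. separated a x \<longrightarrow> \<bar>s - x 0\<bar> < d \<longrightarrow> x(0 := s) \<in> configurations \<and>
     real_cost (x(0 := s)) - real_cost x \<le> (\<Sum>j\<in>{..<n} - {0}. 2 * g (x 0, x j)) * (s - x 0) + e * \<bar>s - x 0\<bar>"
    proof (intro exI[of _ "min d (a / 4)"] conjI ballI impI)
      show "0 < min d (a / 4)" using d(1) a by simp
      fix s x assume s: "s \<in> Iper" and x: "x \<in> configurations" and sep: "separated a x"
        and close: "\<bar>s - x 0\<bar> < min d (a / 4)"
      note x_Iper = configuration_in_Iper[OF x]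
      have zero_less: "0 < n" using n_pos by simp
      have "separated (a / 2) (x(0 := s))" using sep close by (intro separated_fun_upd) auto
      then show "x(0 := s) \<in> configurations" using x_Iper s a by (intro separated_configuration[where a = "a / 2"]) auto
      have "real_cost (x(0 := s)) - real_cost x = (\<Sum>j\<in>{..<n} - {0}. 2 * (w_real (s, x j) - w_real (x 0, x j)))"
        by (rule real_cost_fun_upd[OF x_Iper s])
      also have "\<dots> \<le> (\<Sum>j\<in>{..<n} - {0}. 2 * (g (x 0, x j) * (s - x 0) + e / (2 * real n) * \<bar>s - x 0\<bar>))"
      proof (intro sum_mono mult_left_mono)
        fix j assume j: "j \<in> {..<n} - {0}"
        then have "a \<le> distT (x 0 - x j)" using sep zero_less by (simp add: separated_def)
        then have "\<bar>w_real (s, x j) - w_real (x 0, x j) - g (x 0, x j) * (s - x 0)\<bar> \<le> e / (2 * real n) * \<bar>s - x 0\<bar>"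
          using j close zero_less by (intro d(2) s x_Iper) auto
        then show "w_real (s, x j) - w_real (x 0, x j) \<le> g (x 0, x j) * (s - x 0) + e / (2 * real n) * \<bar>s - x 0\<bar>"
          by linarith
      qed simp
      also have "\<dots>
          = (\<Sum>j\<in>{..<n} - {0}. 2 * g (x 0, x j)) * (s - x 0) + real (card ({..<n} - {0})) * (e / real n * \<bar>s - x 0\<bar>)"
        by (simp add: sum.distrib sum_distrib_right distrib_left mult.assoc)
      also have "\<dots> \<le> (\<Sum>j\<in>{..<n} - {0}. 2 * g (x 0, x j)) * (s - x 0) + real n * (e / real n * \<bar>s - x 0\<bar>)"
        using e zero_less by (intro add_left_mono mult_right_mono) (auto simp: card_Diff_singleton)
      finally show "real_cost (x(0 := s)) - real_cost x
          \<le> (\<Sum>j\<in>{..<n} - {0}. 2 * g (x 0, x j)) * (s - x 0) + e * \<bar>s - x 0\<bar>"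
        using zero_less by simp
    qed
  qed
qed

lemma contact_increment_le:
  assumes u: "dual_feasible u" and contact: "(\<Sum>i<n. u (x i)) = real_cost x" and y: "x(0 := s) \<in> configurations"
  shows "u s - u (x 0) \<le> real_cost (x(0 := s)) - real_cost x"
  using dual_feasibleD[OF u y] sum_fun_upd[of 0 u x s] contact n_pos by simp

lemma configuration_limit:
  assumes a: "0 < a" and y: "\<And>k. y k \<in> configurations" "\<And>k. separated a (y k)"
    and lim: "\<And>i. i < n \<Longrightarrow> (\<lambda>k. y k i) \<longlonglongrightarrow> x i"
  shows "x \<in> configurations" and "(\<lambda>k. real_cost (y k)) \<longlonglongrightarrow> real_cost x"
proof -
  have x_Iper: "x i \<in> Iper" if "i < n" for i
    using closed_sequentially[OF compact_imp_closed[OF compact_Iper] _ lim[OF that]]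
      configuration_in_Iper[OF y(1) that] by blast
  have sep: "separated a x" unfolding separated_def
  proof (intro allI impI)
    fix i j assume ij: "i < n" "j < n" "i \<noteq> j"
    have "isCont distT z" for z
      using continuous_on_distT[OF continuous_on_id, of UNIV] by (simp add: continuous_on_eq_continuous_at)
    then have "(\<lambda>k. distT (y k i - y k j)) \<longlonglongrightarrow> distT (x i - x j)"
      by (rule isCont_tendsto_compose) (intro tendsto_intros lim ij)
    then show "a \<le> distT (x i - x j)" by (rule LIMSEQ_le_const) (use y(2) ij in \<open>auto simp: separated_def\<close>)
  qed
  show "x \<in> configurations" by (rule separated_configuration[OF x_Iper sep a])
  show "(\<lambda>k. real_cost (y k)) \<longlonglongrightarrow> real_cost x"
  proof (rule tendstoI)
    fix e :: real assume "0 < e"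
    then obtain d where d: "0 < d" "\<And>x y. (\<And>i. i < n \<Longrightarrow> x i \<in> Iper) \<Longrightarrow> (\<And>i. i < n \<Longrightarrow> y i \<in> Iper) \<Longrightarrow> separated a x \<Longrightarrow>
        (\<And>i. i < n \<Longrightarrow> \<bar>y i - x i\<bar> < d) \<Longrightarrow> separated (a/2) y \<and> \<bar>real_cost y - real_cost x\<bar> < e"
      using real_cost_uniformly_continuous_separated[OF a] by metis
    have "\<forall>\<^sub>F k in sequentially. \<forall>i\<in>{..<n}. dist (y k i) (x i) < d"
      using lim d(1) by (intro eventually_ball_finite) (auto simp: tendsto_iff)
    then show "\<forall>\<^sub>F k in sequentially. dist (real_cost (y k)) (real_cost x) < e"
    proof eventually_elim
      case (elim k)
      have "\<bar>real_cost (y k) - real_cost x\<bar> < e"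
        using d(2)[of x "y k", OF x_Iper configuration_in_Iper[OF y(1)] sep] elim by (simp add: dist_real_def)
      then show ?case by (simp add: dist_real_def)
    qed
  qed
qed

lemma kantorovich_potD:
  assumes "kantorovich_pot n w \<rho> u"
  shows "dual_feasible u" "0 \<le> (\<integral>t. \<rho> t * u t \<partial>Lper)" "FOT n w \<rho> = ennreal (real n * (\<integral>t. \<rho> t * u t \<partial>Lper))"
proof -
  let ?r = "real n * (\<integral>t. \<rho> t * u t \<partial>Lper)"
  show "dual_feasible u" using assms by (simp add: dual_feasible_iff_cN kantorovich_pot_def)
  have F: "enn2ereal (FOT n w \<rho>) = ereal ?r" using assms by (simp add: kantorovich_pot_def)
  have "0 \<le> enn2ereal (FOT n w \<rho>)" by simp
  then have r: "0 \<le> ?r" unfolding F by simp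
  then show "0 \<le> (\<integral>t. \<rho> t * u t \<partial>Lper)" using n_pos by (simp add: zero_le_mult_iff)
  have "enn2ereal (FOT n w \<rho>) = enn2ereal (ennreal ?r)" using F r by (simp add: enn2ereal_ennreal)
  then show "FOT n w \<rho> = ennreal ?r" by (simp only: enn2ereal_inject)
qed

end

subsection \<open>Common contact configurations\<close>

locale regular_potential_pair = cost +
  fixes \<rho> u\<^sub>1 u\<^sub>2 :: "real \<Rightarrow> real"
  assumes \<rho>_Dper: "Dper \<rho>"
    and u\<^sub>1_regular: "regular_kantorovich_pot n w \<rho> u\<^sub>1"
    and u\<^sub>2_regular: "regular_kantorovich_pot n w \<rho> u\<^sub>2"
begin

lemmas \<rho>_continuous = Dper_D(2)[OF \<rho>_Dper] and \<rho>_pos = Dper_D(3)[OF \<rho>_Dper]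

lemma kantorovich: "kantorovich_pot n w \<rho> u\<^sub>1" "kantorovich_pot n w \<rho> u\<^sub>2"
  and u_continuous: "continuous_on Iper u\<^sub>1" "continuous_on Iper u\<^sub>2"
  using u\<^sub>1_regular u\<^sub>2_regular by (auto simp: regular_kantorovich_pot_def)

lemma integrals_eq: "(\<integral>t. \<rho> t * u\<^sub>1 t \<partial>Lper) = (\<integral>t. \<rho> t * u\<^sub>2 t \<partial>Lper)"
proof -
  have "ennreal (real n * (\<integral>t. \<rho> t * u\<^sub>1 t \<partial>Lper)) = ennreal (real n * (\<integral>t. \<rho> t * u\<^sub>2 t \<partial>Lper))"
    using kantorovich_potD(3)[OF kantorovich(1)] kantorovich_potD(3)[OF kantorovich(2)] by simp
  then show ?thesis using kantorovich_potD(2)[OF kantorovich(1)] kantorovich_potD(2)[OF kantorovich(2)] n_pos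
    by (subst (asm) ennreal_inj) auto
qed

text \<open>Otherwise the average of the two potentials could be raised by a bump near t in one variable, contradicting weak
  duality.\<close>

lemma approximate_contact:
  assumes t: "t \<in> Iper" and \<delta>: "0 < \<delta>" "\<delta> \<le> 1"
  shows "\<exists>x\<in>configurations. \<bar>x 0 - t\<bar> < \<delta> \<and> 2 * real_cost x \<le> (\<Sum>i<n. u\<^sub>1 (x i)) + (\<Sum>i<n. u\<^sub>2 (x i)) + \<delta>"
proof (rule ccontr)
  assume "\<not> ?thesis"
  then have slack: "(\<Sum>i<n. u\<^sub>1 (x i)) + (\<Sum>i<n. u\<^sub>2 (x i)) + \<delta> \<le> 2 * real_cost x"
    if "x \<in> configurations" "\<bar>x 0 - t\<bar> < \<delta>" for x using that by force
  define h where "h s = \<delta> * max 0 (\<delta> - \<bar>s - t\<bar>)" for s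
  have h_cont: "continuous_on A h" for A unfolding h_def[abs_def] by (intro continuous_intros)
  have h_le: "h s \<le> \<delta>" for s using mult_left_mono[of "max 0 (\<delta> - \<bar>s - t\<bar>)" 1 \<delta>] \<delta> by (simp add: h_def)
  define q where "q i s = (u\<^sub>1 s + u\<^sub>2 s + (if i = 0 then h s else 0)) / 2" for i :: nat and s
  have q_cont: "continuous_on Iper (q i)" for i
    unfolding q_def[abs_def] by (cases "i = 0") (auto intro!: continuous_intros u_continuous h_cont)
  have "(\<Sum>i<n. q i (x i)) \<le> real_cost x" if x: "x \<in> configurations" for x
  proof -
    have "(\<Sum>i<n. u\<^sub>1 (x i)) \<le> real_cost x" "(\<Sum>i<n. u\<^sub>2 (x i)) \<le> real_cost x"
      using kantorovich_potD(1)[OF kantorovich(1)] kantorovich_potD(1)[OF kantorovich(2)] x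
      by (auto dest: dual_feasibleD)
    moreover have "h (x 0) = 0" if "\<not> \<bar>x 0 - t\<bar> < \<delta>" using that by (simp add: h_def)
    ultimately have "(\<Sum>i<n. u\<^sub>1 (x i)) + (\<Sum>i<n. u\<^sub>2 (x i)) + h (x 0) \<le> 2 * real_cost x"
      using slack[OF x] h_le[of "x 0"] by (cases "\<bar>x 0 - t\<bar> < \<delta>") auto
    moreover have "(\<Sum>i<n. if i = 0 then h (x i) else 0) = h (x 0)" using n_pos by (simp add: sum.delta)
    then have "2 * (\<Sum>i<n. q i (x i)) = (\<Sum>i<n. u\<^sub>1 (x i)) + (\<Sum>i<n. u\<^sub>2 (x i)) + h (x 0)"
      by (simp add: q_def sum_divide_distrib[symmetric] sum.distrib)
    ultimately show ?thesis by linarith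
  qed
  then have "ennreal (\<Sum>i<n. \<integral>t. \<rho> t * q i t \<partial>Lper) \<le> FOT n w \<rho>"
    using \<rho>_pos by (intro FOT_weak_duality \<rho>_continuous q_cont) (auto intro: less_imp_le)
  moreover have "(\<Sum>i<n. \<integral>t. \<rho> t * q i t \<partial>Lper) = real n * (\<integral>t. \<rho> t * u\<^sub>1 t \<partial>Lper) + (\<integral>t. \<rho> t * h t \<partial>Lper) / 2"
  proof -
    have integrable: "integrable Lper (\<lambda>t. \<rho> t * f t)" if "continuous_on Iper f" for f
      by (intro integrable_Lper_continuous continuous_intros \<rho>_continuous that)
    have "(\<integral>t. \<rho> t * q i t \<partial>Lper) = (\<integral>t. \<rho> t * u\<^sub>1 t \<partial>Lper) + (if i = 0 then (\<integral>t. \<rho> t * h t \<partial>Lper) / 2 else 0)" for i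
      using integrable[OF u_continuous(1)] integrable[OF u_continuous(2)] integrable[OF h_cont] integrals_eq
      by (cases "i = 0") (simp_all add: q_def distrib_left)
    then show ?thesis using n_pos by (simp add: sum.distrib)
  qed
  moreover have "0 < (\<integral>s. \<rho> s * h s \<partial>Lper)"
    using \<rho>_pos t \<delta>
    by (intro integral_Lper_pos[OF _ _ t] continuous_intros \<rho>_continuous h_cont) (auto simp: h_def less_imp_le)
  ultimately show False
    using kantorovich_potD(2,3)[OF kantorovich(1)] by (simp add: ennreal_le_iff)
qed

lemma near_contacts_separated:
  obtains a where "0 < a" "\<And>x. x \<in> configurations \<Longrightarrow>
    2 * real_cost x \<le> (\<Sum>i<n. u\<^sub>1 (x i)) + (\<Sum>i<n. u\<^sub>2 (x i)) + 1 \<Longrightarrow> separated a x"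
proof -
  obtain U\<^sub>1 U\<^sub>2 where U: "\<And>t. t \<in> Iper \<Longrightarrow> \<bar>u\<^sub>1 t\<bar> \<le> U\<^sub>1" "\<And>t. t \<in> Iper \<Longrightarrow> \<bar>u\<^sub>2 t\<bar> \<le> U\<^sub>2"
    using continuous_on_Iper_bounded[OF u_continuous(1)] continuous_on_Iper_bounded[OF u_continuous(2)] by metis
  obtain a where a: "0 < a" "\<And>x. x \<in> configurations \<Longrightarrow> real_cost x \<le> real n * U\<^sub>1 + real n * U\<^sub>2 + 1 \<Longrightarrow> separated a x"
    using separated_if_cost_bounded by blast
  show ?thesis
  proof (rule that[OF a(1) a(2)])
    fix x assume x: "x \<in> configurations" "2 * real_cost x \<le> (\<Sum>i<n. u\<^sub>1 (x i)) + (\<Sum>i<n. u\<^sub>2 (x i)) + 1"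
    note x_Iper = configuration_in_Iper[OF x(1)]
    have "(\<Sum>i<n. u\<^sub>1 (x i)) \<le> (\<Sum>i<n. U\<^sub>1)" using U(1) x_Iper by (intro sum_mono) (auto simp: abs_le_iff)
    moreover have "(\<Sum>i<n. u\<^sub>2 (x i)) \<le> (\<Sum>i<n. U\<^sub>2)" using U(2) x_Iper by (intro sum_mono) (auto simp: abs_le_iff)
    ultimately show "real_cost x \<le> real n * U\<^sub>1 + real n * U\<^sub>2 + 1" using x(2) real_cost_nonneg[of x] by simp
  qed
qed

lemma contact_configuration:
  assumes t: "t \<in> Iper"
  shows "\<exists>x\<in>configurations. x 0 = t \<and> (\<Sum>i<n. u\<^sub>1 (x i)) = real_cost x \<and> (\<Sum>i<n. u\<^sub>2 (x i)) = real_cost x"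
proof -
  define \<delta> where "\<delta> k = inverse (real (Suc k))" for k
  have \<delta>: "0 < \<delta> k" "\<delta> k \<le> 1" for k by (auto simp: \<delta>_def inverse_le_1_iff)
  have "\<forall>k. \<exists>x\<in>configurations. \<bar>x 0 - t\<bar> < \<delta> k \<and> 2 * real_cost x \<le> (\<Sum>i<n. u\<^sub>1 (x i)) + (\<Sum>i<n. u\<^sub>2 (x i)) + \<delta> k"
    using approximate_contact[OF t \<delta>] by blast
  then obtain y where y: "\<And>k. y k \<in> configurations" "\<And>k. \<bar>y k 0 - t\<bar> < \<delta> k"
    "\<And>k. 2 * real_cost (y k) \<le> (\<Sum>i<n. u\<^sub>1 (y k i)) + (\<Sum>i<n. u\<^sub>2 (y k i)) + \<delta> k" by metis
  note y_Iper = configuration_in_Iper[OF y(1)]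
  have "\<bar>if i < n then y k i else 0\<bar> \<le> 2 * pi" for k i using y_Iper[of i k] by (auto simp: Iper_def)
  then obtain r x where r: "strict_mono (r :: nat \<Rightarrow> nat)"
      and truncated_lim: "\<And>i. (\<lambda>k. if i < n then y (r k) i else 0) \<longlonglongrightarrow> x i"
    using coordinatewise_bounded_convergent_subsequence[of "\<lambda>k i. if i < n then y k i else 0" "\<lambda>_. 2 * pi"] by metis
  have lim: "(\<lambda>k. y (r k) i) \<longlonglongrightarrow> x i" if "i < n" for i using truncated_lim[of i] that by simp
  obtain a where a: "0 < a" "\<And>x. x \<in> configurations \<Longrightarrow>
      2 * real_cost x \<le> (\<Sum>i<n. u\<^sub>1 (x i)) + (\<Sum>i<n. u\<^sub>2 (x i)) + 1 \<Longrightarrow> separated a x"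
    using near_contacts_separated by blast
  have sep: "separated a (y k)" for k using y(3)[of k] \<delta>(2)[of k] by (intro a(2)[OF y(1)]) linarith
  note x = configuration_limit[of a "\<lambda>k. y (r k)", OF a(1) y(1) sep lim]
  have \<delta>_lim: "(\<lambda>k. \<delta> (r k)) \<longlonglongrightarrow> 0"
    using LIMSEQ_subseq_LIMSEQ[OF LIMSEQ_inverse_real_of_nat r] by (simp add: o_def \<delta>_def)
  have u_lim: "(\<lambda>k. \<Sum>i<n. u (y (r k) i)) \<longlonglongrightarrow> (\<Sum>i<n. u (x i))" if "continuous_on Iper u" for u :: "real \<Rightarrow> real"
    using configuration_in_Iper[OF x(1)] y_Iper
    by (intro tendsto_sum continuous_on_tendsto_compose[OF that lim]) auto
  have "x 0 = t"
  proof -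
    have "(\<lambda>k. \<bar>y (r k) 0 - t\<bar>) \<longlonglongrightarrow> \<bar>x 0 - t\<bar>" using n_pos by (intro tendsto_intros lim) simp
    then have "\<bar>x 0 - t\<bar> \<le> 0" using \<delta>_lim by (rule LIMSEQ_le) (use y(2) less_imp_le in blast)
    then show ?thesis by simp
  qed
  moreover have "2 * real_cost x \<le> (\<Sum>i<n. u\<^sub>1 (x i)) + (\<Sum>i<n. u\<^sub>2 (x i)) + 0"
  proof (rule LIMSEQ_le)
    show "(\<lambda>k. 2 * real_cost (y (r k))) \<longlonglongrightarrow> 2 * real_cost x" by (intro tendsto_intros x(2))
    show "(\<lambda>k. (\<Sum>i<n. u\<^sub>1 (y (r k) i)) + (\<Sum>i<n. u\<^sub>2 (y (r k) i)) + \<delta> (r k)) \<longlonglongrightarrow> (\<Sum>i<n. u\<^sub>1 (x i)) + (\<Sum>i<n. u\<^sub>2 (x i)) + 0"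
      by (intro tendsto_intros u_lim u_continuous \<delta>_lim)
  qed (use y(3) in blast)
  moreover have "(\<Sum>i<n. u\<^sub>1 (x i)) \<le> real_cost x" "(\<Sum>i<n. u\<^sub>2 (x i)) \<le> real_cost x"
    using kantorovich_potD(1)[OF kantorovich(1)] kantorovich_potD(1)[OF kantorovich(2)] x(1)
    by (auto dest: dual_feasibleD)
  ultimately show ?thesis using x(1) by (intro bexI[of _ x]) auto
qed

lemma common_supergradient:
  assumes w_C1: "C1_offdiag w"
  obtains p where "\<And>e. 0 < e \<Longrightarrow> \<exists>d>0. \<forall>s\<in>Iper. \<forall>t\<in>Iper. \<bar>s - t\<bar> < d \<longrightarrow>
    u\<^sub>1 s - u\<^sub>1 t \<le> p t * (s - t) + e * \<bar>s - t\<bar> \<and> u\<^sub>2 s - u\<^sub>2 t \<le> p t * (s - t) + e * \<bar>s - t\<bar>"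
proof -
  have "\<forall>t. \<exists>x. t \<in> Iper \<longrightarrow> x \<in> configurations \<and> x 0 = t \<and> (\<Sum>i<n. u\<^sub>1 (x i)) = real_cost x \<and>
      (\<Sum>i<n. u\<^sub>2 (x i)) = real_cost x"
    using contact_configuration by blast
  then obtain X where X: "\<And>t. t \<in> Iper \<Longrightarrow> X t \<in> configurations" "\<And>t. t \<in> Iper \<Longrightarrow> X t 0 = t"
    "\<And>t. t \<in> Iper \<Longrightarrow> (\<Sum>i<n. u\<^sub>1 (X t i)) = real_cost (X t)" "\<And>t. t \<in> Iper \<Longrightarrow> (\<Sum>i<n. u\<^sub>2 (X t i)) = real_cost (X t)"
    by metis
  obtain a where a: "0 < a" "\<And>x. x \<in> configurations \<Longrightarrow>
      2 * real_cost x \<le> (\<Sum>i<n. u\<^sub>1 (x i)) + (\<Sum>i<n. u\<^sub>2 (x i)) + 1 \<Longrightarrow> separated a x"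
    using near_contacts_separated by blast
  have sep: "separated a (X t)" if t: "t \<in> Iper" for t using X(3,4)[OF t] by (intro a(2)[OF X(1)[OF t]]) simp
  obtain g where g: "\<And>e. 0 < e \<Longrightarrow> \<exists>d>0. \<forall>s\<in>Iper. \<forall>x\<in>configurations. separated a x \<longrightarrow> \<bar>s - x 0\<bar> < d \<longrightarrow>
     x(0 := s) \<in> configurations \<and>
     real_cost (x(0 := s)) - real_cost x \<le> (\<Sum>j\<in>{..<n} - {0}. 2 * g (x 0, x j)) * (s - x 0) + e * \<bar>s - x 0\<bar>"
    using real_cost_supergradient[OF w_C1 a(1)] by blast
  show ?thesis
  proof (rule that[of "\<lambda>t. \<Sum>j\<in>{..<n} - {0}. 2 * g (t, X t j)"])
    fix e :: real assume "0 < e"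
    then obtain d where d: "0 < d" "\<And>s x. s \<in> Iper \<Longrightarrow> x \<in> configurations \<Longrightarrow> separated a x \<Longrightarrow> \<bar>s - x 0\<bar> < d \<Longrightarrow>
        x(0 := s) \<in> configurations \<and>
        real_cost (x(0 := s)) - real_cost x \<le> (\<Sum>j\<in>{..<n} - {0}. 2 * g (x 0, x j)) * (s - x 0) + e * \<bar>s - x 0\<bar>"
      using g by meson
    have "u s - u t \<le> (\<Sum>j\<in>{..<n} - {0}. 2 * g (t, X t j)) * (s - t) + e * \<bar>s - t\<bar>"
      if s: "s \<in> Iper" and t: "t \<in> Iper" and close: "\<bar>s - t\<bar> < d"
        and u: "dual_feasible u" "(\<Sum>i<n. u (X t i)) = real_cost (X t)" for s t u
    proof -
      have y: "(X t)(0 := s) \<in> configurations"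
        "real_cost ((X t)(0 := s)) - real_cost (X t) \<le> (\<Sum>j\<in>{..<n} - {0}. 2 * g (t, X t j)) * (s - t) + e * \<bar>s - t\<bar>"
        using d(2)[OF s X(1)[OF t] sep[OF t]] close by (simp_all add: X(2)[OF t])
      then show ?thesis using contact_increment_le[OF u y(1)] by (simp add: X(2)[OF t])
    qed
    then show "\<exists>d>0. \<forall>s\<in>Iper. \<forall>t\<in>Iper. \<bar>s - t\<bar> < d \<longrightarrow>
        u\<^sub>1 s - u\<^sub>1 t \<le> (\<Sum>j\<in>{..<n} - {0}. 2 * g (t, X t j)) * (s - t) + e * \<bar>s - t\<bar> \<and>
        u\<^sub>2 s - u\<^sub>2 t \<le> (\<Sum>j\<in>{..<n} - {0}. 2 * g (t, X t j)) * (s - t) + e * \<bar>s - t\<bar>"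
      using d(1) X(3,4) kantorovich_potD(1)[OF kantorovich(1)] kantorovich_potD(1)[OF kantorovich(2)]
      by (intro exI[of _ d] conjI) blast+
  qed
qed

lemma difference_antimono:
  assumes w_C1: "C1_offdiag w" and ab: "a \<in> Iper" "b \<in> Iper" "a \<le> b"
  shows "u\<^sub>1 b - u\<^sub>2 b \<le> u\<^sub>1 a - u\<^sub>2 a"
proof -
  obtain p where p: "\<And>e. 0 < e \<Longrightarrow> \<exists>d>0. \<forall>s\<in>Iper. \<forall>t\<in>Iper. \<bar>s - t\<bar> < d \<longrightarrow>
    u\<^sub>1 s - u\<^sub>1 t \<le> p t * (s - t) + e * \<bar>s - t\<bar> \<and> u\<^sub>2 s - u\<^sub>2 t \<le> p t * (s - t) + e * \<bar>s - t\<bar>"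
    using common_supergradient[OF w_C1] by blast
  show ?thesis
  proof (cases "a = b")
    case False
    have "{a..b} \<subseteq> Iper" using ab by (auto simp: Iper_def)
    then show ?thesis
      using p ab(3) False by (intro common_supergradient_difference_le[of a b _ p]) (meson subsetD, simp)
  qed simp
qed

end

context cost
begin

theorem regular_potential_unique:
  assumes \<rho>: "Dper \<rho>" and w_C1: "C1_offdiag w"
    and u: "regular_kantorovich_pot n w \<rho> u" and v: "regular_kantorovich_pot n w \<rho> v" and x: "x \<in> Iper"
  shows "u x = v x"
proof -
  interpret uv: regular_potential_pair n w \<rho> u v by unfold_locales (fact \<rho> u v)+
  interpret vu: regular_potential_pair n w \<rho> v u by unfold_locales (fact \<rho> u v)+
  define K where "K = u x - v x"
  have K: "u s - v s = K" if "s \<in> Iper" for s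
    using uv.difference_antimono[OF w_C1 x that] vu.difference_antimono[OF w_C1 x that]
      uv.difference_antimono[OF w_C1 that x] vu.difference_antimono[OF w_C1 that x]
        by (cases "s \<le> x") (auto simp: K_def)
  have integrable: "integrable Lper (\<lambda>t. \<rho> t * u t)" "integrable Lper (\<lambda>t. \<rho> t * v t)"
    by (intro integrable_Lper_continuous continuous_intros uv.\<rho>_continuous uv.u_continuous)+
  have "0 = (\<integral>t. \<rho> t * u t \<partial>Lper) - (\<integral>t. \<rho> t * v t \<partial>Lper)" by (simp add: uv.integrals_eq)
  also have "\<dots> = (\<integral>t. \<rho> t * u t - \<rho> t * v t \<partial>Lper)"
    by (rule Bochner_Integration.integral_diff[OF integrable, symmetric])
  also have "\<dots> = (\<integral>t. K * \<rho> t \<partial>Lper)"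
    using K by (intro Bochner_Integration.integral_cong refl) (auto simp: right_diff_distrib[symmetric] mult.commute)
  also have "\<dots> = K" using Dper_D(4)[OF \<rho>] by simp
  finally show ?thesis by (simp add: K_def)
qed

end

section \<open>Convergence of the normalised potentials\<close>

lemma tendsto_at_right_if_subsequences:
  fixes f :: "real \<Rightarrow> 'a::metric_space"
  assumes sub: "\<And>S :: nat \<Rightarrow> real. (\<And>k. 0 < S k) \<Longrightarrow> S \<longlonglongrightarrow> 0 \<Longrightarrow> \<exists>r. strict_mono (r :: nat \<Rightarrow> nat) \<and> (\<lambda>k. f (S (r k))) \<longlonglongrightarrow> L"
  shows "(f \<longlongrightarrow> L) (at_right 0)"
proof (rule tendsto_at_right_sequentially[of 0 1])
  fix S :: "nat \<Rightarrow> real" assume S: "\<And>i. 0 < S i" "S \<longlonglongrightarrow> 0"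
  show "(\<lambda>i. f (S i)) \<longlonglongrightarrow> L"
  proof (rule ccontr)
    assume "\<not> ?thesis"
    then obtain d where d: "0 < d" "\<forall>N. \<exists>i\<ge>N. d \<le> dist (f (S i)) L" by (auto simp: lim_sequentially not_less)
    then have "infinite {i. d \<le> dist (f (S i)) L}" by (auto simp: infinite_nat_iff_unbounded_le)
    then obtain q :: "nat \<Rightarrow> nat" where q: "strict_mono q" "\<And>i. d \<le> dist (f (S (q i))) L"
      using infinite_enumerate by blast
    obtain r :: "nat \<Rightarrow> nat" where "(\<lambda>k. f ((S \<circ> q) (r k))) \<longlonglongrightarrow> L"
      using sub[of "S \<circ> q"] S(1) LIMSEQ_subseq_LIMSEQ[OF S(2) q(1)] by auto
    then have "\<forall>\<^sub>F k in sequentially. dist (f ((S \<circ> q) (r k))) L < d" using d(1) by (rule tendstoD)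
    then show False using q(2) by (auto simp: eventually_sequentially not_less[symmetric])
  qed
qed simp

context cost
begin

text \<open>The additive constant is chosen such that n V(rho) is the energy of rho; then n V is dominated by the
  energy on all admissible densities, with equality at rho.\<close>

definition normalising_constant :: "real \<Rightarrow> (real \<Rightarrow> real) \<Rightarrow> ((real \<Rightarrow> real) \<Rightarrow> real) \<Rightarrow> real" where
  "normalising_constant \<epsilon> \<rho> v = enn2real (Feps n w \<epsilon> \<rho>) / real n - v \<rho>"

definition normalised_potential :: "real \<Rightarrow> (real \<Rightarrow> real) \<Rightarrow> ((real \<Rightarrow> real) \<Rightarrow> real) \<Rightarrow> (real \<Rightarrow> real) \<Rightarrow> real" where
  "normalised_potential \<epsilon> \<rho> v f = v f + normalising_constant \<epsilon> \<rho> v * (\<integral>t. f t \<partial>Lper)"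

definition optimal_potential :: "real \<Rightarrow> (real \<Rightarrow> real) \<Rightarrow> ((real \<Rightarrow> real) \<Rightarrow> real) \<Rightarrow> bool" where
  "optimal_potential \<epsilon> \<rho> v \<longleftrightarrow> Hminus v \<and> (\<forall>\<zeta>. adm \<zeta> \<longrightarrow>
     enn2ereal (Feps n w \<epsilon> \<rho>) - ereal (real n * v \<rho>) \<le> enn2ereal (Feps n w \<epsilon> \<zeta>) - ereal (real n * v \<zeta>))"

lemma Hminus_normalised_potential: "Hminus v \<Longrightarrow> Hminus (normalised_potential \<epsilon> \<rho> v)"
  unfolding normalised_potential_def[abs_def]
  using Hminus_add[OF _ Hminus_integral[of "\<lambda>_. normalising_constant \<epsilon> \<rho> v"]]
  by simp

lemma Feps_finite_if_optimal:
  assumes \<epsilon>: "0 < \<epsilon>" and v: "optimal_potential \<epsilon> \<rho> v"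
  shows "Feps n w \<epsilon> \<rho> = ennreal (enn2real (Feps n w \<epsilon> \<rho>))"
proof -
  obtain \<zeta> where \<zeta>: "adm \<zeta>" "Feps n w \<epsilon> \<zeta> < top" using Feps_finite_somewhere \<epsilon> by blast
  then obtain q where "Feps n w \<epsilon> \<zeta> = ennreal q" "0 \<le> q" by (cases "Feps n w \<epsilon> \<zeta>") auto
  moreover have "enn2ereal (Feps n w \<epsilon> \<rho>) - ereal (real n * v \<rho>) \<le> enn2ereal (Feps n w \<epsilon> \<zeta>) - ereal (real n * v \<zeta>)"
    using v \<zeta>(1) by (simp add: optimal_potential_def)
  ultimately have "enn2ereal (Feps n w \<epsilon> \<rho>) \<noteq> \<infinity>" by auto
  then have "Feps n w \<epsilon> \<rho> < top" by (cases "Feps n w \<epsilon> \<rho>") (auto simp: enn2ereal_ennreal)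
  then show ?thesis by simp
qed

context
  fixes \<epsilon> :: real and \<rho> :: "real \<Rightarrow> real" and v :: "(real \<Rightarrow> real) \<Rightarrow> real"
  assumes \<rho>: "Dper \<rho>" and \<epsilon>: "0 < \<epsilon>" and v: "optimal_potential \<epsilon> \<rho> v"
begin

lemma normalised_potential_at_density: "real n * normalised_potential \<epsilon> \<rho> v \<rho> = enn2real (Feps n w \<epsilon> \<rho>)"
  using n_pos Dper_D(4)[OF \<rho>] by (simp add: normalised_potential_def normalising_constant_def)

lemma normalised_potential_nonneg: "0 \<le> normalised_potential \<epsilon> \<rho> v \<rho>"
proof -
  have "0 \<le> real n * normalised_potential \<epsilon> \<rho> v \<rho>" by (simp add: normalised_potential_at_density)
  then show ?thesis using n_pos by (simp add: zero_le_mult_iff)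
qed

lemma FOT_le_normalised_potential: "FOT n w \<rho> \<le> ennreal (real n * normalised_potential \<epsilon> \<rho> v \<rho>)"
  unfolding normalised_potential_at_density Feps_finite_if_optimal[OF \<epsilon> v, symmetric]
  by (rule FOT_le_Feps[OF n_pos w_assumptionA Dper_D(2)[OF \<rho>]])

lemma normalised_potential_le_Feps:
  assumes \<zeta>: "adm \<zeta>" and B: "Feps n w \<epsilon> \<zeta> \<le> ennreal B" "0 \<le> B"
  shows "real n * normalised_potential \<epsilon> \<rho> v \<zeta> \<le> B"
proof -
  define F where "F = enn2real (Feps n w \<epsilon> \<rho>)"
  have F: "Feps n w \<epsilon> \<rho> = ennreal F" "0 \<le> F" using Feps_finite_if_optimal[OF \<epsilon> v] by (simp_all add: F_def)
  obtain q where q: "Feps n w \<epsilon> \<zeta> = ennreal q" "0 \<le> q" "q \<le> B"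
    using B by (cases "Feps n w \<epsilon> \<zeta>") (auto simp: top_unique)
  have "enn2ereal (Feps n w \<epsilon> \<rho>) - ereal (real n * v \<rho>) \<le> enn2ereal (Feps n w \<epsilon> \<zeta>) - ereal (real n * v \<zeta>)"
    using v \<zeta> by (simp add: optimal_potential_def)
  then have "F - real n * v \<rho> \<le> q - real n * v \<zeta>" using F q(1,2) by (simp add: enn2ereal_ennreal)
  moreover have "(\<integral>t. \<zeta> t \<partial>Lper) = 1" using \<zeta> by (simp add: adm_def)
  then have "real n * normalised_potential \<epsilon> \<rho> v \<zeta> = real n * v \<zeta> + (F - real n * v \<rho>)"
    using n_pos by (simp add: normalised_potential_def normalising_constant_def F_def algebra_simps)
  ultimately show ?thesis using q(3) by linarith
qed

lemma slater_bound_normalised_potential: "slater_bound \<epsilon> (normalised_potential \<epsilon> \<rho> v)"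
  unfolding slater_bound_def
proof (intro allI impI)
  fix \<phi> \<phi>' S
  assume unit: "\<forall>j<n. unit_orbital (\<phi> j) (\<phi>' j)" and disjoint: "disjoint_orbitals n \<phi> \<phi>" and S: "0 \<le> S"
    and cost: "\<forall>x. (\<forall>j<n. x j \<in> Iper \<and> \<phi> j (x j) \<noteq> 0) \<longrightarrow> cN n w x \<le> ennreal S"
  let ?V = "normalised_potential \<epsilon> \<rho> v" and ?B = "\<epsilon> * (fact n * (\<Sum>j<n. \<integral>t. (\<phi>' j t)\<^sup>2 \<partial>Lper)) + S"
  have unit_j: "unit_orbital (\<phi> j) (\<phi>' j)" if "j < n" for j using unit that by simp
  have linear: "H1_linear ?V" using v
    by (intro Hminus_H1_linear Hminus_normalised_potential) (simp add: optimal_potential_def)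
  have square_H1: "H1per (\<lambda>t. (\<phi> j t)\<^sup>2)" if "j < n" for j
    by (rule C1per_H1per[OF C1per_square[OF unit_orbitalD(1)[OF unit_j[OF that]]]])
  have "?V (orbital_density n \<phi>) = (1 / real n) * ?V (\<lambda>t. \<Sum>j<n. (\<phi> j t)\<^sup>2)"
    unfolding orbital_density_def[abs_def]
    by (intro H1_linear_cmult[OF linear] conjunct1[OF H1_linear_sum[OF linear]] square_H1) auto
  also have "?V (\<lambda>t. \<Sum>j<n. (\<phi> j t)\<^sup>2) = (\<Sum>j<n. ?V (\<lambda>t. (\<phi> j t)\<^sup>2))"
    by (intro conjunct2[OF H1_linear_sum[OF linear]] square_H1) auto
  finally have "(\<Sum>j<n. ?V (\<lambda>t. (\<phi> j t)\<^sup>2)) = real n * ?V (orbital_density n \<phi>)" using n_pos by simp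
  also have "\<dots> \<le> ?B"
  proof (rule normalised_potential_le_Feps)
    show "adm (orbital_density n \<phi>)" by (rule adm_orbital_density[OF n_pos unit_j disjoint])
    show "Feps n w \<epsilon> (orbital_density n \<phi>) \<le> ennreal ?B"
      using \<epsilon> S cost by (intro Feps_orbital_density_le n_pos unit_j disjoint) auto
    show "0 \<le> ?B" using S \<epsilon> by (intro add_nonneg_nonneg mult_nonneg_nonneg sum_nonneg) auto
  qed
  finally show "(\<Sum>j<n. ?V (\<lambda>t. (\<phi> j t)\<^sup>2)) \<le> ?B" .
qed

end

theorem normalised_potentials_convergent_subsequence:
  assumes \<rho>: "Dper \<rho>" and v: "\<And>\<epsilon>. 0 < \<epsilon> \<Longrightarrow> optimal_potential \<epsilon> \<rho> (v \<epsilon>)"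
    and e: "\<And>j. 0 < e j" "e \<longlonglongrightarrow> 0"
  shows "\<exists>r u. strict_mono (r :: nat \<Rightarrow> nat) \<and> regular_kantorovich_pot n w \<rho> u \<and>
    (\<forall>f. H1per f \<longrightarrow> (\<lambda>j. normalised_potential (e (r j)) \<rho> (v (e (r j))) f) \<longlonglongrightarrow> (\<integral>t. u t * f t \<partial>Lper))"
proof -
  let ?V = "\<lambda>\<epsilon>. normalised_potential \<epsilon> \<rho> (v \<epsilon>)"
  have V: "Hminus (?V \<epsilon>)" "slater_bound \<epsilon> (?V \<epsilon>)" "0 \<le> ?V \<epsilon> \<rho>" "FOT n w \<rho> \<le> ennreal (real n * ?V \<epsilon> \<rho>)" if "0 < \<epsilon>" for \<epsilon>
    using v[OF that] Hminus_normalised_potential slater_bound_normalised_potential[OF \<rho> that v[OF that]]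
      normalised_potential_nonneg[OF \<rho> that v[OF that]] FOT_le_normalised_potential[OF \<rho> that v[OF that]]
    by (simp_all add: optimal_potential_def)
  obtain C where C: "\<And>\<epsilon> V. 0 \<le> \<epsilon> \<Longrightarrow> \<epsilon> \<le> 1 \<Longrightarrow> Hminus V \<Longrightarrow> slater_bound \<epsilon> V \<Longrightarrow> 0 \<le> V \<rho> \<Longrightarrow> H1_dual_le C V"
    using slater_bound_uniform_dual_bound[OF \<rho>] by blast
  have "\<forall>\<^sub>F j in sequentially. e j < 1" using order_tendstoD(2)[OF e(2), of 1] by simp
  then obtain k where k: "\<And>j. k \<le> j \<Longrightarrow> e j < 1" by (auto simp: eventually_sequentially)
  have "H1_dual_le C (?V (e (j + k)))" for j
    using e(1)[of "j + k"] k[of "j + k"] by (intro C[of "e (j + k)"] V) auto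
  then obtain r W where r: "strict_mono (r :: nat \<Rightarrow> nat)" and W: "H1_dual_le C W"
    and lim: "\<And>f. H1per f \<Longrightarrow> (\<lambda>j. ?V (e (r j + k)) f) \<longlonglongrightarrow> W f"
    using H1_dual_le_weakly_compact[of C "\<lambda>j. ?V (e (j + k))"] by blast
  have r_shift: "strict_mono (\<lambda>j. r j + k)" using r by (simp add: strict_mono_def)
  have e_lim: "(\<lambda>j. e (r j + k)) \<longlonglongrightarrow> 0" using LIMSEQ_subseq_LIMSEQ[OF e(2) r_shift] by (simp add: o_def)
  note \<rho>_lim = lim[OF Dper_D(1)[OF \<rho>]]
  interpret limit_potential n w \<rho> W C
  proof unfold_locales
    show "slater_bound 0 W" by (rule slater_bound_limit[OF V(2)[OF e(1)] e_lim lim])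
    show "0 \<le> W \<rho>" by (rule LIMSEQ_le_const[OF \<rho>_lim]) (use V(3)[OF e(1)] in blast)
    have "(\<lambda>j. ennreal (real n * ?V (e (r j + k)) \<rho>)) \<longlonglongrightarrow> ennreal (real n * W \<rho>)"
      by (intro tendsto_ennrealI tendsto_mult tendsto_const \<rho>_lim)
    then show "FOT n w \<rho> \<le> ennreal (real n * W \<rho>)" by (rule LIMSEQ_le_const) (use V(4)[OF e(1)] in blast)
  qed (fact \<rho> W)+
  obtain u where u: "regular_kantorovich_pot n w \<rho> u" "\<And>f. H1per f \<Longrightarrow> W f = (\<integral>t. u t * f t \<partial>Lper)"
    using represented_by_kantorovich_potential by blast
  have "(\<lambda>j. ?V (e (r j + k)) f) \<longlonglongrightarrow> (\<integral>t. u t * f t \<partial>Lper)" if "H1per f" for f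
    using lim[OF that] by (simp add: u(2)[OF that])
  then show ?thesis using r_shift u(1) by (intro exI[of _ "\<lambda>j. r j + k"] exI[of _ u]) simp
qed

corollary normalised_potentials_convergent:
  assumes \<rho>: "Dper \<rho>" and v: "\<And>\<epsilon>. 0 < \<epsilon> \<Longrightarrow> optimal_potential \<epsilon> \<rho> (v \<epsilon>)"
    and w_C1: "C1_offdiag w" and u: "regular_kantorovich_pot n w \<rho> u" and f: "H1per f"
  shows "((\<lambda>\<epsilon>. normalised_potential \<epsilon> \<rho> (v \<epsilon>) f) \<longlongrightarrow> (\<integral>t. u t * f t \<partial>Lper)) (at_right 0)"
proof (rule tendsto_at_right_if_subsequences)
  fix S :: "nat \<Rightarrow> real" assume S: "\<And>k. 0 < S k" "S \<longlonglongrightarrow> 0"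
  obtain r u' where r: "strict_mono (r :: nat \<Rightarrow> nat)" and u': "regular_kantorovich_pot n w \<rho> u'"
    and lim: "\<forall>f. H1per f \<longrightarrow> (\<lambda>j. normalised_potential (S (r j)) \<rho> (v (S (r j))) f) \<longlonglongrightarrow> (\<integral>t. u' t * f t \<partial>Lper)"
    using normalised_potentials_convergent_subsequence[OF \<rho> v S] by blast
  have "(\<integral>t. u' t * f t \<partial>Lper) = (\<integral>t. u t * f t \<partial>Lper)"
    using regular_potential_unique[OF \<rho> w_C1 u' u] by (intro Bochner_Integration.integral_cong) auto
  then show "\<exists>r. strict_mono (r :: nat \<Rightarrow> nat) \<and>
      (\<lambda>k. normalised_potential (S (r k)) \<rho> (v (S (r k))) f) \<longlonglongrightarrow> (\<integral>t. u t * f t \<partial>Lper)"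
    using r lim[rule_format, OF f] by (intro exI[of _ r]) simp
qed

corollary normalised_potentials_convergent_decreasing:
  assumes \<rho>: "Dper \<rho>" and v: "\<And>\<epsilon>. 0 < \<epsilon> \<Longrightarrow> optimal_potential \<epsilon> \<rho> (v \<epsilon>)"
  shows "\<exists>\<epsilon>s u. regular_kantorovich_pot n w \<rho> u \<and> (\<forall>k::nat. 0 < \<epsilon>s k) \<and> (\<forall>k. \<epsilon>s (Suc k) < \<epsilon>s k) \<and> \<epsilon>s \<longlonglongrightarrow> 0 \<and>
    (\<forall>f. H1per f \<longrightarrow> (\<lambda>k. normalised_potential (\<epsilon>s k) \<rho> (v (\<epsilon>s k)) f) \<longlonglongrightarrow> (\<integral>t. u t * f t \<partial>Lper))"
proof -
  define e where "e j = inverse (real (Suc j))" for j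
  have e: "0 < e j" "e \<longlonglongrightarrow> 0" for j unfolding e_def[abs_def] by (simp, rule LIMSEQ_inverse_real_of_nat)
  obtain r u where r: "strict_mono (r :: nat \<Rightarrow> nat)" and u: "regular_kantorovich_pot n w \<rho> u"
    "\<forall>f. H1per f \<longrightarrow> (\<lambda>j. normalised_potential (e (r j)) \<rho> (v (e (r j))) f) \<longlonglongrightarrow> (\<integral>t. u t * f t \<partial>Lper)"
    using normalised_potentials_convergent_subsequence[OF \<rho> v e] by blast
  have "e (r (Suc k)) < e (r k)" for k using strict_monoD[OF r, of k "Suc k"] by (simp add: e_def)
  then show ?thesis using e(1) LIMSEQ_subseq_LIMSEQ[OF e(2) r] u by (intro exI[of _ "e \<circ> r"] exI[of _ u]) simp
qed

end

theorem theorem2p4: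
  fixes n :: nat and w :: "real \<times> real \<Rightarrow> ennreal" and \<rho> :: "real \<Rightarrow> real"
    and v :: "real \<Rightarrow> (real \<Rightarrow> real) \<Rightarrow> real"
  assumes "1 \<le> n"
    and "assumptionA w"
    and "Dper \<rho>"
    and "\<forall>\<epsilon>>0. Hminus (v \<epsilon>) \<and>
           (\<forall>\<zeta>. adm \<zeta> \<longrightarrow>
              enn2ereal (Feps n w \<epsilon> \<rho>) - ereal (real n * v \<epsilon> \<rho>)
                \<le> enn2ereal (Feps n w \<epsilon> \<zeta>) - ereal (real n * v \<epsilon> \<zeta>))"
  shows "\<exists>(C :: real \<Rightarrow> real) (u :: real \<Rightarrow> real).
           regular_kantorovich_pot n w \<rho> u \<and>
           (\<exists>\<epsilon>s :: nat \<Rightarrow> real. (\<forall>k. 0 < \<epsilon>s k) \<and> (\<forall>k. \<epsilon>s (Suc k) < \<epsilon>s k) \<and> \<epsilon>s \<longlonglongrightarrow> 0 \<and>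
              (\<forall>f. H1per f \<longrightarrow>
                 (\<lambda>k. v (\<epsilon>s k) f + C (\<epsilon>s k) * (\<integral>t. f t \<partial>lebesgue_on Iper))
                   \<longlonglongrightarrow> (\<integral>t. u t * f t \<partial>lebesgue_on Iper))) \<and>
           (C1_offdiag w \<longrightarrow>
              (\<forall>u'. regular_kantorovich_pot n w \<rho> u' \<longrightarrow> (\<forall>x\<in>Iper. u' x = u x)) \<and>
              (\<forall>f. H1per f \<longrightarrow>
                 ((\<lambda>\<epsilon>. v \<epsilon> f + C \<epsilon> * (\<integral>t. f t \<partial>lebesgue_on Iper))
                   \<longlongrightarrow> (\<integral>t. u t * f t \<partial>lebesgue_on Iper)) (at_right 0)))"
proof -
  interpret cost n w by unfold_locales (fact assms)+
  have optimal: "optimal_potential \<epsilon> \<rho> (v \<epsilon>)" if "0 < \<epsilon>" for \<epsilon>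
    using assms(4) that by (simp add: optimal_potential_def)
  define C where "C \<epsilon> = normalising_constant \<epsilon> \<rho> (v \<epsilon>)" for \<epsilon>
  have V: "normalised_potential \<epsilon> \<rho> (v \<epsilon>) f = v \<epsilon> f + C \<epsilon> * (\<integral>t. f t \<partial>lebesgue_on Iper)" for \<epsilon> f
    by (simp add: normalised_potential_def C_def)
  obtain \<epsilon>s u where u: "regular_kantorovich_pot n w \<rho> u"
    and \<epsilon>s: "\<forall>k::nat. 0 < \<epsilon>s k" "\<forall>k. \<epsilon>s (Suc k) < \<epsilon>s k" "\<epsilon>s \<longlonglongrightarrow> 0"
      "\<forall>f. H1per f \<longrightarrow> (\<lambda>k. normalised_potential (\<epsilon>s k) \<rho> (v (\<epsilon>s k)) f) \<longlonglongrightarrow> (\<integral>t. u t * f t \<partial>lebesgue_on Iper)"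
    using normalised_potentials_convergent_decreasing[OF assms(3) optimal] by blast
  have "\<forall>u'. regular_kantorovich_pot n w \<rho> u' \<longrightarrow> (\<forall>x\<in>Iper. u' x = u x)" if "C1_offdiag w"
    using regular_potential_unique[OF assms(3) that _ u] by blast
  moreover have "((\<lambda>\<epsilon>. normalised_potential \<epsilon> \<rho> (v \<epsilon>) f) \<longlongrightarrow> (\<integral>t. u t * f t \<partial>lebesgue_on Iper)) (at_right 0)"
    if "C1_offdiag w" "H1per f" for f
    by (rule normalised_potentials_convergent[OF assms(3) optimal that(1) u that(2)])
  ultimately show ?thesis using u \<epsilon>s unfolding V by blast
qed

end
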